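(* Let $X_1,X_2,\ldots$ be independent and identically distributed copies of a random element $X$ of $\mathbb{H}=L^2([0,1],\mathbb{R})$ with $\mathbb{E}\|X\|_{\mathbb{H}}^2<\infty$ and covariance operator $\mathcal{C}$. Assume that $\int_{\mathbb{H}}\|f\|_{\mathbb{H}}^4\,Q(\mathrm{d}f)<\infty$. Let $T_n^*$ be the parametric bootstrap version of $T_n$, i.e. $T_n^*=T_n(X_1^*,\ldots,X_n^* )$, where, conditionally on $X_1,\ldots,X_n$, the random elements $X_1^*,\ldots,X_n^*$ are independent and identically distributed with the Gaussian distribution $\mathrm{N}(0,\mathcal{C}_n)$. Then, as $n\to\infty$, $$nT_n^*\overset{\mathcal{D}}{\to}\|\mathcal{V}\|_Q^2\quad \mathbb{P}^X\text{-almost surely},$$ that is, for almost every realization of the sequence $X_1,X_2,\ldots$, the conditional distribution of $nT_n^*$ given $X_1,\ldots,X_n$ converges weakly to the distribution of $\|\mathcal{V}\|_Q^2$. Here $\mathcal{V}$ is a centred Gaussian random element of $L^2_Q$ having covariance kernel $$\mathbb{E}[\mathcal{V}(f)\mathcal{V}(g)]=\exp\left(-\tfrac12(\sigma_f^2+\sigma_g^2)\right)\left\{\exp(\sigma_{f,g})-1-\sigma_{f,g}-\tfrac12\sigma_{f,g}^2\right\},\quad f,g\in\mathbb{H},$$ with $\sigma_{f,g}=\langle\mathcal{C}f,g\rangle$ and $\sigma_f^2=\sigma_{f,f}$.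
   Context: $\mathbb{H}=L^2([0,1],\mathbb{R})$ is the separable Hilbert space of (equivalence classes of) square-integrable real functions on $[0,1]$, with inner product $\langle f,g\rangle=\int_0^1 f(t)g(t)\,\mathrm{d}t$, norm $\|f\|_{\mathbb{H}}=\langle f,f\rangle^{1/2}$, and Borel $\sigma$-algebra. $Q$ is a fixed Borel probability measure on $\mathbb{H}$ that is symmetric, i.e. invariant under the map $x\mapsto -x$. For a random element $X$ of $\mathbb{H}$ with $\mathbb{E}\|X\|_{\mathbb{H}}^2<\infty$ and expectation $\mu\in\mathbb{H}$, the covariance operator $\mathcal{C}:\mathbb{H}\to\mathbb{H}$ is $\mathcal{C}f=\mathbb{E}(\langle X-\mu,f\rangle X)$. For $m\in\mathbb{H}$ and a positive symmetric trace-class operator $\mathcal{K}$ on $\mathbb{H}$, put $\varphi(f;m,\mathcal{K})=\exp\left(\mathrm{i}\langle m,f\rangle-\frac12\langle\mathcal{K}f,f\rangle\right)$, $f\in\mathbb{H}$; $\mathrm{N}(m,\mathcal{K})$ is the distribution on $\mathbb{H}$ with characteristic functional $\varphi(\cdot;m,\mathcal{K})$. Given elements $x_1,\ldots,x_n$ of $\mathbb{H}$, let $\overline{x}_n=\frac1n\sum_{j=1}^n x_j$, let $\mathcal{K}_n$ be the sample covariance operator $\mathcal{K}_nf=\frac1n\sum_{j=1}^n\langle x_j-\overline{x}_n,f\rangle(x_j-\overline{x}_n)$, and define $$T_n(x_1,\ldots,x_n)=\int_{\mathbb{H}}\left|\frac1n\sum_{j=1}^n\exp(\mathrm{i}\langle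 f,x_j\rangle)-\varphi(f;\overline{x}_n,\mathcal{K}_n)\right|^2\,Q(\mathrm{d}f).$$ $\mathcal{C}_n$ denotes the sample covariance operator of $X_1,\ldots,X_n$, and $T_n=T_n(X_1,\ldots,X_n)$. $L^2_Q$ is the separable Hilbert space of (equivalence classes of) measurable functions $\Upsilon:\mathbb{H}\to\mathbb{R}$ with $\int_{\mathbb{H}}\Upsilon(f)^2\,Q(\mathrm{d}f)<\infty$, with scalar product $\langle\Upsilon,\Phi\rangle_Q=\int_{\mathbb{H}}\Upsilon(f)\Phi(f)\,Q(\mathrm{d}f)$ and norm $\|\cdot\|_Q$. A centred Gaussian random element $\mathcal{V}$ of $L^2_Q$ has covariance kernel $K(f,g)=\mathbb{E}[\mathcal{V}(f)\mathcal{V}(g)]$ in the sense that $\mathbb{E}[\langle\mathcal{V},\Upsilon\rangle_Q\langle\mathcal{V},\Phi\rangle_Q]=\int_{\mathbb{H}}\int_{\mathbb{H}}K(f,g)\Upsilon(f)\Phi(g)\,Q(\mathrm{d}f)\,Q(\mathrm{d}g)$ for all $\Upsilon,\Phi\in L^2_Q$. *)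

theory Defs
  imports "HOL-Probability.Probability"
begin

section \<open>Square-integrable functions\<close>

definition l2fun :: "'a measure \<Rightarrow> ('a \<Rightarrow> real) set" where
  "l2fun M = {f \<in> borel_measurable M. integrable M (\<lambda>x. (f x)\<^sup>2)}"

definition l2inner :: "'a measure \<Rightarrow> ('a \<Rightarrow> real) \<Rightarrow> ('a \<Rightarrow> real) \<Rightarrow> real" where
  "l2inner M f g = (\<integral>x. f x * g x \<partial>M)"

definition l2norm :: "'a measure \<Rightarrow> ('a \<Rightarrow> real) \<Rightarrow> real" where
  "l2norm M f = sqrt (l2inner M f f)"

lemma l2fun_measurable: "f \<in> l2fun M \<Longrightarrow> f \<in> borel_measurable M"
  by (simp add: l2fun_def)

lemma l2fun_integrable_square: "f \<in> l2fun M \<Longrightarrow> integrable M (\<lambda>x. (f x)\<^sup>2)"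
  by (simp add: l2fun_def)

lemma l2funI: "f \<in> borel_measurable M \<Longrightarrow> integrable M (\<lambda>x. (f x)\<^sup>2) \<Longrightarrow> f \<in> l2fun M"
  by (simp add: l2fun_def)

lemma abs_mult_le_squares: "\<bar>a * b\<bar> \<le> a\<^sup>2 + b\<^sup>2" for a b :: real
proof -
  have "2 * (\<bar>a\<bar> * \<bar>b\<bar>) \<le> a\<^sup>2 + b\<^sup>2"
    using sum_squares_bound[of "\<bar>a\<bar>" "\<bar>b\<bar>"] by simp
  moreover have "0 \<le> \<bar>a\<bar> * \<bar>b\<bar>" by simp
  ultimately show ?thesis unfolding abs_mult by linarith
qed

lemma square_add_le: "(a + b)\<^sup>2 \<le> 2 * a\<^sup>2 + 2 * b\<^sup>2" for a b :: real
  using sum_squares_bound[of a b] by (simp add: power2_sum)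

lemma square_diff_le: "(a - b)\<^sup>2 \<le> 2 * a\<^sup>2 + 2 * b\<^sup>2" for a b :: real
  using square_add_le[of a "- b"] by simp

lemma l2fun_integrable_mult:
  assumes "f \<in> l2fun M" "g \<in> l2fun M"
  shows "integrable M (\<lambda>x. f x * g x)"
proof (rule Bochner_Integration.integrable_bound)
  show "integrable M (\<lambda>x. (f x)\<^sup>2 + (g x)\<^sup>2)"
    using assms by (auto dest: l2fun_integrable_square)
  show "(\<lambda>x. f x * g x) \<in> borel_measurable M"
    using assms by (auto dest!: l2fun_measurable)
  show "AE x in M. norm (f x * g x) \<le> norm ((f x)\<^sup>2 + (g x)\<^sup>2)"
    using abs_mult_le_squares by (auto intro!: AE_I2)
qed

lemma l2fun_zero: "(\<lambda>x. 0) \<in> l2fun M"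
  by (simp add: l2fun_def)

lemma l2fun_add:
  assumes "f \<in> l2fun M" "g \<in> l2fun M"
  shows "(\<lambda>x. f x + g x) \<in> l2fun M"
proof (rule l2funI)
  show m: "(\<lambda>x. f x + g x) \<in> borel_measurable M"
    using assms by (auto dest!: l2fun_measurable)
  show "integrable M (\<lambda>x. (f x + g x)\<^sup>2)"
  proof (rule Bochner_Integration.integrable_bound)
    show "integrable M (\<lambda>x. 2 * (f x)\<^sup>2 + 2 * (g x)\<^sup>2)"
      using assms by (intro Bochner_Integration.integrable_add integrable_mult_right l2fun_integrable_square)
    show "AE x in M. norm ((f x + g x)\<^sup>2) \<le> norm (2 * (f x)\<^sup>2 + 2 * (g x)\<^sup>2)"
      using square_add_le by (auto intro!: AE_I2)
  qed (use m in measurable)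
qed

lemma l2fun_scale: "f \<in> l2fun M \<Longrightarrow> (\<lambda>x. c * f x) \<in> l2fun M"
  by (auto simp: l2fun_def power_mult_distrib)

lemma l2fun_uminus: "f \<in> l2fun M \<Longrightarrow> (\<lambda>x. - f x) \<in> l2fun M"
  by (auto simp: l2fun_def)

lemma l2fun_diff: "f \<in> l2fun M \<Longrightarrow> g \<in> l2fun M \<Longrightarrow> (\<lambda>x. f x - g x) \<in> l2fun M"
  using l2fun_add[of f M "\<lambda>x. - g x"] by (simp add: l2fun_uminus)

lemma (in finite_measure) l2fun_integrable:
  assumes "f \<in> l2fun M"
  shows "integrable M f"
  using l2fun_integrable_mult[OF assms, of "\<lambda>_. 1"] by (simp add: l2fun_def)

lemma (in finite_measure) l2fun_indicator: "A \<in> sets M \<Longrightarrow> indicator A \<in> l2fun M"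
  by (auto simp: l2fun_def power2_eq_square indicator_inter_arith[symmetric] less_top[symmetric])

section \<open>Completeness and separability\<close>

lemma (in prob_space) l2_complete:
  fixes u :: "nat \<Rightarrow> 'a \<Rightarrow> real"
  assumes u: "\<And>n. u n \<in> l2fun M"
    and cauchy: "\<And>e. e > 0 \<Longrightarrow> \<exists>N. \<forall>i\<ge>N. \<forall>j\<ge>N. (\<integral>x. (u i x - u j x)\<^sup>2 \<partial>M) < e"
  obtains f where "f \<in> l2fun M"
    "\<And>e. e > 0 \<Longrightarrow> \<exists>N. \<forall>n\<ge>N. (\<integral>x. (f x - u n x)\<^sup>2 \<partial>M) \<le> e"
proof -
  have um[measurable]: "u n \<in> borel_measurable M" for n
    using u by (rule l2fun_measurable)
  have isq: "integrable M (\<lambda>x. (u i x - u j x)\<^sup>2)" for i j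
    using l2fun_diff[OF u u] by (rule l2fun_integrable_square)
  have L1: "\<exists>N. \<forall>i\<ge>N. \<forall>j\<ge>N. (\<integral>x. norm (u i x - u j x) \<partial>M) < e" if e: "e > 0" for e
  proof -
    obtain N where N: "\<forall>i\<ge>N. \<forall>j\<ge>N. (\<integral>x. (u i x - u j x)\<^sup>2 \<partial>M) < e\<^sup>2"
      using cauchy[of "e\<^sup>2"] e by auto
    have "(\<integral>x. norm (u i x - u j x) \<partial>M) < e" if "i \<ge> N" "j \<ge> N" for i j
    proof -
      have int: "integrable M (\<lambda>x. \<bar>u i x - u j x\<bar>)"
        using l2fun_integrable[OF l2fun_diff[OF u u]] by simp
      have "(expectation (\<lambda>x. \<bar>u i x - u j x\<bar>))\<^sup>2 \<le> expectation (\<lambda>x. \<bar>u i x - u j x\<bar>\<^sup>2)"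
        using variance_positive[of "\<lambda>x. \<bar>u i x - u j x\<bar>"]
          variance_eq[of "\<lambda>x. \<bar>u i x - u j x\<bar>"] int isq by simp
      also have "\<dots> < e\<^sup>2" using N that by simp
      finally show ?thesis using \<open>e > 0\<close> by (simp add: power_less_imp_less_base)
    qed
    then show ?thesis by blast
  qed
  obtain r where r: "strict_mono r" "AE x in M. Cauchy (\<lambda>i. u (r i) x)"
    using cauchy_L1_AE_cauchy_subseq[of M u] l2fun_integrable[OF u] L1 by metis
  define f where "f x = lim (\<lambda>i. u (r i) x)" for x
  have [measurable]: "f \<in> borel_measurable M" unfolding f_def by measurable
  have lim: "AE x in M. (\<lambda>i. u (r i) x) \<longlonglongrightarrow> f x"
    using r(2) by eventually_elim (auto simp: f_def Cauchy_convergent_iff convergent_LIMSEQ_iff)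
  have key: "(\<integral>\<^sup>+x. ennreal ((f x - u n x)\<^sup>2) \<partial>M) \<le> ennreal e"
    if e: "e > 0" and N: "\<forall>i\<ge>N. \<forall>j\<ge>N. (\<integral>x. (u i x - u j x)\<^sup>2 \<partial>M) < e" and n: "n \<ge> N" for e N n
  proof -
    have "(\<integral>\<^sup>+x. ennreal ((f x - u n x)\<^sup>2) \<partial>M)
        = (\<integral>\<^sup>+x. liminf (\<lambda>i. ennreal ((u (r i) x - u n x)\<^sup>2)) \<partial>M)"
      using lim
    proof (intro nn_integral_cong_AE, eventually_elim)
      case (elim x)
      then have "(\<lambda>i. ennreal ((u (r i) x - u n x)\<^sup>2)) \<longlonglongrightarrow> ennreal ((f x - u n x)\<^sup>2)"
        by (intro tendsto_intros)
      then show ?case by (intro lim_imp_Liminf[symmetric]) auto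
    qed
    also have "\<dots> \<le> liminf (\<lambda>i. \<integral>\<^sup>+x. ennreal ((u (r i) x - u n x)\<^sup>2) \<partial>M)"
      by (intro nn_integral_liminf) measurable
    also have "\<dots> \<le> liminf (\<lambda>i. ennreal e)"
    proof (intro Liminf_mono)
      show "\<forall>\<^sub>F i in sequentially. (\<integral>\<^sup>+x. ennreal ((u (r i) x - u n x)\<^sup>2) \<partial>M) \<le> ennreal e"
        using eventually_ge_at_top[of N]
      proof eventually_elim
        case (elim i)
        then have "N \<le> r i" using seq_suble[OF r(1), of i] by simp
        then have "(\<integral>x. (u (r i) x - u n x)\<^sup>2 \<partial>M) \<le> e" using N n by (simp add: less_imp_le)
        then show ?case
          by (subst nn_integral_eq_integral[OF isq]) (auto intro: ennreal_leI)
      qed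
    qed
    also have "\<dots> = ennreal e" by (simp add: Liminf_const)
    finally show ?thesis .
  qed
  have fin: "integrable M (\<lambda>x. (f x - u n x)\<^sup>2) \<and> (\<integral>x. (f x - u n x)\<^sup>2 \<partial>M) \<le> e"
    if "e > 0" and "\<forall>i\<ge>N. \<forall>j\<ge>N. (\<integral>x. (u i x - u j x)\<^sup>2 \<partial>M) < e" and "n \<ge> N" for e N n
  proof -
    have k: "(\<integral>\<^sup>+x. ennreal ((f x - u n x)\<^sup>2) \<partial>M) \<le> ennreal e"
      using key[OF that] .
    have i: "integrable M (\<lambda>x. (f x - u n x)\<^sup>2)"
      by (rule integrableI_bounded) (use k in \<open>auto simp: less_top[symmetric] top_unique\<close>)
    have "ennreal (\<integral>x. (f x - u n x)\<^sup>2 \<partial>M) \<le> ennreal e"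
      using k by (subst (asm) nn_integral_eq_integral[OF i]) auto
    then show ?thesis using i that(1) by simp
  qed
  obtain N1 where N1: "\<forall>i\<ge>N1. \<forall>j\<ge>N1. (\<integral>x. (u i x - u j x)\<^sup>2 \<partial>M) < 1"
    using cauchy[of 1] by auto
  have "(\<lambda>x. f x - u N1 x) \<in> l2fun M"
    using fin[of 1 N1 N1] N1 by (auto simp: l2fun_def)
  from l2fun_add[OF this u[of N1]] have f: "f \<in> l2fun M" by simp
  show ?thesis
  proof (rule that[OF f])
    fix e :: real assume "e > 0"
    then obtain N where "\<forall>i\<ge>N. \<forall>j\<ge>N. (\<integral>x. (u i x - u j x)\<^sup>2 \<partial>M) < e" using cauchy by blast
    then show "\<exists>N. \<forall>n\<ge>N. (\<integral>x. (f x - u n x)\<^sup>2 \<partial>M) \<le> e"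
      using fin[OF \<open>e > 0\<close>] by blast
  qed
qed

lemma (in finite_measure) l2_separable:
  assumes B: "countable B" "B \<subseteq> Pow (space M)" "sets M = sigma_sets (space M) B"
  obtains D where "countable D" "D \<subseteq> l2fun M"
    "\<And>f e. f \<in> l2fun M \<Longrightarrow> e > 0 \<Longrightarrow> \<exists>d\<in>D. (\<integral>x. (f x - d x)\<^sup>2 \<partial>M) < e"
proof -
  define G where "G = (\<lambda>F. space M \<inter> \<Inter>F) ` {F. finite F \<and> F \<subseteq> B}"
  have cG: "countable G"
    unfolding G_def by (intro countable_image countable_Collect_finite_subset B)
  have BM: "A \<in> sets M" if "A \<in> B" for A using that B(3) by auto
  have GM: "A \<in> sets M" if A: "A \<in> G" for A
  proof -
    obtain F where F: "finite F" "F \<subseteq> B" "A = space M \<inter> \<Inter>F" using A by (auto simp: G_def)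
    have "space M \<inter> \<Inter>F \<in> sets M" using F(1,2)
    proof (induction F)
      case (insert b F)
      have "space M \<inter> \<Inter>(insert b F) = b \<inter> (space M \<inter> \<Inter>F)" by auto
      then show ?case using insert BM by auto
    qed simp
    then show ?thesis using F by simp
  qed
  have GP: "G \<subseteq> Pow (space M)" unfolding G_def by auto
  have istG: "Int_stable G"
  proof (rule Int_stableI)
    fix a b assume "a \<in> G" "b \<in> G"
    then obtain E F where EF: "finite E" "E \<subseteq> B" "a = space M \<inter> \<Inter>E"
        "finite F" "F \<subseteq> B" "b = space M \<inter> \<Inter>F"
      unfolding G_def by auto
    then have "a \<inter> b = space M \<inter> \<Inter>(E \<union> F)" by auto
    then show "a \<inter> b \<in> G" unfolding G_def using EF by (intro image_eqI[of _ _ "E \<union> F"]) auto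
  qed
  have BG: "B \<subseteq> G"
  proof
    fix b assume b: "b \<in> B"
    then have "b = space M \<inter> \<Inter>{b}" using B(2) by auto
    then show "b \<in> G" unfolding G_def using b by (intro image_eqI[of _ _ "{b}"]) auto
  qed
  have MG: "sets M = sigma_sets (space M) G"
  proof
    show "sets M \<subseteq> sigma_sets (space M) G"
      unfolding B(3) using BG by (rule sigma_sets_mono')
    show "sigma_sets (space M) G \<subseteq> sets M"
      using GM by (intro sets.sigma_sets_subset) auto
  qed
  have spG: "space M \<in> G" unfolding G_def by (intro image_eqI[of _ _ "{}"]) auto

  define step :: "(rat \<times> 'a set) list \<Rightarrow> 'a \<Rightarrow> real"
    where "step xs x = (\<Sum>(q, A)\<leftarrow>xs. of_rat q * indicator A x)" for xs x
  define D where "D = step ` lists (UNIV \<times> G)"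
  have cD: "countable D"
    unfolding D_def using cG by (intro countable_image countable_lists countable_SIGMA) auto
  have step_l2: "step xs \<in> l2fun M" if "xs \<in> lists (UNIV \<times> G)" for xs
    using that
  proof (induction xs)
    case Nil
    then show ?case by (simp add: step_def[abs_def] l2fun_zero)
  next
    case (Cons a xs)
    obtain q A where a: "a = (q, A)" by (cases a)
    have "step (a # xs) = (\<lambda>x. of_rat q * indicator A x + step xs x)"
      by (auto simp: step_def a)
    moreover have "A \<in> sets M" using Cons a GM by auto
    ultimately show ?case
      using Cons by (auto intro!: l2fun_add l2fun_scale l2fun_indicator)
  qed
  have Dl2: "D \<subseteq> l2fun M" using step_l2 by (auto simp: D_def)
  have Dadd: "(\<lambda>x. d x + d' x) \<in> D" if d: "d \<in> D" "d' \<in> D" for d d'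
  proof -
    obtain xs ys where "d = step xs" "d' = step ys" "xs \<in> lists (UNIV \<times> G)" "ys \<in> lists (UNIV \<times> G)"
      using d unfolding D_def by blast
    then show ?thesis unfolding D_def
      by (intro image_eqI[of _ _ "xs @ ys"]) (auto simp: step_def)
  qed
  have Dscale: "(\<lambda>x. of_rat q * d x) \<in> D" if d: "d \<in> D" for d q
  proof -
    obtain xs where xs: "d = step xs" "xs \<in> lists (UNIV \<times> G)" using d unfolding D_def by blast
    have "(\<lambda>x. of_rat q * step xs x) = step (map (\<lambda>(p, A). (q * p, A)) xs)"
    proof
      fix x show "of_rat q * step xs x = step (map (\<lambda>(p, A). (q * p, A)) xs) x"
        by (induction xs) (auto simp: step_def of_rat_mult algebra_simps)
    qed
    then show ?thesis unfolding D_def xs(1) using xs(2)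
      by (intro image_eqI[of _ _ "map (\<lambda>(p, A). (q * p, A)) xs"]) auto
  qed

  define T where "T = {f \<in> l2fun M. \<forall>e>0. \<exists>d\<in>D. (\<integral>x. (f x - d x)\<^sup>2 \<partial>M) < e}"
  have TD: "D \<subseteq> T" unfolding T_def using Dl2 by (auto intro!: bexI)
  have Tl2: "f \<in> l2fun M" if "f \<in> T" for f using that by (simp add: T_def)
  have Tclosed: "f \<in> T"
    if f: "f \<in> l2fun M" and ap: "\<And>e. e > 0 \<Longrightarrow> \<exists>t\<in>T. (\<integral>x. (f x - t x)\<^sup>2 \<partial>M) < e" for f
    unfolding T_def
  proof (safe intro!: f)
    fix e :: real assume e: "e > 0"
    obtain t where t: "t \<in> T" "(\<integral>x. (f x - t x)\<^sup>2 \<partial>M) < e / 4" using ap[of "e / 4"] e by auto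
    obtain d where d: "d \<in> D" "(\<integral>x. (t x - d x)\<^sup>2 \<partial>M) < e / 4"
      using t(1) e unfolding T_def by (force dest: spec[of _ "e / 4"])
    have tl: "t \<in> l2fun M" and dl: "d \<in> l2fun M" using t d Tl2 Dl2 by auto
    note ints = l2fun_integrable_square[OF l2fun_diff[OF f tl]]
      l2fun_integrable_square[OF l2fun_diff[OF tl dl]] l2fun_integrable_square[OF l2fun_diff[OF f dl]]
    have "(\<integral>x. (f x - d x)\<^sup>2 \<partial>M) \<le> (\<integral>x. 2 * (f x - t x)\<^sup>2 + 2 * (t x - d x)\<^sup>2 \<partial>M)"
    proof (intro integral_mono)
      show "(f x - d x)\<^sup>2 \<le> 2 * (f x - t x)\<^sup>2 + 2 * (t x - d x)\<^sup>2" for x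
        using square_add_le[of "f x - t x" "t x - d x"] by simp
    qed (use ints in auto)
    also have "\<dots> = 2 * (\<integral>x. (f x - t x)\<^sup>2 \<partial>M) + 2 * (\<integral>x. (t x - d x)\<^sup>2 \<partial>M)"
      using ints by simp
    also have "\<dots> < e" using t d by simp
    finally show "\<exists>d\<in>D. (\<integral>x. (f x - d x)\<^sup>2 \<partial>M) < e" using d by blast
  qed
  have Tadd: "(\<lambda>x. f x + g x) \<in> T" if fg: "f \<in> T" "g \<in> T" for f g
    unfolding T_def
  proof (safe intro!: l2fun_add[OF Tl2[OF fg(1)] Tl2[OF fg(2)]])
    fix e :: real assume e: "e > 0"
    obtain c where c: "c \<in> D" "(\<integral>x. (f x - c x)\<^sup>2 \<partial>M) < e / 4"
      using fg(1) e unfolding T_def by (force dest: spec[of _ "e / 4"])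
    obtain d where d: "d \<in> D" "(\<integral>x. (g x - d x)\<^sup>2 \<partial>M) < e / 4"
      using fg(2) e unfolding T_def by (force dest: spec[of _ "e / 4"])
    have l: "f \<in> l2fun M" "g \<in> l2fun M" "c \<in> l2fun M" "d \<in> l2fun M" using fg c d Tl2 Dl2 by auto
    note ints = l2fun_integrable_square[OF l2fun_diff[OF l(1,3)]]
      l2fun_integrable_square[OF l2fun_diff[OF l(2,4)]]
      l2fun_integrable_square[OF l2fun_diff[OF l2fun_add[OF l(1,2)] l2fun_add[OF l(3,4)]]]
    have "(\<integral>x. (f x + g x - (c x + d x))\<^sup>2 \<partial>M) \<le> (\<integral>x. 2 * (f x - c x)\<^sup>2 + 2 * (g x - d x)\<^sup>2 \<partial>M)"
    proof (intro integral_mono)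
      show "(f x + g x - (c x + d x))\<^sup>2 \<le> 2 * (f x - c x)\<^sup>2 + 2 * (g x - d x)\<^sup>2" for x
        using square_add_le[of "f x - c x" "g x - d x"] by (simp add: algebra_simps)
    qed (use ints in auto)
    also have "\<dots> = 2 * (\<integral>x. (f x - c x)\<^sup>2 \<partial>M) + 2 * (\<integral>x. (g x - d x)\<^sup>2 \<partial>M)"
      using ints by simp
    also have "\<dots> < e" using c d by simp
    finally show "\<exists>d\<in>D. (\<integral>x. (f x + g x - d x)\<^sup>2 \<partial>M) < e" 
      by (intro bexI[OF _ Dadd[OF c(1) d(1)]])
  qed
  have Tscale: "(\<lambda>x. c * f x) \<in> T" if f: "f \<in> T" for c f
  proof (rule Tclosed)
    show "(\<lambda>x. c * f x) \<in> l2fun M" using f Tl2 l2fun_scale by blast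
    fix e :: real assume e: "e > 0"
    define e1 where "e1 = e / (4 * (c\<^sup>2 + 1))"
    have e1: "e1 > 0" unfolding e1_def using e by (auto intro!: divide_pos_pos add_nonneg_pos)
    obtain d where d: "d \<in> D" "(\<integral>x. (f x - d x)\<^sup>2 \<partial>M) < e1"
      using f e1 unfolding T_def by blast
    define s where "s = (\<integral>x. (d x)\<^sup>2 \<partial>M)"
    have s: "s \<ge> 0" by (simp add: s_def)
    define e2 where "e2 = sqrt (e / (4 * (s + 1)))"
    have e2: "e2 > 0" unfolding e2_def using e s by (auto intro!: divide_pos_pos add_nonneg_pos)
    obtain q where q: "c < of_rat q" "of_rat q < c + e2"
      using of_rat_dense[of c "c + e2"] e2 by auto
    have l: "f \<in> l2fun M" "d \<in> l2fun M" using f d Tl2 Dl2 by auto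
    note ints = l2fun_integrable_square[OF l2fun_diff[OF l]] l2fun_integrable_square[OF l(2)]
      l2fun_integrable_square[OF l2fun_diff[OF l2fun_scale[OF l(1), of c] l2fun_scale[OF l(2), of "of_rat q"]]]
    have "(\<integral>x. (c * f x - of_rat q * d x)\<^sup>2 \<partial>M)
        \<le> (\<integral>x. 2 * c\<^sup>2 * (f x - d x)\<^sup>2 + 2 * (c - of_rat q)\<^sup>2 * (d x)\<^sup>2 \<partial>M)"
    proof (intro integral_mono)
      show "(c * f x - of_rat q * d x)\<^sup>2
          \<le> 2 * c\<^sup>2 * (f x - d x)\<^sup>2 + 2 * (c - of_rat q)\<^sup>2 * (d x)\<^sup>2" for x
      proof -
        have "c * f x - of_rat q * d x = c * (f x - d x) + (c - of_rat q) * d x"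
          by (simp add: algebra_simps)
        then show ?thesis
          using square_add_le[of "c * (f x - d x)" "(c - of_rat q) * d x"]
          by (simp add: power_mult_distrib)
      qed
    qed (use ints in auto)
    also have "\<dots> = 2 * (c\<^sup>2 * (\<integral>x. (f x - d x)\<^sup>2 \<partial>M)) + 2 * ((c - of_rat q)\<^sup>2 * s)"
      using ints by (simp add: s_def)
    also have "\<dots> < e"
    proof -
      have "c\<^sup>2 * (\<integral>x. (f x - d x)\<^sup>2 \<partial>M) \<le> c\<^sup>2 * e1"
        using d by (intro mult_left_mono) auto
      also have "\<dots> < (c\<^sup>2 + 1) * e1" using e1 by (simp add: algebra_simps)
      also have "\<dots> = e / 4"
      proof -
        have "c\<^sup>2 + 1 \<noteq> 0" using zero_le_power2[of c] by linarith
        then show ?thesis unfolding e1_def by (simp add: field_simps)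
      qed
      finally have 1: "c\<^sup>2 * (\<integral>x. (f x - d x)\<^sup>2 \<partial>M) < e / 4" .
      have "(c - of_rat q)\<^sup>2 \<le> e2\<^sup>2" using q e2 by (intro abs_le_square_iff[THEN iffD1]) auto
      also have "\<dots> = e / (4 * (s + 1))" unfolding e2_def using e s by simp
      finally have "(c - of_rat q)\<^sup>2 * s \<le> e / (4 * (s + 1)) * s" using s by (rule mult_right_mono)
      also have "\<dots> \<le> e / (4 * (s + 1)) * (s + 1)" using e s by (intro mult_left_mono) auto
      also have "\<dots> = e / 4" using s by (simp add: field_simps)
      finally show ?thesis using 1 by simp
    qed
    finally show "\<exists>t\<in>T. (\<integral>x. (c * f x - t x)\<^sup>2 \<partial>M) < e"

      by (intro bexI[OF _ subsetD[OF TD Dscale[OF d(1), of q]]])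
  qed
  have Tlim: "f \<in> T"
    if f: "f \<in> l2fun M" and U: "\<And>i. U i \<in> T" and lim: "\<And>x. x \<in> space M \<Longrightarrow> (\<lambda>i. U i x) \<longlonglongrightarrow> f x"
      and dom: "\<And>i x. x \<in> space M \<Longrightarrow> \<bar>f x - U i x\<bar> \<le> \<bar>f x\<bar>" for f U
  proof (rule Tclosed[OF f])
    fix e :: real assume e: "e > 0"
    have [measurable]: "f \<in> borel_measurable M" "U i \<in> borel_measurable M" for i
      using f U Tl2 by (auto intro: l2fun_measurable)
    have "(\<lambda>i. \<integral>x. (f x - U i x)\<^sup>2 \<partial>M) \<longlonglongrightarrow> (\<integral>x. 0 \<partial>M)"
    proof (rule integral_dominated_convergence[where w = "\<lambda>x. (f x)\<^sup>2"])
      show "integrable M (\<lambda>x. (f x)\<^sup>2)" using f by (rule l2fun_integrable_square)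
      show "AE x in M. (\<lambda>i. (f x - U i x)\<^sup>2) \<longlonglongrightarrow> 0"
      proof (rule AE_I2)
        fix x assume "x \<in> space M"
        from tendsto_power[OF tendsto_diff[OF tendsto_const lim[OF this]], of "f x" 2]
        show "(\<lambda>i. (f x - U i x)\<^sup>2) \<longlonglongrightarrow> 0" by simp
      qed
      show "AE x in M. norm ((f x - U i x)\<^sup>2) \<le> (f x)\<^sup>2" for i
        using dom by (intro AE_I2) (simp add: abs_le_square_iff)
    qed auto
    then have "\<forall>\<^sub>F i in sequentially. (\<integral>x. (f x - U i x)\<^sup>2 \<partial>M) < e"
      using e by (intro order_tendstoD(2)[of _ 0]) auto
    then obtain i where "(\<integral>x. (f x - U i x)\<^sup>2 \<partial>M) < e"
      by (auto dest: eventually_happens)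
    then show "\<exists>t\<in>T. (\<integral>x. (f x - t x)\<^sup>2 \<partial>M) < e" using U by blast
  qed
  have Tzero: "(\<lambda>_. 0) \<in> T"
  proof -
    have "step [] \<in> D" by (auto simp: D_def)
    then show ?thesis using TD by (auto simp: step_def[abs_def])
  qed
  have TG: "indicator A \<in> T" if "A \<in> G" for A
  proof -
    have "step [(1, A)] \<in> D" using that by (auto simp: D_def)
    then show ?thesis using TD by (auto simp: step_def[abs_def])
  qed
  have Tcong: "g \<in> T" if "f \<in> T" "\<And>x. x \<in> space M \<Longrightarrow> f x = g x" for f g
  proof (rule Tclosed)
    show "g \<in> l2fun M"
      using Tl2[OF that(1)] that(2) unfolding l2fun_def
      by (auto cong: measurable_cong Bochner_Integration.integrable_cong)
    fix e :: real assume "e > 0"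
    moreover have "(\<integral>x. (g x - f x)\<^sup>2 \<partial>M) = (\<integral>x. 0 \<partial>M)"
      using that(2) by (intro Bochner_Integration.integral_cong) auto
    ultimately show "\<exists>t\<in>T. (\<integral>x. (g x - t x)\<^sup>2 \<partial>M) < e" using that(1) by (intro bexI[of _ f]) auto
  qed
  have Tind: "indicator A \<in> T" if "A \<in> sets M" for A
    using istG GP that[unfolded MG]
  proof (induction rule: sigma_sets_induct_disjoint)
    case (basic A)
    then show ?case by (rule TG)
  next
    case empty
    then show ?case using Tzero by (simp add: indicator_def[abs_def])
  next
    case (compl A)
    have "(\<lambda>x. indicator (space M) x + (-1) * indicator A x) \<in> T"
      by (intro Tadd Tscale compl TG spG)
    moreover have "A \<subseteq> space M" using compl(1) MG sets.sets_into_space by auto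
    ultimately show ?case by (elim Tcong) (auto simp: indicator_def)
  next
    case (union A)
    have AM: "A i \<in> sets M" for i using union MG by auto
    show ?case
    proof (rule Tlim)
      show "indicator (\<Union>i. A i) \<in> l2fun M" using AM by (intro l2fun_indicator) auto
      show "(\<lambda>x. \<Sum>i<n. indicator (A i) x) \<in> T" for n
        by (induction n) (auto intro!: Tzero Tadd union)
      fix x
      have "(\<lambda>i. indicator (A i) x :: real) sums indicator (\<Union>i. A i) x"
        using union(1) by (intro indicator_sums) (auto simp: disjoint_family_on_def)
      then show "(\<lambda>n. \<Sum>i<n. indicator (A i) x :: real) \<longlonglongrightarrow> indicator (\<Union>i. A i) x"
        by (simp add: sums_def)
      fix n
      have "(\<Sum>i<n. indicator (A i) x :: real) = indicator (\<Union>i<n. A i) x"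
        using union(1) by (intro indicator_UN_disjoint[symmetric]) (auto simp: disjoint_family_on_def)
      then show "\<bar>indicator (\<Union>i. A i) x - (\<Sum>i<n. indicator (A i) x)\<bar> \<le> \<bar>indicator (\<Union>i. A i) x :: real\<bar>"
        by (auto simp: indicator_def)
    qed
  qed
  have Tnonneg: "u \<in> l2fun M \<longrightarrow> u \<in> T" if "u \<in> borel_measurable M" "\<And>x. 0 \<le> u x" for u
    using that
  proof (induction rule: borel_measurable_induct_real)
    case (set A)
    then show ?case using Tind by blast
  next
    case (mult u c)
    show ?case
    proof (cases "c = 0")
      case True then show ?thesis using Tzero by simp
    next
      case False
      show ?thesis
      proof
        assume "(\<lambda>x. c * u x) \<in> l2fun M"
        from l2fun_scale[OF this, of "1 / c"] have "u \<in> l2fun M" using False by simp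
        then show "(\<lambda>x. c * u x) \<in> T" using mult Tscale by blast
      qed
    qed
  next
    case (add u v)
    show ?case
    proof
      assume vu: "(\<lambda>x. v x + u x) \<in> l2fun M"
      have "w \<in> l2fun M" if "w \<in> {u, v}" for w
      proof (rule l2funI)
        show w: "w \<in> borel_measurable M" using that add by auto
        show "integrable M (\<lambda>x. (w x)\<^sup>2)"
        proof (rule Bochner_Integration.integrable_bound[OF l2fun_integrable_square[OF vu]])
          show "AE x in M. norm ((w x)\<^sup>2) \<le> norm ((v x + u x)\<^sup>2)"
            using that add.hyps(2,4) by (intro AE_I2) (auto intro!: power_mono)
        qed (use w in measurable)
      qed
      then show "(\<lambda>x. v x + u x) \<in> T" using add by (intro Tadd) auto
    qed
  next
    case (seq U)
    show ?case
    proof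
      assume u: "u \<in> l2fun M"
      have le: "U i x \<le> u x" if "x \<in> space M" for i x
        using seq.hyps(3) seq.hyps(4)[OF that] by (intro incseq_le) (auto simp: incseq_def le_fun_def)
      have "U i \<in> l2fun M" for i
      proof (rule l2funI[OF seq.hyps(1)])
        show "integrable M (\<lambda>x. (U i x)\<^sup>2)"
        proof (rule Bochner_Integration.integrable_bound[OF l2fun_integrable_square[OF u]])
          show "AE x in M. norm ((U i x)\<^sup>2) \<le> norm ((u x)\<^sup>2)"
            using le seq.hyps(2) by (intro AE_I2) (auto intro!: power_mono)
        qed (use seq(1) in measurable)
      qed
      then have UT: "U i \<in> T" for i using seq by blast
      show "u \<in> T"
      proof (rule Tlim[OF u, of U])
        show "\<bar>u x - U i x\<bar> \<le> \<bar>u x\<bar>" if "x \<in> space M" for i x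
          using le[OF that, of i] seq.hyps(2)[of i x] by simp
      qed (use UT seq.hyps(4) in auto)
    qed
  qed
  have "f \<in> T" if f: "f \<in> l2fun M" for f
  proof -
    have fm[measurable]: "f \<in> borel_measurable M" using f by (rule l2fun_measurable)
    have "(\<lambda>x. max 0 (s * f x)) \<in> l2fun M" for s
    proof (rule l2funI)
      show "integrable M (\<lambda>x. (max 0 (s * f x))\<^sup>2)"
      proof (rule Bochner_Integration.integrable_bound[OF l2fun_integrable_square[OF l2fun_scale[OF f, of s]]])
        show "AE x in M. norm ((max 0 (s * f x))\<^sup>2) \<le> norm ((s * f x)\<^sup>2)"
          by (intro AE_I2) (auto simp: max_def)
      qed measurable
    qed measurable
    then have "(\<lambda>x. max 0 (s * f x)) \<in> T" for s using Tnonneg by auto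
    then have "(\<lambda>x. max 0 (1 * f x) + (-1) * max 0 (-1 * f x)) \<in> T" by (intro Tadd Tscale)
    moreover have "(\<lambda>x. max 0 (1 * f x) + (-1) * max 0 (-1 * f x)) = f" by (auto simp: max_def)
    ultimately show ?thesis by simp
  qed
  then show ?thesis using that[OF cD Dl2] unfolding T_def by blast
qed

section \<open>The Hilbert space of square-integrable functions on the unit interval\<close>

text \<open>Every Lebesgue measurable function agrees almost everywhere with a Borel measurable one,
  so Borel measurable representatives suffice.\<close>

definition unit_lebesgue :: "real measure" where
  "unit_lebesgue = restrict_space lborel {0..1}"

definition l2eq :: "(real \<Rightarrow> real) \<Rightarrow> (real \<Rightarrow> real) \<Rightarrow> bool" where
  "l2eq f g \<longleftrightarrow> f \<in> l2fun unit_lebesgue \<and> g \<in> l2fun unit_lebesgue \<and> (AE t in unit_lebesgue. f t = g t)"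

lemma l2eq_lift:
  assumes "l2eq f f'" and "\<And>f. f \<in> l2fun unit_lebesgue \<Longrightarrow> (\<lambda>t. F (f t)) \<in> l2fun unit_lebesgue"
  shows "l2eq (\<lambda>t. F (f t)) (\<lambda>t. F (f' t))"
proof -
  have "AE t in unit_lebesgue. f t = f' t" using assms by (simp add: l2eq_def)
  then have "AE t in unit_lebesgue. F (f t) = F (f' t)" by eventually_elim simp
  then show ?thesis using assms by (simp add: l2eq_def)
qed

lemma l2eq_lift2:
  assumes "l2eq f f'" "l2eq g g'"
    and "\<And>f g. f \<in> l2fun unit_lebesgue \<Longrightarrow> g \<in> l2fun unit_lebesgue \<Longrightarrow> (\<lambda>t. F (f t) (g t)) \<in> l2fun unit_lebesgue"
  shows "l2eq (\<lambda>t. F (f t) (g t)) (\<lambda>t. F (f' t) (g' t))"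
proof -
  have "AE t in unit_lebesgue. f t = f' t" "AE t in unit_lebesgue. g t = g' t"
    using assms by (simp_all add: l2eq_def)
  then have "AE t in unit_lebesgue. F (f t) (g t) = F (f' t) (g' t)" by eventually_elim simp
  then show ?thesis using assms by (simp add: l2eq_def)
qed

lemma prob_space_unit_lebesgue: "prob_space unit_lebesgue"
  by (intro prob_spaceI) (simp add: unit_lebesgue_def space_restrict_space emeasure_restrict_space)

lemma unit_lebesgue_generator:
  obtains B where "countable B" "B \<subseteq> Pow (space unit_lebesgue)"
    "sets unit_lebesgue = sigma_sets (space unit_lebesgue) B"
proof -
  obtain B :: "real set set" where B: "countable B" "topological_basis B"
    using ex_countable_basis by auto
  have S: "sets (borel :: real measure) = sigma_sets UNIV B"
    unfolding borel_eq_countable_basis[OF B] by (rule sets_measure_of) simp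
  have I: "{0..1} \<in> sigma_sets UNIV B"
    unfolding S[symmetric] by (rule atLeastAtMost_borel)
  have sp: "space unit_lebesgue = {0..1}"
    by (simp add: unit_lebesgue_def space_restrict_space)
  have "sets unit_lebesgue = (\<inter>) {0..1} ` sigma_sets UNIV B"
    unfolding unit_lebesgue_def sets_restrict_space sets_lborel S ..
  also have "\<dots> = sigma_sets {0..1} ((\<inter>) {0..1} ` B)"
    using I by (rule sigma_sets_Int) simp
  finally have "sets unit_lebesgue = sigma_sets (space unit_lebesgue) ((\<inter>) {0..1} ` B)"
    unfolding sp .
  then show ?thesis
    by (rule that[rotated 2]) (use B(1) sp in auto)
qed

quotient_type L2I = "real \<Rightarrow> real" / partial: l2eq
proof (rule part_equivpI)
  show "\<exists>f. l2eq f f" by (intro exI[of _ "\<lambda>_. 0"]) (auto simp: l2eq_def l2fun_zero)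
  show "symp l2eq" by (intro sympI) (simp add: l2eq_def eq_commute)
  show "transp l2eq"
  proof (rule transpI)
    fix f g h assume fg: "l2eq f g" and gh: "l2eq g h"
    then have "AE t in unit_lebesgue. f t = g t" "AE t in unit_lebesgue. g t = h t"
      by (auto simp: l2eq_def)
    then have "AE t in unit_lebesgue. f t = h t" by eventually_elim simp
    then show "l2eq f h" using fg gh by (auto simp: l2eq_def)
  qed
qed

instantiation L2I :: real_inner
begin

lift_definition zero_L2I :: L2I is "\<lambda>_. 0"
  by (auto simp: l2eq_def l2fun_zero)

lift_definition plus_L2I :: "L2I \<Rightarrow> L2I \<Rightarrow> L2I" is "\<lambda>f g t. f t + g t"
  by (rule l2eq_lift2[OF _ _ l2fun_add])

lift_definition minus_L2I :: "L2I \<Rightarrow> L2I \<Rightarrow> L2I" is "\<lambda>f g t. f t - g t"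
  by (rule l2eq_lift2[OF _ _ l2fun_diff])

lift_definition uminus_L2I :: "L2I \<Rightarrow> L2I" is "\<lambda>f t. - f t"
  by (rule l2eq_lift[OF _ l2fun_uminus])

lift_definition scaleR_L2I :: "real \<Rightarrow> L2I \<Rightarrow> L2I" is "\<lambda>c f t. c * f t"
  by (rule l2eq_lift[OF _ l2fun_scale])

lift_definition inner_L2I :: "L2I \<Rightarrow> L2I \<Rightarrow> real" is "l2inner unit_lebesgue"
  unfolding l2inner_def
proof (rule integral_cong_AE)
  fix f f' g g' assume *: "l2eq f f'" "l2eq g g'"
  then show "(\<lambda>t. f t * g t) \<in> borel_measurable unit_lebesgue"
    "(\<lambda>t. f' t * g' t) \<in> borel_measurable unit_lebesgue"
    by (auto simp: l2eq_def dest!: l2fun_measurable)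
  from * have "AE t in unit_lebesgue. f t = f' t" "AE t in unit_lebesgue. g t = g' t"
    by (auto simp: l2eq_def)
  then show "AE t in unit_lebesgue. f t * g t = f' t * g' t" by eventually_elim simp
qed

definition norm_L2I :: "L2I \<Rightarrow> real" where
  "norm_L2I x = sqrt (x \<bullet> x)"

definition dist_L2I :: "L2I \<Rightarrow> L2I \<Rightarrow> real" where
  "dist_L2I x y = norm (x - y)"

definition sgn_L2I :: "L2I \<Rightarrow> L2I" where
  "sgn_L2I x = inverse (norm x) *\<^sub>R x"

definition uniformity_L2I :: "(L2I \<times> L2I) filter" where
  "uniformity_L2I = (INF e\<in>{0<..}. principal {(x, y). dist x y < e})"

definition open_L2I :: "L2I set \<Rightarrow> bool" where
  "open_L2I U \<longleftrightarrow> (\<forall>x\<in>U. eventually (\<lambda>(x', y). x' = x \<longrightarrow> y \<in> U) uniformity)"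

instance
proof
  fix x y z :: L2I and a b r :: real and U :: "L2I set"
  show "x + y + z = x + (y + z)"
    by transfer (auto simp: l2eq_def l2fun_add algebra_simps)
  show "x + y = y + x"
    by transfer (auto simp: l2eq_def l2fun_add algebra_simps)
  show "0 + x = x"
    by transfer (auto simp: l2eq_def)
  show "- x + x = 0"
    by transfer (auto simp: l2eq_def l2fun_zero)
  show "x - y = x + - y"
    by transfer (auto simp: l2eq_def l2fun_diff)
  show "a *\<^sub>R (x + y) = a *\<^sub>R x + a *\<^sub>R y"
    by transfer (auto simp: l2eq_def algebra_simps intro!: l2fun_add l2fun_scale)
  show "(a + b) *\<^sub>R x = a *\<^sub>R x + b *\<^sub>R x"
    by transfer (auto simp: l2eq_def algebra_simps intro!: l2fun_add l2fun_scale)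
  show "a *\<^sub>R b *\<^sub>R x = (a * b) *\<^sub>R x"
    by transfer (auto simp: l2eq_def algebra_simps dest: l2fun_scale)
  show "1 *\<^sub>R x = x"
    by transfer (auto simp: l2eq_def)
  show "sgn x = inverse (norm x) *\<^sub>R x" by (rule sgn_L2I_def)
  show "dist x y = norm (x - y)" by (rule dist_L2I_def)
  show "uniformity = (INF e\<in>{0<..}. principal {(x, y :: L2I). dist x y < e})"
    by (rule uniformity_L2I_def)
  show "open U = (\<forall>x\<in>U. \<forall>\<^sub>F (x', y) in uniformity. x' = x \<longrightarrow> y \<in> U)"
    by (rule open_L2I_def)
  show "x \<bullet> y = y \<bullet> x"
    by transfer (simp add: l2inner_def mult.commute)
  show "(x + y) \<bullet> z = x \<bullet> z + y \<bullet> z"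
    by transfer (simp add: l2inner_def l2eq_def distrib_right l2fun_integrable_mult)
  show "(r *\<^sub>R x) \<bullet> y = r * (x \<bullet> y)"
    by transfer (simp add: l2inner_def mult.assoc)
  show "0 \<le> x \<bullet> x"
    by transfer (simp add: l2inner_def)
  show "x \<bullet> x = 0 \<longleftrightarrow> x = 0"
  proof transfer
    fix f assume "l2eq f f"
    then have f: "f \<in> l2fun unit_lebesgue" by (simp add: l2eq_def)
    have "l2inner unit_lebesgue f f = 0 \<longleftrightarrow> (AE t in unit_lebesgue. f t * f t = 0)"
      unfolding l2inner_def
      by (rule integral_nonneg_eq_0_iff_AE) (auto intro: l2fun_integrable_mult f)
    then show "(l2inner unit_lebesgue f f = 0) = l2eq f (\<lambda>_. 0)"
      using f by (simp add: l2eq_def l2fun_zero)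
  qed
  show "norm x = sqrt (x \<bullet> x)" by (rule norm_L2I_def)
qed

end

lift_definition l2class :: "(real \<Rightarrow> real) \<Rightarrow> L2I"
  is "\<lambda>f. if f \<in> l2fun unit_lebesgue then f else (\<lambda>_. 0)"
  by (auto simp: l2eq_def l2fun_zero)

lemma l2class_surj: obtains f where "f \<in> l2fun unit_lebesgue" "x = l2class f"
proof -
  have "\<exists>f. f \<in> l2fun unit_lebesgue \<and> x = l2class f"
    by transfer (auto simp: l2eq_def)
  then show ?thesis using that by blast
qed

lemma dist_l2class:
  assumes "f \<in> l2fun unit_lebesgue" "g \<in> l2fun unit_lebesgue"
  shows "dist (l2class f) (l2class g) = sqrt (\<integral>t. (f t - g t)\<^sup>2 \<partial>unit_lebesgue)"
proof -
  have "(l2class f - l2class g) \<bullet> (l2class f - l2class g) = (\<integral>t. (f t - g t)\<^sup>2 \<partial>unit_lebesgue)"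
    using assms by transfer (simp add: l2inner_def power2_eq_square)
  then show ?thesis by (simp add: dist_norm norm_L2I_def)
qed

instance L2I :: complete_space
proof
  fix X :: "nat \<Rightarrow> L2I" assume X: "Cauchy X"
  interpret prob_space unit_lebesgue by (rule prob_space_unit_lebesgue)
  have "\<forall>n. \<exists>f. f \<in> l2fun unit_lebesgue \<and> X n = l2class f" using l2class_surj by metis
  then obtain u where u: "\<And>n. u n \<in> l2fun unit_lebesgue" "\<And>n. X n = l2class (u n)" by metis
  have "\<exists>N. \<forall>i\<ge>N. \<forall>j\<ge>N. (\<integral>t. (u i t - u j t)\<^sup>2 \<partial>unit_lebesgue) < e" if e: "e > 0" for e
  proof -
    obtain N where "\<forall>i\<ge>N. \<forall>j\<ge>N. dist (X i) (X j) < sqrt e"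
      using metric_CauchyD[OF X, of "sqrt e"] e by auto
    then show ?thesis by (intro exI[of _ N]) (simp add: u dist_l2class)
  qed
  from l2_complete[of u, OF u(1) this] obtain f where f: "f \<in> l2fun unit_lebesgue"
    "\<And>e. e > 0 \<Longrightarrow> \<exists>N. \<forall>n\<ge>N. (\<integral>t. (f t - u n t)\<^sup>2 \<partial>unit_lebesgue) \<le> e" by blast
  have "X \<longlonglongrightarrow> l2class f"
  proof (rule metric_LIMSEQ_I)
    fix r :: real assume r: "r > 0"
    obtain N where N: "\<forall>n\<ge>N. (\<integral>t. (f t - u n t)\<^sup>2 \<partial>unit_lebesgue) \<le> (r / 2)\<^sup>2"
      using f(2)[of "(r / 2)\<^sup>2"] r by auto
    have "dist (X n) (l2class f) < r" if "n \<ge> N" for n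
    proof -
      have "dist (l2class f) (X n) \<le> sqrt ((r / 2)\<^sup>2)"
        using N that unfolding u(2) dist_l2class[OF f(1) u(1)] by (intro real_sqrt_le_mono) auto
      then show ?thesis using r by (simp add: dist_commute)
    qed
    then show "\<exists>N. \<forall>n\<ge>N. dist (X n) (l2class f) < r" by blast
  qed
  then show "convergent X" by (auto simp: convergent_def)
qed

instance L2I :: banach ..

instance L2I :: second_countable_topology
proof
  interpret prob_space unit_lebesgue by (rule prob_space_unit_lebesgue)
  obtain B where "countable B" "B \<subseteq> Pow (space unit_lebesgue)"
    "sets unit_lebesgue = sigma_sets (space unit_lebesgue) B"
    by (rule unit_lebesgue_generator)
  from l2_separable[OF this] obtain D where D: "countable D" "D \<subseteq> l2fun unit_lebesgue"
    "\<And>f e. f \<in> l2fun unit_lebesgue \<Longrightarrow> e > 0 \<Longrightarrow> \<exists>d\<in>D. (\<integral>t. (f t - d t)\<^sup>2 \<partial>unit_lebesgue) < e"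
    by blast
  define K where "K = (\<lambda>(d, q). ball (l2class d) (of_rat q)) ` (D \<times> (UNIV :: rat set))"
  have "countable K" unfolding K_def using D(1) by (intro countable_image countable_SIGMA) auto
  moreover have "topological_basis K"
  proof (rule topological_basisI)
    fix U :: "L2I set" and x assume U: "open U" "x \<in> U"
    then obtain e where e: "e > 0" "ball x e \<subseteq> U" by (meson open_contains_ball)
    obtain f where f: "f \<in> l2fun unit_lebesgue" "x = l2class f" by (rule l2class_surj)
    obtain d where d: "d \<in> D" "(\<integral>t. (f t - d t)\<^sup>2 \<partial>unit_lebesgue) < (e / 2)\<^sup>2"
      using D(3)[OF f(1), of "(e / 2)\<^sup>2"] e by auto
    have "dist x (l2class d) < sqrt ((e / 2)\<^sup>2)"
      using d D(2) f by (auto simp: dist_l2class simp del: real_sqrt_abs)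
    then have xd: "dist x (l2class d) < e / 2" using e by simp
    obtain q :: rat where q: "dist x (l2class d) < of_rat q" "of_rat q < e / 2"
      using of_rat_dense[OF xd] by auto
    have "ball (l2class d) (of_rat q) \<subseteq> ball x e"
    proof
      fix y assume "y \<in> ball (l2class d) (of_rat q)"
      then have "dist x y < e"
        using q dist_triangle[of x y "l2class d"] by auto
      then show "y \<in> ball x e" by simp
    qed
    then show "\<exists>B'\<in>K. x \<in> B' \<and> B' \<subseteq> U"
      using e d q unfolding K_def
      by (intro bexI[of _ "ball (l2class d) (of_rat q)"]) (auto simp: dist_commute)
  qed (auto simp: K_def)
  ultimately show "\<exists>B::L2I set set. countable B \<and> open = generate_topology B"
    using topological_basis_imp_subbasis by blast
qed

section \<open>Covariance operators, Gaussian laws and the test statistic\<close>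

definition cov_op :: "'a measure \<Rightarrow> ('a \<Rightarrow> L2I) \<Rightarrow> L2I \<Rightarrow> L2I" where
  "cov_op P X f = (\<integral>\<omega>. ((X \<omega> - (\<integral>\<omega>'. X \<omega>' \<partial>P)) \<bullet> f) *\<^sub>R X \<omega> \<partial>P)"

definition gauss_cf :: "L2I \<Rightarrow> (L2I \<Rightarrow> L2I) \<Rightarrow> L2I \<Rightarrow> complex" where
  "gauss_cf m K f = exp (\<i> * of_real (m \<bullet> f) - of_real (K f \<bullet> f) / 2)"

text \<open>Characteristic functionals determine Borel probability measures on a separable Hilbert space;
  the description below denotes \<open>N(m, K)\<close> whenever \<open>K\<close> is positive, symmetric and trace-class, in
  particular for every sample covariance operator.\<close>

definition gauss_law :: "L2I \<Rightarrow> (L2I \<Rightarrow> L2I) \<Rightarrow> L2I measure" where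
  "gauss_law m K = (THE N. sets N = sets borel \<and> prob_space N \<and>
     (\<forall>f. (\<integral>x. exp (\<i> * of_real (x \<bullet> f)) \<partial>N) = gauss_cf m K f))"

text \<open>A sample of size \<open>n\<close> is given by the first \<open>n\<close> entries \<open>x 0, \<dots>, x (n - 1)\<close> of a sequence.\<close>

definition smean :: "nat \<Rightarrow> (nat \<Rightarrow> L2I) \<Rightarrow> L2I" where
  "smean n x = (1 / real n) *\<^sub>R (\<Sum>j<n. x j)"

definition scov :: "nat \<Rightarrow> (nat \<Rightarrow> L2I) \<Rightarrow> L2I \<Rightarrow> L2I" where
  "scov n x f = (1 / real n) *\<^sub>R (\<Sum>j<n. ((x j - smean n x) \<bullet> f) *\<^sub>R (x j - smean n x))"

definition T_stat :: "L2I measure \<Rightarrow> nat \<Rightarrow> (nat \<Rightarrow> L2I) \<Rightarrow> real" where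
  "T_stat Q n x = (\<integral>f. (cmod ((1 / of_nat n) * (\<Sum>j<n. exp (\<i> * of_real (f \<bullet> x j)))
                              - gauss_cf (smean n x) (scov n x) f))\<^sup>2 \<partial>Q)"

section \<open>Conditional distributions\<close>

text \<open>\<open>\<kappa>\<close> is a regular conditional distribution of the \<open>N\<close>-valued random element \<open>Y\<close>
  given the sub-\<open>\<sigma>\<close>-algebra \<open>F\<close> of \<open>M\<close>.\<close>

definition regular_cond_distr ::
    "'a measure \<Rightarrow> 'a measure \<Rightarrow> 'b measure \<Rightarrow> ('a \<Rightarrow> 'b) \<Rightarrow> ('a \<Rightarrow> 'b measure) \<Rightarrow> bool" where
  "regular_cond_distr M F N Y \<kappa> \<longleftrightarrow>
     \<kappa> \<in> F \<rightarrow>\<^sub>M prob_algebra N \<and>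
     (\<forall>A\<in>sets N. AE \<omega> in M. measure (\<kappa> \<omega>) A = real_cond_exp M F (indicator (Y -` A)) \<omega>)"

definition sample_algebra :: "'a measure \<Rightarrow> (nat \<Rightarrow> 'a \<Rightarrow> L2I) \<Rightarrow> nat \<Rightarrow> 'a measure" where
  "sample_algebra M X n =
     vimage_algebra (space M) (\<lambda>\<omega>. \<lambda>j\<in>{..<n}. X j \<omega>) (PiM {..<n} (\<lambda>_. borel))"

section \<open>Gaussian random elements of an \<open>L\<^sup>2\<close> space over an arbitrary measure\<close>

text \<open>Since \<open>Q\<close> is a variable, the quotient of \<open>l2fun Q\<close> by equality almost everywhere is not
  available as a type.  Its random elements are represented by maps into \<open>l2fun Q\<close> which are
  measurable for the Borel \<open>\<sigma>\<close>-algebra of the \<open>l2norm Q\<close>-topology; the open sets of this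
  topology are saturated with respect to equality almost everywhere, so they are exactly the
  preimages of the open sets of the quotient.\<close>

definition l2_borel :: "'a measure \<Rightarrow> ('a \<Rightarrow> real) measure" where
  "l2_borel Q = sigma (l2fun Q)
     {U. U \<subseteq> l2fun Q \<and>
         (\<forall>u\<in>U. \<exists>e>0. \<forall>v\<in>l2fun Q. l2norm Q (\<lambda>x. v x - u x) < e \<longrightarrow> v \<in> U)}"

definition centred_normal :: "real \<Rightarrow> real measure" where
  "centred_normal s = (if s = 0 then return borel 0 else density lborel (normal_density 0 s))"

definition centred_gaussian :: "'w measure \<Rightarrow> 'a measure \<Rightarrow> ('w \<Rightarrow> 'a \<Rightarrow> real) \<Rightarrow> bool" where
  "centred_gaussian W Q V \<longleftrightarrow>
     prob_space W \<and> V \<in> W \<rightarrow>\<^sub>M l2_borel Q \<and>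
     (\<forall>u\<in>l2fun Q. \<exists>s\<ge>0. distr W borel (\<lambda>w. l2inner Q (V w) u) = centred_normal s)"

definition has_cov_kernel ::
    "'w measure \<Rightarrow> 'a measure \<Rightarrow> ('w \<Rightarrow> 'a \<Rightarrow> real) \<Rightarrow> ('a \<Rightarrow> 'a \<Rightarrow> real) \<Rightarrow> bool" where
  "has_cov_kernel W Q V K \<longleftrightarrow>
     (\<forall>u\<in>l2fun Q. \<forall>v\<in>l2fun Q.
        (\<integral>w. l2inner Q (V w) u * l2inner Q (V w) v \<partial>W) =
        (\<integral>f. (\<integral>g. K f g * u f * v g \<partial>Q) \<partial>Q))"

definition limit_kernel :: "(L2I \<Rightarrow> L2I) \<Rightarrow> L2I \<Rightarrow> L2I \<Rightarrow> real" where
  "limit_kernel C f g =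
     (let \<sigma> = (\<lambda>f g. C f \<bullet> g)
      in exp (- (\<sigma> f f + \<sigma> g g) / 2) * (exp (\<sigma> f g) - 1 - \<sigma> f g - (\<sigma> f g)\<^sup>2 / 2))"

end

theory Submission
  imports Defs "HOL-Real_Asymp.Real_Asymp"
begin

text \<open>By uniqueness of conditional distributions, \<open>\<kappa> n \<omega>\<close> is almost surely the law of \<open>n T\<^sub>n\<close> for a sample
  from \<open>N(0, \<C>\<^sub>n)\<close>.  The strong law of large numbers gives \<open>\<langle>\<C>\<^sub>n f, g\<rangle> \<rightarrow> \<langle>\<C> f, g\<rangle>\<close> with a uniform bound on
  \<open>\<C>\<^sub>n\<close>, so it remains to prove a limit theorem for triangular arrays of Gaussian samples whose
  covariances converge in this sense.  Linearising the Gaussian characteristic functional at \<open>\<C>\<^sub>n\<close>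
  changes \<open>n T\<^sub>n\<close> by a negligible amount, by domination with \<open>1 + \<parallel>f\<parallel>\<^sup>4\<close>, and replaces the empirical
  process by a sum of iid functions; symmetry of \<open>Q\<close> turns the squared modulus into the squared
  \<open>L\<^sup>2(Q)\<close>-norm of a real normalised sum \<open>S\<^sub>n\<close> with covariance kernel \<open>limit_kernel \<C>\<^sub>n\<close>.

  The Laplace transform of \<open>\<parallel>S\<^sub>n\<parallel>\<^sup>2\<close> is an average of characteristic functions of linear functionals of
  \<open>S\<^sub>n\<close> by Gaussian linearisation along a Parseval frame.  The one-dimensional central limit theorem
  handles each of these, and convergence of the traces \<open>\<integral> limit_kernel \<C>\<^sub>n f f dQ\<close> controls the tails.
  The frame and the expansion of \<open>limit_kernel\<close> that defines the limit \<open>\<V>\<close> as a random series both come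
  from an infinite Cholesky factorisation, which avoids any spectral theory.\<close>

section \<open>Positive semidefinite kernels\<close>

text \<open>Random elements of L^2(Q) are represented by functions, not by points of a topological
  type, so the argument works with real functionals only. A squared norm is nonnegative, hence
  governed by its Laplace transform, and that transform needs only scalar functionals and a bound on
  expected tails. The kernel subtracts 1, \<sigma> and \<sigma>^2 / 2 from exp \<sigma>: the
  constant comes from centring, the linear term from estimating the mean, the quadratic one from
  estimating the covariance. Two restrictions shape the estimates. The data have only a second
  moment, so the strong law is proved for integrable variables; the bootstrap samples are Gaussian,
  and their score has a fourth moment bounded independently of operator and direction. The weight
  has only a fourth moment, so the linearisation error is estimated twice: one bound is small in n
  but of order eight in the norm of f, the other is uniform in n and of order four. The kernel
  depends on the operator through the numbers \<open>C f \<bullet> g\<close> alone, and their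
  convergence together with a uniform bound follows from countably many strong laws.\<close>

text \<open>The carrier \<open>A\<close> is explicit because the notion serves both a whole type
  (for \<open>limit_kernel\<close>) and the subset \<open>l2fun M\<close> of a function type. Points
  of a family may repeat.\<close>

definition psd_kernel_on :: "'a set \<Rightarrow> ('a \<Rightarrow> 'a \<Rightarrow> real) \<Rightarrow> bool" where
  "psd_kernel_on A K \<longleftrightarrow> (\<forall>x\<in>A. \<forall>y\<in>A. K x y = K y x) \<and>
     (\<forall>(N::nat) x c. (\<forall>i<N. x i \<in> A) \<longrightarrow> 0 \<le> (\<Sum>i<N. \<Sum>j<N. c i * c j * K (x i) (x j)))"

lemma psd_kernel_onD:
  fixes N :: nat
  assumes "psd_kernel_on A K" "\<And>i. i < N \<Longrightarrow> x i \<in> A"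
  shows "0 \<le> (\<Sum>i<N. \<Sum>j<N. c i * c j * K (x i) (x j))"
proof -
  have "\<forall>i<N. x i \<in> A" using assms(2) by simp
  with assms(1)[unfolded psd_kernel_on_def, THEN conjunct2, rule_format, of N x c]
  show ?thesis by simp
qed

lemma psd_kernel_on_sym: "psd_kernel_on A K \<Longrightarrow> x \<in> A \<Longrightarrow> y \<in> A \<Longrightarrow> K x y = K y x"
  unfolding psd_kernel_on_def by blast

lemma psd_kernel_on_nonneg: "psd_kernel_on A K \<Longrightarrow> x \<in> A \<Longrightarrow> 0 \<le> K x x"
  using psd_kernel_onD[of A K "Suc 0" "\<lambda>_. x" "\<lambda>_. 1"] by (simp del: sum_constant add: lessThan_Suc)

lemma psd_kernel_on_two:
  assumes "psd_kernel_on A K" "x \<in> A" "y \<in> A"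
  shows "0 \<le> a\<^sup>2 * K x x + 2 * a * b * K x y + b\<^sup>2 * K y y"
proof -
  have "0 \<le> (\<Sum>i<2::nat. \<Sum>j<2::nat. (if i = 0 then a else b) * (if j = 0 then a else b) *
      K (if i = 0 then x else y) (if j = 0 then x else y))"
    by (rule psd_kernel_onD[OF assms(1)]) (use assms in auto)
  then show ?thesis
    using psd_kernel_on_sym[OF assms] by (simp add: numeral_2_eq_2 power2_eq_square algebra_simps)
qed

lemma psd_kernel_on_Cauchy_Schwarz:
  assumes "psd_kernel_on A K" "x \<in> A" "y \<in> A"
  shows "(K x y)\<^sup>2 \<le> K x x * K y y"
proof (cases "K y y = 0")
  case True
  have "K x y = 0"
  proof (rule ccontr)
    assume n: "K x y \<noteq> 0"
    \<comment> \<open>With \<open>K y y = 0\<close> the quadratic form is affine in the second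
      coefficient; this choice gives it the value -1.\<close>
    have "0 \<le> K x x + 2 * (-(K x x + 1) / (2 * K x y)) * K x y"
      using psd_kernel_on_two[OF assms, of 1 "-(K x x + 1) / (2 * K x y)"] True by simp
    then show False using n by (simp add: field_simps)
  qed
  then show ?thesis using True by simp
next
  case False
  then have p: "K y y > 0" using psd_kernel_on_nonneg[OF assms(1,3)] by simp
  have "0 \<le> K x x + 2 * (-(K x y) / K y y) * K x y + (-(K x y) / K y y)\<^sup>2 * K y y"
    using psd_kernel_on_two[OF assms, of 1 "-(K x y) / K y y"] by simp
  also have "\<dots> = K x x - (K x y)\<^sup>2 / K y y"
    using p by (simp add: field_simps power2_eq_square)
  finally show ?thesis using p by (simp add: field_simps)
qed

text \<open>Adding the point \<open>d\<close> to a finite family, with the coefficient that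
  minimises the quadratic form, leaves exactly the form of the Schur complement. The correction is a
  product of two factors of the same shape, so that the expansion below is a sum of products; for
  \<open>K d d = 0\<close> both factors are 0 and the kernel is unchanged.\<close>

lemma psd_kernel_on_Schur:
  assumes K: "psd_kernel_on A K" and d: "d \<in> A"
  shows "psd_kernel_on A (\<lambda>x y. K x y - K x d / sqrt (K d d) * (K y d / sqrt (K d d)))"
    (is "psd_kernel_on A ?R")
proof (cases "K d d = 0")
  case True then show ?thesis using K by simp
next
  case False
  then have p: "K d d > 0" using psd_kernel_on_nonneg[OF K d] by simp
  have R: "?R = (\<lambda>x y. K x y - K x d * K y d / K d d)"
    using p by (auto simp: fun_eq_iff)
  show ?thesis unfolding R psd_kernel_on_def
  proof (intro conjI ballI allI impI)
    fix x y assume "x \<in> A" "y \<in> A"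
    then show "K x y - K x d * K y d / K d d = K y x - K y d * K x d / K d d"
      using psd_kernel_on_sym[OF K] by simp
  next
    fix N :: nat and x :: "nat \<Rightarrow> 'a" and c :: "nat \<Rightarrow> real"
    assume x: "\<forall>i<N. x i \<in> A"
    define L where "L = (\<Sum>i<N. c i * K (x i) d)"
    define Qf where "Qf = (\<Sum>i<N. \<Sum>j<N. c i * c j * K (x i) (x j))"
    \<comment> \<open>The minimiser of \<open>Qf + 2 * e * L + e\<^sup>2 * K d d\<close> over
      \<open>e\<close>; the minimum is \<open>Qf - L * L / K d d\<close>.\<close>
    define e where "e = - L / K d d"
    have "0 \<le> (\<Sum>i<Suc N. \<Sum>j<Suc N. (c(N := e)) i * (c(N := e)) j * K ((x(N := d)) i) ((x(N := d)) j))"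
      by (rule psd_kernel_onD[OF K]) (use x d in auto)
    also have "\<dots> = (\<Sum>i<N. (\<Sum>j<N. c i * c j * K (x i) (x j)) + c i * e * K (x i) d)
         + ((\<Sum>j<N. e * c j * K d (x j)) + e * e * K d d)"
      by (simp add: sum.lessThan_Suc)
    also have "(\<Sum>j<N. e * c j * K d (x j)) = e * L"
      unfolding L_def sum_distrib_left using x d psd_kernel_on_sym[OF K d]
      by (intro sum.cong) (auto simp: mult_ac)
    also have "(\<Sum>i<N. (\<Sum>j<N. c i * c j * K (x i) (x j)) + c i * e * K (x i) d) = Qf + e * L"
      unfolding L_def Qf_def sum.distrib sum_distrib_left by (simp add: mult_ac)
    also have "Qf + e * L + (e * L + e * e * K d d) = Qf - L * L / K d d"
      using p by (simp add: e_def field_simps)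
    also have "L * L / K d d = (\<Sum>i<N. \<Sum>j<N. c i * c j * (K (x i) d * K (x j) d / K d d))"
      unfolding L_def sum_product sum_divide_distrib by (simp add: mult_ac)
    finally show "0 \<le> (\<Sum>i<N. \<Sum>j<N. c i * c j * (K (x i) (x j) - K (x i) d * K (x j) d / K d d))"
      by (simp add: Qf_def right_diff_distrib sum_subtractf)
  qed
qed

text \<open>Cholesky factorisation: the Schur complement of the kernel at \<open>d i\<close> is taken successively;
  the remainders vanish at all earlier points, hence by density they tend to zero.\<close>

lemma kernel_expansion:
  fixes K :: "'a \<Rightarrow> 'a \<Rightarrow> real"
  assumes K: "psd_kernel_on A K" and d: "\<And>i::nat. d i \<in> A"
    and dense: "\<And>x e. x \<in> A \<Longrightarrow> e > 0 \<Longrightarrow> \<exists>i. K x x - 2 * K x (d i) + K (d i) (d i) < e"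
  obtains c :: "nat \<Rightarrow> nat \<Rightarrow> real" where
    "\<And>x y. x \<in> A \<Longrightarrow> y \<in> A \<Longrightarrow>
      (\<lambda>i. (\<Sum>j\<le>i. c i j * K x (d j)) * (\<Sum>j\<le>i. c i j * K y (d j))) sums K x y"
proof -
  define R where "R = rec_nat K (\<lambda>i R x y. R x y - R x (d i) / sqrt (R (d i) (d i)) * (R y (d i) / sqrt (R (d i) (d i))))"
  define p where "p i x = R i x (d i) / sqrt (R i (d i) (d i))" for i x
  have R0: "R 0 = K" by (simp add: R_def)
  have RS: "R (Suc i) = (\<lambda>x y. R i x y - p i x * p i y)" for i
    by (simp add: R_def p_def)
  have psd: "psd_kernel_on A (R i)" for i
  proof (induction i)
    case (Suc i)
    show ?case unfolding RS p_def by (rule psd_kernel_on_Schur[OF Suc d])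
  qed (simp add: R0 K)
  have Rsum: "R i x y = K x y - (\<Sum>l<i. p l x * p l y)" for i x y
    by (induction i) (simp_all add: R0 RS)
  \<comment> \<open>Step \<open>j\<close> annihilates the diagonal at \<open>d j\<close>. Later
    steps only subtract squares from a diagonal that stays nonnegative, so it remains 0.\<close>
  have dd: "R i (d j) (d j) = 0" if "j < i" for i j
    using that
  proof (induction i)
    case (Suc i)
    show ?case
    proof (cases "j = i")
      case True
      have "0 \<le> R i (d i) (d i)" using psd_kernel_on_nonneg[OF psd d] .
      then show ?thesis using True by (simp add: RS p_def)
    next
      case False
      then have "R (Suc i) (d j) (d j) = - (p i (d j))\<^sup>2" using Suc by (simp add: RS power2_eq_square)
      moreover have "0 \<le> R (Suc i) (d j) (d j)" using psd_kernel_on_nonneg[OF psd d] .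
      ultimately show ?thesis by (smt (verit) zero_le_power2)
    qed
  qed simp
  \<comment> \<open>Each factor is a finite combination of kernel sections \<open>K x (d j)\<close>
    with coefficients independent of \<open>x\<close>. This explicit form makes the factors inner
    products with fixed elements in one application and continuous functions in the other.\<close>
  have comb: "\<exists>c. \<forall>x. p i x = (\<Sum>j\<le>i. c j * K x (d j))" for i
  proof (induction i rule: less_induct)
    case (less i)
    then have "\<forall>l. \<exists>c. l < i \<longrightarrow> (\<forall>x. p l x = (\<Sum>j\<le>l. c j * K x (d j)))" by blast
    then obtain c where c: "\<And>l x. l < i \<Longrightarrow> p l x = (\<Sum>j\<le>l. c l j * K x (d j))" by metis
    define s where "s = sqrt (R i (d i) (d i))"
    \<comment> \<open>Triangular substitution: \<open>p i\<close> is the section at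
      \<open>d i\<close> minus its components along the earlier factors, divided by
      \<open>s\<close>. The inner \<open>if\<close> extends \<open>c l\<close> by 0 beyond
      \<open>l\<close>, so that the sums over \<open>l\<close> and \<open>j\<close> can be
      exchanged.\<close>
    define c' where "c' j = (if j = i then 1 else - (\<Sum>l<i. p l (d i) * (if j \<le> l then c l j else 0))) / s" for j
    have "p i x = (\<Sum>j\<le>i. c' j * K x (d j))" for x
    proof -
      have "(\<Sum>l<i. p l x * p l (d i)) = (\<Sum>l<i. \<Sum>j<i. p l (d i) * (if j \<le> l then c l j else 0) * K x (d j))"
      proof (intro sum.cong refl)
        fix l assume l: "l \<in> {..<i}"
        have "(\<Sum>j\<le>l. c l j * K x (d j)) = (\<Sum>j<i. (if j \<le> l then c l j else 0) * K x (d j))"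
          by (rule sum.mono_neutral_cong_left) (use l in auto)
        then show "p l x * p l (d i) = (\<Sum>j<i. p l (d i) * (if j \<le> l then c l j else 0) * K x (d j))"
          using c[of l] l by (simp add: sum_distrib_left mult_ac)
      qed
      also have "\<dots> = (\<Sum>j<i. (\<Sum>l<i. p l (d i) * (if j \<le> l then c l j else 0)) * K x (d j))"
        by (subst sum.swap) (simp add: sum_distrib_right)
      finally have "p i x = (K x (d i) - (\<Sum>j<i. (\<Sum>l<i. p l (d i) * (if j \<le> l then c l j else 0)) * K x (d j))) / s"
        by (simp add: p_def[of i] s_def[symmetric] Rsum[of i x])
      also have "\<dots> = (\<Sum>j<i. c' j * K x (d j)) + c' i * K x (d i)"
      proof -
        have "(\<Sum>j<i. c' j * K x (d j))
            = (\<Sum>j<i. - ((\<Sum>l<i. p l (d i) * (if j \<le> l then c l j else 0)) * K x (d j) / s))"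
          by (intro sum.cong) (auto simp: c'_def)
        then show ?thesis by (simp add: c'_def sum_negf sum_divide_distrib diff_divide_distrib)
      qed
      finally show ?thesis by (simp add: lessThan_Suc_atMost[symmetric])
    qed
    then show ?case by blast
  qed
  then obtain c where c: "\<And>i x. p i x = (\<Sum>j\<le>i. c i j * K x (d j))" by metis
  have diag: "(\<lambda>n. R n x x) \<longlonglongrightarrow> 0" if x: "x \<in> A" for x
  proof (rule LIMSEQ_I)
    fix e :: real assume e: "e > 0"
    obtain i where i: "K x x - 2 * K x (d i) + K (d i) (d i) < e" using dense[OF x e] by blast
    \<comment> \<open>The squared kernel distance \<open>R n x x - 2 * R n x y + R n y y\<close>
      decreases in \<open>n\<close>, because a square is subtracted at each step; at
      \<open>y = d i\<close> its last two terms vanish once \<open>n > i\<close>.\<close>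
    have "norm (R n x x - 0) < e" if n: "n \<ge> Suc i" for n
    proof -
      have z: "R n (d i) (d i) = 0" using dd n by simp
      then have "R n x (d i) = 0"
        using psd_kernel_on_Cauchy_Schwarz[OF psd x d, of n i] by simp
      then have "R n x x = R n x x - 2 * R n x (d i) + R n (d i) (d i)" using z by simp
      also have "\<dots> = K x x - 2 * K x (d i) + K (d i) (d i) - (\<Sum>l<n. (p l x - p l (d i))\<^sup>2)"
        by (simp add: Rsum power2_diff sum.distrib sum_subtractf sum_distrib_left[symmetric] mult.assoc)
          (simp add: power2_eq_square)
      also have "\<dots> < e" using i sum_nonneg[of "{..<n}" "\<lambda>l. (p l x - p l (d i))\<^sup>2"] by simp
      finally show ?thesis using psd_kernel_on_nonneg[OF psd x, of n] by simp
    qed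
    then show "\<exists>no. \<forall>n\<ge>no. norm (R n x x - 0) < e" by blast
  qed
  have "(\<lambda>i. p i x * p i y) sums K x y" if x: "x \<in> A" and y: "y \<in> A" for x y
  proof -
    have "(\<lambda>n. R n x y) \<longlonglongrightarrow> 0"
    proof (rule Lim_null_comparison)
      show "\<forall>\<^sub>F n in sequentially. norm (R n x y) \<le> sqrt (R n x x * R n y y)"
        using psd_kernel_on_Cauchy_Schwarz[OF psd x y] by (auto intro!: always_eventually real_le_rsqrt)
      show "(\<lambda>n. sqrt (R n x x * R n y y)) \<longlonglongrightarrow> 0"
        using tendsto_real_sqrt[OF tendsto_mult[OF diag[OF x] diag[OF y]]] by simp
    qed
    then have "(\<lambda>n. K x y - R n x y) \<longlonglongrightarrow> K x y" using tendsto_diff[OF tendsto_const] by force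
    then show ?thesis by (simp add: sums_def Rsum)
  qed
  then show ?thesis using that[of c] unfolding c by blast
qed

section \<open>Laplace transforms and weak convergence\<close>

text \<open>The substitution y = exp (- x) maps the half line onto (0, 1] and turns the exponentials
  with natural rates into monomials, so Weierstrass approximation applies.\<close>

lemma cts_step_exp_approx:
  fixes a b e :: real
  assumes ab: "a < b" and e: "e > 0"
  obtains c :: "nat \<Rightarrow> real" and N where
    "\<And>x. x \<ge> 0 \<Longrightarrow> \<bar>cts_step a b x - (\<Sum>k\<le>N. c k * exp (- real k * x))\<bar> < e"
proof -
  define B where "B = max b 0"
  \<comment> \<open>The maximum keeps the logarithm away from its singularity at 0. It alters the
    argument only beyond x = B + 1, where \<open>cts_step a b\<close> already vanishes, so
    \<open>g\<close> is continuous on the closed interval.\<close>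
  define g where "g y = cts_step a b (- ln (max y (exp (- B - 1))))" for y
  have cc: "continuous_on UNIV (cts_step a b)"
    using cts_step_uniformly_continuous[OF ab] uniformly_continuous_imp_continuous by blast
  have "max y (exp (- B - 1)) \<noteq> 0" for y :: real
    by (metis exp_gt_zero max.strict_coboundedI2 order_less_irrefl)
  then have "continuous_on {0..1} (\<lambda>y. - ln (max y (exp (- B - 1))))"
    by (intro continuous_intros) auto
  from continuous_on_compose2[OF cc this] have "continuous_on {0..1} g"
    by (simp add: g_def)
  from Stone_Weierstrass_real_polynomial_function[OF _ this e]
  obtain h where h: "real_polynomial_function h" "\<And>y. y \<in> {0..1} \<Longrightarrow> \<bar>g y - h y\<bar> < e" by auto
  obtain c N where c: "h = (\<lambda>y. \<Sum>k\<le>N. c k * y ^ k)"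
    using h(1) real_polynomial_function_iff_sum by auto
  show ?thesis
  proof (rule that)
    fix x :: real assume x: "x \<ge> 0"
    have "g (exp (- x)) = cts_step a b x"
    proof (cases "x \<le> B + 1")
      case True
      then show ?thesis by (simp add: g_def)
    next
      case False
      then have "max (exp (- x)) (exp (- B - 1)) = exp (- B - 1)" by (simp add: max_def)
      then show ?thesis using False ab by (simp add: g_def cts_step_def B_def)
    qed
    moreover have "\<bar>g (exp (- x)) - h (exp (- x))\<bar> < e" using h(2) x by simp
    ultimately show "\<bar>cts_step a b x - (\<Sum>k\<le>N. c k * exp (- real k * x))\<bar> < e"
      by (simp add: c exp_of_nat_mult[symmetric])
  qed
qed

text \<open>Finite combinations of exp (- k x) with natural k approximate \<open>cts_step\<close>
  uniformly on the half line, which carries all the laws; convergence of the integrals of these step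
  functions characterises weak convergence.\<close>

lemma laplace_imp_weak_conv_m:
  assumes dn: "\<And>n. real_distribution (\<mu> n)" and d: "real_distribution \<nu>"
    and nonneg_n: "\<And>n. AE x in \<mu> n. 0 \<le> x" and nonneg: "AE x in \<nu>. 0 \<le> x"
    and lap: "\<And>s. s \<ge> 0 \<Longrightarrow> (\<lambda>n. \<integral>x. exp (- s * x) \<partial>\<mu> n) \<longlonglongrightarrow> (\<integral>x. exp (- s * x) \<partial>\<nu>)"
  shows "weak_conv_m \<mu> \<nu>"
proof (rule integral_cts_step_conv_imp_weak_conv[OF dn d])
  fix a b :: real assume ab: "a < b"
  have approx: "\<bar>(\<integral>x. cts_step a b x \<partial>M) - (\<Sum>k\<le>N. c k * (\<integral>x. exp (- real k * x) \<partial>M))\<bar> \<le> e"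
    if M: "real_distribution M" "AE x in M. 0 \<le> x" and e: "e \<ge> 0"
      and c: "\<And>x. x \<ge> 0 \<Longrightarrow> \<bar>cts_step a b x - (\<Sum>k\<le>N. c k * exp (- real k * x))\<bar> < e" for M N c e
  proof -
    interpret real_distribution M by (rule M)
    have ie: "integrable M (\<lambda>x. exp (- real k * x))" for k
    proof (rule integrable_const_bound[where B=1])
      show "AE x in M. norm (exp (- real k * x)) \<le> 1" using M(2) by eventually_elim simp
    qed simp
    have ics: "integrable M (cts_step a b)" by (rule integrable_cts_step[OF ab])
    have "\<bar>(\<integral>x. cts_step a b x \<partial>M) - (\<Sum>k\<le>N. c k * (\<integral>x. exp (- real k * x) \<partial>M))\<bar>
        = \<bar>\<integral>x. cts_step a b x - (\<Sum>k\<le>N. c k * exp (- real k * x)) \<partial>M\<bar>"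
      using ie ics by simp
    also have "\<dots> \<le> (\<integral>x. \<bar>cts_step a b x - (\<Sum>k\<le>N. c k * exp (- real k * x))\<bar> \<partial>M)"
      by (rule integral_abs_bound)
    also have "\<dots> \<le> (\<integral>x. e \<partial>M)"
    proof (rule integral_mono_AE)
      show "AE x in M. \<bar>cts_step a b x - (\<Sum>k\<le>N. c k * exp (- real k * x))\<bar> \<le> e"
        using M(2) by eventually_elim (use c in \<open>auto intro: less_imp_le\<close>)
    qed (use ie ics in auto)
    also have "\<dots> = e"
    proof -
      have "prob UNIV = 1" by (metis prob_space space_eq_univ)
      then show ?thesis by simp
    qed
    finally show ?thesis .
  qed
  show "(\<lambda>n. \<integral>x. cts_step a b x \<partial>\<mu> n) \<longlonglongrightarrow> (\<integral>x. cts_step a b x \<partial>\<nu>)"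
  proof (rule LIMSEQ_I)
    fix r :: real assume r: "r > 0"
    obtain c N where c: "\<And>x. x \<ge> 0 \<Longrightarrow> \<bar>cts_step a b x - (\<Sum>k\<le>N. c k * exp (- real k * x))\<bar> < r / 4"
      using cts_step_exp_approx[OF ab, of "r / 4"] r by auto
    let ?L = "\<lambda>M. \<Sum>k\<le>N. c k * (\<integral>x. exp (- real k * x) \<partial>M)"
    have "(\<lambda>n. ?L (\<mu> n)) \<longlonglongrightarrow> ?L \<nu>" by (intro tendsto_intros lap) simp
    then obtain n0 where n0: "\<And>n. n \<ge> n0 \<Longrightarrow> \<bar>?L (\<mu> n) - ?L \<nu>\<bar> < r / 4"
      using LIMSEQ_D[of "\<lambda>n. ?L (\<mu> n)" "?L \<nu>" "r / 4"] r unfolding real_norm_def by auto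
    have "norm ((\<integral>x. cts_step a b x \<partial>\<mu> n) - (\<integral>x. cts_step a b x \<partial>\<nu>)) < r" if "n \<ge> n0" for n
    proof -
      have "\<bar>(\<integral>x. cts_step a b x \<partial>\<mu> n) - ?L (\<mu> n)\<bar> \<le> r / 4"
        by (rule approx[OF dn nonneg_n _ c]) (use r in auto)
      moreover have "\<bar>(\<integral>x. cts_step a b x \<partial>\<nu>) - ?L \<nu>\<bar> \<le> r / 4"
        by (rule approx[OF d nonneg _ c]) (use r in auto)
      ultimately show ?thesis using n0[OF that] r unfolding real_norm_def by linarith
    qed
    then show "\<exists>no. \<forall>n\<ge>no. norm ((\<integral>x. cts_step a b x \<partial>\<mu> n) - (\<integral>x. cts_step a b x \<partial>\<nu>)) < r" by blast
  qed
qed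

section \<open>The strong law of large numbers\<close>

lemma (in prob_space) fourth_moment_imp_integrable_power:
  assumes [measurable]: "Z \<in> borel_measurable M" and i4: "integrable M (\<lambda>x. (Z x :: real) ^ 4)" and k: "k \<le> 4"
  shows "integrable M (\<lambda>x. Z x ^ k)"
proof (rule Bochner_Integration.integrable_bound[where f="\<lambda>x. 1 + Z x ^ 4"])
  show "AE x in M. norm (Z x ^ k) \<le> norm (1 + Z x ^ 4)"
  proof (rule AE_I2)
    fix x
    have "\<bar>Z x\<bar> ^ k \<le> 1 + \<bar>Z x\<bar> ^ 4"
    proof (cases "\<bar>Z x\<bar> \<le> 1")
      case True
      then show ?thesis using power_le_one[of "\<bar>Z x\<bar>" k]
zero_le_power[of "\<bar>Z x\<bar>" 4] by linarith
    next
      case False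
      then have "\<bar>Z x\<bar> ^ k \<le> \<bar>Z x\<bar> ^ 4" using k by (intro power_increasing) auto
      then show ?thesis by simp
    qed
    then show "norm (Z x ^ k) \<le> norm (1 + Z x ^ 4)" by (simp add: power_abs)
  qed
qed (use i4 in auto)

lemma binomial_expansion_4: "(y + s) ^ 4 = s ^ 4 + 4 * (y ^ 1 * s ^ 3) + 6 * (y ^ 2 * s ^ 2)
      + 4 * (y ^ 3 * s ^ 1) + y ^ 4" for y s :: real
  by algebra

text \<open>Induction over the index set: independence and centring remove the cross terms with odd
  exponents, and what remains of them is 6 E(Y^2) E(S^2). The bound on the second moment is carried
  along for this term; sqrt c bounds E(Y^2) because the variance of Y^2 is nonnegative.\<close>

lemma (in prob_space) fourth_moment_sum_le:
  fixes c :: real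
  assumes ind: "indep_vars (\<lambda>_. borel) Y I" and fin: "finite J" "J \<subseteq> I"
    and i4: "\<And>i. i \<in> J \<Longrightarrow> integrable M (\<lambda>x. (Y i x :: real) ^ 4)"
    and m: "\<And>i. i \<in> J \<Longrightarrow> expectation (Y i) = 0"
    and c: "\<And>i. i \<in> J \<Longrightarrow> expectation (\<lambda>x. Y i x ^ 4) \<le> c"
  shows "integrable M (\<lambda>x. (\<Sum>i\<in>J. Y i x) ^ 4) \<and> expectation (\<lambda>x. \<Sum>i\<in>J. Y i x) = 0 \<and>
     expectation (\<lambda>x. (\<Sum>i\<in>J. Y i x)\<^sup>2) \<le> card J * sqrt c \<and>
     expectation (\<lambda>x. (\<Sum>i\<in>J. Y i x) ^ 4) \<le> 3 * (card J)\<^sup>2 * c"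
  using fin i4 m c
proof (induction J rule: finite_induct)
  case empty
  then show ?case by simp
next
  case (insert j J)
  define S where "S x = (\<Sum>i\<in>J. Y i x)" for x
  have IH: "integrable M (\<lambda>x. S x ^ 4)" "expectation S = 0"
     "expectation (\<lambda>x. (S x)\<^sup>2) \<le> card J * sqrt c" "expectation (\<lambda>x. S x ^ 4) \<le> 3 * (card J)\<^sup>2 * c"
    using insert unfolding S_def by auto
  have rv[measurable]: "Y i \<in> borel_measurable M" if "i \<in> I" for i
    using ind that by (auto simp: indep_vars_def)
  have [measurable]: "S \<in> borel_measurable M" "Y j \<in> borel_measurable M"
    unfolding S_def using insert.prems by (auto intro!: borel_measurable_sum rv)
  have Yj: "integrable M (\<lambda>x. Y j x ^ 4)" "expectation (Y j) = 0" "expectation (\<lambda>x. Y j x ^ 4) \<le> c"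
    using insert.prems by auto
  have iv: "indep_var borel (Y j) borel S"
    unfolding S_def using insert by (intro indep_vars_sum indep_vars_subset[OF ind]) auto
  have ip: "indep_var borel (\<lambda>x. Y j x ^ k) borel (\<lambda>x. S x ^ l)" for k l
    using indep_var_compose[OF iv, of "\<lambda>x. x ^ k" borel "\<lambda>x. x ^ l" borel] by (simp add: comp_def)
  note iS = fourth_moment_imp_integrable_power[OF _ IH(1)]
  note iY = fourth_moment_imp_integrable_power[OF _ Yj(1)]
  have prod: "integrable M (\<lambda>x. Y j x ^ k * S x ^ l)"
      "expectation (\<lambda>x. Y j x ^ k * S x ^ l) = expectation (\<lambda>x. Y j x ^ k) * expectation (\<lambda>x. S x ^ l)"
    if "k \<le> 4" "l \<le> 4" for k l
    using that by (intro indep_var_integrable[OF ip] indep_var_lebesgue_integral[OF ip] iS iY; simp)+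
  have e4: "(\<Sum>i\<in>insert j J. Y i x) ^ 4 = S x ^ 4 + 4 * (Y j x ^ 1 * S x ^ 3) + 6 * (Y j x ^ 2 * S x ^ 2)
      + 4 * (Y j x ^ 3 * S x ^ 1) + Y j x ^ 4" for x
    using insert.hyps binomial_expansion_4[of "Y j x" "S x"] by (simp add: S_def)
  have e2: "(\<Sum>i\<in>insert j J. Y i x) ^ 2 = S x ^ 2 + 2 * (Y j x ^ 1 * S x ^ 1) + Y j x ^ 2" for x
    using insert.hyps by (simp add: S_def power2_sum)
  have c0: "0 \<le> c"
    using Yj(3) by (rule order_trans[rotated]) (simp add: Bochner_Integration.integral_nonneg)
  have Y2: "expectation (\<lambda>x. (Y j x)\<^sup>2) \<le> sqrt c"
  proof (rule real_le_rsqrt)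
    have "(expectation (\<lambda>x. (Y j x)\<^sup>2))\<^sup>2 \<le> expectation (\<lambda>x. ((Y j x)\<^sup>2)\<^sup>2)"
      using variance_positive[of "\<lambda>x. (Y j x)\<^sup>2"] variance_eq[of "\<lambda>x. (Y j x)\<^sup>2"] iY[of 2] iY[of 4]
      by simp
    then show "(expectation (\<lambda>x. (Y j x)\<^sup>2))\<^sup>2 \<le> c" using Yj(3) by simp
  qed
  have Y20: "0 \<le> expectation (\<lambda>x. (Y j x)\<^sup>2)" and S20: "0 \<le> expectation (\<lambda>x. (S x)\<^sup>2)" by auto
  show ?case
  proof (intro conjI)
    show "integrable M (\<lambda>x. (\<Sum>i\<in>insert j J. Y i x) ^ 4)"
      unfolding e4 using prod(1)[of 1 3] prod(1)[of 2 2] prod(1)[of 3 1] IH(1) Yj(1)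
      by (intro Bochner_Integration.integrable_add integrable_mult_right) auto
    show "expectation (\<lambda>x. \<Sum>i\<in>insert j J. Y i x) = 0"
      using insert.hyps IH(2) Yj(2) iS[of 1] iY[of 1] by (simp add: S_def[symmetric])
    have "expectation (\<lambda>x. (\<Sum>i\<in>insert j J. Y i x)\<^sup>2) = expectation (\<lambda>x. (S x)\<^sup>2) + expectation (\<lambda>x. (Y j x)\<^sup>2)"
      unfolding e2 using prod[of 1 1] iS[of 2] iY[of 2] IH(2) Yj(2) by simp
    also have "\<dots> \<le> card (insert j J) * sqrt c"
      using insert.hyps IH(3) Y2 by (simp add: algebra_simps)
    finally show "expectation (\<lambda>x. (\<Sum>i\<in>insert j J. Y i x)\<^sup>2) \<le> card (insert j J) * sqrt c" .
    have "expectation (\<lambda>x. (\<Sum>i\<in>insert j J. Y i x) ^ 4) = expectation (\<lambda>x. S x ^ 4)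
        + 6 * (expectation (\<lambda>x. (Y j x)\<^sup>2) * expectation (\<lambda>x. (S x)\<^sup>2)) + expectation (\<lambda>x. Y j x ^ 4)"
      unfolding e4 using prod[of 3 1] prod[of 2 2] prod[of 1 3] IH(1,2) Yj(1,2)
      by simp
    moreover have "expectation (\<lambda>x. (Y j x)\<^sup>2) * expectation (\<lambda>x. (S x)\<^sup>2) \<le> sqrt c * (card J * sqrt c)"
      using IH(3) Y2 S20 c0 by (intro mult_mono) auto
    moreover have "sqrt c * (card J * sqrt c) = card J * c" using c0 by simp
    ultimately have "expectation (\<lambda>x. (\<Sum>i\<in>insert j J. Y i x) ^ 4) \<le> 3 * (card J)\<^sup>2 * c + 6 * (card J * c) + c"
      using IH(4) Yj(3) by simp
    also have "\<dots> \<le> 3 * (card (insert j J))\<^sup>2 * c"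
      using insert.hyps c0 by (simp add: power2_eq_square algebra_simps)
    finally show "expectation (\<lambda>x. (\<Sum>i\<in>insert j J. Y i x) ^ 4) \<le> 3 * (card (insert j J))\<^sup>2 * c" .
  qed
qed

lemma (in prob_space) iid_integrable:
  assumes "\<And>i. Y i \<in> borel_measurable M" "\<And>i. distr M borel (Y i) = distr M borel (Y 0)"
    and f: "f \<in> borel_measurable borel" and "integrable M (\<lambda>x. f (Y 0 x :: 'b :: topological_space) :: real)"
  shows "integrable M (\<lambda>x. f (Y i x))" "expectation (\<lambda>x. f (Y i x)) = expectation (\<lambda>x. f (Y 0 x))"
proof -
  have "integrable (distr M borel (Y 0)) f"
    using assms by (subst integrable_distr_eq) auto
  then have "integrable (distr M borel (Y i)) f" using assms(2) by metis
  then show "integrable M (\<lambda>x. f (Y i x))" using assms by (subst (asm) integrable_distr_eq) auto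
  have "integral\<^sup>L (distr M borel (Y i)) f = integral\<^sup>L (distr M borel (Y 0)) f" using assms(2) by metis
  then show "expectation (\<lambda>x. f (Y i x)) = expectation (\<lambda>x. f (Y 0 x))"
    using assms by (simp add: integral_distr)
qed

text \<open>Fourth moments of the centred averages are of order n^-2, hence summable: almost surely
  the fourth powers have a finite sum, so their terms tend to 0.\<close>

lemma (in prob_space) bounded_SLLN:
  fixes Y :: "nat \<Rightarrow> 'a \<Rightarrow> real"
  assumes ind: "indep_vars (\<lambda>_. borel) Y UNIV" and ident: "\<And>i. distr M borel (Y i) = distr M borel (Y 0)"
    and bd: "\<And>i x. \<bar>Y i x\<bar> \<le> B"
  shows "AE x in M. (\<lambda>n. (\<Sum>j<n. Y j x) / real n) \<longlonglongrightarrow> expectation (Y 0)"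
proof -
  define m where "m = expectation (Y 0)"
  define Z where "Z j x = Y j x - m" for j x
  have rvY[measurable]: "Y i \<in> borel_measurable M" for i
    using ind by (auto simp: indep_vars_def)
  have rvZ[measurable]: "Z i \<in> borel_measurable M" for i unfolding Z_def by measurable
  have iY: "integrable M (Y i)" for i
    by (rule integrable_const_bound[where B=B]) (use bd in auto)
  have indZ: "indep_vars (\<lambda>_. borel) Z UNIV"
    unfolding Z_def using indep_vars_compose[OF ind, of "\<lambda>_ x. x - m"] by (simp add: comp_def)
  have mZ: "expectation (Z i) = 0" for i
    using iid_integrable(2)[where Y=Y and f="\<lambda>x. x" and i=i, OF rvY ident] iY prob_space unfolding Z_def by (simp add: m_def)
  have bZ: "\<bar>Z i x\<bar> \<le> B + \<bar>m\<bar>" for i x using bd[of i x] unfolding Z_def by linarith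
  define c where "c = (B + \<bar>m\<bar>) ^ 4"
  have Z4: "Z i x ^ 4 \<le> c" for i x
    using power_mono[OF bZ[of i x], of 4] unfolding c_def by (simp add: power_abs)
  have iZ4: "integrable M (\<lambda>x. Z i x ^ 4)" for i
    by (rule integrable_const_bound[where B=c]) (use Z4 in auto)
  have EZ4: "expectation (\<lambda>x. Z i x ^ 4) \<le> c" for i
    using integral_mono[OF iZ4, of "\<lambda>_. c"] Z4 prob_space by simp
  define S where "S n x = ((\<Sum>j<n. Z j x) / real n) ^ 4" for n x
  \<comment> \<open>At \<open>n = 0\<close> both sides of the bound are 0 by the convention for
    division by 0, so no case distinction arises.\<close>
  have iS: "integrable M (S n)" and ES: "expectation (S n) \<le> 3 * c / real n ^ 2" for n
  proof -
    note * = fourth_moment_sum_le[OF indZ finite_lessThan[of n] subset_UNIV iZ4 mZ EZ4]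
    show "integrable M (S n)" using * unfolding S_def power_divide by auto
    have "expectation (S n) \<le> 3 * (real n)\<^sup>2 * c / real n ^ 4"
      using * unfolding S_def power_divide by (simp add: divide_right_mono)
    also have "\<dots> = 3 * c / real n ^ 2" by (simp add: eval_nat_numeral)
    finally show "expectation (S n) \<le> 3 * c / real n ^ 2" .
  qed
  have "(\<integral>\<^sup>+x. (\<Sum>n. ennreal (S n x)) \<partial>M) = (\<Sum>n. \<integral>\<^sup>+x. ennreal (S n x) \<partial>M)"
    by (rule nn_integral_suminf) (simp add: S_def)
  also have "\<dots> = (\<Sum>n. ennreal (expectation (S n)))"
    by (subst nn_integral_eq_integral[OF iS]) (auto simp: S_def)
  also have "\<dots> \<noteq> \<infinity>"
  proof -
    have "summable (\<lambda>n. expectation (S n))"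
    proof (rule summable_comparison_test')
      show "summable (\<lambda>n. 3 * c * inverse (real n ^ 2))"
        using inverse_power_summable[of 2] by (intro summable_mult) auto
      show "norm (expectation (S n)) \<le> 3 * c * inverse (real n ^ 2)" for n
        using ES[of n] by (simp add: S_def divide_inverse)
    qed
    then show ?thesis
      by (subst suminf_ennreal2) (auto simp: S_def)
  qed
  finally have "AE x in M. (\<Sum>n. ennreal (S n x)) \<noteq> \<infinity>"
    by (intro nn_integral_PInf_AE) (auto simp: S_def)
  then show ?thesis
  proof eventually_elim
    case (elim x)
    have "summable (\<lambda>n. S n x)"
      using elim by (intro summable_suminf_not_top) (auto simp: S_def)
    then have "(\<lambda>n. S n x) \<longlonglongrightarrow> 0" by (rule summable_LIMSEQ_zero)
    then have "(\<lambda>n. root 4 (S n x)) \<longlonglongrightarrow> root 4 0" by (intro tendsto_real_root)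
    moreover have "root 4 (S n x) = \<bar>(\<Sum>j<n. Z j x) / real n\<bar>" for n
    proof -
      have "root 4 (q ^ 4) = \<bar>q\<bar>" for q :: real
        using real_root_power_cancel[of 4 "\<bar>q\<bar>"] power_even_abs[of 4 q] by simp
      then show ?thesis by (simp only: S_def)
    qed
    ultimately have "(\<lambda>n. \<bar>(\<Sum>j<n. Z j x) / real n\<bar>) \<longlonglongrightarrow> 0" by simp
    then have "(\<lambda>n. (\<Sum>j<n. Z j x) / real n) \<longlonglongrightarrow> 0" by (rule tendsto_rabs_zero_cancel)
    then have "(\<lambda>n. (\<Sum>j<n. Z j x) / real n + m) \<longlonglongrightarrow> 0 + m" by (intro tendsto_intros)
    moreover have "\<forall>\<^sub>F n in sequentially. (\<Sum>j<n. Z j x) / real n + m = (\<Sum>j<n. Y j x) / real n"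
      using eventually_gt_at_top[of 0]
      by eventually_elim (simp add: Z_def sum_subtractf field_simps)
    ultimately show ?case
      unfolding m_def[symmetric] by (simp add: filterlim_cong)
  qed
qed

section \<open>The maximal inequality\<close>

text \<open>This is the maximum of the partial sums of \<open>y j - l\<close> over all lengths from
  0 to \<open>N\<close>. The recursion splits off the first term, so that the functional of the
  shifted sequence appears on the right.\<close>

fun max_excess :: "real \<Rightarrow> nat \<Rightarrow> (nat \<Rightarrow> real) \<Rightarrow> real" where
  "max_excess l 0 y = 0"
| "max_excess l (Suc N) y = max 0 (y 0 - l + max_excess l N (\<lambda>j. y (Suc j)))"

lemma max_excess_nonneg: "0 \<le> max_excess l N y"
  by (cases N) auto

lemma max_excess_ge: "n \<le> N \<Longrightarrow> (\<Sum>j<n. y j - l) \<le> max_excess l N y"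
proof (induction N arbitrary: y n)
  case (Suc N)
  show ?case
  proof (cases n)
    case (Suc m)
    then have "(\<Sum>j<m. y (Suc j) - l) \<le> max_excess l N (\<lambda>j. y (Suc j))"
      using Suc.IH[of m "\<lambda>j. y (Suc j)"] Suc.prems by simp
    then show ?thesis unfolding Suc sum.lessThan_Suc_shift by simp
  qed simp
qed simp

lemma max_excess_le: "max_excess l N y \<le> (\<Sum>j<N. \<bar>y j - l\<bar>)"
proof (induction N arbitrary: y)
  case (Suc N)
  have "max_excess l N (\<lambda>j. y (Suc j)) \<le> (\<Sum>j<N. \<bar>y (Suc j) - l\<bar>)" by (rule Suc.IH)
  moreover have "0 \<le> (\<Sum>j<N. \<bar>y (Suc j) - l\<bar>)" by (intro sum_nonneg) auto
  ultimately show ?case unfolding sum.lessThan_Suc_shift by simp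
qed simp

lemma max_excess_mono: "max_excess l N y \<le> max_excess l (Suc N) y"
proof (induction N arbitrary: y)
  case (Suc N)
  have "max_excess l N (\<lambda>j. y (Suc j)) \<le> max_excess l (Suc N) (\<lambda>j. y (Suc j))" by (rule Suc.IH)
  then show ?case by (simp del: max_excess.simps(2) add: max_excess.simps(2)[of l N y] max_excess.simps(2)[of l "Suc N" y])
qed simp

lemma measurable_max_excess[measurable]: "max_excess l N \<in> borel_measurable (PiM UNIV (\<lambda>_. borel))"
proof (induction N)
  case 0
  then show ?case by simp
next
  case (Suc N)
  have sh: "(\<lambda>y j. y (Suc j)) \<in> PiM UNIV (\<lambda>_. borel) \<rightarrow>\<^sub>M PiM UNIV (\<lambda>_. borel :: real measure)"
    by (rule measurable_PiM_single') (auto simp: space_PiM)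
  have y0: "(\<lambda>y. y 0) \<in> borel_measurable (PiM (UNIV :: nat set) (\<lambda>_. borel :: real measure))" by simp
  have "(\<lambda>y. max 0 (y 0 - l + max_excess l N (\<lambda>j. y (Suc j)))) \<in> borel_measurable (PiM UNIV (\<lambda>_. borel))"
    by (intro borel_measurable_max borel_measurable_add borel_measurable_diff borel_measurable_const
      y0 measurable_compose[OF sh Suc])
  then show ?case by (simp only: max_excess.simps(2)[abs_def])
qed

lemma (in prob_space) indep_vars_Suc:
  assumes "indep_vars N Y UNIV"
  shows "indep_vars (\<lambda>j. N (Suc j)) (\<lambda>j. Y (Suc j)) UNIV"
  unfolding indep_vars_def2
proof (intro conjI ballI)
  show "random_variable (N (Suc i)) (Y (Suc i))" for i
    using assms by (simp add: indep_vars_def)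
  have sets: "indep_sets (\<lambda>i. {Y i -` A \<inter> space M |A. A \<in> sets (N i)}) UNIV"
    using assms by (simp add: indep_vars_def2)
  show "indep_sets (\<lambda>i. {Y (Suc i) -` A \<inter> space M |A. A \<in> sets (N (Suc i))}) UNIV"
  proof (rule indep_setsI)
    show "{Y (Suc i) -` A \<inter> space M |A. A \<in> sets (N (Suc i))} \<subseteq> events" for i
      using sets unfolding indep_sets_def by (auto simp: subset_iff)
    fix A J assume J: "J \<noteq> {}" "finite J"
      and A: "\<forall>j\<in>J. A j \<in> {Y (Suc j) -` A \<inter> space M |A. A \<in> sets (N (Suc j))}"
    have "prob (\<Inter>j\<in>Suc ` J. A (j - 1)) = (\<Prod>j\<in>Suc ` J. prob (A (j - 1)))"
      by (rule indep_setsD[OF sets]) (use J A in auto)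
    then show "prob (\<Inter>j\<in>J. A j) = (\<Prod>j\<in>J. prob (A j))"
      by (simp add: prod.reindex)
  qed
qed

text \<open>Garsia's proof of the maximal ergodic inequality: the law of the sequence is invariant
  under the shift.\<close>

lemma (in prob_space) maximal_inequality:
  fixes Y :: "nat \<Rightarrow> 'a \<Rightarrow> real"
  assumes ind: "indep_vars (\<lambda>_. borel) Y UNIV" and ident: "\<And>i. distr M borel (Y i) = distr M borel (Y 0)"
    and int: "integrable M (Y 0)" and nonneg: "\<And>i x. 0 \<le> Y i x" and l: "l > 0"
  shows "prob {x \<in> space M. \<exists>n. l * real n < (\<Sum>j<n. Y j x)} \<le> expectation (Y 0) / l"
proof -
  have rv[measurable]: "Y i \<in> borel_measurable M" for i
    using ind by (auto simp: indep_vars_def)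
  have iY: "integrable M (Y i)" for i
    using iid_integrable(1)[where Y=Y and f="\<lambda>x. x" and i=i, OF rv ident] int by simp
  let ?P = "PiM UNIV (\<lambda>_. borel) :: (nat \<Rightarrow> real) measure"
  have m1[measurable]: "(\<lambda>x j. Y j x) \<in> M \<rightarrow>\<^sub>M ?P"
    by (rule measurable_PiM_single') (auto simp: space_PiM)
  have m2[measurable]: "(\<lambda>x j. Y (Suc j) x) \<in> M \<rightarrow>\<^sub>M ?P"
    by (rule measurable_PiM_single') (auto simp: space_PiM)
  have ind2: "indep_vars (\<lambda>_. borel) (\<lambda>j. Y (Suc j)) UNIV"
    by (rule indep_vars_Suc[OF ind])
  have "distr M ?P (\<lambda>x j. Y j x) = PiM UNIV (\<lambda>j. distr M borel (Y j))"
    using indep_vars_iff_distr_eq_PiM[of UNIV Y "\<lambda>_. borel"] ind by (simp add: restrict_UNIV)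
  also have "\<dots> = PiM UNIV (\<lambda>j. distr M borel (Y (Suc j)))"
    by (subst ident, subst (2) ident) (rule refl)
  also have "\<dots> = distr M ?P (\<lambda>x j. Y (Suc j) x)"
    using indep_vars_iff_distr_eq_PiM[of UNIV "\<lambda>j. Y (Suc j)" "\<lambda>_. borel"] ind2 by (simp add: restrict_UNIV)
  finally have shift: "distr M ?P (\<lambda>x j. Y j x) = distr M ?P (\<lambda>x j. Y (Suc j) x)" .
  define E where "E N = {x \<in> space M. 0 < max_excess l N (\<lambda>j. Y j x)}" for N
  have E[measurable]: "E N \<in> sets M" for N unfolding E_def by measurable
  have bound: "prob (E N) \<le> expectation (Y 0) / l" for N
  proof (cases N)
    case 0
    then show ?thesis using l nonneg by (simp add: E_def)
  next
    case (Suc K)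
    define A where "A x = max_excess l N (\<lambda>j. Y j x)" for x
    define B where "B x = max_excess l K (\<lambda>j. Y (Suc j) x)" for x
    define B' where "B' x = max_excess l K (\<lambda>j. Y j x)" for x
    have [measurable]: "A \<in> borel_measurable M" "B \<in> borel_measurable M" "B' \<in> borel_measurable M"
      unfolding A_def B_def B'_def by measurable
    have iA: "integrable M A"
      by (rule Bochner_Integration.integrable_bound[where f="\<lambda>x. \<Sum>j<N. \<bar>Y j x - l\<bar>"])
        (use iY max_excess_le max_excess_nonneg in \<open>auto simp: A_def intro!: AE_I2 order_trans[OF max_excess_le]\<close>)
    have iB: "integrable M B"
      by (rule Bochner_Integration.integrable_bound[where f="\<lambda>x. \<Sum>j<K. \<bar>Y (Suc j) x - l\<bar>"])
        (use iY max_excess_le max_excess_nonneg in \<open>auto simp: B_def intro!: AE_I2 order_trans[OF max_excess_le]\<close>)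
    have iB': "integrable M B'"
      by (rule Bochner_Integration.integrable_bound[where f="\<lambda>x. \<Sum>j<K. \<bar>Y j x - l\<bar>"])
        (use iY max_excess_le max_excess_nonneg in \<open>auto simp: B'_def intro!: AE_I2 order_trans[OF max_excess_le]\<close>)
    have EB: "expectation B = expectation B'"
    proof -
      have "expectation B = integral\<^sup>L (distr M ?P (\<lambda>x j. Y (Suc j) x)) (max_excess l K)"
        unfolding B_def by (simp add: integral_distr)
      also have "\<dots> = expectation B'"
        unfolding B'_def shift[symmetric] by (simp add: integral_distr)
      finally show ?thesis .
    qed
    \<comment> \<open>The maximum grows with the number of terms; together with shift invariance
      this gives \<open>A - B\<close> a nonnegative expectation.\<close>
    have "expectation B' \<le> expectation A"
      by (rule integral_mono[OF iB' iA]) (simp only: A_def B'_def Suc max_excess_mono)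
    then have "0 \<le> expectation A - expectation B'" by simp
    also have "\<dots> = (\<integral>x. A x - B x \<partial>M)" using iA iB EB by simp
    also have "\<dots> \<le> (\<integral>x. Y 0 x - l * indicator (E N) x \<partial>M)"
    proof (rule integral_mono)
      show "integrable M (\<lambda>x. A x - B x)" using iA iB by simp
      show "integrable M (\<lambda>x. Y 0 x - l * indicator (E N) x)" using int
        by (intro Bochner_Integration.integrable_diff integrable_mult_right integrable_real_indicator)
          (simp_all add: less_top[symmetric])
      fix x assume x: "x \<in> space M"
      show "A x - B x \<le> Y 0 x - l * indicator (E N) x"
      \<comment> \<open>On \<open>E N\<close> the outer maximum of the recursion is attained by its
        second entry, so \<open>A x - B x\<close> equals \<open>Y 0 x - l\<close>. Off
        \<open>E N\<close> it is at most 0, while \<open>Y 0 x\<close> is nonnegative.\<close>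
      proof (cases "x \<in> E N")
        case True
        then show ?thesis by (auto simp: A_def B_def E_def Suc)
      next
        case False
        then have "A x \<le> 0" using x by (simp add: E_def A_def)
        moreover have "0 \<le> B x" by (simp add: B_def max_excess_nonneg)
        ultimately show ?thesis using False nonneg[of 0 x] by simp
      qed
    qed
    also have "\<dots> = expectation (Y 0) - l * prob (E N)"
      by (subst Bochner_Integration.integral_diff[OF int]) (simp_all add: less_top[symmetric])
    finally show ?thesis using l by (simp add: field_simps)
  qed
  have incE: "incseq E"
  proof (rule incseq_SucI)
    show "E n \<subseteq> E (Suc n)" for n
      unfolding E_def using max_excess_mono[of l n] by (auto simp del: max_excess.simps intro: less_le_trans)
  qed
  have "{x \<in> space M. \<exists>n. l * real n < (\<Sum>j<n. Y j x)} \<subseteq> (\<Union>N. E N)"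
  proof safe
    fix x n assume x: "x \<in> space M" "l * real n < (\<Sum>j<n. Y j x)"
    then have "0 < (\<Sum>j<n. Y j x - l)" by (simp add: sum_subtractf mult.commute)
    also have "\<dots> \<le> max_excess l n (\<lambda>j. Y j x)" by (rule max_excess_ge) simp
    finally show "x \<in> (\<Union>N. E N)" using x by (auto simp: E_def)
  qed
  then have "prob {x \<in> space M. \<exists>n. l * real n < (\<Sum>j<n. Y j x)} \<le> prob (\<Union>N. E N)"
    by (rule finite_measure_mono) auto
  also have "\<dots> \<le> expectation (Y 0) / l"
  proof (rule LIMSEQ_le_const2)
    show "(\<lambda>N. prob (E N)) \<longlonglongrightarrow> prob (\<Union>N. E N)"
      by (rule finite_Lim_measure_incseq) (use incE in auto)
  qed (use bound in auto)
  finally show ?thesis .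
qed

text \<open>The truncation level R is fixed while n grows. The truncated variables obey the bounded
  law, and the maximal inequality bounds the probability that an average of the excess over R ever
  passes e by a quantity that vanishes as R grows.\<close>

theorem (in prob_space) SLLN:
  fixes Y :: "nat \<Rightarrow> 'a \<Rightarrow> real"
  assumes ind: "indep_vars (\<lambda>_. borel) Y UNIV" and ident: "\<And>i. distr M borel (Y i) = distr M borel (Y 0)"
    and int: "integrable M (Y 0)"
  shows "AE x in M. (\<lambda>n. (\<Sum>j<n. Y j x) / real n) \<longlonglongrightarrow> expectation (Y 0)"
proof -
  define T where "T R y = (if \<bar>y\<bar> \<le> R then y else 0)" for R y :: real
  define V where "V R y = (if \<bar>y\<bar> \<le> R then 0 else \<bar>y\<bar>)" for R y :: real
  have [measurable]: "T R \<in> borel_measurable borel" "V R \<in> borel_measurable borel" for R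
    unfolding T_def V_def by measurable
  have TV: "\<bar>y - T R y\<bar> = V R y" "\<bar>V R y\<bar> \<le> \<bar>y\<bar>" "0 \<le> V R y" for R y by (auto simp: T_def V_def)
  have rv[measurable]: "Y i \<in> borel_measurable M" for i
    using ind by (auto simp: indep_vars_def)
  have ind': "indep_vars (\<lambda>_. borel) (\<lambda>j x. f (Y j x)) UNIV"
    if "f \<in> borel_measurable borel" for f :: "real \<Rightarrow> real"
    using indep_vars_compose[OF ind, of "\<lambda>_. f"] that by (simp add: comp_def)
  have ident': "distr M borel (\<lambda>x. f (Y i x)) = distr M borel (\<lambda>x. f (Y 0 x))"
    if f: "f \<in> borel_measurable borel" for f :: "real \<Rightarrow> real" and i
    using distr_distr[OF f rv[of i]] distr_distr[OF f rv[of 0]] ident[of i] by (simp add: comp_def)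
  have iV: "integrable M (\<lambda>x. V R (Y 0 x))" for R
    by (rule Bochner_Integration.integrable_bound[OF int]) (use TV in auto)
  have iT: "integrable M (\<lambda>x. T R (Y 0 x))" for R
    by (rule Bochner_Integration.integrable_bound[OF int]) (auto simp: T_def)
  have V0: "(\<lambda>R. expectation (\<lambda>x. V (real R) (Y 0 x))) \<longlonglongrightarrow> 0"
  proof -
    have "(\<lambda>R. expectation (\<lambda>x. V (real R) (Y 0 x))) \<longlonglongrightarrow> expectation (\<lambda>x. 0)"
    proof (rule integral_dominated_convergence[where w="\<lambda>x. \<bar>Y 0 x\<bar>"])
      show "AE x in M. (\<lambda>R. V (real R) (Y 0 x)) \<longlonglongrightarrow> 0"
      proof (rule AE_I2, rule tendsto_eventually)
        fix x
        obtain R0 :: nat where "\<bar>Y 0 x\<bar> \<le> real R0" using real_arch_simple by blast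
        then show "\<forall>\<^sub>F R in sequentially. V (real R) (Y 0 x) = 0"
          unfolding eventually_sequentially by (intro exI[of _ R0]) (auto simp: V_def)
      qed
    qed (use int TV in auto)
    then show ?thesis by simp
  qed
  define m where "m = expectation (Y 0)"
  \<comment> \<open>The three contributions of size e are the error in the bounded law, the effect
    of truncation on the mean, and the averaged excess.\<close>
  have main: "AE x in M. \<forall>\<^sub>F n in sequentially. \<bar>(\<Sum>j<n. Y j x) / real n - m\<bar> < 3 * e" if e: "e > 0" for e
  proof -
    define G where "G = {x \<in> space M. \<forall>\<^sub>F n in sequentially. \<bar>(\<Sum>j<n. Y j x) / real n - m\<bar> < 3 * e}"
    have G[measurable]: "G \<in> sets M" unfolding G_def eventually_sequentially by measurable
    \<comment> \<open>The exceptional set does not depend on R, so its probability is at most the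
      limit of the bounds obtained for each R.\<close>
    have "prob (space M - G) \<le> 0"
    proof (rule LIMSEQ_le_const)
      show "(\<lambda>R. expectation (\<lambda>x. V (real R) (Y 0 x)) / e) \<longlonglongrightarrow> 0"
        using tendsto_divide[OF V0 tendsto_const, of e] e by simp
      have "\<forall>\<^sub>F R in sequentially. expectation (\<lambda>x. V (real R) (Y 0 x)) < e"
        by (rule order_tendstoD(2)[OF V0 e])
      then obtain R0 where R0: "\<And>R. R \<ge> R0 \<Longrightarrow> expectation (\<lambda>x. V (real R) (Y 0 x)) < e"
        unfolding eventually_sequentially by blast
      have "prob (space M - G) \<le> expectation (\<lambda>x. V (real R) (Y 0 x)) / e" if R: "R \<ge> R0" for R
      proof -
        define A where "A = {x \<in> space M. \<exists>n. e * real n < (\<Sum>j<n. V (real R) (Y j x))}"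
        have A[measurable]: "A \<in> sets M" unfolding A_def by measurable
        have "AE x in M. (\<lambda>n. (\<Sum>j<n. T (real R) (Y j x)) / real n) \<longlonglongrightarrow> expectation (\<lambda>x. T (real R) (Y 0 x))"
          by (rule bounded_SLLN[OF ind' ident', where B="real R"]) (auto simp: T_def)
        then have "AE x in M. x \<in> space M - G \<longrightarrow> x \<in> A"
        proof (rule AE_mp, intro AE_I2 impI)
          fix x assume x: "x \<in> space M" "x \<in> space M - G"
            and lim: "(\<lambda>n. (\<Sum>j<n. T (real R) (Y j x)) / real n) \<longlonglongrightarrow> expectation (\<lambda>x. T (real R) (Y 0 x))"
          show "x \<in> A"
          proof (rule ccontr)
            assume "x \<notin> A"
            then have le: "(\<Sum>j<n. V (real R) (Y j x)) \<le> e * real n" for n using x by (auto simp: A_def not_less)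
            have mm: "\<bar>expectation (\<lambda>x. T (real R) (Y 0 x)) - m\<bar> < e"
            proof -
              have "\<bar>expectation (\<lambda>x. T (real R) (Y 0 x)) - m\<bar> = \<bar>expectation (\<lambda>x. Y 0 x - T (real R) (Y 0 x))\<bar>"
                unfolding m_def using int iT by (simp add: abs_minus_commute)
              also have "\<dots> \<le> expectation (\<lambda>x. V (real R) (Y 0 x))"
                using integral_abs_bound[of M "\<lambda>x. Y 0 x - T (real R) (Y 0 x)"] by (simp add: TV)
              finally show ?thesis using R0[OF R] by simp
            qed
            have "\<forall>\<^sub>F n in sequentially. \<bar>(\<Sum>j<n. T (real R) (Y j x)) / real n - expectation (\<lambda>x. T (real R) (Y 0 x))\<bar> < e"
              using lim e unfolding tendsto_iff dist_real_def by blast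
            moreover have "\<forall>\<^sub>F n :: nat in sequentially. n > 0" by (rule eventually_gt_at_top)
            ultimately have "\<forall>\<^sub>F n in sequentially. \<bar>(\<Sum>j<n. Y j x) / real n - m\<bar> < 3 * e"
            proof eventually_elim
              case (elim n)
              have "\<bar>(\<Sum>j<n. Y j x) / real n - (\<Sum>j<n. T (real R) (Y j x)) / real n\<bar>
                  = \<bar>\<Sum>j<n. Y j x - T (real R) (Y j x)\<bar> / real n"
                by (simp add: sum_subtractf diff_divide_distrib[symmetric] abs_divide)
              also have "\<dots> \<le> (\<Sum>j<n. V (real R) (Y j x)) / real n"
                by (intro divide_right_mono order_trans[OF sum_abs]) (auto simp: TV)
              also have "\<dots> \<le> e" using le[of n] elim by (simp add: field_simps)
              finally show ?case using elim(1) mm by linarith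
            qed
            then show False using x by (simp add: G_def)
          qed
        qed
        then have "prob (space M - G) \<le> prob A"
          by (intro finite_measure_mono_AE) auto
        also have "\<dots> \<le> expectation (\<lambda>x. V (real R) (Y 0 x)) / e"
          unfolding A_def by (rule maximal_inequality[OF ind' ident' iV TV(3) e]) auto
        finally show ?thesis .
      qed
      then show "\<exists>N. \<forall>n\<ge>N. prob (space M - G) \<le> expectation (\<lambda>x. V (real n) (Y 0 x)) / e" by blast
    qed
    then have "prob G = 1" using prob_compl[OF G] prob_le_1[of G] by simp
    then have "AE x in M. x \<in> G" using prob_eq_1[OF G] by simp
    then show ?thesis by eventually_elim (simp add: G_def)
  qed
  have "AE x in M. \<forall>k. \<forall>\<^sub>F n in sequentially. \<bar>(\<Sum>j<n. Y j x) / real n - m\<bar> < 3 * inverse (real (Suc k))"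
    using main by (subst AE_all_countable) simp
  then show ?thesis
  proof eventually_elim
    case (elim x)
    show ?case unfolding tendsto_iff dist_real_def m_def[symmetric]
    proof safe
      fix e :: real assume "e > 0"
      then obtain k where k: "inverse (real (Suc k)) < e / 3"
        using reals_Archimedean[of "e / 3"] by auto
      show "\<forall>\<^sub>F n in sequentially. \<bar>(\<Sum>j<n. Y j x) / real n - m\<bar> < e"
        using elim[rule_format, of k] by eventually_elim (use k in linarith)
    qed
  qed
qed

section \<open>Characteristic functionals\<close>

text \<open>After normalisation \<open>w\<close> is a probability density, and the law of
  \<open>U\<close> under it is determined by its characteristic function. The weight allows
  constraints on further coordinates to be carried along.\<close>

lemma weighted_char_unique:
  fixes N1 N2 :: "'a measure" and U w :: "'a \<Rightarrow> real"
  assumes N: "prob_space N1" "prob_space N2"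
    and U[measurable]: "U \<in> borel_measurable N1" "U \<in> borel_measurable N2"
    and w[measurable]: "w \<in> borel_measurable N1" "w \<in> borel_measurable N2"
    and w0: "\<And>x. 0 \<le> w x" and wB: "\<And>x. w x \<le> B"
    and eq: "\<And>s. (\<integral>x. w x *\<^sub>R iexp (s * U x) \<partial>N1) = (\<integral>x. w x *\<^sub>R iexp (s * U x) \<partial>N2)"
    and A: "A \<in> sets borel"
  shows "(\<integral>x. w x * indicator A (U x) \<partial>N1) = (\<integral>x. w x * indicator A (U x) \<partial>N2)"
proof -
  interpret N1: prob_space N1 by (rule N)
  interpret N2: prob_space N2 by (rule N)
  have iw: "integrable N1 w" "integrable N2 w"
    using w0 wB by (auto intro!: N1.integrable_const_bound[where B=B] N2.integrable_const_bound[where B=B])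
  have "complex_of_real (\<integral>x. w x \<partial>N1) = complex_of_real (\<integral>x. w x \<partial>N2)"
    using eq[of 0] by (simp add: scaleR_conv_of_real)
  then have m: "(\<integral>x. w x \<partial>N1) = (\<integral>x. w x \<partial>N2)" by simp
  define m where "m = (\<integral>x. w x \<partial>N1)"
  have m0: "m \<ge> 0" unfolding m_def using w0 by simp
  show ?thesis
  proof (cases "m = 0")
    case True
    then have "AE x in N1. w x = 0" "AE x in N2. w x = 0"
      using integral_nonneg_eq_0_iff_AE[of N1 w] integral_nonneg_eq_0_iff_AE[of N2 w] iw w0 m
      unfolding m_def by auto
    then have "AE x in N1. w x * indicator A (U x) = 0" "AE x in N2. w x * indicator A (U x) = 0"
      by auto
    then show ?thesis by (simp add: integral_eq_zero_AE)
  next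
    case False
    then have mp: "m > 0" using m0 by simp
    define L where "L N = distr (density N (\<lambda>x. ennreal (w x / m))) borel U" for N
    have L: "real_distribution (L N)" "\<And>t. char (L N) t = (\<integral>x. w x *\<^sub>R iexp (t * U x) \<partial>N) / m"
        "measure (L N) A = (\<integral>x. w x * indicator A (U x) \<partial>N) / m"
      if [measurable]: "U \<in> borel_measurable N" "w \<in> borel_measurable N" and iN: "integrable N w"
        and mN: "(\<integral>x. w x \<partial>N) = m" for N :: "'a measure"
    proof -
      have pr: "prob_space (density N (\<lambda>x. ennreal (w x / m)))"
      proof
        have "emeasure (density N (\<lambda>x. ennreal (w x / m))) (space N) = (\<integral>\<^sup>+x. ennreal (w x / m) \<partial>N)"
          by (simp add: emeasure_density cong: nn_integral_cong)
        also have "\<dots> = ennreal (\<integral>x. w x / m \<partial>N)"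
          using iN w0 mp by (intro nn_integral_eq_integral) auto
        also have "\<dots> = 1" using mN mp by simp
        finally show "emeasure (density N (\<lambda>x. ennreal (w x / m))) (space (density N (\<lambda>x. ennreal (w x / m)))) = 1"
          by simp
      qed
      then interpret D: prob_space "density N (\<lambda>x. ennreal (w x / m))" .
      show "real_distribution (L N)" unfolding L_def by (rule D.real_distribution_distr) simp
      show "char (L N) t = (\<integral>x. w x *\<^sub>R iexp (t * U x) \<partial>N) / m" for t
      proof -
        have "char (L N) t = (\<integral>x. (w x / m) *\<^sub>R iexp (t * U x) \<partial>N)"
          unfolding L_def char_def using w0 mp by (simp add: integral_distr integral_density)
        also have "\<dots> = (\<integral>x. w x *\<^sub>R iexp (t * U x) / complex_of_real m \<partial>N)"
          by (intro Bochner_Integration.integral_cong) (auto simp: scaleR_conv_of_real)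
        also have "\<dots> = (\<integral>x. w x *\<^sub>R iexp (t * U x) \<partial>N) / m"
          by (rule integral_divide_zero)
        finally show ?thesis .
      qed
      have "measure (L N) A = integral\<^sup>L (L N) (indicator A)" using A by (simp add: L_def)
      also have "\<dots> = (\<integral>x. indicator A (U x) \<partial>density N (\<lambda>x. ennreal (w x / m)))"
        unfolding L_def using A by (intro integral_distr) auto
      also have "\<dots> = (\<integral>x. (w x / m) *\<^sub>R indicator A (U x) \<partial>N)"
        using w0 mp A by (intro integral_density) auto
      finally show "measure (L N) A = (\<integral>x. w x * indicator A (U x) \<partial>N) / m" by simp
    qed
    note L1 = L[OF U(1) w(1) iw(1) m_def[symmetric]]
    note L2 = L[OF U(2) w(2) iw(2) trans[OF m[symmetric] m_def[symmetric]]]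
    have "L N1 = L N2"
      by (rule Levy_uniqueness[OF L1(1) L2(1)]) (rule ext, simp only: L1(2) L2(2) eq)
    then show ?thesis using L1(3) L2(3) mp by simp
  qed
qed

text \<open>The indicator of a cylinder set, kept as a product over a list so that constraints can
  be added one at a time by induction on the list.\<close>

definition cyl_weight :: "('a::real_inner \<times> real set) list \<Rightarrow> 'a \<Rightarrow> real" where
  "cyl_weight fs x = (\<Prod>(f, A)\<leftarrow>fs. indicator A (x \<bullet> f))"

lemma cyl_weight_01: "0 \<le> cyl_weight fs x" "cyl_weight fs x \<le> 1"
proof -
  have "0 \<le> cyl_weight fs x \<and> cyl_weight fs x \<le> 1"
    unfolding cyl_weight_def by (induction fs) (auto simp: indicator_def)
  then show "0 \<le> cyl_weight fs x" "cyl_weight fs x \<le> 1" by auto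
qed

lemma cyl_weight_measurable:
  fixes fs :: "('a::{real_inner,second_countable_topology} \<times> real set) list"
  assumes "\<And>f A. (f, A) \<in> set fs \<Longrightarrow> A \<in> sets borel"
  shows "cyl_weight fs \<in> borel_measurable borel"
  using assms
proof (induction fs)
  case Nil
  then show ?case by (simp add: cyl_weight_def[abs_def])
next
  case (Cons a fs)
  obtain f A where a: "a = (f, A)" by (cases a)
  have [measurable]: "A \<in> sets borel" "cyl_weight fs \<in> borel_measurable borel" using Cons a by auto
  have "cyl_weight (a # fs) = (\<lambda>x. indicator A (x \<bullet> f) * cyl_weight fs x)"
    by (auto simp: cyl_weight_def a)
  then show ?case by simp
qed

text \<open>Conditioning on one more cylinder constraint is possible because the real and the imaginary
  part of a character become nonnegative weights after adding \<open>1\<close>.\<close>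

lemma char_functional_cyl:
  fixes N1 N2 :: "'a::{real_inner,second_countable_topology} measure"
  assumes N: "prob_space N1" "prob_space N2" and sets[measurable_cong]: "sets N1 = sets borel" "sets N2 = sets borel"
    and eq: "\<And>f. (\<integral>x. exp (\<i> * of_real (x \<bullet> f)) \<partial>N1) = (\<integral>x. exp (\<i> * of_real (x \<bullet> f)) \<partial>N2)"
    and fs: "\<And>f A. (f, A) \<in> set fs \<Longrightarrow> A \<in> sets borel"
  shows "(\<integral>x. cyl_weight fs x *\<^sub>R exp (\<i> * of_real (x \<bullet> g)) \<partial>N1)
       = (\<integral>x. cyl_weight fs x *\<^sub>R exp (\<i> * of_real (x \<bullet> g)) \<partial>N2)"
  using fs
proof (induction fs arbitrary: g)
  case Nil
  then show ?case using eq by (simp add: cyl_weight_def)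
next
  case (Cons a fs)
  obtain f A where a: "a = (f, A)" by (cases a)
  have A[measurable]: "A \<in> sets borel" and fsA: "\<And>f A. (f, A) \<in> set fs \<Longrightarrow> A \<in> sets borel"
    using Cons.prems a by auto
  note [measurable] = cyl_weight_measurable[OF fsA]
  let ?I = "\<lambda>N g. (\<integral>x. cyl_weight fs x *\<^sub>R exp (\<i> * of_real (x \<bullet> g)) \<partial>N)"
  have IH: "?I N1 g = ?I N2 g" for g using Cons.IH[OF fsA] .
  have int1: "integrable N (\<lambda>x. cyl_weight fs x *\<^sub>R exp (\<i> * of_real (x \<bullet> g)))"
    if "prob_space N" and [measurable_cong]: "sets N = sets borel" for N g
  proof -
    interpret prob_space N by fact
    show ?thesis by (rule integrable_const_bound[where B=1]) (use cyl_weight_01[of fs] in auto)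
  qed
  have int2: "integrable N (\<lambda>x. cyl_weight fs x * indicator A (x \<bullet> f) * t (x \<bullet> g))"
    if "prob_space N" and [measurable_cong]: "sets N = sets borel" and t: "t \<in> {sin, cos, \<lambda>_. 1}"
      for N g and t :: "real \<Rightarrow> real"
  proof -
    interpret prob_space N by fact
    have [measurable]: "t \<in> borel_measurable borel"
      using t by (auto intro!: borel_measurable_continuous_onI continuous_intros)
    have tb: "\<bar>t y\<bar> \<le> 1" for y using t by auto
    have "\<bar>cyl_weight fs x * indicator A (x \<bullet> f) * t (x \<bullet> g)\<bar> \<le> 1" for x
      using cyl_weight_01[of fs x] tb[of "x \<bullet> g"]
      by (auto simp: abs_mult indicator_def intro!: mult_le_one)
    then show ?thesis by (intro integrable_const_bound[where B=1]) auto
  qed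
  \<comment> \<open>A trigonometric weight in direction \<open>g\<close> only shifts the frequency
    by \<open>g\<close> or \<open>- g\<close>, so the weighted transform is a combination of
    transforms that the induction hypothesis covers.\<close>
  have char: "(\<integral>x. (cyl_weight fs x * (1 + t (x \<bullet> g))) *\<^sub>R iexp (s * (x \<bullet> f)) \<partial>N)
      = ?I N (s *\<^sub>R f) + c * ?I N (s *\<^sub>R f + g) + cnj c * ?I N (s *\<^sub>R f - g)"
    if N: "prob_space N" "sets N = sets borel"
      and t: "\<And>y. complex_of_real (t y) = c * exp (\<i> * of_real y) + cnj c * exp (\<i> * of_real (- y))" for N t c s
  proof -
    note i = int1[OF N]
    have e: "(cyl_weight fs x * (1 + t (x \<bullet> g))) *\<^sub>R iexp (s * (x \<bullet> f))
        = cyl_weight fs x *\<^sub>R exp (\<i> * of_real (x \<bullet> (s *\<^sub>R f)))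
        + c * (cyl_weight fs x *\<^sub>R exp (\<i> * of_real (x \<bullet> (s *\<^sub>R f + g))))
        + cnj c * (cyl_weight fs x *\<^sub>R exp (\<i> * of_real (x \<bullet> (s *\<^sub>R f - g))))" for x
    proof -
      have "exp (\<i> * of_real (x \<bullet> (s *\<^sub>R f + g))) = iexp (s * (x \<bullet> f)) * exp (\<i> * of_real (x \<bullet> g))"
        "exp (\<i> * of_real (x \<bullet> (s *\<^sub>R f - g))) = iexp (s * (x \<bullet> f)) * exp (\<i> * of_real (- (x \<bullet> g)))"
        by (simp_all add: exp_add[symmetric] inner_add_right inner_diff_right algebra_simps)
      then show ?thesis
        using t[of "x \<bullet> g"] by (simp add: scaleR_conv_of_real algebra_simps)
    qed
    show ?thesis unfolding e
      by (simp only: Bochner_Integration.integral_add Bochner_Integration.integrable_add i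
        integrable_mult_right integral_mult_right_zero)
  qed
  have key: "(\<integral>x. (cyl_weight fs x * (1 + t (x \<bullet> g))) * indicator A (x \<bullet> f) \<partial>N1)
      = (\<integral>x. (cyl_weight fs x * (1 + t (x \<bullet> g))) * indicator A (x \<bullet> f) \<partial>N2)"
    if t: "\<And>y. complex_of_real (t y) = c * exp (\<i> * of_real y) + cnj c * exp (\<i> * of_real (- y))"
      and tb: "\<And>y. \<bar>t y\<bar> \<le> 1" and [measurable]: "t \<in> borel_measurable borel" for t c
  proof (rule weighted_char_unique[OF N, where B=2])
    show "0 \<le> cyl_weight fs x * (1 + t (x \<bullet> g))" for x
      using cyl_weight_01[of fs x] tb[of "x \<bullet> g"] by (intro mult_nonneg_nonneg) auto
    show "cyl_weight fs x * (1 + t (x \<bullet> g)) \<le> 2" for x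
      using cyl_weight_01[of fs x] tb[of "x \<bullet> g"] mult_mono[of "cyl_weight fs x" 1 "1 + t (x \<bullet> g)" 2] by auto
    show "(\<integral>x. (cyl_weight fs x * (1 + t (x \<bullet> g))) *\<^sub>R iexp (s * (x \<bullet> f)) \<partial>N1)
      = (\<integral>x. (cyl_weight fs x * (1 + t (x \<bullet> g))) *\<^sub>R iexp (s * (x \<bullet> f)) \<partial>N2)" for s
      unfolding char[OF N(1) sets(1) t] char[OF N(2) sets(2) t] IH ..
  qed (use A in measurable)
  let ?J = "\<lambda>N t. (\<integral>x. cyl_weight fs x * indicator A (x \<bullet> f) * t (x \<bullet> g) \<partial>N)"
  \<comment> \<open>The coefficient 0 gives the weight without a trigonometric factor;
    \<open>1/2\<close> and \<open>-\<i>/2\<close> below are the Fourier coefficients of cosine and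
    sine.\<close>
  have J0: "?J N1 (\<lambda>_. 1) = ?J N2 (\<lambda>_. 1)"
    using key[of "\<lambda>_. 0" 0] by simp
  have split: "(\<integral>x. (cyl_weight fs x * (1 + t (x \<bullet> g))) * indicator A (x \<bullet> f) \<partial>N) = ?J N (\<lambda>_. 1) + ?J N t"
    if "prob_space N" "sets N = sets borel" "t \<in> {sin, cos}" for N and t :: "real \<Rightarrow> real"
    using int2[OF that(1,2), of t] int2[OF that(1,2), of "\<lambda>_. 1"] that(3)
    by (subst Bochner_Integration.integral_add[symmetric]) (auto simp: algebra_simps intro!: Bochner_Integration.integral_cong)
  have Jc: "?J N1 cos = ?J N2 cos"
    using key[of cos "1/2"] split[OF N(1) sets(1), of cos] split[OF N(2) sets(2), of cos] J0
    by (simp add: cos_of_real[symmetric] cos_exp_eq algebra_simps)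
  have Js: "?J N1 sin = ?J N2 sin"
    using key[of sin "-\<i>/2"] split[OF N(1) sets(1), of sin] split[OF N(2) sets(2), of sin] J0
    by (simp add: sin_of_real[symmetric] sin_exp_eq field_simps)
  have fin: "(\<integral>x. cyl_weight (a # fs) x *\<^sub>R exp (\<i> * of_real (x \<bullet> g)) \<partial>N) = of_real (?J N cos) + \<i> * of_real (?J N sin)"
    if "prob_space N" "sets N = sets borel" for N
  proof -
    have "(\<integral>x. cyl_weight (a # fs) x *\<^sub>R exp (\<i> * of_real (x \<bullet> g)) \<partial>N)
        = (\<integral>x. complex_of_real (cyl_weight fs x * indicator A (x \<bullet> f) * cos (x \<bullet> g))
            + \<i> * complex_of_real (cyl_weight fs x * indicator A (x \<bullet> f) * sin (x \<bullet> g)) \<partial>N)"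
      by (intro Bochner_Integration.integral_cong)
        (auto simp: cyl_weight_def a scaleR_conv_of_real exp_Euler cos_of_real[symmetric] sin_of_real[symmetric] algebra_simps)
    also have "\<dots> = of_real (?J N cos) + \<i> * of_real (?J N sin)"
      by (simp only: Bochner_Integration.integral_add integrable_of_real integrable_mult_right
          int2[OF that] insertI1 insertI2 integral_mult_right_zero integral_complex_of_real)
    finally show ?thesis .
  qed
  show ?case unfolding fin[OF N(1) sets(1)] fin[OF N(2) sets(2)] Jc Js ..
qed

text \<open>The inequalities are closed conditions on \<open>d\<close>, hence pass from a dense set
  to \<open>d = z\<close>. With a countable dense set this presents a closed ball as a countable
  intersection of half-spaces.\<close>

lemma norm_le_iff_dense:
  fixes z :: "'a::real_inner"
  assumes D: "\<And>X. open X \<Longrightarrow> X \<noteq> {} \<Longrightarrow> \<exists>d\<in>D. d \<in> X"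
  shows "norm z \<le> r \<longleftrightarrow> (\<forall>d\<in>D. z \<bullet> d \<le> r * norm d) \<and> 0 \<le> r"
proof
  assume "norm z \<le> r"
  then show "(\<forall>d\<in>D. z \<bullet> d \<le> r * norm d) \<and> 0 \<le> r"
    using norm_cauchy_schwarz[of z] mult_right_mono[of "norm z" r "norm _"] norm_ge_zero[of z]
    by (meson norm_ge_zero order_trans)
next
  assume *: "(\<forall>d\<in>D. z \<bullet> d \<le> r * norm d) \<and> 0 \<le> r"
  have "closed {d. z \<bullet> d \<le> r * norm d}" by (intro closed_Collect_le continuous_intros)
  moreover have "D \<subseteq> {d. z \<bullet> d \<le> r * norm d}" using * by auto
  ultimately have "open (- {d. z \<bullet> d \<le> r * norm d})" "\<not> (\<exists>d\<in>D. d \<in> - {d. z \<bullet> d \<le> r * norm d})" by auto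
  then have "- {d. z \<bullet> d \<le> r * norm d} = {}" using D by blast
  then have "z \<bullet> z \<le> r * norm z" by auto
  then have "norm z * norm z \<le> r * norm z" by (simp add: norm_eq_sqrt_inner)
  then show "norm z \<le> r" using * by (cases "norm z = 0") auto
qed

text \<open>Closed balls are countable intersections of half-spaces, open balls are countable unions
  of closed ones, and by the Lindelof property every open set is a countable union of open
  balls.\<close>

lemma borel_eq_sigma_halfspaces:
  fixes M :: "'a::{real_inner,second_countable_topology} measure"
  assumes sp: "space M = UNIV" and half: "\<And>f c. {x. x \<bullet> f \<le> c} \<in> sets M"
  shows "sets borel \<subseteq> sets M"
proof -
  obtain D :: "'a set" where D: "countable D" "\<And>X. open X \<Longrightarrow> X \<noteq> {} \<Longrightarrow> \<exists>d\<in>D. d \<in> X"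
    using countable_dense_exists by blast
  have cb: "{x. norm (x - y) \<le> r} \<in> sets M" for y r
  proof -
    have "{x. norm (x - y) \<le> r} = (if 0 \<le> r then (\<Inter>d\<in>D. {x. x \<bullet> d \<le> r * norm d + y \<bullet> d}) else {})"
    proof (intro set_eqI)
      fix x
      show "x \<in> {x. norm (x - y) \<le> r} \<longleftrightarrow> x \<in> (if 0 \<le> r then (\<Inter>d\<in>D. {x. x \<bullet> d \<le> r * norm d + y \<bullet> d}) else {})"
        using norm_le_iff_dense[OF D(2), where z="x - y" and r=r]
        by (simp add: sp inner_diff_left diff_le_eq)
    qed
    also have "\<dots> \<in> sets M" using D(1) D(2)[of UNIV] half by (auto intro!: sets.countable_INT')
    finally show ?thesis .
  qed
  have b: "ball y r \<in> sets M" for y r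
  proof -
    have "ball y r = (\<Union>q\<in>{q::rat. of_rat q < r}. {x. norm (x - y) \<le> of_rat q})"
    proof safe
      fix x assume "x \<in> ball y r"
      then have "norm (x - y) < r" by (simp add: dist_norm norm_minus_commute)
      then obtain q :: rat where "norm (x - y) < of_rat q" "of_rat q < r" using of_rat_dense by blast
      then show "x \<in> (\<Union>q\<in>{q::rat. of_rat q < r}. {x. norm (x - y) \<le> of_rat q})"
        by (intro UN_I[of q]) auto
    qed (auto simp: dist_norm norm_minus_commute)
    also have "\<dots> \<in> sets M" using cb by (intro sets.countable_UN') auto
    finally show ?thesis .
  qed
  have op: "U \<in> sets M" if "open U" for U
  proof -
    define F where "F = {B. \<exists>y r. B = ball y r \<and> B \<subseteq> U}"
    obtain F' where F': "F' \<subseteq> F" "countable F'" "\<Union>F' = \<Union>F"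
      using Lindelof[of F] by (auto simp: F_def)
    have "\<Union>F = U"
    proof
      show "U \<subseteq> \<Union>F"
      proof
        fix x assume "x \<in> U"
        then obtain e where "e > 0" "ball x e \<subseteq> U" using \<open>open U\<close> by (meson open_contains_ball)
        then show "x \<in> \<Union>F" unfolding F_def by (intro UnionI[of "ball x e"]) auto
      qed
    qed (auto simp: F_def)
    moreover have "\<Union>F' \<in> sets M"
      using F' b unfolding F_def by (intro sets.countable_Union) auto
    ultimately show ?thesis using F' by simp
  qed
  have "sigma_sets UNIV {U. open U} \<subseteq> sets M"
    using op by (metis mem_Collect_eq sets.sigma_sets_subset sp subsetI)
  then show ?thesis by (simp add: borel_def)
qed

text \<open>Cylinder sets are stable under intersection and generate the Borel sets; the measure of
  a cylinder is the integral of its weight, which is the case of frequency 0 in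
  \<open>char_functional_cyl\<close>.\<close>

theorem char_functional_unique:
  fixes N1 N2 :: "'a::{real_inner,second_countable_topology} measure"
  assumes N: "prob_space N1" "prob_space N2" and sets: "sets N1 = sets borel" "sets N2 = sets borel"
    and eq: "\<And>f. (\<integral>x. exp (\<i> * of_real (x \<bullet> f)) \<partial>N1) = (\<integral>x. exp (\<i> * of_real (x \<bullet> f)) \<partial>N2)"
  shows "N1 = N2"
proof -
  interpret N1: prob_space N1 by (rule N)
  interpret N2: prob_space N2 by (rule N)
  note [measurable_cong] = sets
  define C :: "('a \<times> real set) list \<Rightarrow> 'a set" where "C fs = {x. \<forall>(f, A)\<in>set fs. x \<bullet> f \<in> A}" for fs
  define E where "E = C ` {fs. \<forall>(f, A)\<in>set fs. A \<in> sets borel}"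
  have Cw: "indicator (C fs) x = cyl_weight fs x" for fs x
  proof (induction fs)
    case (Cons a fs)
    obtain f A where a: "a = (f, A)" by (cases a)
    have "indicator (C (a # fs)) x = indicator A (x \<bullet> f) * (indicator (C fs) x :: real)"
      by (auto simp: C_def a indicator_def)
    then show ?case using Cons by (simp add: cyl_weight_def a)
  qed (simp add: C_def cyl_weight_def)
  have CM: "C fs \<in> sets borel" if "\<forall>(f, A)\<in>set fs. A \<in> sets borel" for fs
  proof -
    have "(indicator (C fs) :: 'a \<Rightarrow> real) \<in> borel_measurable borel"
      unfolding Cw[abs_def] by (rule cyl_weight_measurable) (use that in auto)
    then show ?thesis by (simp add: borel_measurable_indicator_iff)
  qed
  have sE: "sets borel = sigma_sets UNIV E"
  proof
    show "sigma_sets UNIV E \<subseteq> sets borel"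
      using CM by (intro sets.sigma_sets_subset[of E borel, simplified]) (auto simp: E_def)
    have "{x. x \<bullet> f \<le> c} \<in> E" for f c
      unfolding E_def by (rule image_eqI[of _ _ "[(f, {..c})]"]) (auto simp: C_def)
    then show "sets borel \<subseteq> sigma_sets UNIV E"
      using borel_eq_sigma_halfspaces[of "sigma UNIV E"] by (auto simp: space_measure_of_conv)
  qed
  have "UNIV \<in> E" unfolding E_def by (rule image_eqI[of _ _ "[]"]) (auto simp: C_def)
  show ?thesis
  proof (rule measure_eqI_generator_eq[where E=E and A="\<lambda>_. UNIV" and \<Omega>=UNIV])
    show "Int_stable E"
    proof (rule Int_stableI)
      fix a b assume "a \<in> E" "b \<in> E"
      then obtain fs gs where *: "a = C fs" "b = C gs" "\<forall>(f, A)\<in>set fs. A \<in> sets borel" "\<forall>(f, A)\<in>set gs. A \<in> sets borel"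
        unfolding E_def by auto
      then have "a \<inter> b = C (fs @ gs)" by (auto simp: C_def)
      moreover have "\<forall>(f, A)\<in>set (fs @ gs). A \<in> sets borel" using * by auto
      ultimately show "a \<inter> b \<in> E" unfolding E_def by blast
    qed
    show "emeasure N1 X = emeasure N2 X" if "X \<in> E" for X
    proof -
      obtain fs where fs: "X = C fs" "\<forall>(f, A)\<in>set fs. A \<in> sets borel" using \<open>X \<in> E\<close> by (auto simp: E_def)
      have fs': "\<And>f A. (f, A) \<in> set fs \<Longrightarrow> A \<in> sets borel" using fs(2) by auto
      have "complex_of_real (\<integral>x. cyl_weight fs x \<partial>N1) = complex_of_real (\<integral>x. cyl_weight fs x \<partial>N2)"
        using char_functional_cyl[OF N sets eq fs', where g=0] by (simp add: scaleR_conv_of_real)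
      then have "measure N1 X = measure N2 X"
        unfolding of_real_eq_iff Cw[symmetric] fs(1) using CM[OF fs(2)] sets by simp
      then show ?thesis by (simp add: N1.emeasure_eq_measure N2.emeasure_eq_measure)
    qed
  qed (use sets sE \<open>UNIV \<in> E\<close> in auto)
qed

section \<open>Gaussian laws on the Hilbert space\<close>

abbreviation stdn :: "real measure" where "stdn \<equiv> std_normal_distribution"

lemma real_distribution_stdn: "real_distribution stdn"
  by (rule real_dist_normal_dist)

lemma prob_space_stdn: "prob_space stdn"
  using real_distribution_stdn by (simp add: real_distribution_def)

lemma finite_product_stdn: "finite_product_prob_space (\<lambda>_. stdn) {..<m::nat}"
proof -
  interpret prob_space stdn by (rule prob_space_stdn)
  show ?thesis by unfold_locales simp
qed

lemma iexp_stdn: "(\<integral>y. iexp (t * y) \<partial>stdn) = complex_of_real (exp (- t\<^sup>2 / 2))"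
  using char_std_normal_distribution unfolding char_def by (metis (no_types))

lemma stdn_integrable_power: "integrable stdn (\<lambda>y. y ^ k)"
  using integrable_std_normal_moment[of k]
  by (subst integrable_density) (auto simp: mult.commute)

lemma stdn_moments:
  "(\<integral>y. y ^ 2 \<partial>stdn) = 1" "(\<integral>y. y ^ 4 \<partial>stdn) = 3"
proof -
  have *: "(\<integral>y. y ^ k \<partial>stdn) = (\<integral>y. std_normal_density y * y ^ k \<partial>lborel)" for k
    by (subst integral_density) auto
  show "(\<integral>y. y ^ 2 \<partial>stdn) = 1" unfolding * using integral_std_normal_moment_even[of 1] by simp
  show "(\<integral>y. y ^ 4 \<partial>stdn) = 3" unfolding * using integral_std_normal_moment_even[of 2]
    by (simp add: fact_numeral)
qed

definition pos_op :: "(L2I \<Rightarrow> L2I) \<Rightarrow> bool" where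
  "pos_op C \<longleftrightarrow> bounded_linear C \<and> (\<forall>f g. C f \<bullet> g = f \<bullet> C g) \<and> (\<forall>f. 0 \<le> C f \<bullet> f)"

lemma pos_op_bilinear:
  assumes "pos_op C"
  shows "C (f + g) = C f + C g" "C (f - g) = C f - C g" "C (r *\<^sub>R f) = r *\<^sub>R C f" "C (- f) = - C f"
    "C f \<bullet> g = C g \<bullet> f" "0 \<le> C f \<bullet> f"
proof -
  interpret bounded_linear C using assms by (simp add: pos_op_def)
  show "C (f + g) = C f + C g" "C (f - g) = C f - C g" "C (r *\<^sub>R f) = r *\<^sub>R C f" "C (- f) = - C f"
    by (rule add, rule diff, rule scaleR, rule neg)
  show "C f \<bullet> g = C g \<bullet> f" "0 \<le> C f \<bullet> f" using assms by (auto simp: pos_op_def inner_commute)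
qed

lemma pos_op_continuous: "pos_op C \<Longrightarrow> continuous_on A C"
  by (auto simp: pos_op_def intro: linear_continuous_on)

lemma pos_op_measurable: "pos_op C \<Longrightarrow> C \<in> borel_measurable borel"
  by (intro borel_measurable_continuous_onI pos_op_continuous)

section \<open>Sample covariances as positive operators\<close>

lemma scov_inner:
  "scov n x f \<bullet> g = (1 / real n) * (\<Sum>j<n. ((x j - smean n x) \<bullet> f) * ((x j - smean n x) \<bullet> g))"
  by (simp add: scov_def inner_sum_left sum_distrib_left mult.assoc)

lemma pos_op_scov: "pos_op (scov n x)"
proof -
  have "bounded_linear (\<lambda>f. (1 / real n) *\<^sub>R (\<Sum>j<n. ((x j - smean n x) \<bullet> f) *\<^sub>R (x j - smean n x)))"
    by (intro bounded_linear_const_scaleR bounded_linear_sum bounded_linear_scaleR_const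
        bounded_linear_inner_right)
  then have "bounded_linear (scov n x)" by (simp add: scov_def[abs_def])
  moreover have "scov n x f \<bullet> g = f \<bullet> scov n x g" for f g
    unfolding inner_commute[of f] scov_inner by (simp add: mult.commute)
  moreover have "0 \<le> scov n x f \<bullet> f" for f
    unfolding scov_inner by (simp add: sum_nonneg)
  ultimately show ?thesis by (simp add: pos_op_def)
qed

lemma scov_inner_raw:
  assumes "n > 0"
  shows "scov n x f \<bullet> g = (\<Sum>j<n. (x j \<bullet> f) * (x j \<bullet> g)) / real n - (smean n x \<bullet> f) * (smean n x \<bullet> g)"
proof -
  have m: "smean n x \<bullet> f = (\<Sum>j<n. x j \<bullet> f) / real n" for f
    by (simp add: smean_def inner_sum_left)
  have "(\<Sum>j<n. ((x j - smean n x) \<bullet> f) * ((x j - smean n x) \<bullet> g))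
      = (\<Sum>j<n. (x j \<bullet> f) * (x j \<bullet> g)) - (\<Sum>j<n. x j \<bullet> f) * (smean n x \<bullet> g)
        - (smean n x \<bullet> f) * (\<Sum>j<n. x j \<bullet> g) + real n * ((smean n x \<bullet> f) * (smean n x \<bullet> g))"
    by (simp add: inner_diff_left algebra_simps sum.distrib sum_subtractf sum_distrib_left)
  also have "\<dots> = (\<Sum>j<n. (x j \<bullet> f) * (x j \<bullet> g)) - real n * ((smean n x \<bullet> f) * (smean n x \<bullet> g))"
    using assms unfolding m by (simp add: field_simps)
  finally show ?thesis using assms unfolding scov_inner by (simp add: field_simps)
qed

text \<open>Dropping the mean term only increases the form. The averages of the squared norms stay
  bounded along almost every realization, which yields one bound for all n.\<close>

lemma scov_bound:
  assumes "n > 0"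
  shows "scov n x f \<bullet> f \<le> ((\<Sum>j<n. (norm (x j))\<^sup>2) / real n) * (norm f)\<^sup>2"
proof -
  have "scov n x f \<bullet> f \<le> (\<Sum>j<n. (x j \<bullet> f) * (x j \<bullet> f)) / real n"
    unfolding scov_inner_raw[OF assms] by simp
  also have "\<dots> \<le> (\<Sum>j<n. (norm (x j))\<^sup>2 * (norm f)\<^sup>2) / real n"
  proof (intro divide_right_mono sum_mono)
    fix j
    show "(x j \<bullet> f) * (x j \<bullet> f) \<le> (norm (x j))\<^sup>2 * (norm f)\<^sup>2"
      using Cauchy_Schwarz_ineq[of "x j" f] unfolding power2_norm_eq_inner
      by (simp add: power2_eq_square)
  qed simp
  finally show ?thesis by (simp add: sum_distrib_right)
qed

section \<open>Centred Gaussian laws and their moments\<close>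

locale hilbert_gaussian = prob_space N for N :: "L2I measure" +
  fixes C :: "L2I \<Rightarrow> L2I"
  assumes sets_N [measurable_cong]: "sets N = sets borel"
    and cf: "\<And>f. (\<integral>x. exp (\<i> * of_real (x \<bullet> f)) \<partial>N) = gauss_cf 0 C f"
    and pos: "pos_op C"
begin

lemma gauss_cf_zero: "gauss_cf 0 C f = of_real (exp (- (C f \<bullet> f) / 2))"
  by (simp add: gauss_cf_def exp_of_real[symmetric])

text \<open>Along each direction the characteristic functional is that of a scaled standard normal
  variable. Scaling, rather than a normal density, covers variance 0 as well, so moments reduce to
  integrals over \<open>stdn\<close> without a case distinction.\<close>

lemma distr_inner: "distr N borel (\<lambda>x. x \<bullet> f) = distr stdn borel (\<lambda>y. sqrt (C f \<bullet> f) * y)"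
proof (rule Levy_uniqueness)
  interpret S: prob_space stdn by (rule prob_space_stdn)
  show "real_distribution (distr N borel (\<lambda>x. x \<bullet> f))" by (rule real_distribution_distr) simp
  show "real_distribution (distr stdn borel (\<lambda>y. sqrt (C f \<bullet> f) * y))"
    by (rule S.real_distribution_distr) simp
  have "char (distr N borel (\<lambda>x. x \<bullet> f)) t = char (distr stdn borel (\<lambda>y. sqrt (C f \<bullet> f) * y)) t" for t
  proof -
    have "char (distr N borel (\<lambda>x. x \<bullet> f)) t = (\<integral>x. exp (\<i> * of_real (x \<bullet> (t *\<^sub>R f))) \<partial>N)"
      by (simp add: char_def integral_distr)
    also have "\<dots> = of_real (exp (- (t\<^sup>2 * (C f \<bullet> f)) / 2))"
      unfolding cf gauss_cf_zero by (simp add: pos_op_bilinear[OF pos] power2_eq_square)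
    also have "\<dots> = (\<integral>y. iexp ((t * sqrt (C f \<bullet> f)) * y) \<partial>stdn)"
      unfolding iexp_stdn using pos_op_bilinear(6)[OF pos, of f] by (simp add: power_mult_distrib)
    also have "\<dots> = char (distr stdn borel (\<lambda>y. sqrt (C f \<bullet> f) * y)) t"
      by (simp add: char_def integral_distr mult_ac)
    finally show ?thesis .
  qed
  then show "char (distr N borel (\<lambda>x. x \<bullet> f)) = char (distr stdn borel (\<lambda>y. sqrt (C f \<bullet> f) * y))" ..
qed

lemma integral_inner:
  fixes F :: "real \<Rightarrow> real"
  assumes [measurable]: "F \<in> borel_measurable borel"
  shows "(\<integral>x. F (x \<bullet> f) \<partial>N) = (\<integral>y. F (sqrt (C f \<bullet> f) * y) \<partial>stdn)"
    and "integrable N (\<lambda>x. F (x \<bullet> f)) \<longleftrightarrow> integrable stdn (\<lambda>y. F (sqrt (C f \<bullet> f) * y))"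
proof -
  have "(\<integral>x. F (x \<bullet> f) \<partial>N) = integral\<^sup>L (distr N borel (\<lambda>x. x \<bullet> f)) F" by (simp add: integral_distr)
  also have "\<dots> = (\<integral>y. F (sqrt (C f \<bullet> f) * y) \<partial>stdn)" unfolding distr_inner by (simp add: integral_distr)
  finally show "(\<integral>x. F (x \<bullet> f) \<partial>N) = (\<integral>y. F (sqrt (C f \<bullet> f) * y) \<partial>stdn)" .
  have "integrable N (\<lambda>x. F (x \<bullet> f)) \<longleftrightarrow> integrable (distr N borel (\<lambda>x. x \<bullet> f)) F" by (simp add: integrable_distr_eq)
  also have "\<dots> \<longleftrightarrow> integrable stdn (\<lambda>y. F (sqrt (C f \<bullet> f) * y))" unfolding distr_inner by (simp add: integrable_distr_eq)
  finally show "integrable N (\<lambda>x. F (x \<bullet> f)) \<longleftrightarrow> integrable stdn (\<lambda>y. F (sqrt (C f \<bullet> f) * y))" .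
qed

lemma integrable_inner_power: "integrable N (\<lambda>x. (x \<bullet> f) ^ k)"
  using integral_inner(2)[of "\<lambda>u. u ^ k" f] stdn_integrable_power[of k] by (simp add: power_mult_distrib)

lemma integrable_inner_power_mult: "integrable N (\<lambda>x. (x \<bullet> f) ^ k * (x \<bullet> g) ^ l)"
proof (rule Bochner_Integration.integrable_bound)
  show "integrable N (\<lambda>x. (x \<bullet> f) ^ (2 * k) + (x \<bullet> g) ^ (2 * l))"
    by (intro Bochner_Integration.integrable_add integrable_inner_power)
  show "AE x in N. norm ((x \<bullet> f) ^ k * (x \<bullet> g) ^ l) \<le> norm ((x \<bullet> f) ^ (2 * k) + (x \<bullet> g) ^ (2 * l))"
  proof (rule AE_I2)
    fix x
    show "norm ((x \<bullet> f) ^ k * (x \<bullet> g) ^ l) \<le> norm ((x \<bullet> f) ^ (2 * k) + (x \<bullet> g) ^ (2 * l))"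
      using order_trans[OF abs_mult_le_squares[of "(x \<bullet> f) ^ k" "(x \<bullet> g) ^ l"] abs_ge_self]
      by (simp only: real_norm_def power_even_eq)
  qed
qed measurable

lemma second_moment: "expectation (\<lambda>x. (x \<bullet> f)\<^sup>2) = C f \<bullet> f"
  and fourth_moment: "expectation (\<lambda>x. (x \<bullet> f) ^ 4) = 3 * (C f \<bullet> f)\<^sup>2"
proof -
  have "sqrt s ^ 4 = s\<^sup>2" if "s \<ge> 0" for s
    using that real_sqrt_pow2[of s] by (metis power2_eq_square power4_eq_xxxx mult.assoc)
  then show "expectation (\<lambda>x. (x \<bullet> f) ^ 4) = 3 * (C f \<bullet> f)\<^sup>2"
    using integral_inner(1)[of "\<lambda>u. u ^ 4" f] stdn_moments pos_op_bilinear(6)[OF pos, of f]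
    by (simp add: power_mult_distrib)
  show "expectation (\<lambda>x. (x \<bullet> f)\<^sup>2) = C f \<bullet> f"
    using integral_inner(1)[of "\<lambda>u. u ^ 2" f] stdn_moments pos_op_bilinear(6)[OF pos, of f]
    by (simp add: power_mult_distrib)
qed

text \<open>The Gaussian functional is even in f. This symmetry removes the expectations of all odd
  functions in the computations below.\<close>

lemma distr_uminus: "distr N borel uminus = N"
proof (rule char_functional_unique)
  show "prob_space (distr N borel uminus)" by (rule prob_space_distr) simp
  show "prob_space N" by (rule prob_space_axioms)
  show "(\<integral>x. exp (\<i> * of_real (x \<bullet> f)) \<partial>distr N borel uminus) = (\<integral>x. exp (\<i> * of_real (x \<bullet> f)) \<partial>N)" for f
  proof -
    have "(\<integral>x. exp (\<i> * of_real (x \<bullet> f)) \<partial>distr N borel uminus) = (\<integral>x. exp (\<i> * of_real (- x \<bullet> f)) \<partial>N)"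
      by (subst integral_distr) simp_all
    also have "\<dots> = (\<integral>x. exp (\<i> * of_real (x \<bullet> (- f))) \<partial>N)" by simp
    also have "\<dots> = (\<integral>x. exp (\<i> * of_real (x \<bullet> f)) \<partial>N)"
      unfolding cf gauss_cf_zero by (simp add: pos_op_bilinear[OF pos])
    finally show ?thesis .
  qed
qed (simp_all add: sets_N)

lemma expectation_odd:
  fixes F :: "L2I \<Rightarrow> real"
  assumes [measurable]: "F \<in> borel_measurable borel" and odd: "\<And>x. F (- x) = - F x"
  shows "expectation F = 0"
proof -
  have "expectation F = integral\<^sup>L (distr N borel uminus) F" by (simp add: distr_uminus)
  also have "\<dots> = expectation (\<lambda>x. F (- x))" by (subst integral_distr) simp_all
  also have "\<dots> = - expectation F" by (simp add: odd)
  finally show ?thesis by simp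
qed

text \<open>Polarisation: the second moment at f + g gives the mixed one, and adding the fourth
  moments at f + g and f - g cancels the terms of odd degree in g.\<close>

lemma mixed_moment: "expectation (\<lambda>x. (x \<bullet> f) * (x \<bullet> g)) = C f \<bullet> g"
  and mixed_fourth_moment:
    "expectation (\<lambda>x. (x \<bullet> f)\<^sup>2 * (x \<bullet> g)\<^sup>2) = (C f \<bullet> f) * (C g \<bullet> g) + 2 * (C f \<bullet> g)\<^sup>2"
proof -
  note b = pos_op_bilinear[OF pos]
  have i1: "integrable N (\<lambda>x. (x \<bullet> f) * (x \<bullet> g))"
    using integrable_inner_power_mult[of f 1 g 1] by simp
  have i2: "integrable N (\<lambda>x. (x \<bullet> f)\<^sup>2 * (x \<bullet> g)\<^sup>2)"
    by (rule integrable_inner_power_mult)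
  have "C (f + g) \<bullet> (f + g) = expectation (\<lambda>x. (x \<bullet> f)\<^sup>2 + 2 * ((x \<bullet> f) * (x \<bullet> g)) + (x \<bullet> g)\<^sup>2)"
    unfolding second_moment[symmetric]
    by (intro Bochner_Integration.integral_cong) (auto simp: inner_add_right power2_sum)
  also have "\<dots> = C f \<bullet> f + 2 * expectation (\<lambda>x. (x \<bullet> f) * (x \<bullet> g)) + C g \<bullet> g"
    using integrable_inner_power i1 by (simp add: second_moment)
  finally show "expectation (\<lambda>x. (x \<bullet> f) * (x \<bullet> g)) = C f \<bullet> g"
    using b(5)[of g f] by (simp add: b inner_add_left inner_add_right)
  have "3 * (C (f + g) \<bullet> (f + g))\<^sup>2 + 3 * (C (f - g) \<bullet> (f - g))\<^sup>2
      = expectation (\<lambda>x. (x \<bullet> (f + g)) ^ 4) + expectation (\<lambda>x. (x \<bullet> (f - g)) ^ 4)"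
    by (simp add: fourth_moment)
  also have "\<dots> = expectation (\<lambda>x. (x \<bullet> (f + g)) ^ 4 + (x \<bullet> (f - g)) ^ 4)"
    by (intro Bochner_Integration.integral_add[symmetric] integrable_inner_power)
  also have "\<dots> = expectation (\<lambda>x. 2 * (x \<bullet> f) ^ 4 + 12 * ((x \<bullet> f)\<^sup>2 * (x \<bullet> g)\<^sup>2) + 2 * (x \<bullet> g) ^ 4)"
  proof (intro Bochner_Integration.integral_cong refl)
    fix x
    have "(u + v) ^ 4 + (u - v) ^ 4 = 2 * u ^ 4 + 12 * (u\<^sup>2 * v\<^sup>2) + 2 * v ^ 4" for u v :: real by algebra
    then show "(x \<bullet> (f + g)) ^ 4 + (x \<bullet> (f - g)) ^ 4 = 2 * (x \<bullet> f) ^ 4 + 12 * ((x \<bullet> f)\<^sup>2 * (x \<bullet> g)\<^sup>2) + 2 * (x \<bullet> g) ^ 4"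
      by (simp add: inner_add_right inner_diff_right)
  qed
  also have "\<dots> = 6 * (C f \<bullet> f)\<^sup>2 + 12 * expectation (\<lambda>x. (x \<bullet> f)\<^sup>2 * (x \<bullet> g)\<^sup>2) + 6 * (C g \<bullet> g)\<^sup>2"
    using integrable_inner_power i2 by (simp add: fourth_moment)
  finally have *: "3 * (C (f + g) \<bullet> (f + g))\<^sup>2 + 3 * (C (f - g) \<bullet> (f - g))\<^sup>2
      = 6 * (C f \<bullet> f)\<^sup>2 + 12 * expectation (\<lambda>x. (x \<bullet> f)\<^sup>2 * (x \<bullet> g)\<^sup>2) + 6 * (C g \<bullet> g)\<^sup>2" .
  have e: "C (f + g) \<bullet> (f + g) = C f \<bullet> f + 2 * (C f \<bullet> g) + C g \<bullet> g"
    "C (f - g) \<bullet> (f - g) = C f \<bullet> f - 2 * (C f \<bullet> g) + C g \<bullet> g"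
    using b(5)[of g f] by (simp_all add: b inner_add_left inner_add_right inner_diff_left inner_diff_right)
  show "expectation (\<lambda>x. (x \<bullet> f)\<^sup>2 * (x \<bullet> g)\<^sup>2) = (C f \<bullet> f) * (C g \<bullet> g) + 2 * (C f \<bullet> g)\<^sup>2"
    using * unfolding e by (simp add: power2_eq_square algebra_simps)
qed

lemma expectation_cos: "expectation (\<lambda>x. cos (x \<bullet> f)) = exp (- (C f \<bullet> f) / 2)"
proof -
  have "integrable N (\<lambda>x. exp (\<i> * of_real (x \<bullet> f)))"
    by (rule integrable_const_bound[where B=1]) auto
  from integral_Re[OF this] show ?thesis
    unfolding cf gauss_cf_zero by (simp add: exp_Euler Re_cos Re_sin cos_of_real sin_of_real)
qed

text \<open>Up to sign, \<open>?F t\<close> is the symmetric second difference quotient of cos (x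
  \<bullet> (f + t g)) at t = 0, and it is dominated by (x \<bullet> g)^2. Its expectation is
  explicit by \<open>expectation_cos\<close>, so the mixed expectation is a second derivative
  computed from one-dimensional marginals alone.\<close>

lemma expectation_cos_square:
  "expectation (\<lambda>x. cos (x \<bullet> f) * (x \<bullet> g)\<^sup>2) = exp (- (C f \<bullet> f) / 2) * (C g \<bullet> g - (C f \<bullet> g)\<^sup>2)"
proof (rule LIMSEQ_unique)
  let ?t = "\<lambda>n. inverse (real (Suc n))"
  let ?F = "\<lambda>t x. cos (x \<bullet> f) * (2 * (1 - cos (t * (x \<bullet> g))) / t\<^sup>2)"
  show "(\<lambda>n. expectation (?F (?t n))) \<longlonglongrightarrow> expectation (\<lambda>x. cos (x \<bullet> f) * (x \<bullet> g)\<^sup>2)"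
  proof (rule integral_dominated_convergence[where w="\<lambda>x. (x \<bullet> g)\<^sup>2"])
    show "AE x in N. (\<lambda>n. ?F (?t n) x) \<longlonglongrightarrow> cos (x \<bullet> f) * (x \<bullet> g)\<^sup>2"
    proof (intro AE_I2 tendsto_mult tendsto_const)
      fix x
      have "((\<lambda>t. 2 * (1 - cos (t * v)) / t\<^sup>2) \<longlongrightarrow> v * v) (at_right 0)" for v :: real by real_asymp
      moreover have "filterlim ?t (at_right 0) sequentially"
        by real_asymp
      ultimately show "(\<lambda>n. 2 * (1 - cos (?t n * (x \<bullet> g))) / (?t n)\<^sup>2) \<longlonglongrightarrow> (x \<bullet> g)\<^sup>2"
        unfolding power2_eq_square[of "x \<bullet> g"] by (rule filterlim_compose)
    qed
    have "\<bar>2 * (1 - cos (t * v)) / t\<^sup>2\<bar> \<le> v\<^sup>2" if "t > 0" for t v :: real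
    proof -
      have "1 - cos (t * v) \<le> (t * v)\<^sup>2 / 2"
      proof -
        have "1 - cos (t * v) = 2 * (sin (t * v / 2))\<^sup>2" using cos_double_sin[of "t * v / 2"] by simp
        also have "\<dots> \<le> 2 * (t * v / 2)\<^sup>2"
          using abs_sin_x_le_abs_x[of "t * v / 2"] unfolding abs_le_square_iff by simp
        finally show ?thesis by (simp add: power_divide)
      qed
      then show ?thesis using that by (simp add: field_simps)
    qed
    note bd = this
    show "AE x in N. norm (?F (?t n) x) \<le> (x \<bullet> g)\<^sup>2" for n
    proof (rule AE_I2)
      fix x
      have "\<bar>cos u * w\<bar> \<le> \<bar>w\<bar>" for u w :: real
        by (simp add: abs_mult mult_left_le_one_le)
      from order_trans[OF this bd[of "?t n"]] show "norm (?F (?t n) x) \<le> (x \<bullet> g)\<^sup>2"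
        unfolding real_norm_def by simp
    qed
  qed (use integrable_inner_power in auto)
  let ?a = "C f \<bullet> f" and ?b = "C g \<bullet> g" and ?c = "C f \<bullet> g"
  have E: "expectation (?F t) = exp (- ?a / 2) * ((2 - exp (- (2 * t * ?c + t\<^sup>2 * ?b) / 2) - exp (- (- 2 * t * ?c + t\<^sup>2 * ?b) / 2)) / t\<^sup>2)" for t
  proof -
    have ic: "integrable N (\<lambda>x. cos (x \<bullet> h))" for h
      by (rule integrable_const_bound[where B=1]) auto
    have "expectation (?F t) = expectation (\<lambda>x. (2 * cos (x \<bullet> f) - cos (x \<bullet> (f + t *\<^sub>R g)) - cos (x \<bullet> (f - t *\<^sub>R g))) / t\<^sup>2)"
      by (intro Bochner_Integration.integral_cong)
        (auto simp: inner_add_right inner_diff_right cos_add cos_diff algebra_simps)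
    also have "\<dots> = (2 * exp (- ?a / 2) - exp (- (C (f + t *\<^sub>R g) \<bullet> (f + t *\<^sub>R g)) / 2)
        - exp (- (C (f - t *\<^sub>R g) \<bullet> (f - t *\<^sub>R g)) / 2)) / t\<^sup>2"
      using ic by (simp add: expectation_cos del: inner_add_right inner_diff_right)
    also have "C (f + t *\<^sub>R g) \<bullet> (f + t *\<^sub>R g) = ?a + (2 * t * ?c + t\<^sup>2 * ?b)"
      using pos_op_bilinear(5)[OF pos, of g f]
      by (simp add: pos_op_bilinear[OF pos] inner_add_left inner_add_right power2_eq_square algebra_simps)
    also have "C (f - t *\<^sub>R g) \<bullet> (f - t *\<^sub>R g) = ?a + (- 2 * t * ?c + t\<^sup>2 * ?b)"
      using pos_op_bilinear(5)[OF pos, of g f]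
      by (simp add: pos_op_bilinear[OF pos] inner_diff_left inner_diff_right power2_eq_square algebra_simps)
    finally show ?thesis
      by (simp add: exp_add[symmetric] right_diff_distrib diff_divide_distrib add_divide_distrib)
  qed
  have "((\<lambda>t. (2 - exp (- (2 * t * c + t\<^sup>2 * b) / 2) - exp (- (- 2 * t * c + t\<^sup>2 * b) / 2)) / t\<^sup>2) \<longlongrightarrow> b - c * c) (at_right 0)" for b c :: real
    by real_asymp
  moreover have "filterlim ?t (at_right 0) sequentially" by real_asymp
  ultimately have "(\<lambda>n. (2 - exp (- (2 * ?t n * ?c + (?t n)\<^sup>2 * ?b) / 2) - exp (- (- 2 * ?t n * ?c + (?t n)\<^sup>2 * ?b) / 2)) / (?t n)\<^sup>2) \<longlonglongrightarrow> ?b - ?c\<^sup>2"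
    unfolding power2_eq_square[of ?c] by (rule filterlim_compose)
  then show "(\<lambda>n. expectation (?F (?t n))) \<longlonglongrightarrow> exp (- ?a / 2) * (?b - ?c\<^sup>2)"
    unfolding E by (intro tendsto_mult tendsto_const)
qed

text \<open>Differentiation at t = 0 as for the cosine, now with a first difference: cos (x
  \<bullet> (f - t g)) - cos (x \<bullet> (f + t g)) is twice the product of the two sines.\<close>

lemma expectation_sin_mult:
  "expectation (\<lambda>x. sin (x \<bullet> f) * (x \<bullet> g)) = exp (- (C f \<bullet> f) / 2) * (C f \<bullet> g)"
proof (rule LIMSEQ_unique)
  let ?t = "\<lambda>n. inverse (real (Suc n))"
  let ?F = "\<lambda>t x. sin (x \<bullet> f) * (sin (t * (x \<bullet> g)) / t)"
  show "(\<lambda>n. expectation (?F (?t n))) \<longlonglongrightarrow> expectation (\<lambda>x. sin (x \<bullet> f) * (x \<bullet> g))"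
  proof (rule integral_dominated_convergence[where w="\<lambda>x. \<bar>x \<bullet> g\<bar>"])
    show "AE x in N. (\<lambda>n. ?F (?t n) x) \<longlonglongrightarrow> sin (x \<bullet> f) * (x \<bullet> g)"
    proof (intro AE_I2 tendsto_mult tendsto_const)
      fix x
      have "((\<lambda>t. sin (t * v) / t) \<longlongrightarrow> v) (at_right 0)" for v :: real by real_asymp
      moreover have "filterlim ?t (at_right 0) sequentially"
        by real_asymp
      ultimately show "(\<lambda>n. sin (?t n * (x \<bullet> g)) / ?t n) \<longlonglongrightarrow> x \<bullet> g"
        by (rule filterlim_compose)
    qed
    have "\<bar>sin (t * v) / t\<bar> \<le> \<bar>v\<bar>" if "t > 0" for t v :: real
      using abs_sin_x_le_abs_x[of "t * v"] that by (simp add: abs_mult field_simps)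
    note bd = this
    show "AE x in N. norm (?F (?t n) x) \<le> \<bar>x \<bullet> g\<bar>" for n
    proof (rule AE_I2)
      fix x
      have "\<bar>sin u * w\<bar> \<le> \<bar>w\<bar>" for u w :: real
        by (simp add: abs_mult mult_left_le_one_le)
      from order_trans[OF this bd[of "?t n"]] show "norm (?F (?t n) x) \<le> \<bar>x \<bullet> g\<bar>"
        unfolding real_norm_def by simp
    qed
  qed (use integrable_inner_power[of g 1] in auto)
  let ?a = "C f \<bullet> f" and ?b = "C g \<bullet> g" and ?c = "C f \<bullet> g"
  have E: "expectation (?F t) = exp (- ?a / 2) * (exp (- t\<^sup>2 * ?b / 2) * (exp (t * ?c) - exp (- (t * ?c))) / t / 2)" for t
  proof -
    have ic: "integrable N (\<lambda>x. cos (x \<bullet> h))" for h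
      by (rule integrable_const_bound[where B=1]) auto
    have "expectation (?F t) = expectation (\<lambda>x. (cos (x \<bullet> (f - t *\<^sub>R g)) - cos (x \<bullet> (f + t *\<^sub>R g))) / (2 * t))"
      by (intro Bochner_Integration.integral_cong)
        (auto simp: inner_add_right inner_diff_right cos_add cos_diff)
    also have "\<dots> = (exp (- (C (f - t *\<^sub>R g) \<bullet> (f - t *\<^sub>R g)) / 2) - exp (- (C (f + t *\<^sub>R g) \<bullet> (f + t *\<^sub>R g)) / 2)) / (2 * t)"
      using ic by (simp add: expectation_cos del: inner_add_right inner_diff_right)
    also have "C (f + t *\<^sub>R g) \<bullet> (f + t *\<^sub>R g) = ?a + (t\<^sup>2 * ?b + 2 * t * ?c)"
      using pos_op_bilinear(5)[OF pos, of g f]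
      by (simp add: pos_op_bilinear[OF pos] inner_add_left inner_add_right power2_eq_square algebra_simps)
    also have "C (f - t *\<^sub>R g) \<bullet> (f - t *\<^sub>R g) = ?a + (t\<^sup>2 * ?b - 2 * t * ?c)"
      using pos_op_bilinear(5)[OF pos, of g f]
      by (simp add: pos_op_bilinear[OF pos] inner_diff_left inner_diff_right power2_eq_square algebra_simps)
    finally show ?thesis
      by (simp add: exp_add[symmetric] right_diff_distrib diff_divide_distrib add_divide_distrib)
  qed
  have "((\<lambda>t. exp (- t\<^sup>2 * b / 2) * (exp (t * c) - exp (- (t * c))) / t / 2) \<longlongrightarrow> c) (at_right 0)" for b c :: real
    by real_asymp
  moreover have "filterlim ?t (at_right 0) sequentially" by real_asymp
  ultimately have "(\<lambda>n. exp (- (?t n)\<^sup>2 * ?b / 2) * (exp (?t n * ?c) - exp (- (?t n * ?c))) / ?t n / 2) \<longlonglongrightarrow> ?c"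
    by (rule filterlim_compose)
  then show "(\<lambda>n. expectation (?F (?t n))) \<longlonglongrightarrow> exp (- ?a / 2) * ?c"
    unfolding E by (intro tendsto_mult tendsto_const)
qed

end

text \<open>The real part plus the imaginary part of the linearised empirical process at \<open>f\<close>,
  for a single observation \<open>x\<close>.\<close>

definition lin_score :: "(L2I \<Rightarrow> L2I) \<Rightarrow> L2I \<Rightarrow> L2I \<Rightarrow> real" where
  "lin_score C f x = cos (x \<bullet> f) + sin (x \<bullet> f)
     - exp (- (C f \<bullet> f) / 2) * (1 + x \<bullet> f - ((x \<bullet> f)\<^sup>2 - C f \<bullet> f) / 2)"

lemma lin_score_measurable [measurable]:
  assumes "pos_op C" and [measurable]: "g \<in> borel_measurable M" "h \<in> borel_measurable M"
  shows "(\<lambda>z. lin_score C (g z) (h z)) \<in> borel_measurable M"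
proof -
  have [measurable]: "C \<in> borel_measurable borel" by (rule pos_op_measurable[OF assms(1)])
  show ?thesis unfolding lin_score_def by measurable
qed

text \<open>The factor exp (- a / 2) absorbs the first and the second power of the standard
  deviation sqrt a. This is why moments of the score are bounded independently of the
  variance.\<close>

lemma abs_mult_exp_le: "\<bar>sqrt a * y\<bar> * exp (- a / 2) \<le> \<bar>y\<bar>" "a * y\<^sup>2 * exp (- a / 2) \<le> y\<^sup>2" if "a \<ge> 0" for a y :: real
proof -
  have 1: "a * exp (- a / 2) \<le> 1"
  proof -
    have "a \<le> exp (a / 2)"
    proof -
      have "1 + a / 2 + (a / 2)\<^sup>2 / 2 \<le> exp (a / 2)" using exp_lower_Taylor_quadratic[of "a / 2"] that by simp
      moreover have "a \<le> 1 + a / 2 + (a / 2)\<^sup>2 / 2"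
        using sum_squares_bound[of 1 "a / 2"] zero_le_power2[of "a / 2 - 1"]
        by (simp add: power2_eq_square algebra_simps)
      ultimately show ?thesis by linarith
    qed
    then show ?thesis by (simp add: exp_minus field_simps)
  qed
  then show "a * y\<^sup>2 * exp (- a / 2) \<le> y\<^sup>2"
    using mult_right_mono[OF 1, of "y\<^sup>2"] by (simp add: mult_ac)
  have "sqrt a * exp (- a / 2) \<le> 1"
  proof (cases "a \<le> 1")
    case True
    then show ?thesis using that by (intro mult_le_one) auto
  next
    case False
    then have "sqrt a \<le> a" by (simp add: real_le_lsqrt power2_eq_square)
    then have "sqrt a * exp (- a / 2) \<le> a * exp (- a / 2)" by (rule mult_right_mono) simp
    from order_trans[OF this 1] show ?thesis .
  qed
  then show "\<bar>sqrt a * y\<bar> * exp (- a / 2) \<le> \<bar>y\<bar>"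
    using mult_right_mono[of "sqrt a * exp (- a / 2)" 1 "\<bar>y\<bar>"] that by (simp add: abs_mult mult_ac)
qed

text \<open>With a the variance and x \<bullet> f = sqrt a * y, the score is at most 5 + y^2 in
  modulus for every a. Its fourth moment is therefore bounded by this constant, whatever the
  operator and the direction.\<close>

definition score_const :: real where
  "score_const = (\<integral>y. (5 + y\<^sup>2) ^ 4 \<partial>stdn)"

context hilbert_gaussian
begin

text \<open>The score is A f - exp (- (C f \<bullet> f) / 2) p f with a trigonometric part A and a
  quadratic polynomial p. Since E(A f p g) equals exp (- (C f \<bullet> f) / 2) E(p f p g), the
  score is orthogonal to every p g. Hence the three corrections in the product collapse into one,
  and E(p f p g) = 1 + c + c^2 / 2, with c = C f \<bullet> g, is what is subtracted from exp
  c.\<close>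

lemma expectation_lin_score: "expectation (lin_score C f) = 0"
  and integrable_lin_score_mult: "integrable N (\<lambda>x. lin_score C f x * lin_score C g x)"
  and expectation_lin_score_mult: "expectation (\<lambda>x. lin_score C f x * lin_score C g x) = limit_kernel C f g"
  and integrable_lin_score: "integrable N (lin_score C f)"
  and integrable_lin_score_4: "integrable N (\<lambda>x. lin_score C f x ^ 4)"
  and expectation_lin_score_4: "expectation (\<lambda>x. lin_score C f x ^ 4) \<le> score_const"
proof -
  have cm[measurable]: "(\<lambda>x. lin_score C f x) \<in> borel_measurable N" for f
    by (intro lin_score_measurable pos) auto
  have bound: "\<bar>lin_score C f x\<bar> \<le> 2 + exp (- (C f \<bullet> f) / 2) * (1 + \<bar>x \<bullet> f\<bar> + ((x \<bullet> f)\<^sup>2 + C f \<bullet> f) / 2)" for f x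
  proof -
    have "\<bar>cos (x \<bullet> f) + sin (x \<bullet> f)\<bar> \<le> 2"
      using abs_cos_le_one[of "x \<bullet> f"] abs_sin_le_one[of "x \<bullet> f"] by linarith
    moreover have "\<bar>1 + x \<bullet> f - ((x \<bullet> f)\<^sup>2 - C f \<bullet> f) / 2\<bar> \<le> 1 + \<bar>x \<bullet> f\<bar> + ((x \<bullet> f)\<^sup>2 + C f \<bullet> f) / 2"
    proof -
      have "\<bar>1 + u - (s - a) / 2\<bar> \<le> 1 + \<bar>u\<bar> + (s + a) / 2" if "0 \<le> s" "0 \<le> a" for u s a :: real
      proof (rule abs_leI)
        show "1 + u - (s - a) / 2 \<le> 1 + \<bar>u\<bar> + (s + a) / 2"
          using that abs_ge_self[of u] by (simp add: field_simps)
        show "- (1 + u - (s - a) / 2) \<le> 1 + \<bar>u\<bar> + (s + a) / 2"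
          using that abs_ge_minus_self[of u] by (simp add: field_simps)
      qed
      then show ?thesis using pos_op_bilinear(6)[OF pos] by simp
    qed
    then have "\<bar>exp (- (C f \<bullet> f) / 2) * (1 + x \<bullet> f - ((x \<bullet> f)\<^sup>2 - C f \<bullet> f) / 2)\<bar>
        \<le> exp (- (C f \<bullet> f) / 2) * (1 + \<bar>x \<bullet> f\<bar> + ((x \<bullet> f)\<^sup>2 + C f \<bullet> f) / 2)"
      unfolding abs_mult abs_exp_cancel by (rule mult_left_mono) simp
    ultimately show ?thesis unfolding lin_score_def by linarith
  qed
  have i5: "integrable stdn (\<lambda>y. (5 + y\<^sup>2) ^ 4)"
  proof -
    have "(5 + y\<^sup>2) ^ 4 = y ^ 8 + 20 * y ^ 6 + 150 * y ^ 4 + 500 * y ^ 2 + 625" for y :: real by algebra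
    moreover have "integrable stdn (\<lambda>y. y ^ 8 + 20 * y ^ 6 + 150 * y ^ 4 + 500 * y ^ 2 + 625 * y ^ 0)"
      by (intro Bochner_Integration.integrable_add integrable_mult_right stdn_integrable_power)
    ultimately show ?thesis by simp
  qed
  have fourth: "integrable N (\<lambda>x. lin_score C f x ^ 4) \<and> expectation (\<lambda>x. lin_score C f x ^ 4) \<le> score_const" for f
  proof -
    define a where "a = C f \<bullet> f"
    have a: "a \<ge> 0" using pos_op_bilinear(6)[OF pos] by (simp add: a_def)
    define F where "F u = 2 + exp (- a / 2) * (1 + \<bar>u\<bar> + (u\<^sup>2 + a) / 2)" for u
    have [measurable]: "F \<in> borel_measurable borel" unfolding F_def by measurable
    have F0: "0 \<le> F u" for u unfolding F_def using a by (intro add_nonneg_nonneg mult_nonneg_nonneg) auto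
    have Fb: "F (sqrt a * y) \<le> 5 + y\<^sup>2" for y
    proof -
      have "F (sqrt a * y) = 2 + exp (- a / 2) + \<bar>sqrt a * y\<bar> * exp (- a / 2)
          + (a * y\<^sup>2 * exp (- a / 2)) / 2 + (a * 1\<^sup>2 * exp (- a / 2)) / 2"
        using a by (simp add: F_def algebra_simps power_mult_distrib add_divide_distrib)
      also have "\<dots> \<le> 2 + 1 + \<bar>y\<bar> + y\<^sup>2 / 2 + 1\<^sup>2 / 2"
        using a by (intro add_mono divide_right_mono abs_mult_exp_le order_refl) auto
      also have "\<dots> \<le> 5 + y\<^sup>2"
        using zero_le_power2[of "\<bar>y\<bar> - 1"] by (simp add: power2_diff)
      finally show ?thesis .
    qed
    have Fb4: "F (sqrt a * y) ^ 4 \<le> (5 + y\<^sup>2) ^ 4" for y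
      by (rule power_mono[OF Fb F0])
    have iF': "integrable stdn (\<lambda>y. F (sqrt a * y) ^ 4)"
      by (rule Bochner_Integration.integrable_bound[OF i5]) (use Fb4 F0 in auto)
    have iF: "integrable N (\<lambda>x. F (x \<bullet> f) ^ 4)"
      using integral_inner(2)[of "\<lambda>u. F u ^ 4" f] iF' by (simp add: a_def)
    have EF: "expectation (\<lambda>x. F (x \<bullet> f) ^ 4) \<le> score_const"
      using integral_inner(1)[of "\<lambda>u. F u ^ 4" f] integral_mono[OF iF' i5 Fb4]
      by (simp add: a_def score_const_def)
    have le: "lin_score C f x ^ 4 \<le> F (x \<bullet> f) ^ 4" for x
      using power_mono[OF bound[of f x], of 4] by (simp add: F_def a_def power_abs)
    have i: "integrable N (\<lambda>x. lin_score C f x ^ 4)"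
      by (rule Bochner_Integration.integrable_bound[OF iF]) (use le in auto)
    then show ?thesis using integral_mono[OF i iF le] EF by simp
  qed
  then show "integrable N (\<lambda>x. lin_score C f x ^ 4)" "expectation (\<lambda>x. lin_score C f x ^ 4) \<le> score_const" by auto
  have i2: "integrable N (\<lambda>x. (lin_score C f x)\<^sup>2)" for f
    using fourth_moment_imp_integrable_power[of "lin_score C f" 2] fourth[of f] cm[of f] by simp
  show im: "integrable N (\<lambda>x. lin_score C f x * lin_score C g x)" for f g
    using l2fun_integrable_mult[of "lin_score C f" N "lin_score C g"] i2 cm by (auto simp: l2fun_def)
  show "integrable N (lin_score C f)"
    using l2fun_integrable[of "lin_score C f"] i2 cm by (auto simp: l2fun_def)
  have Cm[measurable]: "C \<in> borel_measurable borel" by (rule pos_op_measurable[OF pos])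
  have ic: "integrable N (\<lambda>x. cos (x \<bullet> f))" "integrable N (\<lambda>x. sin (x \<bullet> f))" for f
    by (auto intro!: integrable_const_bound[where B=1])
  have ib: "integrable N (\<lambda>x. t x * ((x \<bullet> g) ^ k))" if [measurable]: "t \<in> borel_measurable borel" and "\<And>x. \<bar>t x\<bar> \<le> 1"
    for t :: "L2I \<Rightarrow> real" and g k
  proof (rule Bochner_Integration.integrable_bound[OF integrable_inner_power[of g k]])
    show "AE x in N. norm (t x * ((x \<bullet> g) ^ k)) \<le> norm ((x \<bullet> g) ^ k)"
      using that(2) by (intro AE_I2) (simp add: abs_mult mult_left_le_one_le)
  qed simp
  have ibc: "integrable N (\<lambda>x. cos (x \<bullet> f) * ((x \<bullet> g) ^ k))" "integrable N (\<lambda>x. sin (x \<bullet> f) * ((x \<bullet> g) ^ k))" for f g k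
    by (auto intro!: ib)
  have odd1: "expectation (\<lambda>x. x \<bullet> f) = 0" for f by (rule expectation_odd) auto
  have odds: "expectation (\<lambda>x. sin (x \<bullet> f)) = 0" for f by (rule expectation_odd) auto
  have odd3: "expectation (\<lambda>x. (x \<bullet> f) * (x \<bullet> g)\<^sup>2) = 0" for f g by (rule expectation_odd) auto
  have odds2: "expectation (\<lambda>x. sin (x \<bullet> f) * (x \<bullet> g)\<^sup>2) = 0" for f g by (rule expectation_odd) auto
  have oddc: "expectation (\<lambda>x. cos (x \<bullet> f) * (x \<bullet> g)) = 0" for f g by (rule expectation_odd) auto
  have i1: "integrable N (\<lambda>x. x \<bullet> f)" for f using integrable_inner_power[of f 1] by simp
  show "expectation (lin_score C f) = 0"
  proof -
    have "expectation (lin_score C f) = expectation (\<lambda>x. cos (x \<bullet> f)) + expectation (\<lambda>x. sin (x \<bullet> f))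
       - exp (- (C f \<bullet> f) / 2) * (1 + expectation (\<lambda>x. x \<bullet> f) - (expectation (\<lambda>x. (x \<bullet> f)\<^sup>2) - C f \<bullet> f) / 2)"
      unfolding lin_score_def using ic i1 integrable_inner_power[of f 2] by (simp add: prob_space)
    then show ?thesis by (simp add: expectation_cos odds odd1 second_moment)
  qed
  let ?a = "C f \<bullet> f" and ?b = "C g \<bullet> g" and ?c = "C f \<bullet> g"
  define p where "p f x = 1 + x \<bullet> f - ((x \<bullet> f)\<^sup>2 - C f \<bullet> f) / 2" for f x
  define A where "A f x = cos (x \<bullet> f) + sin (x \<bullet> f)" for f and x :: L2I
  have [measurable]: "p f \<in> borel_measurable N" "A f \<in> borel_measurable N" for f
    unfolding p_def A_def by measurable
  have iAA: "integrable N (\<lambda>x. A f x * A g x)"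
  proof (rule integrable_const_bound[where B=4])
    have "\<bar>A f x\<bar> \<le> 2" for f x
      using abs_cos_le_one[of "x \<bullet> f"] abs_sin_le_one[of "x \<bullet> f"] unfolding A_def by linarith
    then show "AE x in N. norm (A f x * A g x) \<le> 4"
      using mult_mono[of "\<bar>A f _\<bar>" 2 "\<bar>A g _\<bar>" 2] by (intro AE_I2) (simp add: abs_mult)
  qed simp
  have EAA: "expectation (\<lambda>x. A f x * A g x) = exp (- (?a + ?b) / 2) * exp ?c"
  proof -
    \<comment> \<open>The sine term is odd and integrates to 0, which leaves a single cosine at f -
      g.\<close>
    have "A f x * A g x = cos (x \<bullet> (f - g)) + sin (x \<bullet> (f + g))" for x
      unfolding A_def by (simp add: inner_add_right inner_diff_right cos_diff sin_add algebra_simps)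
    then have "expectation (\<lambda>x. A f x * A g x) = exp (- (C (f - g) \<bullet> (f - g)) / 2)"
      using ic by (simp add: expectation_cos odds del: inner_add_right inner_diff_right)
    also have "C (f - g) \<bullet> (f - g) = ?a + ?b - 2 * ?c"
      using pos_op_bilinear(5)[OF pos, of g f] by (simp add: pos_op_bilinear[OF pos] inner_diff_left inner_diff_right)
    finally show ?thesis by (simp add: exp_add[symmetric] diff_divide_distrib add_divide_distrib)
  qed
  have Ap: "integrable N (\<lambda>x. A f x * p g x)"
      "expectation (\<lambda>x. A f x * p g x) = exp (- (C f \<bullet> f) / 2) * (1 + C f \<bullet> g + (C f \<bullet> g)\<^sup>2 / 2)" for f g
  proof -
    let ?b = "C g \<bullet> g"
    have e: "A f x * p g x = (1 + ?b / 2) * cos (x \<bullet> f) + cos (x \<bullet> f) * (x \<bullet> g) ^ 1 - (1/2) * (cos (x \<bullet> f) * (x \<bullet> g)\<^sup>2)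
       + (1 + ?b / 2) * sin (x \<bullet> f) + sin (x \<bullet> f) * (x \<bullet> g) ^ 1 - (1/2) * (sin (x \<bullet> f) * (x \<bullet> g)\<^sup>2)" for x
      unfolding A_def p_def by (simp add: field_simps)
    show "integrable N (\<lambda>x. A f x * p g x)"
      unfolding e by (intro Bochner_Integration.integrable_add Bochner_Integration.integrable_diff integrable_mult_right ic ibc)
    have "expectation (\<lambda>x. A f x * p g x) = (1 + ?b / 2) * expectation (\<lambda>x. cos (x \<bullet> f)) + expectation (\<lambda>x. cos (x \<bullet> f) * (x \<bullet> g) ^ 1)
       - (1/2) * expectation (\<lambda>x. cos (x \<bullet> f) * (x \<bullet> g)\<^sup>2) + (1 + ?b / 2) * expectation (\<lambda>x. sin (x \<bullet> f))
       + expectation (\<lambda>x. sin (x \<bullet> f) * (x \<bullet> g) ^ 1) - (1/2) * expectation (\<lambda>x. sin (x \<bullet> f) * (x \<bullet> g)\<^sup>2)"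
      unfolding e by (simp only: Bochner_Integration.integral_add Bochner_Integration.integral_diff
          Bochner_Integration.integrable_add Bochner_Integration.integrable_diff integrable_mult_right
          ic ibc integral_mult_right_zero)
    then show "expectation (\<lambda>x. A f x * p g x) = exp (- (C f \<bullet> f) / 2) * (1 + C f \<bullet> g + (C f \<bullet> g)\<^sup>2 / 2)"
      by (simp add: expectation_cos expectation_cos_square expectation_sin_mult odds odds2 oddc) (simp add: field_simps)
  qed
  have ipp: "integrable N (\<lambda>x. p f x * p g x)"
    and Epp: "expectation (\<lambda>x. p f x * p g x) = 1 + ?c + ?c\<^sup>2 / 2"
  proof -
    note im' = integrable_inner_power_mult
    \<comment> \<open>Every monomial carries both powers, zero exponents included, so that one
      integrability fact covers all terms.\<close>
    have e: "p f x * p g x = (1 + ?a / 2) * (1 + ?b / 2) * ((x \<bullet> f) ^ 0 * (x \<bullet> g) ^ 0)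
       + (1 + ?b / 2) * ((x \<bullet> f) ^ 1 * (x \<bullet> g) ^ 0) + (1 + ?a / 2) * ((x \<bullet> f) ^ 0 * (x \<bullet> g) ^ 1)
       - ((1 + ?b / 2) / 2) * ((x \<bullet> f) ^ 2 * (x \<bullet> g) ^ 0) - ((1 + ?a / 2) / 2) * ((x \<bullet> f) ^ 0 * (x \<bullet> g) ^ 2)
       + 1 * ((x \<bullet> f) ^ 1 * (x \<bullet> g) ^ 1) - (1/2) * ((x \<bullet> f) ^ 2 * (x \<bullet> g) ^ 1) - (1/2) * ((x \<bullet> f) ^ 1 * (x \<bullet> g) ^ 2)
       + (1/4) * ((x \<bullet> f) ^ 2 * (x \<bullet> g) ^ 2)" for x
      unfolding p_def by (simp add: field_simps power2_eq_square)
    show "integrable N (\<lambda>x. p f x * p g x)"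
      unfolding e by (intro Bochner_Integration.integrable_add Bochner_Integration.integrable_diff integrable_mult_right im')
    let ?E = "\<lambda>k l. expectation (\<lambda>x. (x \<bullet> f) ^ k * (x \<bullet> g) ^ l)"
    have "expectation (\<lambda>x. p f x * p g x) = (1 + ?a / 2) * (1 + ?b / 2) * ?E 0 0
       + (1 + ?b / 2) * ?E 1 0 + (1 + ?a / 2) * ?E 0 1
       - ((1 + ?b / 2) / 2) * ?E 2 0 - ((1 + ?a / 2) / 2) * ?E 0 2
       + 1 * ?E 1 1 - (1/2) * ?E 2 1 - (1/2) * ?E 1 2 + (1/4) * ?E 2 2"
      unfolding e by (simp only: Bochner_Integration.integral_add Bochner_Integration.integral_diff
          Bochner_Integration.integrable_add Bochner_Integration.integrable_diff integrable_mult_right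
          im' integral_mult_right_zero)
    moreover have "?E 0 0 = 1" "?E 1 0 = 0" "?E 0 1 = 0" "?E 2 0 = ?a" "?E 0 2 = ?b" "?E 1 1 = ?c"
      "?E 2 1 = 0" "?E 1 2 = 0" "?E 2 2 = ?a * ?b + 2 * ?c\<^sup>2"
      using odd3[of g f] by (simp_all add: prob_space odd1 odd3 second_moment mixed_moment mixed_fourth_moment mult.commute)
    ultimately show "expectation (\<lambda>x. p f x * p g x) = 1 + ?c + ?c\<^sup>2 / 2"
      by (simp only:) (simp add: field_simps)
  qed
  have hh: "lin_score C f x * lin_score C g x = A f x * A g x - exp (- ?b / 2) * (A f x * p g x)
      - exp (- ?a / 2) * (A g x * p f x) + exp (- ?a / 2) * exp (- ?b / 2) * (p f x * p g x)" for x
    unfolding lin_score_def A_def[symmetric] p_def[symmetric] by (simp add: algebra_simps)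
  have "expectation (\<lambda>x. lin_score C f x * lin_score C g x) = expectation (\<lambda>x. A f x * A g x)
      - exp (- ?b / 2) * expectation (\<lambda>x. A f x * p g x) - exp (- ?a / 2) * expectation (\<lambda>x. A g x * p f x)
      + exp (- ?a / 2) * exp (- ?b / 2) * expectation (\<lambda>x. p f x * p g x)"
    unfolding hh by (simp only: Bochner_Integration.integral_add Bochner_Integration.integral_diff
          Bochner_Integration.integrable_add Bochner_Integration.integrable_diff integrable_mult_right
          iAA Ap(1) ipp integral_mult_right_zero)
  also have "\<dots> = exp (- (?a + ?b) / 2) * (exp ?c - (1 + ?c + ?c\<^sup>2 / 2))"
  proof -
    have ee: "exp (- (?a + ?b) / 2) = exp (- ?a / 2) * exp (- ?b / 2)"
      by (simp add: exp_add[symmetric] add_divide_distrib)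
    have "e1 * e2 * z - e2 * (e1 * q) - e1 * (e2 * q) + e1 * e2 * q = e1 * e2 * (z - q)" for e1 e2 z q :: real
      by (simp add: algebra_simps)
    then show ?thesis unfolding EAA Ap(2) Epp ee pos_op_bilinear(5)[OF pos, of g f] .
  qed
  also have "\<dots> = limit_kernel C f g" by (simp add: limit_kernel_def Let_def algebra_simps)
  finally show "expectation (\<lambda>x. lin_score C f x * lin_score C g x) = limit_kernel C f g" .
qed

lemma psd_limit_kernel: "psd_kernel_on UNIV (limit_kernel C)"
  unfolding psd_kernel_on_def
proof (intro conjI ballI allI impI)
  show "limit_kernel C f g = limit_kernel C g f" for f g
    unfolding expectation_lin_score_mult[symmetric] by (simp add: mult.commute)
  fix m :: nat and f :: "nat \<Rightarrow> L2I" and c :: "nat \<Rightarrow> real"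
  have "0 \<le> expectation (\<lambda>x. (\<Sum>i<m. c i * lin_score C (f i) x)\<^sup>2)" by simp
  also have "\<dots> = expectation (\<lambda>x. \<Sum>i<m. \<Sum>j<m. c i * c j * (lin_score C (f i) x * lin_score C (f j) x))"
    by (simp add: power2_eq_square sum_product mult_ac)
  also have "\<dots> = (\<Sum>i<m. \<Sum>j<m. c i * c j * limit_kernel C (f i) (f j))"
    using integrable_lin_score_mult
    by (simp add: Bochner_Integration.integral_sum Bochner_Integration.integrable_sum expectation_lin_score_mult)
  finally show "0 \<le> (\<Sum>i<m. \<Sum>j<m. c i * c j * limit_kernel C (f i) (f j))" .
qed

end

section \<open>Bounds for the limit kernel and existence of the Gaussian laws\<close>

lemma limit_kernel_diag_le_one:
  assumes "pos_op C" shows "limit_kernel C f f \<le> 1"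
proof -
  have a: "0 \<le> C f \<bullet> f" using pos_op_bilinear(6)[OF assms] .
  have "limit_kernel C f f = exp (- (C f \<bullet> f)) * (exp (C f \<bullet> f) - 1 - C f \<bullet> f - (C f \<bullet> f)\<^sup>2 / 2)"
    by (simp add: limit_kernel_def Let_def)
  also have "\<dots> \<le> exp (- (C f \<bullet> f)) * exp (C f \<bullet> f)"
  proof (rule mult_left_mono)
    have "0 \<le> (C f \<bullet> f)\<^sup>2 / 2" by simp
    then show "exp (C f \<bullet> f) - 1 - C f \<bullet> f - (C f \<bullet> f)\<^sup>2 / 2 \<le> exp (C f \<bullet> f)" using a by linarith
  qed simp
  also have "\<dots> = 1" by (simp add: exp_minus)
  finally show ?thesis .
qed

lemma limit_kernel_abs_le_one:
  assumes "pos_op C" "psd_kernel_on UNIV (limit_kernel C)" shows "\<bar>limit_kernel C f g\<bar> \<le> 1"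
proof -
  have "(limit_kernel C f g)\<^sup>2 \<le> limit_kernel C f f * limit_kernel C g g"
    by (rule psd_kernel_on_Cauchy_Schwarz[OF assms(2)]) auto
  also have "\<dots> \<le> 1"
    using limit_kernel_diag_le_one[OF assms(1)] psd_kernel_on_nonneg[OF assms(2)] by (intro mult_le_one) auto
  finally show ?thesis by (simp add: abs_square_le_1)
qed

text \<open>A sample covariance has finite rank: its centred Gaussian law is that of the combination
  of the centred observations with independent standard normal coefficients scaled by 1 / sqrt
  n.\<close>

theorem gaussian_law_exists:
  "\<exists>N. hilbert_gaussian N (scov n x)"
proof -
  interpret S: finite_product_prob_space "\<lambda>_. stdn" "{..<n}" by (rule finite_product_stdn)
  define G where "G g = (\<Sum>j<n. (g j / sqrt (real n)) *\<^sub>R (x j - smean n x))" for g :: "nat \<Rightarrow> real"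
  have [measurable]: "G \<in> borel_measurable (PiM {..<n} (\<lambda>_. stdn))"
    unfolding G_def by measurable
  define N where "N = distr (PiM {..<n} (\<lambda>_. stdn)) borel G"
  have "(\<integral>y. exp (\<i> * of_real (y \<bullet> f)) \<partial>N) = gauss_cf 0 (scov n x) f" for f
  proof -
    define a where "a j = ((x j - smean n x) \<bullet> f) / sqrt (real n)" for j
    have Gf: "G g \<bullet> f = (\<Sum>j<n. a j * g j)" for g
      unfolding G_def a_def by (simp add: inner_sum_left mult_ac)
    have "(\<integral>y. exp (\<i> * of_real (y \<bullet> f)) \<partial>N) = (\<integral>g. (\<Prod>j<n. iexp (a j * g j)) \<partial>PiM {..<n} (\<lambda>_. stdn))"
      unfolding N_def by (simp add: integral_distr Gf exp_sum sum_distrib_left mult_ac)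
    also have "\<dots> = (\<Prod>j<n. \<integral>y. iexp (a j * y) \<partial>stdn)"
    proof (rule S.product_integral_prod)
      show "integrable stdn (\<lambda>y. iexp (a j * y))" for j
        by (rule finite_measure.integrable_const_bound[OF prob_space.finite_measure[OF prob_space_stdn], where B=1]) auto
    qed simp
    also have "\<dots> = exp (of_real (- (\<Sum>j<n. (a j)\<^sup>2) / 2))"
      unfolding iexp_stdn by (simp add: exp_sum[symmetric] exp_of_real[symmetric] sum_divide_distrib sum_negf)
    also have "(\<Sum>j<n. (a j)\<^sup>2) = scov n x f \<bullet> f"
      unfolding scov_inner a_def by (simp add: power_divide sum_divide_distrib power2_eq_square)
    finally show ?thesis by (simp add: gauss_cf_def)
  qed
  moreover have "prob_space N" unfolding N_def by (rule S.prob_space_distr) simp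
  ultimately show ?thesis
    by (intro exI[of _ N]) (simp add: hilbert_gaussian_def hilbert_gaussian_axioms_def pos_op_scov, simp add: N_def)
qed

text \<open>Existence and uniqueness together show that the definite description in
  \<open>gauss_law\<close> denotes.\<close>

theorem hilbert_gaussian_gauss_law: "hilbert_gaussian (gauss_law 0 (scov n x)) (scov n x)"
proof -
  obtain N where N: "hilbert_gaussian N (scov n x)" using gaussian_law_exists by blast
  let ?P = "\<lambda>N. sets N = sets borel \<and> prob_space N \<and>
     (\<forall>f. (\<integral>x. exp (\<i> * of_real (x \<bullet> f)) \<partial>N) = gauss_cf 0 (scov n x) f)"
  have PN: "?P N" using N by (auto simp: hilbert_gaussian_def hilbert_gaussian_axioms_def)
  have "?P (gauss_law 0 (scov n x))"
    unfolding gauss_law_def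
  proof (rule theI[of ?P, OF PN])
    fix N' assume "?P N'"
    then show "N' = N" using PN by (intro char_functional_unique) auto
  qed
  then show ?thesis by (simp add: hilbert_gaussian_def hilbert_gaussian_axioms_def pos_op_scov)
qed

section \<open>Sums of squares and Parseval frames\<close>

lemma exp_minus_lipschitz: "0 \<le> x \<Longrightarrow> 0 \<le> y \<Longrightarrow> \<bar>exp (- x) - exp (- y)\<bar> \<le> \<bar>x - y\<bar>" for x y :: real
proof (induction x y rule: linorder_wlog)
  case (le x y)
  have "exp (- x) - exp (- y) = exp (- x) * (1 - exp (- (y - x)))" by (simp add: exp_diff exp_minus field_simps)
  also have "\<dots> \<le> 1 * (y - x)"
  proof (rule mult_mono)
    show "1 - exp (- (y - x)) \<le> y - x" using exp_ge_add_one_self[of "- (y - x)"] by linarith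
  qed (use le in auto)
  finally show ?case using le by simp
qed (simp add: abs_minus_commute)

text \<open>The Hubbard--Stratonovich identity \<open>exp (- |a|\<^sup>2 / 2) = E (exp (i \<xi> \<bullet> a))\<close>, \<open>\<xi>\<close> standard normal.\<close>

lemma gaussian_linearisation:
  fixes m :: nat
  assumes "prob_space M" and a[measurable]: "\<And>k. a k \<in> borel_measurable M" and s: "s \<ge> 0"
  shows "complex_of_real (\<integral>\<omega>. exp (- s * (\<Sum>k<m. (a k \<omega>)\<^sup>2) / 2) \<partial>M)
    = (\<integral>\<xi>. (\<integral>\<omega>. iexp (\<Sum>k<m. sqrt s * \<xi> k * a k \<omega>) \<partial>M) \<partial>PiM {..<m} (\<lambda>_. stdn))"
proof -
  interpret M: prob_space M by fact
  interpret S: finite_product_prob_space "\<lambda>_. stdn" "{..<m}" by (rule finite_product_stdn)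
  let ?X = "PiM {..<m} (\<lambda>_. stdn)"
  interpret P: pair_prob_space M ?X by unfold_locales
  have inner: "(\<integral>\<xi>. iexp (\<Sum>k<m. sqrt s * \<xi> k * a k \<omega>) \<partial>?X) = complex_of_real (exp (- s * (\<Sum>k<m. (a k \<omega>)\<^sup>2) / 2))" for \<omega>
  proof -
    have "(\<integral>\<xi>. iexp (\<Sum>k<m. sqrt s * \<xi> k * a k \<omega>) \<partial>?X) = (\<integral>\<xi>. (\<Prod>k<m. iexp ((sqrt s * a k \<omega>) * \<xi> k)) \<partial>?X)"
      by (simp add: exp_sum sum_distrib_left mult_ac)
    also have "\<dots> = (\<Prod>k<m. \<integral>y. iexp ((sqrt s * a k \<omega>) * y) \<partial>stdn)"
    proof (rule S.product_integral_prod)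
      show "integrable stdn (\<lambda>y. iexp ((sqrt s * a k \<omega>) * y))" for k
        by (rule finite_measure.integrable_const_bound[OF prob_space.finite_measure[OF prob_space_stdn], where B=1]) auto
    qed simp
    also have "\<dots> = complex_of_real (exp (\<Sum>k<m. - (sqrt s * a k \<omega>)\<^sup>2 / 2))"
      unfolding iexp_stdn exp_sum[OF finite_lessThan] of_real_prod ..
    also have "(\<Sum>k<m. - (sqrt s * a k \<omega>)\<^sup>2 / 2) = - s * (\<Sum>k<m. (a k \<omega>)\<^sup>2) / 2"
      using s by (simp add: power_mult_distrib sum_distrib_left sum_negf sum_divide_distrib)
    finally show ?thesis .
  qed
  have [measurable]: "(\<lambda>\<xi>. \<xi> k) \<in> borel_measurable ?X" if "k < m" for k
    using that measurable_component_singleton[of k "{..<m}" "\<lambda>_. stdn"] by (simp cong: measurable_cong_sets)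
  have "(\<integral>\<xi>. (\<integral>\<omega>. iexp (\<Sum>k<m. sqrt s * \<xi> k * a k \<omega>) \<partial>M) \<partial>?X) = (\<integral>\<omega>. (\<integral>\<xi>. iexp (\<Sum>k<m. sqrt s * \<xi> k * a k \<omega>) \<partial>?X) \<partial>M)"
    by (rule P.Fubini_integral, rule P.P.integrable_const_bound[where B=1]) auto
  also have "\<dots> = complex_of_real (\<integral>\<omega>. exp (- s * (\<Sum>k<m. (a k \<omega>)\<^sup>2) / 2) \<partial>M)"
    unfolding inner by simp
  finally show ?thesis by simp
qed

text \<open>For a fixed number of coordinates the linearisation turns the Laplace transform into an
  average of characteristic functions, which converges by domination. Cutting after m coordinates
  costs at most s times the expected tail, because exp (- x) is Lipschitz on the half line; here
  tails that are small for all large n at once are needed.\<close>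

theorem sum_squares_laplace_tendsto:
  fixes P :: "nat \<Rightarrow> 'a measure" and P' :: "'b measure"
    and a :: "nat \<Rightarrow> nat \<Rightarrow> 'a \<Rightarrow> real" and b :: "nat \<Rightarrow> 'b \<Rightarrow> real"
  assumes P: "\<And>n. prob_space (P n)" and P': "prob_space P'"
    and a[measurable]: "\<And>n k. a n k \<in> borel_measurable (P n)" and b[measurable]: "\<And>k. b k \<in> borel_measurable P'"
    and char: "\<And>m \<xi>. (\<lambda>n. \<integral>\<omega>. iexp (\<Sum>k<m. \<xi> k * a n k \<omega>) \<partial>P n) \<longlonglongrightarrow> (\<integral>\<omega>. iexp (\<Sum>k<m. \<xi> k * b k \<omega>) \<partial>P')"
    and A: "\<And>n. integrable (P n) (A n)" "\<And>n. AE \<omega> in P n. (\<lambda>k. (a n k \<omega>)\<^sup>2) sums A n \<omega>"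
    and B[measurable]: "B \<in> borel_measurable P'" and Bs: "AE \<omega> in P'. (\<lambda>k. (b k \<omega>)\<^sup>2) sums B \<omega>"
    and tails: "\<And>e. e > 0 \<Longrightarrow> \<exists>m. \<forall>\<^sub>F n in sequentially. (\<integral>\<omega>. A n \<omega> - (\<Sum>k<m. (a n k \<omega>)\<^sup>2) \<partial>P n) \<le> e"
    and s: "s \<ge> 0"
  shows "(\<lambda>n. \<integral>\<omega>. exp (- s * A n \<omega>) \<partial>P n) \<longlonglongrightarrow> (\<integral>\<omega>. exp (- s * B \<omega>) \<partial>P')"
proof -
  interpret P': prob_space P' by fact
  interpret P: prob_space "P n" for n by (rule P)
  have fin: "(\<lambda>n. \<integral>\<omega>. exp (- s * (\<Sum>k<m. (a n k \<omega>)\<^sup>2)) \<partial>P n) \<longlonglongrightarrow> (\<integral>\<omega>. exp (- s * (\<Sum>k<m. (b k \<omega>)\<^sup>2)) \<partial>P')" for m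
  proof -
    let ?X = "PiM {..<m} (\<lambda>_. stdn)"
    interpret S: finite_product_prob_space "\<lambda>_. stdn" "{..<m}" by (rule finite_product_stdn)
    \<comment> \<open>The doubled parameter compensates the factor 1/2 in the exponent of the
      Gaussian transform.\<close>
    have s2: "2 * s \<ge> 0" using s by simp
    have [measurable]: "(\<lambda>\<xi>. \<xi> k) \<in> borel_measurable ?X" if "k < m" for k
      using that measurable_component_singleton[of k "{..<m}" "\<lambda>_. stdn"] by (simp cong: measurable_cong_sets)
    have "(\<lambda>n. \<integral>\<xi>. (\<integral>\<omega>. iexp (\<Sum>k<m. sqrt (2 * s) * \<xi> k * a n k \<omega>) \<partial>P n) \<partial>?X)
        \<longlonglongrightarrow> (\<integral>\<xi>. (\<integral>\<omega>. iexp (\<Sum>k<m. sqrt (2 * s) * \<xi> k * b k \<omega>) \<partial>P') \<partial>?X)"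
    proof (rule integral_dominated_convergence[where w="\<lambda>_. 1"])
      show "AE \<xi> in ?X. norm (\<integral>\<omega>. iexp (\<Sum>k<m. sqrt (2 * s) * \<xi> k * a n k \<omega>) \<partial>P n) \<le> 1" for n
      proof (rule AE_I2)
        fix \<xi>
        have "norm (\<integral>\<omega>. iexp (\<Sum>k<m. sqrt (2 * s) * \<xi> k * a n k \<omega>) \<partial>P n)
           \<le> (\<integral>\<omega>. norm (iexp (\<Sum>k<m. sqrt (2 * s) * \<xi> k * a n k \<omega>)) \<partial>P n)"
          by (rule integral_norm_bound)
        also have "\<dots> = 1" unfolding norm_exp_i_times by (simp add: P.prob_space)
        finally show "norm (\<integral>\<omega>. iexp (\<Sum>k<m. sqrt (2 * s) * \<xi> k * a n k \<omega>) \<partial>P n) \<le> 1" .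
      qed
      show "AE \<xi> in ?X. (\<lambda>n. \<integral>\<omega>. iexp (\<Sum>k<m. sqrt (2 * s) * \<xi> k * a n k \<omega>) \<partial>P n)
          \<longlonglongrightarrow> (\<integral>\<omega>. iexp (\<Sum>k<m. sqrt (2 * s) * \<xi> k * b k \<omega>) \<partial>P')"
        by (rule AE_I2, rule char)
      show "(\<lambda>\<xi>. \<integral>\<omega>. iexp (\<Sum>k<m. sqrt (2 * s) * \<xi> k * a n k \<omega>) \<partial>P n) \<in> borel_measurable ?X" for n
        by (rule P.borel_measurable_lebesgue_integral) measurable
      show "(\<lambda>\<xi>. \<integral>\<omega>. iexp (\<Sum>k<m. sqrt (2 * s) * \<xi> k * b k \<omega>) \<partial>P') \<in> borel_measurable ?X"
        by (rule P'.borel_measurable_lebesgue_integral) measurable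
    qed simp
    then have "(\<lambda>n. complex_of_real (\<integral>\<omega>. exp (- (2 * s) * (\<Sum>k<m. (a n k \<omega>)\<^sup>2) / 2) \<partial>P n))
        \<longlonglongrightarrow> complex_of_real (\<integral>\<omega>. exp (- (2 * s) * (\<Sum>k<m. (b k \<omega>)\<^sup>2) / 2) \<partial>P')"
      unfolding gaussian_linearisation[OF P a s2] gaussian_linearisation[OF P' b s2] .
    then show ?thesis unfolding tendsto_of_real_iff by simp
  qed
  have Blim: "(\<lambda>m. \<integral>\<omega>. exp (- s * (\<Sum>k<m. (b k \<omega>)\<^sup>2)) \<partial>P') \<longlonglongrightarrow> (\<integral>\<omega>. exp (- s * B \<omega>) \<partial>P')"
  proof (rule integral_dominated_convergence[where w="\<lambda>_. 1"])
    show "AE \<omega> in P'. (\<lambda>m. exp (- s * (\<Sum>k<m. (b k \<omega>)\<^sup>2))) \<longlonglongrightarrow> exp (- s * B \<omega>)"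
      using Bs by eventually_elim (auto simp: sums_def intro!: tendsto_intros)
    show "AE \<omega> in P'. norm (exp (- s * (\<Sum>k<m. (b k \<omega>)\<^sup>2))) \<le> 1" for m
      using s by (intro AE_I2) (simp add: sum_nonneg)
  qed auto
  have part_le: "AE \<omega> in P n. (\<Sum>k<m. (a n k \<omega>)\<^sup>2) \<le> A n \<omega>" for n m
    using A(2)[of n]
  proof eventually_elim
    case (elim \<omega>)
    then show ?case using sum_le_suminf[of "\<lambda>k. (a n k \<omega>)\<^sup>2" "{..<m}"] by (simp add: sums_iff)
  qed
  have ia: "integrable (P n) (\<lambda>\<omega>. \<Sum>k<m. (a n k \<omega>)\<^sup>2)" for n m
  proof (rule Bochner_Integration.integrable_bound[OF A(1)])
    show "AE \<omega> in P n. norm (\<Sum>k<m. (a n k \<omega>)\<^sup>2) \<le> norm (A n \<omega>)"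
      using part_le[of n m] by eventually_elim (simp add: sum_nonneg)
  qed simp
  have ie: "integrable (P n) (\<lambda>\<omega>. exp (- s * (\<Sum>k<m. (a n k \<omega>)\<^sup>2)))" "integrable (P n) (\<lambda>\<omega>. exp (- s * A n \<omega>))" for n m
  proof -
    have [measurable]: "A n \<in> borel_measurable (P n)" using A(1) by simp
    show "integrable (P n) (\<lambda>\<omega>. exp (- s * (\<Sum>k<m. (a n k \<omega>)\<^sup>2)))"
      using s by (intro P.integrable_const_bound[where B=1]) (auto simp: sum_nonneg)
    show "integrable (P n) (\<lambda>\<omega>. exp (- s * A n \<omega>))"
    proof (rule P.integrable_const_bound[where B=1])
      show "AE \<omega> in P n. norm (exp (- s * A n \<omega>)) \<le> 1"
        using part_le[of n 0] by eventually_elim (use s in simp)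
    qed simp
  qed
  have near: "\<bar>(\<integral>\<omega>. exp (- s * A n \<omega>) \<partial>P n) - (\<integral>\<omega>. exp (- s * (\<Sum>k<m. (a n k \<omega>)\<^sup>2)) \<partial>P n)\<bar>
      \<le> s * (\<integral>\<omega>. A n \<omega> - (\<Sum>k<m. (a n k \<omega>)\<^sup>2) \<partial>P n)" for n m
  proof -
    have "\<bar>(\<integral>\<omega>. exp (- s * A n \<omega>) \<partial>P n) - (\<integral>\<omega>. exp (- s * (\<Sum>k<m. (a n k \<omega>)\<^sup>2)) \<partial>P n)\<bar>
      = \<bar>\<integral>\<omega>. exp (- s * A n \<omega>) - exp (- s * (\<Sum>k<m. (a n k \<omega>)\<^sup>2)) \<partial>P n\<bar>"
      using ie by (simp add: Bochner_Integration.integral_diff)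
    also have "\<dots> \<le> (\<integral>\<omega>. \<bar>exp (- s * A n \<omega>) - exp (- s * (\<Sum>k<m. (a n k \<omega>)\<^sup>2))\<bar> \<partial>P n)"
      by (rule integral_abs_bound)
    also have "\<dots> \<le> (\<integral>\<omega>. s * (A n \<omega> - (\<Sum>k<m. (a n k \<omega>)\<^sup>2)) \<partial>P n)"
    proof (rule integral_mono_AE)
      show "integrable (P n) (\<lambda>\<omega>. \<bar>exp (- s * A n \<omega>) - exp (- s * (\<Sum>k<m. (a n k \<omega>)\<^sup>2))\<bar>)"
        by (intro integrable_abs Bochner_Integration.integrable_diff ie)
      show "integrable (P n) (\<lambda>\<omega>. s * (A n \<omega> - (\<Sum>k<m. (a n k \<omega>)\<^sup>2)))"
        by (intro integrable_mult_right Bochner_Integration.integrable_diff A ia)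
      show "AE \<omega> in P n. \<bar>exp (- s * A n \<omega>) - exp (- s * (\<Sum>k<m. (a n k \<omega>)\<^sup>2))\<bar> \<le> s * (A n \<omega> - (\<Sum>k<m. (a n k \<omega>)\<^sup>2))"
        using part_le[of n m] part_le[of n 0]
      proof eventually_elim
        case (elim \<omega>)
        have S0: "0 \<le> (\<Sum>k<m. (a n k \<omega>)\<^sup>2)" by (rule sum_nonneg) simp
        have "\<bar>exp (- (s * A n \<omega>)) - exp (- (s * (\<Sum>k<m. (a n k \<omega>)\<^sup>2)))\<bar> \<le> \<bar>s * A n \<omega> - s * (\<Sum>k<m. (a n k \<omega>)\<^sup>2)\<bar>"
          using elim s S0 by (intro exp_minus_lipschitz) auto
        also have "\<dots> = s * (A n \<omega> - (\<Sum>k<m. (a n k \<omega>)\<^sup>2))"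
          using elim s by (simp add: right_diff_distrib[symmetric] abs_mult)
        finally show ?case by simp
      qed
    qed
    also have "\<dots> = s * (\<integral>\<omega>. A n \<omega> - (\<Sum>k<m. (a n k \<omega>)\<^sup>2) \<partial>P n)" by simp
    finally show ?thesis .
  qed
  show ?thesis
  proof (rule LIMSEQ_I)
    fix r :: real assume r: "r > 0"
    define e where "e = r / (4 * (s + 1))"
    have e: "e > 0" "s * e \<le> r / 4" using r s by (auto simp: e_def field_simps)
    obtain m0 where m0: "\<forall>\<^sub>F n in sequentially. (\<integral>\<omega>. A n \<omega> - (\<Sum>k<m0. (a n k \<omega>)\<^sup>2) \<partial>P n) \<le> e"
      using tails[OF e(1)] by blast
    obtain m1 where m1: "\<And>m. m \<ge> m1 \<Longrightarrow> norm ((\<integral>\<omega>. exp (- s * (\<Sum>k<m. (b k \<omega>)\<^sup>2)) \<partial>P') - (\<integral>\<omega>. exp (- s * B \<omega>) \<partial>P')) < r / 4"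
      using LIMSEQ_D[OF Blim, of "r / 4"] r by auto
    \<comment> \<open>The expected tail decreases in the number of coordinates, so enlarging
      \<open>m0\<close> to suit the limit side preserves the tail bound.\<close>
    define m where "m = max m0 m1"
    obtain n1 where n1: "\<And>n. n \<ge> n1 \<Longrightarrow> norm ((\<integral>\<omega>. exp (- s * (\<Sum>k<m. (a n k \<omega>)\<^sup>2)) \<partial>P n) - (\<integral>\<omega>. exp (- s * (\<Sum>k<m. (b k \<omega>)\<^sup>2)) \<partial>P')) < r / 4"
      using LIMSEQ_D[OF fin[of m], of "r / 4"] r by auto
    obtain n0 where n0: "\<And>n. n \<ge> n0 \<Longrightarrow> (\<integral>\<omega>. A n \<omega> - (\<Sum>k<m0. (a n k \<omega>)\<^sup>2) \<partial>P n) \<le> e"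
      using m0 unfolding eventually_sequentially by blast
    have "norm ((\<integral>\<omega>. exp (- s * A n \<omega>) \<partial>P n) - (\<integral>\<omega>. exp (- s * B \<omega>) \<partial>P')) < r" if n: "n \<ge> max n0 n1" for n
    proof -
      have "(\<integral>\<omega>. A n \<omega> - (\<Sum>k<m. (a n k \<omega>)\<^sup>2) \<partial>P n) \<le> (\<integral>\<omega>. A n \<omega> - (\<Sum>k<m0. (a n k \<omega>)\<^sup>2) \<partial>P n)"
        by (intro integral_mono Bochner_Integration.integrable_diff A ia diff_left_mono sum_mono2) (auto simp: m_def)
      also have "\<dots> \<le> e" using n0 n by simp
      finally have "s * (\<integral>\<omega>. A n \<omega> - (\<Sum>k<m. (a n k \<omega>)\<^sup>2) \<partial>P n) \<le> r / 4"
        using e(2) mult_left_mono[OF _ s] by (meson order_trans)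
      moreover have "m \<ge> m1" by (simp add: m_def)
      ultimately show ?thesis using near[of n m] n1[of n] m1[of m] n r unfolding real_norm_def by linarith
    qed
    then show "\<exists>no. \<forall>n\<ge>no. norm ((\<integral>\<omega>. exp (- s * A n \<omega>) \<partial>P n) - (\<integral>\<omega>. exp (- s * B \<omega>) \<partial>P')) < r" by blast
  qed
qed

section \<open>Inner products of square-integrable functions and Parseval frames\<close>

lemma l2inner_commute: "l2inner M f g = l2inner M g f"
  by (simp add: l2inner_def mult.commute)

lemma l2fun_sum: "finite I \<Longrightarrow> (\<And>i. i \<in> I \<Longrightarrow> f i \<in> l2fun M) \<Longrightarrow> (\<lambda>x. \<Sum>i\<in>I. f i x) \<in> l2fun M"
  by (induction I rule: finite_induct) (auto intro: l2fun_add l2fun_zero)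

lemma l2inner_sum_right:
  assumes "u \<in> l2fun M" "\<And>i. i \<in> I \<Longrightarrow> f i \<in> l2fun M"
  shows "l2inner M u (\<lambda>x. \<Sum>i\<in>I. c i * f i x) = (\<Sum>i\<in>I. c i * l2inner M u (f i))"
proof -
  have "l2inner M u (\<lambda>x. \<Sum>i\<in>I. c i * f i x) = (\<integral>x. (\<Sum>i\<in>I. c i * (u x * f i x)) \<partial>M)"
    unfolding l2inner_def by (simp add: sum_distrib_left mult_ac)
  also have "\<dots> = (\<Sum>i\<in>I. \<integral>x. c i * (u x * f i x) \<partial>M)"
    using assms by (intro Bochner_Integration.integral_sum integrable_mult_right l2fun_integrable_mult) auto
  finally show ?thesis by (simp add: l2inner_def)
qed

lemma l2inner_diff_left:
  assumes "f \<in> l2fun M" "g \<in> l2fun M" "u \<in> l2fun M"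
  shows "l2inner M (\<lambda>x. f x - g x) u = l2inner M f u - l2inner M g u"
  unfolding l2inner_def left_diff_distrib
  by (rule Bochner_Integration.integral_diff) (intro l2fun_integrable_mult assms)+

lemma l2inner_diff_diff:
  assumes "f \<in> l2fun M" "g \<in> l2fun M"
  shows "(\<integral>x. (f x - g x)\<^sup>2 \<partial>M) = l2inner M f f - 2 * l2inner M f g + l2inner M g g"
proof -
  have "(\<integral>x. (f x - g x)\<^sup>2 \<partial>M) = l2inner M (\<lambda>x. f x - g x) (\<lambda>x. f x - g x)"
    by (simp add: l2inner_def power2_eq_square)
  also have "\<dots> = l2inner M f f - 2 * l2inner M f g + l2inner M g g"
  proof -
    have "l2inner M w (\<lambda>x. f x - g x) = l2inner M f w - l2inner M g w" if "w \<in> l2fun M" for w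
      by (subst l2inner_commute) (rule l2inner_diff_left[OF assms that])
    then show ?thesis
      unfolding l2inner_diff_left[OF assms l2fun_diff[OF assms]]
      using assms l2inner_commute[of M g f] by simp
  qed
  finally show ?thesis .
qed

lemma psd_l2inner: "psd_kernel_on (l2fun M) (l2inner M)"
  unfolding psd_kernel_on_def
proof (intro conjI ballI allI impI)
  fix N :: nat and x :: "nat \<Rightarrow> 'a \<Rightarrow> real" and c :: "nat \<Rightarrow> real"
  assume x: "\<forall>i<N. x i \<in> l2fun M"
  have l: "(\<lambda>y. \<Sum>j<N. c j * x j y) \<in> l2fun M" using x by (intro l2fun_sum l2fun_scale) auto
  have "0 \<le> l2inner M (\<lambda>y. \<Sum>i<N. c i * x i y) (\<lambda>y. \<Sum>j<N. c j * x j y)"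
    by (simp add: l2inner_def)
  also have "\<dots> = (\<Sum>j<N. c j * l2inner M (\<lambda>y. \<Sum>i<N. c i * x i y) (x j))"
    using x l by (intro l2inner_sum_right) auto
  also have "\<dots> = (\<Sum>j<N. c j * (\<Sum>i<N. c i * l2inner M (x j) (x i)))"
    using x by (intro sum.cong refl, subst l2inner_commute, subst l2inner_sum_right) auto
  also have "\<dots> = (\<Sum>i<N. \<Sum>j<N. c i * c j * l2inner M (x i) (x j))"
    by (simp add: sum_distrib_left mult_ac)
  finally show "0 \<le> (\<Sum>i<N. \<Sum>j<N. c i * c j * l2inner M (x i) (x j))" .
qed (rule l2inner_commute)

lemma l2inner_Cauchy_Schwarz:
  "f \<in> l2fun M \<Longrightarrow> g \<in> l2fun M \<Longrightarrow> \<bar>l2inner M f g\<bar> \<le> l2norm M f * l2norm M g"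
  using real_sqrt_le_mono[OF psd_kernel_on_Cauchy_Schwarz[OF psd_l2inner, of f M g]]
  by (simp only: real_sqrt_abs real_sqrt_mult l2norm_def)

lemma borel_countable_generator:
  fixes Q :: "'a::second_countable_topology measure"
  assumes "sets Q = sets borel"
  obtains B where "countable B" "B \<subseteq> Pow (space Q)" "sets Q = sigma_sets (space Q) B"
proof -
  obtain B :: "'a set set" where B: "countable B" "topological_basis B"
    using ex_countable_basis by auto
  have sp: "space Q = UNIV" using sets_eq_imp_space_eq[OF assms] by simp
  have "sets (borel :: 'a measure) = sigma_sets UNIV B"
    unfolding borel_eq_countable_basis[OF B] by (rule sets_measure_of) simp
  then show ?thesis using that[of B] B(1) assms sp by auto
qed

lemma l2_countable_dense:
  fixes Q :: "'a::second_countable_topology measure"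
  assumes "finite_measure Q" and "sets Q = sets borel"
  obtains d :: "nat \<Rightarrow> 'a \<Rightarrow> real" where "\<And>i. d i \<in> l2fun Q"
    "\<And>f e. f \<in> l2fun Q \<Longrightarrow> e > 0 \<Longrightarrow> \<exists>i. (\<integral>x. (f x - d i x)\<^sup>2 \<partial>Q) < e"
proof -
  interpret finite_measure Q by fact
  obtain B where "countable B" "B \<subseteq> Pow (space Q)" "sets Q = sigma_sets (space Q) B"
    by (rule borel_countable_generator[OF assms(2)])
  from l2_separable[OF this] obtain D where D: "countable D" "D \<subseteq> l2fun Q"
    "\<And>f e. f \<in> l2fun Q \<Longrightarrow> e > 0 \<Longrightarrow> \<exists>d\<in>D. (\<integral>x. (f x - d x)\<^sup>2 \<partial>Q) < e" by blast
  have "D \<noteq> {}" using D(3)[OF l2fun_zero, of 1] by auto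
  then have r: "range (from_nat_into D) = D" using D(1) by (rule range_from_nat_into)
  show ?thesis
  proof (rule that[of "from_nat_into D"])
    show "from_nat_into D i \<in> l2fun Q" for i using r D(2) by auto
    show "\<exists>i. (\<integral>x. (f x - from_nat_into D i x)\<^sup>2 \<partial>Q) < e" if "f \<in> l2fun Q" "e > 0" for f e
    proof -
      obtain d where "d \<in> D" "(\<integral>x. (f x - d x)\<^sup>2 \<partial>Q) < e" using D(3)[OF \<open>f \<in> l2fun Q\<close> \<open>e > 0\<close>] by blast
      moreover obtain i where "d = from_nat_into D i" using \<open>d \<in> D\<close> r by (metis imageE)
      ultimately show ?thesis by blast
    qed
  qed
qed

text \<open>The kernel expansion is applied to the inner product itself, along a dense sequence. Its
  factors are inner products with finite combinations of that sequence, and these combinations form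
  the frame; some of them may be 0, which the Parseval identity tolerates.\<close>

theorem l2_parseval:
  fixes Q :: "'a::second_countable_topology measure"
  assumes "finite_measure Q" and "sets Q = sets borel"
  obtains e :: "nat \<Rightarrow> 'a \<Rightarrow> real" where "\<And>k. e k \<in> l2fun Q"
    "\<And>u v. u \<in> l2fun Q \<Longrightarrow> v \<in> l2fun Q \<Longrightarrow> (\<lambda>k. l2inner Q u (e k) * l2inner Q v (e k)) sums l2inner Q u v"
proof -
  obtain d :: "nat \<Rightarrow> 'a \<Rightarrow> real" where d: "\<And>i. d i \<in> l2fun Q"
    "\<And>f e. f \<in> l2fun Q \<Longrightarrow> e > 0 \<Longrightarrow> \<exists>i. (\<integral>x. (f x - d i x)\<^sup>2 \<partial>Q) < e"
    using l2_countable_dense[OF assms] by blast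
  obtain c :: "nat \<Rightarrow> nat \<Rightarrow> real" where c: "\<And>u v. u \<in> l2fun Q \<Longrightarrow> v \<in> l2fun Q \<Longrightarrow>
      (\<lambda>i. (\<Sum>j\<le>i. c i j * l2inner Q u (d j)) * (\<Sum>j\<le>i. c i j * l2inner Q v (d j))) sums l2inner Q u v"
  proof (rule kernel_expansion[OF psd_l2inner d(1)])
    show "\<exists>i. l2inner Q x x - 2 * l2inner Q x (d i) + l2inner Q (d i) (d i) < e" if "x \<in> l2fun Q" "e > 0" for x e
      using d(2)[OF that] l2inner_diff_diff[OF that(1) d(1)] by simp
  qed blast
  show ?thesis
  proof (rule that[of "\<lambda>i x. \<Sum>j\<le>i. c i j * d j x"])
    show "(\<lambda>x. \<Sum>j\<le>i. c i j * d j x) \<in> l2fun Q" for i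
      using d by (intro l2fun_sum l2fun_scale) auto
    show "(\<lambda>k. l2inner Q u (\<lambda>x. \<Sum>j\<le>k. c k j * d j x) * l2inner Q v (\<lambda>x. \<Sum>j\<le>k. c k j * d j x)) sums l2inner Q u v"
      if "u \<in> l2fun Q" "v \<in> l2fun Q" for u v
      using c[OF that] that d by (simp add: l2inner_sum_right)
  qed
qed

section \<open>Gaussian random elements of the weighted function space\<close>

lemma indep_vars_PiM_coordinates:
  assumes M: "\<And>i. i \<in> I \<Longrightarrow> prob_space (M i)" and I: "I \<noteq> {}"
    and X: "\<And>i. i \<in> I \<Longrightarrow> X i \<in> M i \<rightarrow>\<^sub>M N i"
  shows "prob_space.indep_vars (PiM I M) N (\<lambda>i \<omega>. X i (\<omega> i)) I"
proof -
  interpret P: prob_space "PiM I M" by (rule prob_space_PiM[OF M])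
  have "distr (PiM I M) (PiM I M) (\<lambda>x. \<lambda>i\<in>I. x i) = distr (PiM I M) (PiM I M) (\<lambda>x. x)"
    by (rule distr_cong) (auto simp: space_PiM)
  also have "\<dots> = PiM I M" by simp
  also have "\<dots> = PiM I (\<lambda>i. distr (PiM I M) (M i) (\<lambda>\<omega>. \<omega> i))"
    by (rule PiM_cong[OF refl]) (rule distr_PiM_component[OF M, symmetric])
  finally have "P.indep_vars M (\<lambda>i \<omega>. \<omega> i) I"
    by (subst P.indep_vars_iff_distr_eq_PiM'[OF I]) auto
  from P.indep_vars_compose2[OF this X] show ?thesis by simp
qed

section \<open>Measurability with respect to the norm topology\<close>

lemma l2norm_square: "(l2norm M f)\<^sup>2 = (\<integral>x. (f x)\<^sup>2 \<partial>M)"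
  by (simp add: l2norm_def l2inner_def power2_eq_square)

lemma l2norm_nonneg: "0 \<le> l2norm M f"
  by (simp add: l2norm_def l2inner_def)

lemma space_l2_borel: "space (l2_borel Q) = l2fun Q"
  unfolding l2_borel_def by (rule space_measure_of) auto

lemma sets_l2_borelI:
  assumes "U \<subseteq> l2fun Q" "\<And>u. u \<in> U \<Longrightarrow> \<exists>e>0. \<forall>v\<in>l2fun Q. l2norm Q (\<lambda>x. v x - u x) < e \<longrightarrow> v \<in> U"
  shows "U \<in> sets (l2_borel Q)"
  unfolding l2_borel_def using assms by (subst sets_measure_of) auto

lemma measurable_l2inner:
  assumes u: "u \<in> l2fun Q"
  shows "(\<lambda>v. l2inner Q v u) \<in> borel_measurable (l2_borel Q)"
proof (rule borel_measurableI_greater)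
  fix y :: real
  show "{v \<in> space (l2_borel Q). y < l2inner Q v u} \<in> sets (l2_borel Q)"
  proof (rule sets_l2_borelI)
    fix v assume "v \<in> {v \<in> space (l2_borel Q). y < l2inner Q v u}"
    then have v: "v \<in> l2fun Q" "y < l2inner Q v u" by (auto simp: space_l2_borel)
    define e where "e = (l2inner Q v u - y) / (l2norm Q u + 1)"
    have e: "e > 0" unfolding e_def using v l2norm_nonneg[of Q u] by (intro divide_pos_pos) auto
    have "y < l2inner Q w u" if w: "w \<in> l2fun Q" "l2norm Q (\<lambda>x. w x - v x) < e" for w
    proof -
      have "\<bar>l2inner Q w u - l2inner Q v u\<bar> \<le> l2norm Q (\<lambda>x. w x - v x) * l2norm Q u"
        using l2inner_Cauchy_Schwarz[OF l2fun_diff[OF w(1) v(1)] u] l2inner_diff_left[OF w(1) v(1) u] by simp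
      also have "\<dots> \<le> e * l2norm Q u"
        using w(2) l2norm_nonneg[of Q u] by (intro mult_right_mono) auto
      also have "\<dots> < e * (l2norm Q u + 1)" using e by simp
      also have "\<dots> = l2inner Q v u - y" unfolding e_def using l2norm_nonneg[of Q u] by simp
      finally show ?thesis by linarith
    qed
    then show "\<exists>e>0. \<forall>w\<in>l2fun Q. l2norm Q (\<lambda>x. w x - v x) < e \<longrightarrow> w \<in> {v \<in> space (l2_borel Q). y < l2inner Q v u}"
      using e by (intro exI[of _ e]) (auto simp: space_l2_borel)
  qed (auto simp: space_l2_borel)
qed

text \<open>By separability every open set is a countable union of balls with centres in a dense
  sequence and rational squared radii, so measurability of the squared distances to fixed functions
  suffices.\<close>

lemma measurable_l2_borelI:
  fixes Q :: "'a::second_countable_topology measure"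
  assumes Q: "finite_measure Q" "sets Q = sets borel"
    and V: "\<And>w. w \<in> space W \<Longrightarrow> V w \<in> l2fun Q"
    and dist: "\<And>d. d \<in> l2fun Q \<Longrightarrow> (\<lambda>w. \<integral>x. (V w x - d x)\<^sup>2 \<partial>Q) \<in> borel_measurable W"
  shows "V \<in> W \<rightarrow>\<^sub>M l2_borel Q"
  unfolding l2_borel_def
proof (rule measurable_measure_of)
  obtain d :: "nat \<Rightarrow> 'a \<Rightarrow> real" where d: "\<And>i. d i \<in> l2fun Q"
    "\<And>f e. f \<in> l2fun Q \<Longrightarrow> e > 0 \<Longrightarrow> \<exists>i. (\<integral>x. (f x - d i x)\<^sup>2 \<partial>Q) < e"
    using l2_countable_dense[OF Q] by blast
  fix U assume "U \<in> {U. U \<subseteq> l2fun Q \<and> (\<forall>u\<in>U. \<exists>e>0. \<forall>v\<in>l2fun Q. l2norm Q (\<lambda>x. v x - u x) < e \<longrightarrow> v \<in> U)}"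
  then have U: "U \<subseteq> l2fun Q" "\<And>u. u \<in> U \<Longrightarrow> \<exists>e>0. \<forall>v\<in>l2fun Q. l2norm Q (\<lambda>x. v x - u x) < e \<longrightarrow> v \<in> U" by auto
  define I :: "(nat \<times> rat) set" where "I = {(i, q). \<forall>v\<in>l2fun Q. (\<integral>x. (v x - d i x)\<^sup>2 \<partial>Q) < of_rat q \<longrightarrow> v \<in> U}"
  have "V -` U \<inter> space W = (\<Union>(i, q)\<in>I. {w \<in> space W. (\<integral>x. (V w x - d i x)\<^sup>2 \<partial>Q) < of_rat q})"
  proof safe
    fix w assume w: "w \<in> space W" "V w \<in> U"
    have Vw: "V w \<in> l2fun Q" using V w by simp
    obtain e where e: "e > 0" "\<And>v. v \<in> l2fun Q \<Longrightarrow> l2norm Q (\<lambda>x. v x - V w x) < e \<Longrightarrow> v \<in> U" using U(2)[OF w(2)] by blast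
    \<comment> \<open>When both squared distances to \<open>d i\<close> are below e^2 / 4, the
      inequality (p - q)^2 \<le> 2 p^2 + 2 q^2 keeps the squared distance to \<open>V w\<close>
      below e^2.\<close>
    obtain i where i: "(\<integral>x. (V w x - d i x)\<^sup>2 \<partial>Q) < e\<^sup>2 / 4" using d(2)[OF Vw, of "e\<^sup>2 / 4"] e by auto
    obtain q :: rat where q: "(\<integral>x. (V w x - d i x)\<^sup>2 \<partial>Q) < of_rat q" "of_rat q < e\<^sup>2 / 4" using of_rat_dense[OF i] by blast
    have "v \<in> U" if v: "v \<in> l2fun Q" "(\<integral>x. (v x - d i x)\<^sup>2 \<partial>Q) < of_rat q" for v
    proof (rule e(2)[OF v(1)])
      have "(\<integral>x. (v x - V w x)\<^sup>2 \<partial>Q) \<le> (\<integral>x. 2 * (v x - d i x)\<^sup>2 + 2 * (V w x - d i x)\<^sup>2 \<partial>Q)"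
      proof (rule integral_mono)
        show "(v x - V w x)\<^sup>2 \<le> 2 * (v x - d i x)\<^sup>2 + 2 * (V w x - d i x)\<^sup>2" for x
          using square_diff_le[of "v x - d i x" "V w x - d i x"] by simp
      qed (intro Bochner_Integration.integrable_add integrable_mult_right l2fun_integrable_square l2fun_diff v Vw d)+
      also have "\<dots> = 2 * (\<integral>x. (v x - d i x)\<^sup>2 \<partial>Q) + 2 * (\<integral>x. (V w x - d i x)\<^sup>2 \<partial>Q)"
        using l2fun_integrable_square[OF l2fun_diff[OF v(1) d(1)]] l2fun_integrable_square[OF l2fun_diff[OF Vw d(1)]] by simp
      also have "\<dots> < e\<^sup>2" using v(2) q by simp
      finally have "(l2norm Q (\<lambda>x. v x - V w x))\<^sup>2 < e\<^sup>2" unfolding l2norm_square .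
      then show "l2norm Q (\<lambda>x. v x - V w x) < e" using e by (simp add: power_less_imp_less_base)
    qed
    then have "(i, q) \<in> I" by (auto simp: I_def)
    then show "w \<in> (\<Union>(i, q)\<in>I. {w \<in> space W. (\<integral>x. (V w x - d i x)\<^sup>2 \<partial>Q) < of_rat q})" using q w by auto
  qed (auto simp: I_def V)
  also have "\<dots> \<in> sets W"
  proof (rule sets.countable_UN')
    show "countable I" by (rule countableI_type)
    show "(\<lambda>(i, q). {w \<in> space W. (\<integral>x. (V w x - d i x)\<^sup>2 \<partial>Q) < of_rat q}) ` I \<subseteq> sets W"
      using dist[OF d(1)] by auto
  qed
  finally show "V -` U \<inter> space W \<in> sets W" .
qed (use V in auto)

section \<open>Scalar functionals of Gaussian elements\<close>

lemma centred_normal_eq: "s \<ge> 0 \<Longrightarrow> centred_normal s = distr stdn borel (\<lambda>y. s * y)"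
proof (cases "s = 0")
  case True
  interpret prob_space stdn by (rule prob_space_stdn)
  show ?thesis using True by (simp add: centred_normal_def)
next
  case False
  assume s: "s \<ge> 0"
  interpret prob_space stdn by (rule prob_space_stdn)
  have "distributed stdn lborel (\<lambda>y. y) std_normal_density"
    by (auto simp: distributed_def intro!: distr_id2)
  from normal_density_affine[OF this, of s 0] False s
  have "distributed stdn lborel (\<lambda>y. s * y) (normal_density 0 s)" by simp
  then have "distr stdn lborel (\<lambda>y. s * y) = density lborel (normal_density 0 s)"
    by (simp add: distributed_def)
  moreover have "distr stdn lborel (\<lambda>y. s * y) = distr stdn borel (\<lambda>y. s * y)"
    by (rule distr_cong) auto
  ultimately show ?thesis using False by (simp add: centred_normal_def)
qed

text \<open>The standard deviation s of a functional is identified through its second moment: s^2 is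
  the value of the kernel form. So the characteristic function of every functional depends on the
  kernel alone, and with it everything that the limit theorem extracts from V.\<close>

lemma centred_gaussianD:
  assumes cg: "centred_gaussian W Q V" and hk: "has_cov_kernel W Q V K" and u: "u \<in> l2fun Q"
  shows "prob_space W" "V \<in> W \<rightarrow>\<^sub>M l2_borel Q" "(\<lambda>w. l2inner Q (V w) u) \<in> borel_measurable W"
    "(\<integral>w. iexp (l2inner Q (V w) u) \<partial>W) = complex_of_real (exp (- (\<integral>f. (\<integral>g. K f g * u f * u g \<partial>Q) \<partial>Q) / 2))"
proof -
  show W: "prob_space W" and V: "V \<in> W \<rightarrow>\<^sub>M l2_borel Q" using cg by (auto simp: centred_gaussian_def)
  show [measurable]: "(\<lambda>w. l2inner Q (V w) u) \<in> borel_measurable W"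
    using measurable_compose[OF V measurable_l2inner[OF u]] .
  obtain s where s: "s \<ge> 0" "distr W borel (\<lambda>w. l2inner Q (V w) u) = centred_normal s"
    using cg u unfolding centred_gaussian_def by blast
  have "(\<integral>f. (\<integral>g. K f g * u f * u g \<partial>Q) \<partial>Q) = (\<integral>w. l2inner Q (V w) u * l2inner Q (V w) u \<partial>W)"
    using hk u unfolding has_cov_kernel_def by simp
  also have "\<dots> = (\<integral>y. y * y \<partial>distr W borel (\<lambda>w. l2inner Q (V w) u))"
    by (subst integral_distr) auto
  also have "\<dots> = (\<integral>y. s\<^sup>2 * y\<^sup>2 \<partial>stdn)"
    unfolding s(2) centred_normal_eq[OF s(1)] by (subst integral_distr) (auto simp: power2_eq_square mult_ac)
  also have "\<dots> = s\<^sup>2" using stdn_moments(1) by simp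
  finally have B: "(\<integral>f. (\<integral>g. K f g * u f * u g \<partial>Q) \<partial>Q) = s\<^sup>2" .
  have "(\<integral>w. iexp (l2inner Q (V w) u) \<partial>W) = (\<integral>y. iexp y \<partial>distr W borel (\<lambda>w. l2inner Q (V w) u))"
    by (subst integral_distr) auto
  also have "\<dots> = (\<integral>y. iexp (s * y) \<partial>stdn)"
    unfolding s(2) centred_normal_eq[OF s(1)] by (subst integral_distr) auto
  also have "\<dots> = complex_of_real (exp (- s\<^sup>2 / 2))" by (rule iexp_stdn)
  finally show "(\<integral>w. iexp (l2inner Q (V w) u) \<partial>W) = complex_of_real (exp (- (\<integral>f. (\<integral>g. K f g * u f * u g \<partial>Q) \<partial>Q) / 2))"
    unfolding B .
qed

lemma ennreal_suminf_swap: "(\<Sum>i. \<Sum>j. f i j) = (\<Sum>j. \<Sum>i. f i j)" for f :: "nat \<Rightarrow> nat \<Rightarrow> ennreal"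
proof -
  have "(\<Sum>i. \<Sum>j. f i j) = (\<integral>\<^sup>+i. (\<Sum>j. f i j) \<partial>count_space UNIV)"
    by (simp add: nn_integral_count_space_nat)
  also have "\<dots> = (\<Sum>j. \<integral>\<^sup>+i. f i j \<partial>count_space UNIV)"
    by (rule nn_integral_suminf) simp
  finally show ?thesis by (simp add: nn_integral_count_space_nat)
qed

text \<open>A kernel with a pointwise expansion \<open>K f g = \<Sum>\<^sub>i \<phi>\<^sub>i f * \<phi>\<^sub>i g\<close> is the covariance of the
  random series \<open>\<Sum>\<^sub>i \<xi>\<^sub>i \<phi>\<^sub>i\<close> with independent standard normal coefficients.\<close>

locale kernel_series = prob_space Q for Q :: "'a::second_countable_topology measure" +
  fixes K :: "'a \<Rightarrow> 'a \<Rightarrow> real" and \<phi> :: "nat \<Rightarrow> 'a \<Rightarrow> real"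
  assumes sets_Q [measurable_cong]: "sets Q = sets borel"
    and \<phi>_meas [measurable]: "\<And>i. \<phi> i \<in> borel_measurable borel"
    and K_sums: "\<And>f g. (\<lambda>i. \<phi> i f * \<phi> i g) sums K f g"
    and K_le: "\<And>f. K f f \<le> 1"
begin

lemma partial_le: "(\<Sum>i<n. (\<phi> i f)\<^sup>2) \<le> K f f"
  using K_sums[of f f] sum_le_suminf[of "\<lambda>i. (\<phi> i f)\<^sup>2" "{..<n}"]
  by (simp add: sums_iff power2_eq_square)

lemma partial_abs_le: "\<bar>\<Sum>i<n. \<phi> i f * \<phi> i g\<bar> \<le> 1"
proof -
  have "\<bar>\<Sum>i<n. \<phi> i f * \<phi> i g\<bar> \<le> (\<Sum>i<n. ((\<phi> i f)\<^sup>2 + (\<phi> i g)\<^sup>2) / 2)"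
  proof (intro order_trans[OF sum_abs] sum_mono)
    show "\<bar>\<phi> i f * \<phi> i g\<bar> \<le> ((\<phi> i f)\<^sup>2 + (\<phi> i g)\<^sup>2) / 2" for i
      using sum_squares_bound[of "\<bar>\<phi> i f\<bar>" "\<bar>\<phi> i g\<bar>"] by (simp add: abs_mult)
  qed
  also have "\<dots> = ((\<Sum>i<n. (\<phi> i f)\<^sup>2) + (\<Sum>i<n. (\<phi> i g)\<^sup>2)) / 2"
    by (simp add: sum.distrib sum_divide_distrib[symmetric])
  also have "\<dots> \<le> 1"
    using order_trans[OF partial_le[where f=f and n=n] K_le[where f=f]]
      order_trans[OF partial_le[where f=g and n=n] K_le[where f=g]] by simp
  finally show ?thesis .
qed

lemma \<phi>_l2: "\<phi> i \<in> l2fun Q"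
proof (rule l2funI)
  have "(\<phi> i f)\<^sup>2 \<le> 1" for f
  proof -
    have "(\<phi> i f)\<^sup>2 \<le> (\<Sum>j<Suc i. (\<phi> j f)\<^sup>2)" by (simp add: sum_nonneg)
    also have "\<dots> \<le> 1" using partial_le[of f "Suc i"] K_le[of f] by linarith
    finally show ?thesis .
  qed
  then show "integrable Q (\<lambda>x. (\<phi> i x)\<^sup>2)" by (intro integrable_const_bound[where B=1]) auto
qed measurable

definition kform :: "('a \<Rightarrow> real) \<Rightarrow> ('a \<Rightarrow> real) \<Rightarrow> real" where
  "kform u v = (\<integral>f. (\<integral>g. K f g * u f * v g \<partial>Q) \<partial>Q)"

text \<open>Dominated convergence twice, in g and then in f: the partial kernels are bounded by 1 in
  modulus, and \<open>u\<close> and \<open>v\<close> are integrable because \<open>Q\<close> is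
  finite.\<close>

lemma kform_sums:
  assumes u: "u \<in> l2fun Q" and v: "v \<in> l2fun Q"
  shows "(\<lambda>i. l2inner Q (\<phi> i) u * l2inner Q (\<phi> i) v) sums kform u v"
proof -
  have [measurable]: "u \<in> borel_measurable Q" "v \<in> borel_measurable Q" using u v by (auto dest: l2fun_measurable)
  have iu: "integrable Q u" "integrable Q v" using u v l2fun_integrable by auto
  have Km: "(\<lambda>g. K f g) \<in> borel_measurable Q" for f
    by (rule borel_measurable_LIMSEQ_real[of Q "\<lambda>n g. \<Sum>i<n. \<phi> i f * \<phi> i g"])
      (use K_sums in \<open>auto simp: sums_def\<close>)
  define S where "S n f g = (\<Sum>i<n. \<phi> i f * \<phi> i g)" for n f g
  have S1: "\<bar>S n f g\<bar> \<le> 1" for n f g unfolding S_def by (rule partial_abs_le)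
  have Slim: "(\<lambda>n. S n f g) \<longlonglongrightarrow> K f g" for f g using K_sums[of f g] by (simp add: sums_def S_def)
  have Sm[measurable]: "(\<lambda>g. S n f g) \<in> borel_measurable Q" for n f unfolding S_def by measurable
  have ib: "integrable Q (\<lambda>g. S n f g * u f * v g)" for n f
    by (rule Bochner_Integration.integrable_bound[OF integrable_mult_right[OF iu(2), of "u f"]])
      (use S1 in \<open>auto simp: abs_mult mult_le_cancel_right intro!: AE_I2 mult_right_mono mult_left_le_one_le\<close>)
  have inner: "(\<lambda>n. \<integral>g. S n f g * u f * v g \<partial>Q) \<longlonglongrightarrow> (\<integral>g. K f g * u f * v g \<partial>Q)" for f
  proof (rule integral_dominated_convergence[where w="\<lambda>g. \<bar>u f\<bar> * \<bar>v g\<bar>"])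
    show "AE g in Q. (\<lambda>n. S n f g * u f * v g) \<longlonglongrightarrow> K f g * u f * v g"
      by (intro AE_I2 tendsto_mult tendsto_const Slim)
    show "AE g in Q. norm (S n f g * u f * v g) \<le> \<bar>u f\<bar> * \<bar>v g\<bar>" for n
      using mult_right_mono[OF S1, of "\<bar>u f\<bar> * \<bar>v _\<bar>"] by (intro AE_I2) (simp add: abs_mult mult.assoc)
    show "integrable Q (\<lambda>g. \<bar>u f\<bar> * \<bar>v g\<bar>)" using iu by simp
  qed (use Km in measurable)
  have Sint: "(\<integral>g. S n f g * u f * v g \<partial>Q) = (\<Sum>i<n. (\<phi> i f * u f) * l2inner Q (\<phi> i) v)" for n f
  proof -
    have "(\<integral>g. S n f g * u f * v g \<partial>Q) = (\<integral>g. (\<Sum>i<n. (\<phi> i f * u f) * (\<phi> i g * v g)) \<partial>Q)"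
      by (intro Bochner_Integration.integral_cong refl)
        (simp add: S_def sum_distrib_right sum_distrib_left mult_ac)
    also have "\<dots> = (\<Sum>i<n. \<integral>g. (\<phi> i f * u f) * (\<phi> i g * v g) \<partial>Q)"
      by (intro Bochner_Integration.integral_sum integrable_mult_right l2fun_integrable_mult \<phi>_l2 v)
    finally show ?thesis by (simp add: l2inner_def)
  qed
  have m1: "(\<lambda>f. \<integral>g. S n f g * u f * v g \<partial>Q) \<in> borel_measurable Q" for n
    unfolding Sint by measurable
  have "(\<lambda>n. \<integral>f. (\<integral>g. S n f g * u f * v g \<partial>Q) \<partial>Q) \<longlonglongrightarrow> kform u v"
    unfolding kform_def
  proof (rule integral_dominated_convergence[where w="\<lambda>f. \<bar>u f\<bar> * (\<integral>g. \<bar>v g\<bar> \<partial>Q)"])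
    show "AE f in Q. norm (\<integral>g. S n f g * u f * v g \<partial>Q) \<le> \<bar>u f\<bar> * (\<integral>g. \<bar>v g\<bar> \<partial>Q)" for n
    proof (rule AE_I2)
      fix f
      have "norm (\<integral>g. S n f g * u f * v g \<partial>Q) \<le> (\<integral>g. norm (S n f g * u f * v g) \<partial>Q)"
        by (rule integral_norm_bound)
      also have "\<dots> \<le> (\<integral>g. \<bar>u f\<bar> * \<bar>v g\<bar> \<partial>Q)"
      proof (rule integral_mono)
        show "integrable Q (\<lambda>g. norm (S n f g * u f * v g))" using ib by simp
        show "norm (S n f g * u f * v g) \<le> \<bar>u f\<bar> * \<bar>v g\<bar>" for g
          using mult_right_mono[OF S1, of "\<bar>u f\<bar> * \<bar>v g\<bar>"] by (simp add: abs_mult mult.assoc)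
      qed (use iu in simp)
      finally show "norm (\<integral>g. S n f g * u f * v g \<partial>Q) \<le> \<bar>u f\<bar> * (\<integral>g. \<bar>v g\<bar> \<partial>Q)" by simp
    qed
    show "(\<lambda>f. \<integral>g. K f g * u f * v g \<partial>Q) \<in> borel_measurable Q"
      by (rule borel_measurable_LIMSEQ_real[OF inner m1])
    show "integrable Q (\<lambda>f. \<bar>u f\<bar> * (\<integral>g. \<bar>v g\<bar> \<partial>Q))" using iu by simp
  qed (use inner m1 in auto)
  moreover have "(\<integral>f. (\<integral>g. S n f g * u f * v g \<partial>Q) \<partial>Q) = (\<Sum>i<n. l2inner Q (\<phi> i) u * l2inner Q (\<phi> i) v)" for n
  proof -
    have "(\<integral>f. (\<integral>g. S n f g * u f * v g \<partial>Q) \<partial>Q) = (\<Sum>i<n. \<integral>f. (\<phi> i f * u f) * l2inner Q (\<phi> i) v \<partial>Q)"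
      unfolding Sint by (intro Bochner_Integration.integral_sum integrable_mult_left l2fun_integrable_mult \<phi>_l2 u)
    then show ?thesis by (simp add: l2inner_def)
  qed
  ultimately show ?thesis by (simp add: sums_def)
qed

lemma K_diag: "(\<lambda>f. K f f) \<in> borel_measurable Q" "integrable Q (\<lambda>f. K f f)"
  "(\<lambda>i. \<integral>f. (\<phi> i f)\<^sup>2 \<partial>Q) sums (\<integral>f. K f f \<partial>Q)"
proof -
  show [measurable]: "(\<lambda>f. K f f) \<in> borel_measurable Q"
    by (rule borel_measurable_LIMSEQ_real[of Q "\<lambda>n g. \<Sum>i<n. \<phi> i g * \<phi> i g"])
      (use K_sums in \<open>auto simp: sums_def\<close>)
  have "0 \<le> K f f" for f using partial_le[of f 0] by simp
  then show "integrable Q (\<lambda>f. K f f)"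
    using K_le by (intro integrable_const_bound[where B=1]) auto
  have "(\<lambda>n. \<integral>f. (\<Sum>i<n. (\<phi> i f)\<^sup>2) \<partial>Q) \<longlonglongrightarrow> (\<integral>f. K f f \<partial>Q)"
  proof (rule integral_dominated_convergence[where w="\<lambda>_. 1"])
    show "AE f in Q. norm (\<Sum>i<n. (\<phi> i f)\<^sup>2) \<le> 1" for n
    proof (rule AE_I2)
      fix f show "norm (\<Sum>i<n. (\<phi> i f)\<^sup>2) \<le> 1"
        using partial_le[of f n] K_le[of f] by (simp add: sum_nonneg)
    qed
  qed (use K_sums in \<open>auto simp: sums_def power2_eq_square\<close>)
  then show "(\<lambda>i. \<integral>f. (\<phi> i f)\<^sup>2 \<partial>Q) sums (\<integral>f. K f f \<partial>Q)"
    unfolding sums_def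
    by (subst (asm) Bochner_Integration.integral_sum) (auto intro: l2fun_integrable_square \<phi>_l2)
qed

text \<open>Tonelli for the squared coefficients of the \<open>\<phi> i\<close> along the frame:
  summing over the frame gives the squared norm of \<open>\<phi> i\<close>, summing over
  \<open>i\<close> gives the form at \<open>e k\<close>. That the frame exhausts the trace is what
  controls the tails in the limit theorem.\<close>

lemma kform_trace:
  assumes e: "\<And>k. e k \<in> l2fun Q"
    and parseval: "\<And>u v. u \<in> l2fun Q \<Longrightarrow> v \<in> l2fun Q \<Longrightarrow> (\<lambda>k. l2inner Q u (e k) * l2inner Q v (e k)) sums l2inner Q u v"
  shows "(\<lambda>k. kform (e k) (e k)) sums (\<integral>f. K f f \<partial>Q)"
proof -
  have k0: "0 \<le> kform (e k) (e k)" for k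
    using sums_le[OF _ sums_zero kform_sums[OF e e]] by simp
  have I0: "0 \<le> (\<integral>f. K f f \<partial>Q)"
    using sums_le[OF _ sums_zero K_diag(3)] by simp
  have "(\<Sum>k. ennreal (kform (e k) (e k))) = (\<Sum>k. \<Sum>i. ennreal ((l2inner Q (\<phi> i) (e k))\<^sup>2))"
    using kform_sums[OF e e] by (intro suminf_cong suminf_ennreal_eq[symmetric]) (auto simp: power2_eq_square)
  also have "\<dots> = (\<Sum>i. \<Sum>k. ennreal ((l2inner Q (\<phi> i) (e k))\<^sup>2))" by (rule ennreal_suminf_swap)
  also have "\<dots> = (\<Sum>i. ennreal (\<integral>f. (\<phi> i f)\<^sup>2 \<partial>Q))"
    using parseval[OF \<phi>_l2 \<phi>_l2]
    by (intro suminf_cong suminf_ennreal_eq) (auto simp: power2_eq_square l2inner_def)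
  also have "\<dots> = ennreal (\<integral>f. K f f \<partial>Q)"
    using K_diag(3) by (intro suminf_ennreal_eq) auto
  finally have *: "(\<Sum>k. ennreal (kform (e k) (e k))) = ennreal (\<integral>f. K f f \<partial>Q)" .
  then have sm: "summable (\<lambda>k. kform (e k) (e k))"
    by (intro summable_suminf_not_top k0) simp
  then have "ennreal (\<Sum>k. kform (e k) (e k)) = ennreal (\<integral>f. K f f \<partial>Q)"
    using * by (subst (asm) suminf_ennreal2[OF k0]) auto
  then show ?thesis using sm I0 suminf_nonneg[OF sm k0] by (simp add: sums_iff)
qed

text \<open>The series converges in \<open>L\<^sup>2\<close> of the product of the coefficient space and \<open>Q\<close>.\<close>

lemma gaussian_series:
  obtains F :: "(nat \<Rightarrow> real) \<times> 'a \<Rightarrow> real" where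
    "F \<in> l2fun (PiM UNIV (\<lambda>_. stdn) \<Otimes>\<^sub>M Q)"
    "\<And>n. (\<lambda>z. \<Sum>i<n. fst z i * \<phi> i (snd z)) \<in> l2fun (PiM UNIV (\<lambda>_. stdn) \<Otimes>\<^sub>M Q)"
    "(\<lambda>n. \<integral>z. (F z - (\<Sum>i<n. fst z i * \<phi> i (snd z)))\<^sup>2 \<partial>(PiM UNIV (\<lambda>_. stdn) \<Otimes>\<^sub>M Q)) \<longlonglongrightarrow> 0"
proof -
  let ?O = "PiM (UNIV :: nat set) (\<lambda>_. stdn)"
  interpret O: prob_space ?O by (rule prob_space_PiM[OF prob_space_stdn])
  interpret P: pair_prob_space ?O Q by unfold_locales
  have [measurable]: "(\<lambda>\<omega>. \<omega> i) \<in> borel_measurable ?O" for i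
    using measurable_component_singleton[of i UNIV "\<lambda>_. stdn"] by (simp cong: measurable_cong_sets)
  have O2: "integrable ?O (\<lambda>\<omega>. \<omega> i * \<omega> j)" "O.expectation (\<lambda>\<omega>. \<omega> i * \<omega> j) = (if i = j then 1 else 0)" for i j :: nat
  proof -
    have d: "distr ?O stdn (\<lambda>\<omega>. \<omega> i) = stdn" for i
      using distr_PiM_component[of UNIV "\<lambda>_. stdn" i] prob_space_stdn by simp
    have i: "integrable ?O (\<lambda>\<omega>. (\<omega> i) ^ k)" "O.expectation (\<lambda>\<omega>. (\<omega> i) ^ k) = (\<integral>y. y ^ k \<partial>stdn)" for i k
    proof -
      have "integrable (distr ?O stdn (\<lambda>\<omega>. \<omega> i)) (\<lambda>y. y ^ k)" unfolding d by (rule stdn_integrable_power)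
      then show "integrable ?O (\<lambda>\<omega>. (\<omega> i) ^ k)" by (subst (asm) integrable_distr_eq) auto
      have "(\<integral>y. y ^ k \<partial>stdn) = (\<integral>y. y ^ k \<partial>distr ?O stdn (\<lambda>\<omega>. \<omega> i))" unfolding d ..
      also have "\<dots> = O.expectation (\<lambda>\<omega>. (\<omega> i) ^ k)" by (subst integral_distr) auto
      finally show "O.expectation (\<lambda>\<omega>. (\<omega> i) ^ k) = (\<integral>y. y ^ k \<partial>stdn)" ..
    qed
    have m1: "(\<integral>y. y ^ 1 \<partial>stdn) = 0"
    proof -
      have "(\<integral>y. y ^ 1 \<partial>stdn) = (\<integral>y. std_normal_density y * y ^ (2 * 0 + 1) \<partial>lborel)"
        by (subst integral_density) auto
      then show ?thesis by (simp only: integral_std_normal_moment_odd)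
    qed
    show "integrable ?O (\<lambda>\<omega>. \<omega> i * \<omega> j)" "O.expectation (\<lambda>\<omega>. \<omega> i * \<omega> j) = (if i = j then 1 else 0)"
    proof (atomize (full), cases "i = j")
      case True
      then show "integrable ?O (\<lambda>\<omega>. \<omega> i * \<omega> j) \<and> O.expectation (\<lambda>\<omega>. \<omega> i * \<omega> j) = (if i = j then 1 else 0)"
        using i[of i 2] stdn_moments(1) by (simp add: power2_eq_square)
    next
      case False
      have coords: "O.indep_vars (\<lambda>_. borel) (\<lambda>i \<omega>. \<omega> i) (UNIV :: nat set)"
        by (rule indep_vars_PiM_coordinates) (auto simp: prob_space_stdn)
      have "O.indep_var borel (\<lambda>\<omega>. \<omega> i) borel (\<lambda>\<omega>. \<Sum>k\<in>{j}. \<omega> k)"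
        by (rule O.indep_vars_sum) (use False in \<open>auto intro: O.indep_vars_subset[OF coords]\<close>)
      then have iv: "O.indep_var borel (\<lambda>\<omega>. \<omega> i) borel (\<lambda>\<omega>. \<omega> j)" by simp
      have i1: "integrable ?O (\<lambda>\<omega>. \<omega> k)" "O.expectation (\<lambda>\<omega>. \<omega> k) = 0" for k
        using i[of k 1] m1 by simp_all
      show "integrable ?O (\<lambda>\<omega>. \<omega> i * \<omega> j) \<and> O.expectation (\<lambda>\<omega>. \<omega> i * \<omega> j) = (if i = j then 1 else 0)"
        using O.indep_var_integrable[OF iv] O.indep_var_lebesgue_integral[OF iv] i1 False by simp
    qed
  qed
  define S where "S n z = (\<Sum>i<n. fst z i * \<phi> i (snd z))" for n and z :: "(nat \<Rightarrow> real) \<times> 'a"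
  have Sm[measurable]: "S n \<in> borel_measurable (?O \<Otimes>\<^sub>M Q)" for n
    unfolding S_def by measurable
  define m where "m i = (\<integral>f. (\<phi> i f)\<^sup>2 \<partial>Q)" for i
  \<comment> \<open>The coefficients are uncorrelated with variance 1, so only diagonal terms
    survive and the squared norm of a block of the series is a partial sum of
    \<open>m\<close>.\<close>
  have key: "integrable (?O \<Otimes>\<^sub>M Q) (\<lambda>z. (\<Sum>i\<in>I. fst z i * \<phi> i (snd z))\<^sup>2)"
    "(\<integral>z. (\<Sum>i\<in>I. fst z i * \<phi> i (snd z))\<^sup>2 \<partial>(?O \<Otimes>\<^sub>M Q)) = (\<Sum>i\<in>I. m i)" if I: "finite I" for I
  proof -
    have e: "(\<Sum>i\<in>I. fst z i * \<phi> i (snd z))\<^sup>2 = (\<Sum>i\<in>I. \<Sum>j\<in>I. (fst z i * fst z j) * (\<phi> i (snd z) * \<phi> j (snd z)))"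
      for z :: "(nat \<Rightarrow> real) \<times> 'a"
      by (simp add: power2_eq_square sum_product mult_ac)
    have ii: "integrable (?O \<Otimes>\<^sub>M Q) (\<lambda>z. (fst z i * fst z j) * (\<phi> i (snd z) * \<phi> j (snd z)))"
      "(\<integral>z. (fst z i * fst z j) * (\<phi> i (snd z) * \<phi> j (snd z)) \<partial>(?O \<Otimes>\<^sub>M Q)) = (if i = j then 1 else 0) * (\<integral>f. \<phi> i f * \<phi> j f \<partial>Q)" for i j
    proof -
      have p: "integrable Q (\<lambda>f. \<phi> i f * \<phi> j f)" by (intro l2fun_integrable_mult \<phi>_l2)
      show int: "integrable (?O \<Otimes>\<^sub>M Q) (\<lambda>z. (fst z i * fst z j) * (\<phi> i (snd z) * \<phi> j (snd z)))"
      proof (rule P.Fubini_integrable)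
        show "AE x in ?O. integrable Q (\<lambda>y. (fst (x, y) i * fst (x, y) j) * (\<phi> i (snd (x, y)) * \<phi> j (snd (x, y))))"
          using p by simp
        show "integrable ?O (\<lambda>x. \<integral>y. norm ((fst (x, y) i * fst (x, y) j) * (\<phi> i (snd (x, y)) * \<phi> j (snd (x, y)))) \<partial>Q)"
          using integrable_abs[OF O2(1)[of i j]] by (simp add: abs_mult)
      qed measurable
      show "(\<integral>z. (fst z i * fst z j) * (\<phi> i (snd z) * \<phi> j (snd z)) \<partial>(?O \<Otimes>\<^sub>M Q)) = (if i = j then 1 else 0) * (\<integral>f. \<phi> i f * \<phi> j f \<partial>Q)"
        using P.integral_fst'[OF int] O2(2)[of i j] by simp
    qed
    show "integrable (?O \<Otimes>\<^sub>M Q) (\<lambda>z. (\<Sum>i\<in>I. fst z i * \<phi> i (snd z))\<^sup>2)"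
      unfolding e by (intro Bochner_Integration.integrable_sum ii)
    have "(\<integral>z. (\<Sum>i\<in>I. fst z i * \<phi> i (snd z))\<^sup>2 \<partial>(?O \<Otimes>\<^sub>M Q)) = (\<Sum>i\<in>I. \<Sum>j\<in>I. (if i = j then 1 else 0) * (\<integral>f. \<phi> i f * \<phi> j f \<partial>Q))"
      unfolding e by (subst Bochner_Integration.integral_sum, intro Bochner_Integration.integrable_sum ii,
          rule sum.cong[OF refl], subst Bochner_Integration.integral_sum, rule ii, simp only: ii)
    also have "\<dots> = (\<Sum>i\<in>I. \<Sum>j\<in>I. if i = j then \<integral>f. \<phi> i f * \<phi> j f \<partial>Q else 0)"
      by (intro sum.cong refl) auto
    also have "\<dots> = (\<Sum>i\<in>I. m i)"
      using I by (simp add: sum.delta m_def power2_eq_square)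
    finally show "(\<integral>z. (\<Sum>i\<in>I. fst z i * \<phi> i (snd z))\<^sup>2 \<partial>(?O \<Otimes>\<^sub>M Q)) = (\<Sum>i\<in>I. m i)" .
  qed
  have Sl2: "S n \<in> l2fun (?O \<Otimes>\<^sub>M Q)" for n
    unfolding l2fun_def using key(1)[of "{..<n}"] Sm by (simp add: S_def[abs_def])
  have dif: "(\<integral>z. (S i z - S j z)\<^sup>2 \<partial>(?O \<Otimes>\<^sub>M Q)) = (\<Sum>k\<in>{j..<i}. m k)" if "j \<le> i" for i j
  proof -
    have "S i z - S j z = (\<Sum>k\<in>{j..<i}. fst z k * \<phi> k (snd z))" for z
      unfolding S_def lessThan_atLeast0 using that by (subst sum_diff_nat_ivl) auto
    then show ?thesis using key(2)[of "{j..<i}"] by simp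
  qed
  have sm: "summable m" using K_diag(3) unfolding m_def[symmetric] by (simp add: sums_iff)
  have cauchy: "\<exists>N. \<forall>i\<ge>N. \<forall>j\<ge>N. (\<integral>z. (S i z - S j z)\<^sup>2 \<partial>(?O \<Otimes>\<^sub>M Q)) < e" if e: "e > 0" for e
  proof -
    obtain N where N: "\<And>a b. a \<ge> N \<Longrightarrow> norm (\<Sum>k\<in>{a..<b}. m k) < e"
      using sm e unfolding summable_Cauchy by blast
    have "(\<integral>z. (S i z - S j z)\<^sup>2 \<partial>(?O \<Otimes>\<^sub>M Q)) < e" if "i \<ge> N" "j \<ge> N" for i j
    proof (cases "j \<le> i")
      case True
      then show ?thesis using dif[OF True] N[OF that(2), of i] by simp
    next
      case False
      then have "(\<integral>z. (S i z - S j z)\<^sup>2 \<partial>(?O \<Otimes>\<^sub>M Q)) = (\<Sum>k\<in>{i..<j}. m k)"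
        using dif[of i j] by (simp add: power2_commute)
      then show ?thesis using N[OF that(1), of j] by simp
    qed
    then show ?thesis by blast
  qed
  obtain F where F: "F \<in> l2fun (?O \<Otimes>\<^sub>M Q)"
    "\<And>e. e > 0 \<Longrightarrow> \<exists>N. \<forall>n\<ge>N. (\<integral>z. (F z - S n z)\<^sup>2 \<partial>(?O \<Otimes>\<^sub>M Q)) \<le> e"
    using P.P.l2_complete[of S, OF Sl2 cauchy] by blast
  have "(\<lambda>n. \<integral>z. (F z - S n z)\<^sup>2 \<partial>(?O \<Otimes>\<^sub>M Q)) \<longlonglongrightarrow> 0"
  proof (rule LIMSEQ_I)
    fix r :: real assume "r > 0"
    then obtain N where "\<forall>n\<ge>N. (\<integral>z. (F z - S n z)\<^sup>2 \<partial>(?O \<Otimes>\<^sub>M Q)) \<le> r / 2" using F(2)[of "r / 2"] by auto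
    then show "\<exists>no. \<forall>n\<ge>no. norm ((\<integral>z. (F z - S n z)\<^sup>2 \<partial>(?O \<Otimes>\<^sub>M Q)) - 0) < r"
      using \<open>r > 0\<close> by (intro exI[of _ N]) force
  qed
  then show ?thesis using that[OF F(1)] Sl2 unfolding S_def by blast
qed

end

context kernel_series
begin

text \<open>The limit \<open>F\<close> lives on the product space, and its sections serve as
  elements of L^2(Q). The characteristic function of a functional is the limit of those of the
  partial sums, which are finite combinations of independent normal variables.\<close>

lemma gaussian_series_element:
  obtains V :: "(nat \<Rightarrow> real) \<Rightarrow> 'a \<Rightarrow> real" where
    "V \<in> PiM UNIV (\<lambda>_. stdn) \<rightarrow>\<^sub>M l2_borel Q"
    "\<And>u. u \<in> l2fun Q \<Longrightarrow>
      (\<integral>\<omega>. iexp (l2inner Q (V \<omega>) u) \<partial>PiM UNIV (\<lambda>_. stdn)) = complex_of_real (exp (- kform u u / 2))"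
proof -
  let ?O = "PiM (UNIV :: nat set) (\<lambda>_. stdn)"
  interpret O: prob_space ?O by (rule prob_space_PiM[OF prob_space_stdn])
  interpret P: pair_prob_space ?O Q by unfold_locales
  have co[measurable]: "(\<lambda>\<omega>. \<omega> i) \<in> borel_measurable ?O" for i
    using measurable_component_singleton[of i UNIV "\<lambda>_. stdn"] by (simp cong: measurable_cong_sets)
  obtain F :: "(nat \<Rightarrow> real) \<times> 'a \<Rightarrow> real" where F: "F \<in> l2fun (?O \<Otimes>\<^sub>M Q)"
    and partial_l2: "\<And>n. (\<lambda>z. \<Sum>i<n. fst z i * \<phi> i (snd z)) \<in> l2fun (?O \<Otimes>\<^sub>M Q)"
    and Flim: "(\<lambda>n. \<integral>z. (F z - (\<Sum>i<n. fst z i * \<phi> i (snd z)))\<^sup>2 \<partial>(?O \<Otimes>\<^sub>M Q)) \<longlonglongrightarrow> 0"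
    by (rule gaussian_series) blast
  have Fm[measurable]: "F \<in> borel_measurable (?O \<Otimes>\<^sub>M Q)" using F by (rule l2fun_measurable)
  \<comment> \<open>The value 0 on the null set of sections that are not square-integrable makes
    \<open>V \<omega>\<close> an element of \<open>l2fun Q\<close> at every point.\<close>
  define V where "V \<omega> = (if integrable Q (\<lambda>f. (F (\<omega>, f))\<^sup>2) then (\<lambda>f. F (\<omega>, f)) else (\<lambda>_. 0))" for \<omega>
  have Vl2: "V \<omega> \<in> l2fun Q" if [measurable]: "\<omega> \<in> space ?O" for \<omega>
    by (auto simp: V_def l2fun_def)
  have Vm: "V \<in> ?O \<rightarrow>\<^sub>M l2_borel Q"
  proof (rule measurable_l2_borelI[OF _ sets_Q Vl2])
    show "finite_measure Q" by unfold_locales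
    fix d assume d: "d \<in> l2fun Q"
    then have [measurable]: "d \<in> borel_measurable Q" by (rule l2fun_measurable)
    have "(\<lambda>\<omega>. \<integral>x. (V \<omega> x - d x)\<^sup>2 \<partial>Q)
        = (\<lambda>\<omega>. if integrable Q (\<lambda>f. (F (\<omega>, f))\<^sup>2) then \<integral>x. (F (\<omega>, x) - d x)\<^sup>2 \<partial>Q else \<integral>x. (0 - d x)\<^sup>2 \<partial>Q)"
      by (auto simp: V_def)
    also have "\<dots> \<in> borel_measurable ?O" by measurable
    finally show "(\<lambda>\<omega>. \<integral>x. (V \<omega> x - d x)\<^sup>2 \<partial>Q) \<in> borel_measurable ?O" .
  qed
  have char: "(\<integral>\<omega>. iexp (l2inner Q (V \<omega>) u) \<partial>?O) = complex_of_real (exp (- kform u u / 2))" if u: "u \<in> l2fun Q" for u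
  proof -
    have [measurable]: "u \<in> borel_measurable Q" using u by (rule l2fun_measurable)
    define c where "c i = l2inner Q (\<phi> i) u" for i
    define S where "S n z = (\<Sum>i<n. fst z i * \<phi> i (snd z))" for n and z :: "(nat \<Rightarrow> real) \<times> 'a"
    define L where "L n \<omega> = (\<Sum>i<n. c i * \<omega> i)" for n and \<omega> :: "nat \<Rightarrow> real"
    have [measurable]: "S n \<in> borel_measurable (?O \<Otimes>\<^sub>M Q)" "L n \<in> borel_measurable ?O" for n
      unfolding S_def L_def by measurable
    have Lm[measurable]: "(\<lambda>\<omega>. l2inner Q (V \<omega>) u) \<in> borel_measurable ?O"
      by (rule measurable_compose[OF Vm measurable_l2inner[OF u]])
    have charL: "(\<integral>\<omega>. iexp (L n \<omega>) \<partial>?O) = complex_of_real (exp (- (\<Sum>i<n. c i * c i) / 2))" for n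
    proof (cases "n = 0")
      case True
      then show ?thesis using O.prob_space by (simp add: L_def)
    next
      case False
      have "O.indep_vars (\<lambda>_. borel) (\<lambda>i \<omega>. c i * \<omega> i) UNIV"
        by (rule indep_vars_PiM_coordinates) (auto simp: prob_space_stdn)
      then have iv: "O.indep_vars (\<lambda>_. borel) (\<lambda>i \<omega>. c i * \<omega> i) {..<n}"
        by (rule O.indep_vars_subset) auto
      have one: "char (distr ?O borel (\<lambda>\<omega>. c i * \<omega> i)) 1 = complex_of_real (exp (- (c i)\<^sup>2 / 2))" for i
      proof -
        have d: "distr ?O stdn (\<lambda>\<omega>. \<omega> i) = stdn"
          using distr_PiM_component[of UNIV "\<lambda>_. stdn" i] prob_space_stdn by simp
        have "char (distr ?O borel (\<lambda>\<omega>. c i * \<omega> i)) 1 = (\<integral>\<omega>. iexp (c i * \<omega> i) \<partial>?O)"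
          unfolding char_def by (subst integral_distr) auto
        also have "\<dots> = (\<integral>y. iexp (c i * y) \<partial>distr ?O stdn (\<lambda>\<omega>. \<omega> i))"
          by (subst integral_distr) auto
        also have "\<dots> = complex_of_real (exp (- (c i)\<^sup>2 / 2))" unfolding d by (rule iexp_stdn)
        finally show ?thesis .
      qed
      have "(\<integral>\<omega>. iexp (L n \<omega>) \<partial>?O) = char (distr ?O borel (\<lambda>\<omega>. \<Sum>i<n. c i * \<omega> i)) 1"
        unfolding char_def L_def by (subst integral_distr) auto
      also have "\<dots> = (\<Prod>i<n. complex_of_real (exp (- (c i)\<^sup>2 / 2)))"
        unfolding O.char_distr_sum[OF iv] one ..
      also have "\<dots> = complex_of_real (exp (\<Sum>i<n. - (c i)\<^sup>2 / 2))"
        unfolding exp_sum[OF finite_lessThan] of_real_prod ..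
      also have "(\<Sum>i<n. - (c i)\<^sup>2 / 2) = - (\<Sum>i<n. c i * c i) / 2"
        by (simp add: sum_divide_distrib sum_negf power2_eq_square)
      finally show ?thesis .
    qed
    have lim1: "(\<lambda>n. \<integral>\<omega>. iexp (L n \<omega>) \<partial>?O) \<longlonglongrightarrow> complex_of_real (exp (- kform u u / 2))"
      unfolding charL using kform_sums[OF u u] by (intro tendsto_intros) (auto simp: sums_def c_def)
    have AEV: "AE \<omega> in ?O. V \<omega> = (\<lambda>f. F (\<omega>, f))"
      using P.AE_integrable_fst'[OF l2fun_integrable_square[OF F]] by eventually_elim (simp add: V_def)
    have ul2: "(\<lambda>z. u (snd z)) \<in> l2fun (?O \<Otimes>\<^sub>M Q)"
    proof (rule l2funI)
      have "integrable (?O \<Otimes>\<^sub>M Q) (\<lambda>(x, y). (u y)\<^sup>2)"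
      proof (rule P.Fubini_integrable)
        show "integrable ?O (\<lambda>x. \<integral>y. norm (case (x, y) of (x, y) \<Rightarrow> (u y)\<^sup>2) \<partial>Q)" by simp
        show "AE x in ?O. integrable Q (\<lambda>y. case (x, y) of (x, y) \<Rightarrow> (u y)\<^sup>2)"
          using l2fun_integrable_square[OF u] by simp
      qed measurable
      then show "integrable (?O \<Otimes>\<^sub>M Q) (\<lambda>z. (u (snd z))\<^sup>2)" by (simp add: split_def)
    qed measurable
    have Sl2: "S n \<in> l2fun (?O \<Otimes>\<^sub>M Q)" for n
      unfolding S_def by (rule partial_l2)
    define D where "D n z = \<bar>F z - S n z\<bar>" for n z
    have Dl2: "D n \<in> l2fun (?O \<Otimes>\<^sub>M Q)" for n
      using l2fun_diff[OF F Sl2[of n]] unfolding l2fun_def D_def by auto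
    have ual2: "(\<lambda>z. \<bar>u (snd z)\<bar>) \<in> l2fun (?O \<Otimes>\<^sub>M Q)" using ul2 by (simp add: l2fun_def)
    have iD: "integrable (?O \<Otimes>\<^sub>M Q) (\<lambda>z. D n z * \<bar>u (snd z)\<bar>)" for n
      by (rule l2fun_integrable_mult[OF Dl2 ual2])
    \<comment> \<open>Since exp (i a) is 1-Lipschitz in a, the difference of the characteristic
      functions is at most an integral over the product space, where Cauchy-Schwarz applies.\<close>
    have bound: "norm ((\<integral>\<omega>. iexp (l2inner Q (V \<omega>) u) \<partial>?O) - (\<integral>\<omega>. iexp (L n \<omega>) \<partial>?O))
        \<le> sqrt (\<integral>z. (F z - S n z)\<^sup>2 \<partial>(?O \<Otimes>\<^sub>M Q)) * l2norm (?O \<Otimes>\<^sub>M Q) (\<lambda>z. \<bar>u (snd z)\<bar>)" for n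
    proof -
      have i1: "integrable ?O (\<lambda>\<omega>. iexp (l2inner Q (V \<omega>) u))" "integrable ?O (\<lambda>\<omega>. iexp (L n \<omega>))"
        by (auto intro!: O.integrable_const_bound[where B=1])
      have "norm ((\<integral>\<omega>. iexp (l2inner Q (V \<omega>) u) \<partial>?O) - (\<integral>\<omega>. iexp (L n \<omega>) \<partial>?O))
          = norm (\<integral>\<omega>. iexp (l2inner Q (V \<omega>) u) - iexp (L n \<omega>) \<partial>?O)"
        using i1 by (simp add: Bochner_Integration.integral_diff)
      also have "\<dots> \<le> (\<integral>\<omega>. norm (iexp (l2inner Q (V \<omega>) u) - iexp (L n \<omega>)) \<partial>?O)"
        by (rule integral_norm_bound)
      also have "\<dots> \<le> (\<integral>\<omega>. (\<integral>f. D n (\<omega>, f) * \<bar>u (snd (\<omega>, f))\<bar> \<partial>Q) \<partial>?O)"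
      proof (rule integral_mono_AE)
        show "integrable ?O (\<lambda>\<omega>. norm (iexp (l2inner Q (V \<omega>) u) - iexp (L n \<omega>)))"
          using i1 by (intro integrable_norm Bochner_Integration.integrable_diff)
        show "integrable ?O (\<lambda>\<omega>. \<integral>f. D n (\<omega>, f) * \<bar>u (snd (\<omega>, f))\<bar> \<partial>Q)"
          by (rule P.integrable_fst'[OF iD])
        show "AE \<omega> in ?O. norm (iexp (l2inner Q (V \<omega>) u) - iexp (L n \<omega>)) \<le> (\<integral>f. D n (\<omega>, f) * \<bar>u (snd (\<omega>, f))\<bar> \<partial>Q)"
          using AEV AE_space
        proof eventually_elim
          case (elim \<omega>)
          have Sw: "(\<lambda>f. S n (\<omega>, f)) \<in> l2fun Q"
            unfolding S_def by (auto intro!: l2fun_sum l2fun_scale \<phi>_l2)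
          have L: "L n \<omega> = l2inner Q (\<lambda>f. S n (\<omega>, f)) u"
            unfolding L_def S_def c_def using l2inner_sum_right[OF u, where I="{..<n}" and f=\<phi> and c=\<omega>] \<phi>_l2
            by (simp add: l2inner_commute mult.commute)
          have Vw: "(\<lambda>f. F (\<omega>, f)) \<in> l2fun Q" using Vl2[OF elim(2)] elim(1) by simp
          have "norm (iexp (l2inner Q (V \<omega>) u) - iexp (L n \<omega>)) \<le> \<bar>l2inner Q (V \<omega>) u - L n \<omega>\<bar>"
          proof -
            have "iexp a - iexp b = iexp b * (iexp (a - b) - 1)" for a b :: real
              by (simp add: right_diff_distrib exp_add[symmetric])
            then have "norm (iexp a - iexp b) \<le> \<bar>a - b\<bar>" for a b :: real
              using iexp_approx1[of "a - b" 0] by (simp add: norm_mult)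
            then show ?thesis .
          qed
          also have "\<dots> = \<bar>\<integral>f. (F (\<omega>, f) - S n (\<omega>, f)) * u f \<partial>Q\<bar>"
            unfolding L elim(1) using l2inner_diff_left[OF Vw Sw u] by (simp add: l2inner_def)
          also have "\<dots> \<le> (\<integral>f. \<bar>(F (\<omega>, f) - S n (\<omega>, f)) * u f\<bar> \<partial>Q)" by (rule integral_abs_bound)
          finally show ?case by (simp add: D_def abs_mult)
        qed
      qed
      also have "\<dots> = l2inner (?O \<Otimes>\<^sub>M Q) (D n) (\<lambda>z. \<bar>u (snd z)\<bar>)"
        using P.integral_fst'[OF iD] by (simp add: l2inner_def)
      also have "\<dots> \<le> l2norm (?O \<Otimes>\<^sub>M Q) (D n) * l2norm (?O \<Otimes>\<^sub>M Q) (\<lambda>z. \<bar>u (snd z)\<bar>)"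
        using l2inner_Cauchy_Schwarz[OF Dl2 ual2] by (meson abs_ge_self order_trans)
      also have "l2norm (?O \<Otimes>\<^sub>M Q) (D n) = sqrt (\<integral>z. (F z - S n z)\<^sup>2 \<partial>(?O \<Otimes>\<^sub>M Q))"
        by (simp add: l2norm_def l2inner_def D_def power2_eq_square abs_mult[symmetric])
      finally show ?thesis .
    qed
    have "(\<lambda>n. (\<integral>\<omega>. iexp (l2inner Q (V \<omega>) u) \<partial>?O) - (\<integral>\<omega>. iexp (L n \<omega>) \<partial>?O)) \<longlonglongrightarrow> 0"
    proof (rule Lim_null_comparison[OF always_eventually, rule_format, OF bound])
      show "(\<lambda>n. sqrt (\<integral>z. (F z - S n z)\<^sup>2 \<partial>(?O \<Otimes>\<^sub>M Q)) * l2norm (?O \<Otimes>\<^sub>M Q) (\<lambda>z. \<bar>u (snd z)\<bar>)) \<longlonglongrightarrow> 0"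
        using tendsto_mult[OF tendsto_real_sqrt[OF Flim] tendsto_const] unfolding S_def by simp
    qed
    from tendsto_add[OF this lim1] show ?thesis by (simp add: LIMSEQ_const_iff)
  qed
  show ?thesis by (rule that[OF Vm char])
qed

text \<open>Taking the law of the series, with the identity map as random element, moves the
  construction to a measure on functions. The laws of the functionals follow from their
  characteristic functions, the covariances from the variances by polarisation.\<close>

theorem centred_gaussian_exists:
  "\<exists>(W :: ('a \<Rightarrow> real) measure) V. centred_gaussian W Q V \<and> has_cov_kernel W Q V K"
proof -
  let ?O = "PiM (UNIV :: nat set) (\<lambda>_. stdn)"
  interpret O: prob_space ?O by (rule prob_space_PiM[OF prob_space_stdn])
  interpret N: prob_space stdn by (rule prob_space_stdn)
  obtain V :: "(nat \<Rightarrow> real) \<Rightarrow> 'a \<Rightarrow> real" where V[measurable]: "V \<in> ?O \<rightarrow>\<^sub>M l2_borel Q"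
    and char: "\<And>u. u \<in> l2fun Q \<Longrightarrow> (\<integral>\<omega>. iexp (l2inner Q (V \<omega>) u) \<partial>?O) = complex_of_real (exp (- kform u u / 2))"
    by (rule gaussian_series_element) blast
  define W where "W = distr ?O (l2_borel Q) V"
  have k0: "0 \<le> kform u u" if "u \<in> l2fun Q" for u
    using sums_le[OF _ sums_zero kform_sums[OF that that]] by simp
  have kscale: "kform (\<lambda>x. t * u x) (\<lambda>x. t * u x) = t\<^sup>2 * kform u u" for t u
    unfolding kform_def power2_eq_square by (simp add: mult_ac flip: integral_mult_right_zero)
  have law: "distr W borel (\<lambda>w. l2inner Q w u) = centred_normal (sqrt (kform u u))" if u: "u \<in> l2fun Q" for u
  proof -
    note [measurable] = measurable_l2inner[OF u]
    have "distr W borel (\<lambda>w. l2inner Q w u) = distr ?O borel (\<lambda>\<omega>. l2inner Q (V \<omega>) u)"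
      unfolding W_def by (subst distr_distr) (auto simp: comp_def)
    also have "\<dots> = distr stdn borel (\<lambda>y. sqrt (kform u u) * y)"
    proof (rule Levy_uniqueness)
      show "real_distribution (distr ?O borel (\<lambda>\<omega>. l2inner Q (V \<omega>) u))" by (rule O.real_distribution_distr) simp
      show "real_distribution (distr stdn borel (\<lambda>y. sqrt (kform u u) * y))" by (rule N.real_distribution_distr) simp
      have "char (distr ?O borel (\<lambda>\<omega>. l2inner Q (V \<omega>) u)) t = char (distr stdn borel (\<lambda>y. sqrt (kform u u) * y)) t" for t
      proof -
        have "char (distr ?O borel (\<lambda>\<omega>. l2inner Q (V \<omega>) u)) t = (\<integral>\<omega>. iexp (t * l2inner Q (V \<omega>) u) \<partial>?O)"
          unfolding char_def by (subst integral_distr) auto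
        also have "\<dots> = (\<integral>\<omega>. iexp (l2inner Q (V \<omega>) (\<lambda>x. t * u x)) \<partial>?O)"
          unfolding l2inner_def by (simp add: mult_ac flip: integral_mult_right_zero)
        also have "\<dots> = complex_of_real (exp (- (t * sqrt (kform u u))\<^sup>2 / 2))"
          unfolding char[OF l2fun_scale[OF u]] kscale using k0[OF u] by (simp add: power_mult_distrib)
        also have "\<dots> = (\<integral>y. iexp ((t * sqrt (kform u u)) * y) \<partial>stdn)" by (rule iexp_stdn[symmetric])
        also have "\<dots> = char (distr stdn borel (\<lambda>y. sqrt (kform u u) * y)) t"
          unfolding char_def by (subst integral_distr) (auto simp: mult_ac)
        finally show ?thesis .
      qed
      then show "char (distr ?O borel (\<lambda>\<omega>. l2inner Q (V \<omega>) u)) = char (distr stdn borel (\<lambda>y. sqrt (kform u u) * y))" ..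
    qed
    also have "\<dots> = centred_normal (sqrt (kform u u))" using k0[OF u] by (simp add: centred_normal_eq)
    finally show ?thesis .
  qed
  have W: "prob_space W" unfolding W_def by (rule O.prob_space_distr) simp
  have cg: "centred_gaussian W Q (\<lambda>w. w)"
    unfolding centred_gaussian_def
  proof (intro conjI ballI W)
    show "(\<lambda>w. w) \<in> W \<rightarrow>\<^sub>M l2_borel Q" by (simp add: W_def)
    show "\<exists>s\<ge>0. distr W borel (\<lambda>w. l2inner Q w u) = centred_normal s" if "u \<in> l2fun Q" for u
      using law[OF that] k0[OF that] by (intro exI[of _ "sqrt (kform u u)"]) auto
  qed
  have second: "integrable W (\<lambda>w. (l2inner Q w u)\<^sup>2)" "(\<integral>w. (l2inner Q w u)\<^sup>2 \<partial>W) = kform u u" if u: "u \<in> l2fun Q" for u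
  proof -
    have [measurable]: "(\<lambda>w. l2inner Q w u) \<in> borel_measurable W"
      using measurable_l2inner[OF u] by (simp add: W_def)
    have d: "distr W borel (\<lambda>w. l2inner Q w u) = distr stdn borel (\<lambda>y. sqrt (kform u u) * y)"
      using law[OF u] k0[OF u] by (simp add: centred_normal_eq)
    have "integrable W (\<lambda>w. (l2inner Q w u)\<^sup>2) \<longleftrightarrow> integrable (distr W borel (\<lambda>w. l2inner Q w u)) (\<lambda>y. y\<^sup>2)"
      by (subst integrable_distr_eq) auto
    also have "\<dots> \<longleftrightarrow> integrable stdn (\<lambda>y. (sqrt (kform u u) * y)\<^sup>2)"
      unfolding d by (subst integrable_distr_eq) auto
    finally show "integrable W (\<lambda>w. (l2inner Q w u)\<^sup>2)"
      using stdn_integrable_power[of 2] by (simp add: power_mult_distrib)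
    have "(\<integral>w. (l2inner Q w u)\<^sup>2 \<partial>W) = (\<integral>y. y\<^sup>2 \<partial>distr W borel (\<lambda>w. l2inner Q w u))"
      by (subst integral_distr) auto
    also have "\<dots> = (\<integral>y. (sqrt (kform u u) * y)\<^sup>2 \<partial>stdn)"
      unfolding d by (subst integral_distr) auto
    also have "\<dots> = kform u u" using k0[OF u] stdn_moments(1) by (simp add: power_mult_distrib)
    finally show "(\<integral>w. (l2inner Q w u)\<^sup>2 \<partial>W) = kform u u" .
  qed
  have spW: "space W = l2fun Q" by (simp add: W_def space_l2_borel)
  have "has_cov_kernel W Q (\<lambda>w. w) K"
    unfolding has_cov_kernel_def kform_def[symmetric]
  proof (intro ballI)
    fix u v assume u: "u \<in> l2fun Q" and v: "v \<in> l2fun Q"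
    have uv: "(\<lambda>x. u x + v x) \<in> l2fun Q" using u v by (rule l2fun_add)
    have add: "l2inner Q w (\<lambda>x. u x + v x) = l2inner Q w u + l2inner Q w v" if "w \<in> l2fun Q" for w
      unfolding l2inner_def distrib_left
      by (rule Bochner_Integration.integral_add) (intro l2fun_integrable_mult that u v)+
    have "(\<integral>w. l2inner Q w u * l2inner Q w v \<partial>W) =
        (\<integral>w. ((l2inner Q w (\<lambda>x. u x + v x))\<^sup>2 - (l2inner Q w u)\<^sup>2 - (l2inner Q w v)\<^sup>2) / 2 \<partial>W)"
      by (intro Bochner_Integration.integral_cong refl) (simp add: spW add power2_sum)
    also have "\<dots> = (kform (\<lambda>x. u x + v x) (\<lambda>x. u x + v x) - kform u u - kform v v) / 2"
      using second[OF u] second[OF v] second[OF uv] by simp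
    also have "\<dots> = kform u v"
    proof -
      have "(\<lambda>i. l2inner Q (\<phi> i) (\<lambda>x. u x + v x) * l2inner Q (\<phi> i) (\<lambda>x. u x + v x))
          sums (kform u u + 2 * kform u v + kform v v)"
        using sums_add[OF sums_add[OF kform_sums[OF u u] sums_mult[OF kform_sums[OF u v], of 2]] kform_sums[OF v v]]
        by (simp add: add[OF \<phi>_l2] algebra_simps)
      with kform_sums[OF uv uv] have "kform (\<lambda>x. u x + v x) (\<lambda>x. u x + v x) = kform u u + 2 * kform u v + kform v v"
        by (rule sums_unique2)
      then show ?thesis by simp
    qed
    finally show "(\<integral>w. l2inner Q w u * l2inner Q w v \<partial>W) = kform u v" .
  qed
  then show ?thesis using cg by blast
qed

end

section \<open>The central limit theorem for the score\<close>

lemma (in prob_space) second_moment_sum: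
  assumes ind: "indep_vars (\<lambda>_. borel) Y I" and fin: "finite J" "J \<subseteq> I"
    and i2: "\<And>i. i \<in> J \<Longrightarrow> integrable M (\<lambda>x. (Y i x :: real)\<^sup>2)"
    and m: "\<And>i. i \<in> J \<Longrightarrow> expectation (Y i) = 0"
  shows "integrable M (\<lambda>x. (\<Sum>i\<in>J. Y i x)\<^sup>2) \<and> expectation (\<lambda>x. \<Sum>i\<in>J. Y i x) = 0 \<and>
     expectation (\<lambda>x. (\<Sum>i\<in>J. Y i x)\<^sup>2) = (\<Sum>i\<in>J. expectation (\<lambda>x. (Y i x)\<^sup>2))"
  using fin i2 m
proof (induction J rule: finite_induct)
  case (insert j J)
  define S where "S x = (\<Sum>i\<in>J. Y i x)" for x
  have IH: "integrable M (\<lambda>x. (S x)\<^sup>2)" "expectation S = 0"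
     "expectation (\<lambda>x. (S x)\<^sup>2) = (\<Sum>i\<in>J. expectation (\<lambda>x. (Y i x)\<^sup>2))"
    using insert unfolding S_def by auto
  have rv[measurable]: "Y i \<in> borel_measurable M" if "i \<in> I" for i
    using ind that by (auto simp: indep_vars_def)
  have [measurable]: "S \<in> borel_measurable M" "Y j \<in> borel_measurable M"
    unfolding S_def using insert.prems by (auto intro!: borel_measurable_sum rv)
  have Yj: "integrable M (\<lambda>x. (Y j x)\<^sup>2)" "expectation (Y j) = 0"
    using insert.prems by auto
  have i1: "integrable M S" "integrable M (Y j)"
    using l2fun_integrable[of S] l2fun_integrable[of "Y j"] IH(1) Yj(1) by (auto simp: l2fun_def)
  have iv: "indep_var borel (Y j) borel S"
    unfolding S_def using insert by (intro indep_vars_sum indep_vars_subset[OF ind]) auto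
  have prod: "integrable M (\<lambda>x. Y j x * S x)" "expectation (\<lambda>x. Y j x * S x) = 0"
    using indep_var_integrable[OF iv i1(2,1)] indep_var_lebesgue_integral[OF iv i1(2,1)] IH(2) by auto
  have e2: "(\<Sum>i\<in>insert j J. Y i x)\<^sup>2 = (S x)\<^sup>2 + 2 * (Y j x * S x) + (Y j x)\<^sup>2" for x
    using insert.hyps by (simp add: S_def power2_sum)
  have e1: "(\<Sum>i\<in>insert j J. Y i x) = Y j x + S x" for x
    using insert.hyps by (simp add: S_def)
  have "expectation (\<lambda>x. (\<Sum>i\<in>insert j J. Y i x)\<^sup>2) = expectation (\<lambda>x. (S x)\<^sup>2) + expectation (\<lambda>x. (Y j x)\<^sup>2)"
    unfolding e2 using prod IH(1) Yj(1) by simp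
  moreover have "integrable M (\<lambda>x. (\<Sum>i\<in>insert j J. Y i x)\<^sup>2)"
    unfolding e2 using prod IH(1) Yj(1) by simp
  moreover have "expectation (\<lambda>x. \<Sum>i\<in>insert j J. Y i x) = 0"
    unfolding e1 using i1 IH(2) Yj(2) by simp
  ultimately show ?case using insert.hyps IH(3) by simp
qed simp

lemma PiM_component_integral:
  fixes F :: "'a \<Rightarrow> real"
  assumes N: "prob_space N" and j: "j < (n::nat)" and [measurable]: "F \<in> borel_measurable N"
  shows "integrable (PiM {..<n} (\<lambda>_. N)) (\<lambda>x. F (x j)) \<longleftrightarrow> integrable N F"
    and "(\<integral>x. F (x j) \<partial>PiM {..<n} (\<lambda>_. N)) = (\<integral>x. F x \<partial>N)"
proof -
  have d: "distr (PiM {..<n} (\<lambda>_. N)) N (\<lambda>x. x j) = N"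
    by (rule distr_PiM_component) (use N j in auto)
  have [measurable]: "(\<lambda>x. x j) \<in> PiM {..<n} (\<lambda>_. N) \<rightarrow>\<^sub>M N"
    using j by (intro measurable_component_singleton) auto
  show "integrable (PiM {..<n} (\<lambda>_. N)) (\<lambda>x. F (x j)) \<longleftrightarrow> integrable N F"
    using integrable_distr_eq[of "\<lambda>x. x j" "PiM {..<n} (\<lambda>_. N)" N F] by (simp add: d)
  show "(\<integral>x. F (x j) \<partial>PiM {..<n} (\<lambda>_. N)) = (\<integral>x. F x \<partial>N)"
    using integral_distr[of "\<lambda>x. x j" "PiM {..<n} (\<lambda>_. N)" N F] by (simp add: d)
qed

lemma iid_normalised_sum_square:
  fixes Y :: "'a \<Rightarrow> real"
  assumes N: "prob_space N" and [measurable]: "Y \<in> borel_measurable N" and n: "n > 0"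
    and Y2: "integrable N (\<lambda>x. (Y x)\<^sup>2)" and m: "(\<integral>x. Y x \<partial>N) = 0"
  shows "integrable (PiM {..<n} (\<lambda>_. N)) (\<lambda>x. ((\<Sum>j<n. Y (x j)) / sqrt (real n))\<^sup>2)"
    and "(\<integral>x. ((\<Sum>j<n. Y (x j)) / sqrt (real n))\<^sup>2 \<partial>PiM {..<n} (\<lambda>_. N)) = (\<integral>x. (Y x)\<^sup>2 \<partial>N)"
proof -
  interpret P: prob_space "PiM {..<n} (\<lambda>_. N)" by (rule prob_space_PiM[OF N])
  have ind: "P.indep_vars (\<lambda>_. borel) (\<lambda>i x. Y (x i)) {..<n}"
    by (rule indep_vars_PiM_coordinates) (use N n in auto)
  have m1: "(\<lambda>x. (Y x)\<^sup>2) \<in> borel_measurable N" by measurable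
  note * = P.second_moment_sum[OF ind finite_lessThan order_refl]
  have **: "integrable (PiM {..<n} (\<lambda>_. N)) (\<lambda>x. (\<Sum>j<n. Y (x j))\<^sup>2)"
     "(\<integral>x. (\<Sum>j<n. Y (x j))\<^sup>2 \<partial>PiM {..<n} (\<lambda>_. N)) = (\<Sum>j<n. (\<integral>x. (Y x)\<^sup>2 \<partial>N))"
    using * PiM_component_integral[OF N _ m1, of _ n] PiM_component_integral[OF N, of _ n Y] Y2 m by auto
  show "integrable (PiM {..<n} (\<lambda>_. N)) (\<lambda>x. ((\<Sum>j<n. Y (x j)) / sqrt (real n))\<^sup>2)"
    unfolding power_divide using ** by simp
  show "(\<integral>x. ((\<Sum>j<n. Y (x j)) / sqrt (real n))\<^sup>2 \<partial>PiM {..<n} (\<lambda>_. N)) = (\<integral>x. (Y x)\<^sup>2 \<partial>N)"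
    unfolding power_divide using ** n by simp
qed

lemma iid_normalised_sum_char:
  fixes Y :: "'a \<Rightarrow> real"
  assumes N: "prob_space N" and [measurable]: "Y \<in> borel_measurable N"
  shows "(\<integral>x. iexp ((\<Sum>j<n. Y (x j)) / sqrt (real n)) \<partial>PiM {..<n} (\<lambda>_. N)) = (\<integral>x. iexp (Y x / sqrt (real n)) \<partial>N) ^ n"
proof -
  interpret N: prob_space N by fact
  interpret S: finite_product_prob_space "\<lambda>_. N" "{..<n}" by unfold_locales simp
  have "(\<integral>x. iexp ((\<Sum>j<n. Y (x j)) / sqrt (real n)) \<partial>PiM {..<n} (\<lambda>_. N))
      = (\<integral>x. (\<Prod>j<n. iexp (Y (x j) / sqrt (real n))) \<partial>PiM {..<n} (\<lambda>_. N))"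
    by (intro Bochner_Integration.integral_cong refl)
      (simp add: exp_sum[symmetric] sum_divide_distrib sum_distrib_left)
  also have "\<dots> = (\<Prod>j<n. \<integral>x. iexp (Y x / sqrt (real n)) \<partial>N)"
    by (rule S.product_integral_prod) (auto intro!: N.integrable_const_bound[where B=1])
  finally show ?thesis by simp
qed

lemma exp_minus_quadratic: "\<bar>(1 - x) - exp (- x)\<bar> \<le> x\<^sup>2 / 2" if x: "0 \<le> x" for x :: real
proof -
  define q where "q = 1 + x + x\<^sup>2 / 2"
  have q: "0 < q" unfolding q_def using x by (intro add_pos_nonneg) auto
  have "exp (- x) \<le> inverse q"
    unfolding exp_minus by (rule le_imp_inverse_le[OF _ q]) (simp add: q_def exp_lower_Taylor_quadratic[OF x])
  also have "\<dots> \<le> 1 - x + x\<^sup>2 / 2"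
  proof -
    \<comment> \<open>The quadratic Taylor polynomials at x and at -x multiply to 1 + x^4 / 4, so
      the reciprocal of \<open>q\<close>, which bounds exp (- x), is at most 1 - x + x^2 /
      2.\<close>
    have "(1 - x + x\<^sup>2 / 2) * q = 1 + x ^ 4 / 4"
      unfolding q_def by (simp add: field_simps power2_eq_square power4_eq_xxxx)
    then have "1 \<le> (1 - x + x\<^sup>2 / 2) * q" by simp
    then show ?thesis using q by (simp add: inverse_eq_divide pos_divide_le_eq)
  qed
  finally have "exp (- x) \<le> 1 - x + x\<^sup>2 / 2" .
  moreover have "1 - x \<le> exp (- x)" using exp_ge_add_one_self[of "- x"] by linarith
  ultimately show ?thesis by linarith
qed

text \<open>The law varies with n. Each factor is compared with exp (- v / (2 n)), where v is the
  current variance: the error is of order n^(-3/2), from the third absolute moment, which the fourth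
  one controls. Passing to n-th powers multiplies it by at most n, since all moduli are at most
  1.\<close>

lemma triangular_clt:
  fixes N :: "nat \<Rightarrow> 'a measure" and Y :: "nat \<Rightarrow> 'a \<Rightarrow> real"
  assumes N: "\<And>n. prob_space (N n)" and Y[measurable]: "\<And>n. Y n \<in> borel_measurable (N n)"
    and m: "\<And>n. (\<integral>x. Y n x \<partial>N n) = 0"
    and i4: "\<And>n. integrable (N n) (\<lambda>x. Y n x ^ 4)" and m4: "\<And>n. (\<integral>x. Y n x ^ 4 \<partial>N n) \<le> b"
    and s: "(\<lambda>n. \<integral>x. (Y n x)\<^sup>2 \<partial>N n) \<longlonglongrightarrow> s"
  shows "(\<lambda>n. (\<integral>x. iexp (Y n x / sqrt (real n)) \<partial>N n) ^ n) \<longlonglongrightarrow> complex_of_real (exp (- s / 2))"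
proof -
  interpret N: prob_space "N n" for n by (rule N)
  define v where "v n = (\<integral>x. (Y n x)\<^sup>2 \<partial>N n)" for n
  have v0: "0 \<le> v n" for n by (simp add: v_def)
  note ip = N.fourth_moment_imp_integrable_power[OF Y i4]
  have i1: "integrable (N n) (Y n)" and i2: "integrable (N n) (\<lambda>x. (Y n x)\<^sup>2)" for n
    using ip[of 1 n] ip[of 2 n] by auto
  define \<phi> where "\<phi> n = (\<integral>x. iexp (Y n x / sqrt (real n)) \<partial>N n)" for n
  define \<psi> where "\<psi> n = complex_of_real (exp (- (v n / (2 * real n))))" for n
  have m40: "0 \<le> b" using order_trans[OF _ m4[of 0]] by simp
  have app: "norm (\<phi> n - \<psi> n) \<le> (1 + b) / (6 * real n * sqrt (real n)) + (v n)\<^sup>2 / (8 * (real n)\<^sup>2)" if n: "n > 0" for n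
  proof -
    let ?t = "1 / sqrt (real n)"
    have t2: "?t\<^sup>2 = 1 / real n" using n by (simp add: power_divide)
    have "norm (char (distr (N n) borel (Y n)) ?t - (1 - ?t\<^sup>2 * v n / 2))
        \<le> (?t\<^sup>2 / 6) * (\<integral>x. min (6 * (Y n x)\<^sup>2) (\<bar>?t\<bar> * \<bar>Y n x\<bar> ^ 3) \<partial>N n)"
      by (rule N.char_approx3') (use i1 i2 m in \<open>auto simp: v_def\<close>)
    also have "(\<integral>x. min (6 * (Y n x)\<^sup>2) (\<bar>?t\<bar> * \<bar>Y n x\<bar> ^ 3) \<partial>N n) \<le> (\<integral>x. ?t * (1 + Y n x ^ 4) \<partial>N n)"
    proof (rule integral_mono)
      show "integrable (N n) (\<lambda>x. min (6 * (Y n x)\<^sup>2) (\<bar>?t\<bar> * \<bar>Y n x\<bar> ^ 3))"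
        by (rule Bochner_Integration.integrable_bound[OF integrable_mult_right[OF i2[of n], of 6]])
          (auto simp: min_def)
      show "integrable (N n) (\<lambda>x. ?t * (1 + Y n x ^ 4))" using i4[of n] by simp
      fix x
      have "\<bar>Y n x\<bar> ^ 3 \<le> 1 + Y n x ^ 4"
      proof (cases "\<bar>Y n x\<bar> \<le> 1")
        case True
        then have "\<bar>Y n x\<bar> ^ 3 \<le> 1" by (simp add: power_le_one)
        moreover have "0 \<le> Y n x ^ 4" by simp
        ultimately show ?thesis by linarith
      next
        case False
        then have "\<bar>Y n x\<bar> ^ 3 \<le> \<bar>Y n x\<bar> ^ 4" by (intro power_increasing) auto
        then show ?thesis by (simp add: power_abs)
      qed
      then have "\<bar>?t\<bar> * \<bar>Y n x\<bar> ^ 3 \<le> ?t * (1 + Y n x ^ 4)"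
        by (simp add: divide_right_mono)
      then show "min (6 * (Y n x)\<^sup>2) (\<bar>?t\<bar> * \<bar>Y n x\<bar> ^ 3) \<le> ?t * (1 + Y n x ^ 4)" by linarith
    qed
    also have "(\<integral>x. ?t * (1 + Y n x ^ 4) \<partial>N n) \<le> ?t * (1 + b)"
    proof -
      have "(\<integral>x. ?t * (1 + Y n x ^ 4) \<partial>N n) = ?t * (1 + (\<integral>x. Y n x ^ 4 \<partial>N n))"
        using i4[of n] N.prob_space[of n] by simp
      also have "\<dots> \<le> ?t * (1 + b)" using m4[of n] by (intro mult_left_mono) auto
      finally show ?thesis .
    qed
    finally have 1: "norm (char (distr (N n) borel (Y n)) ?t - (1 - ?t\<^sup>2 * v n / 2)) \<le> (?t\<^sup>2 / 6) * (?t * (1 + b))"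
      by (simp add: mult_left_mono)
    have "char (distr (N n) borel (Y n)) ?t = \<phi> n"
      unfolding char_def \<phi>_def by (subst integral_distr) auto
    moreover have "complex_of_real (1 - ?t\<^sup>2 * v n / 2) = 1 - ?t\<^sup>2 * v n / 2" by simp
    ultimately have 2: "norm (\<phi> n - complex_of_real (1 - v n / (2 * real n))) \<le> (1 + b) / (6 * real n * sqrt (real n))"
      using 1 unfolding t2 by (simp add: mult_ac)
    from exp_minus_quadratic[of "v n / (2 * real n)"] have "norm (complex_of_real (1 - v n / (2 * real n)) - \<psi> n) \<le> (v n)\<^sup>2 / (8 * (real n)\<^sup>2)"
      using v0[of n] unfolding \<psi>_def of_real_diff[symmetric] norm_of_real
      by (simp add: power_divide power_mult_distrib)
    with 2 show ?thesis
      using norm_triangle_ineq[of "\<phi> n - complex_of_real (1 - v n / (2 * real n))" "complex_of_real (1 - v n / (2 * real n)) - \<psi> n"]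
      by simp
  qed
  have n1: "norm (\<phi> n) \<le> 1" for n
  proof -
    have "norm (\<phi> n) \<le> (\<integral>x. norm (iexp (Y n x / sqrt (real n))) \<partial>N n)"
      unfolding \<phi>_def by (rule integral_norm_bound)
    then show ?thesis unfolding norm_exp_i_times by (simp add: N.prob_space)
  qed
  have n2: "norm (\<psi> n) \<le> 1" for n unfolding \<psi>_def norm_of_real using v0[of n] by simp
  have "(\<lambda>n. \<phi> n ^ n - \<psi> n ^ n) \<longlonglongrightarrow> 0"
  proof (rule Lim_null_comparison)
    show "\<forall>\<^sub>F n in sequentially. norm (\<phi> n ^ n - \<psi> n ^ n) \<le> (1 + b) / 6 * (1 / sqrt (real n)) + (v n)\<^sup>2 / 8 * (1 / real n)"
      using eventually_gt_at_top[of 0]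
    proof eventually_elim
      case (elim n)
      have "norm (\<phi> n ^ n - \<psi> n ^ n) \<le> real n * norm (\<phi> n - \<psi> n)"
        by (rule norm_power_diff[OF n1 n2])
      also have "\<dots> \<le> real n * ((1 + b) / (6 * real n * sqrt (real n)) + (v n)\<^sup>2 / (8 * (real n)\<^sup>2))"
        using app[OF elim] by (rule mult_left_mono) simp
      also have "\<dots> = (1 + b) / 6 * (1 / sqrt (real n)) + (v n)\<^sup>2 / 8 * (1 / real n)"
        using elim by (simp add: field_simps power2_eq_square)
      finally show ?case .
    qed
    have l: "(\<lambda>n. 1 / sqrt (real n)) \<longlonglongrightarrow> 0" "(\<lambda>n. 1 / real n) \<longlonglongrightarrow> 0"
      by real_asymp+
    have "(\<lambda>n. (1 + b) / 6 * (1 / sqrt (real n)) + (v n)\<^sup>2 / 8 * (1 / real n)) \<longlonglongrightarrow> (1 + b) / 6 * 0 + s\<^sup>2 / 8 * 0"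
      using s[folded v_def] by (intro tendsto_add tendsto_mult tendsto_const tendsto_divide tendsto_power l) auto
    then show "(\<lambda>n. (1 + b) / 6 * (1 / sqrt (real n)) + (v n)\<^sup>2 / 8 * (1 / real n)) \<longlonglongrightarrow> 0"
      by simp
  qed
  moreover have "(\<lambda>n. \<psi> n ^ n) \<longlonglongrightarrow> complex_of_real (exp (- s / 2))"
  proof (rule Lim_transform_eventually)
    show "(\<lambda>n. complex_of_real (exp (- v n / 2))) \<longlonglongrightarrow> complex_of_real (exp (- s / 2))"
      using s[folded v_def] by (intro tendsto_of_real tendsto_exp tendsto_divide tendsto_minus tendsto_const) auto
    have pw: "exp (- v n / 2) = exp (- (v n / (2 * real n))) ^ n" if "n > 0" for n
      unfolding exp_of_nat_mult[symmetric] using that by simp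
    show "\<forall>\<^sub>F n in sequentially. complex_of_real (exp (- v n / 2)) = \<psi> n ^ n"
      unfolding \<psi>_def of_real_power[symmetric]
      by (rule eventually_mono[OF eventually_gt_at_top[of 0]]) (simp only: pw)
  qed
  ultimately have "(\<lambda>n. (\<phi> n ^ n - \<psi> n ^ n) + \<psi> n ^ n) \<longlonglongrightarrow> 0 + complex_of_real (exp (- s / 2))"
    by (rule tendsto_add)
  then show ?thesis by (simp add: \<phi>_def)
qed

section \<open>Growth of the score and projections in L^2(Q)\<close>

lemma pos_op_bound:
  assumes "pos_op C" obtains c where "c \<ge> 0" "\<And>f. C f \<bullet> f \<le> c * (norm f)\<^sup>2"
proof -
  interpret bounded_linear C using assms by (simp add: pos_op_def)
  obtain K where K: "K \<ge> 0" "\<And>f. norm (C f) \<le> norm f * K" using nonneg_bounded by blast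
  show ?thesis
  proof (rule that[OF K(1)])
    fix f
    have "C f \<bullet> f \<le> norm (C f) * norm f" by (rule norm_cauchy_schwarz)
    also have "\<dots> \<le> (norm f * K) * norm f" using K(2) by (rule mult_right_mono) simp
    finally show "C f \<bullet> f \<le> K * (norm f)\<^sup>2" by (simp add: power2_eq_square mult_ac)
  qed
qed

lemma lin_score_abs_le:
  assumes "0 \<le> C f \<bullet> f"
  shows "\<bar>lin_score C f x\<bar> \<le> 3 + \<bar>x \<bullet> f\<bar> + ((x \<bullet> f)\<^sup>2 + C f \<bullet> f) / 2"
proof -
  have h1: "\<bar>cos (x \<bullet> f) + sin (x \<bullet> f)\<bar> \<le> 2"
    using abs_cos_le_one[of "x \<bullet> f"] abs_sin_le_one[of "x \<bullet> f"] by linarith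
  have h2: "\<bar>exp (- (C f \<bullet> f) / 2) * (1 + x \<bullet> f - ((x \<bullet> f)\<^sup>2 - C f \<bullet> f) / 2)\<bar>
      \<le> 1 * \<bar>1 + x \<bullet> f - ((x \<bullet> f)\<^sup>2 - C f \<bullet> f) / 2\<bar>"
    unfolding abs_mult using assms by (intro mult_right_mono) auto
  have "\<bar>1 + u - (s - a) / 2\<bar> \<le> 1 + \<bar>u\<bar> + (s + a) / 2" if "0 \<le> s" "0 \<le> a" for u s a :: real
  proof (rule abs_leI)
    show "1 + u - (s - a) / 2 \<le> 1 + \<bar>u\<bar> + (s + a) / 2"
      using that abs_ge_self[of u] by (simp add: field_simps)
    show "- (1 + u - (s - a) / 2) \<le> 1 + \<bar>u\<bar> + (s + a) / 2"
      using that abs_ge_minus_self[of u] by (simp add: field_simps)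
  qed
  from this[of "(x \<bullet> f)\<^sup>2" "C f \<bullet> f" "x \<bullet> f"] assms
  have h3: "1 * \<bar>1 + x \<bullet> f - ((x \<bullet> f)\<^sup>2 - C f \<bullet> f) / 2\<bar> \<le> 1 + \<bar>x \<bullet> f\<bar> + ((x \<bullet> f)\<^sup>2 + C f \<bullet> f) / 2" by simp
  show ?thesis
    using order_trans[OF abs_triangle_ineq4 add_mono[OF h1 order_trans[OF h2 h3]]]
    by (simp add: lin_score_def)
qed

text \<open>The constant depends on \<open>x\<close>, but quadratic growth in f is what membership
  in L^2(Q) asks for when the norm has a fourth moment.\<close>

lemma lin_score_growth:
  assumes "pos_op C"
  obtains B where "\<And>f. \<bar>lin_score C f x\<bar> \<le> B * (1 + (norm f)\<^sup>2)"
proof -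
  obtain c where c: "c \<ge> 0" "\<And>f. C f \<bullet> f \<le> c * (norm f)\<^sup>2" using pos_op_bound[OF assms] by blast
  have "\<bar>lin_score C f x\<bar> \<le> (4 + (norm x)\<^sup>2 + c) * (1 + (norm f)\<^sup>2)" for f
  proof -
    have xf: "\<bar>x \<bullet> f\<bar> \<le> norm x * norm f" by (rule Cauchy_Schwarz_ineq2)
    then have xf2: "(x \<bullet> f)\<^sup>2 \<le> (norm x)\<^sup>2 * (norm f)\<^sup>2"
      using power_mono[OF xf, of 2] by (simp add: power_mult_distrib)
    have "\<bar>x \<bullet> f\<bar> \<le> 1 + (x \<bullet> f)\<^sup>2 / 2"
      using sum_squares_bound[of 1 "\<bar>x \<bullet> f\<bar>"] by simp
    then have "\<bar>lin_score C f x\<bar> \<le> 4 + (x \<bullet> f)\<^sup>2 + (C f \<bullet> f) / 2"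
      using lin_score_abs_le[of C f x] pos_op_bilinear(6)[OF assms, of f] by (simp add: add_divide_distrib)
    also have "\<dots> \<le> 4 + (norm x)\<^sup>2 * (norm f)\<^sup>2 + c * (norm f)\<^sup>2"
      using xf2 c(2)[of f] mult_nonneg_nonneg[OF c(1) zero_le_power2[of "norm f"]] pos_op_bilinear(6)[OF assms, of f] by linarith
    also have "\<dots> \<le> (4 + (norm x)\<^sup>2 + c) * (1 + (norm f)\<^sup>2)"
      using c(1) by (simp add: algebra_simps)
    finally show ?thesis .
  qed
  then show ?thesis by (rule that)
qed

locale weight_measure = prob_space Q for Q :: "L2I measure" +
  assumes sets_Q [measurable_cong]: "sets Q = sets borel"
    and norm4: "integrable Q (\<lambda>f. norm f ^ 4)"
begin

lemma growth_l2fun: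
  assumes [measurable]: "u \<in> borel_measurable borel" and u: "\<And>f. \<bar>u f\<bar> \<le> B * (1 + (norm f)\<^sup>2)"
  shows "u \<in> l2fun Q"
proof (rule l2funI)
  show "integrable Q (\<lambda>f. (u f)\<^sup>2)"
  proof (rule Bochner_Integration.integrable_bound)
    show "integrable Q (\<lambda>f. B\<^sup>2 * (2 + 2 * norm f ^ 4))" using norm4 by simp
    show "AE f in Q. norm ((u f)\<^sup>2) \<le> norm (B\<^sup>2 * (2 + 2 * norm f ^ 4))"
    proof (rule AE_I2)
      fix f
      have "(u f)\<^sup>2 \<le> (B * (1 + (norm f)\<^sup>2))\<^sup>2"
        using power_mono[OF u[of f], of 2] by simp
      also have "\<dots> = B\<^sup>2 * (1 + (norm f)\<^sup>2)\<^sup>2" by (simp add: power_mult_distrib)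
      also have "\<dots> \<le> B\<^sup>2 * (2 + 2 * norm f ^ 4)"
        using square_add_le[of 1 "(norm f)\<^sup>2"] by (intro mult_left_mono) (simp_all flip: power_mult)
      finally show "norm ((u f)\<^sup>2) \<le> norm (B\<^sup>2 * (2 + 2 * norm f ^ 4))" by simp
    qed
  qed measurable
qed measurable

lemma lin_score_l2fun: "pos_op C \<Longrightarrow> (\<lambda>f. lin_score C f x) \<in> l2fun Q"
  using lin_score_growth[of C x] growth_l2fun[of "\<lambda>f. lin_score C f x"]
    lin_score_measurable[of C "\<lambda>f. f" borel "\<lambda>_. x"] by auto

end

text \<open>One observation \<open>x\<close> with Gaussian law \<open>N\<close>, viewed through its score \<open>f \<mapsto> lin_score C f x\<close>
  as a random element of \<open>L\<^sup>2(Q)\<close>.\<close>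

locale gaussian_score = hilbert_gaussian N C + Q: weight_measure Q for N C Q
begin

sublocale NQ: pair_prob_space N Q ..

definition proj :: "(L2I \<Rightarrow> real) \<Rightarrow> L2I \<Rightarrow> real" where
  "proj u x = l2inner Q (\<lambda>f. lin_score C f x) u"

lemma score_measurable: "(\<lambda>z. lin_score C (snd z) (fst z)) \<in> borel_measurable (N \<Otimes>\<^sub>M Q)"
  by (rule lin_score_measurable[OF pos]) measurable

lemma limit_kernel_01: "0 \<le> limit_kernel C f f" "limit_kernel C f f \<le> 1" "\<bar>limit_kernel C f g\<bar> \<le> 1"
  using psd_kernel_on_nonneg[OF psd_limit_kernel] limit_kernel_diag_le_one[OF pos]
    limit_kernel_abs_le_one[OF pos psd_limit_kernel] by auto

lemma limit_kernel_measurable: "(\<lambda>z. limit_kernel C (fst z) (snd z)) \<in> borel_measurable (borel \<Otimes>\<^sub>M borel)"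
proof -
  have [measurable]: "C \<in> borel_measurable borel" by (rule pos_op_measurable[OF pos])
  show ?thesis unfolding limit_kernel_def Let_def by measurable
qed

lemma proj_measurable [measurable]: "u \<in> borel_measurable Q \<Longrightarrow> proj u \<in> borel_measurable N"
  unfolding proj_def[abs_def] l2inner_def
proof -
  assume [measurable]: "u \<in> borel_measurable Q"
  have [measurable]: "(\<lambda>(x, f). lin_score C f x) \<in> borel_measurable (N \<Otimes>\<^sub>M Q)"
    using score_measurable by (simp add: split_def)
  show "(\<lambda>x. \<integral>f. lin_score C f x * u f \<partial>Q) \<in> borel_measurable N" by measurable
qed

lemma integrable_score_square: "integrable (N \<Otimes>\<^sub>M Q) (\<lambda>z. (lin_score C (snd z) (fst z))\<^sup>2)"
proof -
  interpret QN: pair_prob_space Q N ..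
  have m: "(\<lambda>z. (lin_score C (fst z) (snd z))\<^sup>2) \<in> borel_measurable (Q \<Otimes>\<^sub>M N)"
    by (intro borel_measurable_power lin_score_measurable[OF pos]) measurable
  have [measurable]: "(\<lambda>f. limit_kernel C f f) \<in> borel_measurable Q"
    using measurable_compose[OF _ limit_kernel_measurable, of "\<lambda>f. (f, f)" Q] by simp
  have "integrable (Q \<Otimes>\<^sub>M N) (\<lambda>z. (lin_score C (fst z) (snd z))\<^sup>2)"
  proof (rule QN.Fubini_integrable[OF m])
    show "AE f in Q. integrable N (\<lambda>x. (lin_score C (fst (f, x)) (snd (f, x)))\<^sup>2)"
      using integrable_lin_score_mult by (simp add: power2_eq_square)
    have "(\<integral>x. norm ((lin_score C (fst (f, x)) (snd (f, x)))\<^sup>2) \<partial>N) = limit_kernel C f f" for f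
      using expectation_lin_score_mult[of f f] by (simp add: power2_eq_square)
    then show "integrable Q (\<lambda>f. \<integral>x. norm ((lin_score C (fst (f, x)) (snd (f, x)))\<^sup>2) \<partial>N)"
      using limit_kernel_01 by (simp add: Q.integrable_const_bound[where B=1])
  qed
  from QN.integrable_product_swap[OF this] show ?thesis by (simp add: split_def)
qed

lemma score_l2fun: "(\<lambda>z. lin_score C (snd z) (fst z)) \<in> l2fun (N \<Otimes>\<^sub>M Q)"
  by (rule l2funI[OF score_measurable integrable_score_square])

lemma tensor_l2fun:
  assumes G: "G \<in> l2fun N" and u: "u \<in> l2fun Q"
  shows "(\<lambda>z. G (fst z) * u (snd z)) \<in> l2fun (N \<Otimes>\<^sub>M Q)"
proof (rule l2funI)
  have [measurable]: "G \<in> borel_measurable N" "u \<in> borel_measurable Q" using G u by (auto dest: l2fun_measurable)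
  show "(\<lambda>z. G (fst z) * u (snd z)) \<in> borel_measurable (N \<Otimes>\<^sub>M Q)" by measurable
  show "integrable (N \<Otimes>\<^sub>M Q) (\<lambda>z. (G (fst z) * u (snd z))\<^sup>2)"
  proof (rule NQ.Fubini_integrable)
    show "integrable N (\<lambda>x. \<integral>y. norm ((G (fst (x, y)) * u (snd (x, y)))\<^sup>2) \<partial>Q)"
      using l2fun_integrable_square[OF G] by (simp add: power_mult_distrib)
    show "AE x in N. integrable Q (\<lambda>y. (G (fst (x, y)) * u (snd (x, y)))\<^sup>2)"
      using l2fun_integrable_square[OF u] by (simp add: power_mult_distrib)
  qed measurable
qed

text \<open>A Fubini exchange with a free factor \<open>G\<close>. The choice 1 gives the mean of a
  projection; a projection and then a score in place of \<open>G\<close> give its variance.\<close>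

lemma expectation_mult_proj:
  assumes G: "G \<in> l2fun N" and u: "u \<in> l2fun Q"
  shows "integrable N (\<lambda>x. G x * proj u x)"
    and "expectation (\<lambda>x. G x * proj u x) = (\<integral>f. u f * expectation (\<lambda>x. G x * lin_score C f x) \<partial>Q)"
proof -
  have i: "integrable (N \<Otimes>\<^sub>M Q) (\<lambda>z. lin_score C (snd z) (fst z) * (G (fst z) * u (snd z)))"
    by (rule l2fun_integrable_mult[OF score_l2fun tensor_l2fun[OF G u]])
  have e: "(\<integral>f. lin_score C f x * (G x * u f) \<partial>Q) = G x * proj u x" for x
    unfolding proj_def l2inner_def by (simp add: mult_ac flip: integral_mult_right_zero)
  show "integrable N (\<lambda>x. G x * proj u x)"
    using NQ.integrable_fst'[OF i] by (simp add: e)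
  have "expectation (\<lambda>x. G x * proj u x) = (\<integral>x. (\<integral>f. lin_score C f x * (G x * u f) \<partial>Q) \<partial>N)" by (simp add: e)
  also have "\<dots> = (\<integral>f. (\<integral>x. lin_score C f x * (G x * u f) \<partial>N) \<partial>Q)"
    by (rule NQ.Fubini_integral[symmetric]) (use i in \<open>simp add: split_def\<close>)
  also have "\<dots> = (\<integral>f. u f * expectation (\<lambda>x. G x * lin_score C f x) \<partial>Q)"
    by (simp add: mult_ac flip: integral_mult_right_zero)
  finally show "expectation (\<lambda>x. G x * proj u x) = (\<integral>f. u f * expectation (\<lambda>x. G x * lin_score C f x) \<partial>Q)" .
qed

lemma one_l2fun: "(\<lambda>_. 1) \<in> l2fun N"
  by (simp add: l2fun_def)

lemma expectation_proj:
  assumes u: "u \<in> l2fun Q"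
  shows "expectation (proj u) = 0"
  using expectation_mult_proj(2)[OF one_l2fun u] expectation_lin_score by simp

text \<open>Jensen for the inner integral gives the fourth moment of a projection.\<close>

lemma proj_fourth:
  assumes u: "u \<in> l2fun Q"
  shows "integrable N (\<lambda>x. proj u x ^ 4)" "expectation (\<lambda>x. proj u x ^ 4) \<le> (l2norm Q u) ^ 4 * score_const"
proof -
  interpret QN: pair_prob_space Q N ..
  have [measurable]: "u \<in> borel_measurable Q" using u by (rule l2fun_measurable)
  have m: "(\<lambda>z. (lin_score C (fst z) (snd z)) ^ 4) \<in> borel_measurable (Q \<Otimes>\<^sub>M N)"
    by (intro borel_measurable_power lin_score_measurable[OF pos]) measurable
  have m2: "(\<lambda>(f, x). (lin_score C f x) ^ 4) \<in> borel_measurable (Q \<Otimes>\<^sub>M N)"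
    using m by (simp add: split_def)
  have iE: "integrable Q (\<lambda>f. expectation (\<lambda>x. lin_score C f x ^ 4))"
  proof (rule Q.integrable_const_bound[where B=score_const])
    show "(\<lambda>f. expectation (\<lambda>x. lin_score C f x ^ 4)) \<in> borel_measurable Q"
      using borel_measurable_lebesgue_integral[OF m2] .
  qed (use expectation_lin_score_4 in auto)
  have "integrable (Q \<Otimes>\<^sub>M N) (\<lambda>z. (lin_score C (fst z) (snd z)) ^ 4)"
    by (rule QN.Fubini_integrable[OF m]) (use integrable_lin_score_4 iE in auto)
  from QN.integrable_product_swap[OF this]
  have i: "integrable (N \<Otimes>\<^sub>M Q) (\<lambda>z. (lin_score C (snd z) (fst z)) ^ 4)" by (simp add: split_def)
  have le: "AE x in N. proj u x ^ 4 \<le> (l2norm Q u) ^ 4 * (\<integral>f. lin_score C f x ^ 4 \<partial>Q)"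
    using NQ.AE_integrable_fst'[OF i]
  proof eventually_elim
    case (elim x)
    then have i4: "integrable Q (\<lambda>f. lin_score C f x ^ 4)" by simp
    have s: "(\<lambda>f. lin_score C f x) \<in> l2fun Q" by (rule Q.lin_score_l2fun[OF pos])
    have i2: "integrable Q (\<lambda>f. (lin_score C f x)\<^sup>2)" by (rule l2fun_integrable_square[OF s])
    have "\<bar>proj u x\<bar> \<le> l2norm Q (\<lambda>f. lin_score C f x) * l2norm Q u"
      unfolding proj_def by (rule l2inner_Cauchy_Schwarz[OF s u])
    then have "\<bar>proj u x\<bar> ^ 4 \<le> (l2norm Q (\<lambda>f. lin_score C f x) * l2norm Q u) ^ 4"
      by (rule power_mono) simp
    also have "\<dots> = ((l2norm Q (\<lambda>f. lin_score C f x))\<^sup>2)\<^sup>2 * l2norm Q u ^ 4"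
      by (simp add: power_mult_distrib flip: power_mult)
    also have "((l2norm Q (\<lambda>f. lin_score C f x))\<^sup>2)\<^sup>2 \<le> (\<integral>f. lin_score C f x ^ 4 \<partial>Q)"
    proof -
      have "(\<integral>f. (lin_score C f x)\<^sup>2 \<partial>Q)\<^sup>2 \<le> (\<integral>f. ((lin_score C f x)\<^sup>2)\<^sup>2 \<partial>Q)"
        using Q.variance_positive[of "\<lambda>f. (lin_score C f x)\<^sup>2"] Q.variance_eq[of "\<lambda>f. (lin_score C f x)\<^sup>2"] i2 i4
        by simp
      then show ?thesis unfolding l2norm_square by simp
    qed
    finally show ?case by (simp add: power_abs mult.commute mult_left_mono mult_right_mono)
  qed
  have ir: "integrable N (\<lambda>x. (l2norm Q u) ^ 4 * (\<integral>f. lin_score C f x ^ 4 \<partial>Q))"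
    using NQ.integrable_fst'[OF i] by simp
  show i4: "integrable N (\<lambda>x. proj u x ^ 4)"
    by (rule Bochner_Integration.integrable_bound[OF ir]) (use le in \<open>auto elim!: eventually_mono\<close>)
  have "expectation (\<lambda>x. proj u x ^ 4) \<le> expectation (\<lambda>x. (l2norm Q u) ^ 4 * (\<integral>f. lin_score C f x ^ 4 \<partial>Q))"
    by (rule integral_mono_AE[OF i4 ir le])
  also have "\<dots> = (l2norm Q u) ^ 4 * (\<integral>f. expectation (\<lambda>x. lin_score C f x ^ 4) \<partial>Q)"
    using NQ.Fubini_integral[of "\<lambda>x f. lin_score C f x ^ 4"] i by (simp add: split_def)
  also have "\<dots> \<le> (l2norm Q u) ^ 4 * (\<integral>f. score_const \<partial>Q)"
    by (intro mult_left_mono integral_mono iE) (auto simp: expectation_lin_score_4)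
  finally show "expectation (\<lambda>x. proj u x ^ 4) \<le> (l2norm Q u) ^ 4 * score_const"
    using Q.prob_space by simp
qed

lemma proj_l2fun: "u \<in> l2fun Q \<Longrightarrow> proj u \<in> l2fun N"
  using fourth_moment_imp_integrable_power[OF proj_measurable proj_fourth(1), of u 2] l2fun_measurable
  by (auto simp: l2fun_def)

lemma proj_square:
  assumes u: "u \<in> l2fun Q"
  shows "expectation (\<lambda>x. (proj u x)\<^sup>2) = (\<integral>f. (\<integral>g. limit_kernel C f g * u f * u g \<partial>Q) \<partial>Q)"
proof -
  have hl2: "lin_score C f \<in> l2fun N" for f
    using integrable_lin_score_mult[of f f] integrable_lin_score[of f] by (simp add: l2fun_def power2_eq_square)
  have "expectation (\<lambda>x. (proj u x)\<^sup>2) = (\<integral>f. u f * expectation (\<lambda>x. proj u x * lin_score C f x) \<partial>Q)"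
    using expectation_mult_proj(2)[OF proj_l2fun[OF u] u] by (simp add: power2_eq_square)
  also have "\<dots> = (\<integral>f. u f * (\<integral>g. u g * limit_kernel C f g \<partial>Q) \<partial>Q)"
    using expectation_mult_proj(2)[OF hl2 u] by (simp add: mult.commute expectation_lin_score_mult)
  also have "\<dots> = (\<integral>f. (\<integral>g. limit_kernel C f g * u f * u g \<partial>Q) \<partial>Q)"
    by (simp add: mult_ac flip: integral_mult_right_zero)
  finally show ?thesis .
qed

end

section \<open>Arrays of Gaussian samples with converging covariances\<close>

lemma l2inner_self: "l2inner M f f = (l2norm M f)\<^sup>2"
  unfolding l2norm_square by (simp add: l2inner_def power2_eq_square)

text \<open>This describes one fixed realization of the data: \<open>N n\<close> is the law of a
  single bootstrap observation, and the bound \<open>c\<close> may depend on the realization. The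
  bootstrap samples are the only randomness left.\<close>

locale bootstrap_array = weight_measure Q for Q :: "L2I measure" +
  fixes N :: "nat \<Rightarrow> L2I measure" and C :: "nat \<Rightarrow> L2I \<Rightarrow> L2I" and C0 :: "L2I \<Rightarrow> L2I" and c :: real
  assumes gauss: "\<And>n. hilbert_gaussian (N n) (C n)"
    and pos0: "pos_op C0"
    and bd: "\<And>n f. C n f \<bullet> f \<le> c * (norm f)\<^sup>2"
    and conv: "\<And>f g. (\<lambda>n. C n f \<bullet> g) \<longlonglongrightarrow> C0 f \<bullet> g"
begin

lemma gscore: "gaussian_score (N n) (C n) Q"
  using gauss[of n] weight_measure_axioms by (simp add: gaussian_score_def)

lemma posn: "pos_op (C n)"
  using gauss[of n] by (simp add: hilbert_gaussian_def hilbert_gaussian_axioms_def)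

lemma prob_N: "prob_space (N n)" and sets_Nn [measurable_cong]: "sets (N n) = sets borel"
  using gauss[of n] by (simp_all add: hilbert_gaussian_def hilbert_gaussian_axioms_def)

lemma kernel_tendsto: "(\<lambda>n. limit_kernel (C n) f g) \<longlonglongrightarrow> limit_kernel C0 f g"
  unfolding limit_kernel_def Let_def by (intro tendsto_intros conv) auto

text \<open>No Gaussian law with operator \<open>C0\<close> is at hand, so positivity is inherited
  from the kernels of \<open>C n\<close> as a pointwise limit.\<close>

lemma psd0: "psd_kernel_on UNIV (limit_kernel C0)"
  unfolding psd_kernel_on_def
proof (intro conjI ballI allI impI)
  note psdn = hilbert_gaussian.psd_limit_kernel[OF gauss]
  show "limit_kernel C0 f g = limit_kernel C0 g f" for f g
    using pos_op_bilinear(5)[OF pos0, of f g] by (simp add: limit_kernel_def Let_def add.commute)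
  fix m :: nat and f :: "nat \<Rightarrow> L2I" and a :: "nat \<Rightarrow> real"
  have l: "(\<lambda>n. \<Sum>i<m. \<Sum>j<m. a i * a j * limit_kernel (C n) (f i) (f j)) \<longlonglongrightarrow> (\<Sum>i<m. \<Sum>j<m. a i * a j * limit_kernel C0 (f i) (f j))"
    by (intro tendsto_sum tendsto_mult tendsto_const kernel_tendsto)
  show "0 \<le> (\<Sum>i<m. \<Sum>j<m. a i * a j * limit_kernel C0 (f i) (f j))"
    by (rule LIMSEQ_le_const[OF l]) (use psd_kernel_onD[OF psdn] in blast)
qed

lemma kernel_continuous: "continuous_on UNIV (\<lambda>f. limit_kernel C0 f d)" "continuous_on UNIV (\<lambda>d. limit_kernel C0 f d)"
  "continuous_on UNIV (\<lambda>d. limit_kernel C0 d d)"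
proof -
  note [continuous_intros] = continuous_on_compose2[OF pos_op_continuous[OF pos0, of UNIV]]
  show "continuous_on UNIV (\<lambda>f. limit_kernel C0 f d)" "continuous_on UNIV (\<lambda>d. limit_kernel C0 f d)"
    "continuous_on UNIV (\<lambda>d. limit_kernel C0 d d)"
    unfolding limit_kernel_def Let_def by (intro continuous_intros; simp)+
qed

text \<open>Continuity of the kernel makes a countable dense subset of the Hilbert space dense for
  the kernel distance as well.\<close>

lemma kernel_series_exists: "\<exists>\<phi>. kernel_series Q (limit_kernel C0) \<phi>"
proof -
  obtain D :: "L2I set" where D: "countable D" "\<And>X. open X \<Longrightarrow> X \<noteq> {} \<Longrightarrow> \<exists>d\<in>D. d \<in> X"
    using countable_dense_exists by blast
  have "D \<noteq> {}" using D(2)[of UNIV] by auto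
  then have r: "range (from_nat_into D) = D" using D(1) by (rule range_from_nat_into)
  have dense: "\<exists>i. limit_kernel C0 f f - 2 * limit_kernel C0 f (from_nat_into D i) + limit_kernel C0 (from_nat_into D i) (from_nat_into D i) < e"
    if e: "e > 0" for f e
  proof -
    have "open {d. limit_kernel C0 f f - 2 * limit_kernel C0 f d + limit_kernel C0 d d < e}"
      by (intro open_Collect_less continuous_intros kernel_continuous)
    moreover have "f \<in> {d. limit_kernel C0 f f - 2 * limit_kernel C0 f d + limit_kernel C0 d d < e}"
      using e by simp
    ultimately obtain d where d: "d \<in> D" "limit_kernel C0 f f - 2 * limit_kernel C0 f d + limit_kernel C0 d d < e"
      using D(2) by blast
    moreover obtain i where "d = from_nat_into D i" using d(1) r by (metis imageE)
    ultimately show ?thesis by blast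
  qed
  obtain a :: "nat \<Rightarrow> nat \<Rightarrow> real" where a: "\<And>f g. (\<lambda>i. (\<Sum>j\<le>i. a i j * limit_kernel C0 f (from_nat_into D j)) *
      (\<Sum>j\<le>i. a i j * limit_kernel C0 g (from_nat_into D j))) sums limit_kernel C0 f g"
    by (rule kernel_expansion[OF psd0, of "from_nat_into D"]) (use dense in blast)+
  have "kernel_series Q (limit_kernel C0) (\<lambda>i f. \<Sum>j\<le>i. a i j * limit_kernel C0 f (from_nat_into D j))"
  proof unfold_locales
    show "sets Q = sets borel" by (rule sets_Q)
    show "(\<lambda>f. \<Sum>j\<le>i. a i j * limit_kernel C0 f (from_nat_into D j)) \<in> borel_measurable borel" for i
      by (intro borel_measurable_continuous_onI continuous_intros kernel_continuous)
    show "limit_kernel C0 f f \<le> 1" for f by (rule limit_kernel_diag_le_one[OF pos0])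
  qed (rule a)
  then show ?thesis by blast
qed

lemma kernel_abs_le: "\<bar>limit_kernel (C n) f g\<bar> \<le> 1" "\<bar>limit_kernel C0 f g\<bar> \<le> 1"
  using gaussian_score.limit_kernel_01(3)[OF gscore] limit_kernel_abs_le_one[OF pos0 psd0] by auto

lemma kernel_measurable:
  assumes "pos_op B"
  shows "(\<lambda>(f, g). limit_kernel B f g) \<in> borel_measurable (borel \<Otimes>\<^sub>M borel)"
proof -
  have [measurable]: "B \<in> borel_measurable borel" by (rule pos_op_measurable[OF assms])
  show ?thesis unfolding limit_kernel_def Let_def split_def by measurable
qed

lemma form_tendsto:
  assumes u: "u \<in> l2fun Q"
  shows "(\<lambda>n. \<integral>f. (\<integral>g. limit_kernel (C n) f g * u f * u g \<partial>Q) \<partial>Q) \<longlonglongrightarrow> (\<integral>f. (\<integral>g. limit_kernel C0 f g * u f * u g \<partial>Q) \<partial>Q)"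
proof -
  have [measurable]: "u \<in> borel_measurable Q" using u by (rule l2fun_measurable)
  have iu: "integrable Q u" using u by (rule l2fun_integrable)
  note [measurable] = kernel_measurable[OF posn] kernel_measurable[OF pos0]
  have b: "norm (limit_kernel (C n) f g * u f * u g) \<le> \<bar>u f\<bar> * \<bar>u g\<bar>" for n f g
    using mult_right_mono[OF kernel_abs_le(1)[of n f g], of "\<bar>u f\<bar> * \<bar>u g\<bar>"] by (simp add: abs_mult mult.assoc)
  have inner: "(\<lambda>n. \<integral>g. limit_kernel (C n) f g * u f * u g \<partial>Q) \<longlonglongrightarrow> (\<integral>g. limit_kernel C0 f g * u f * u g \<partial>Q)" for f
  proof (rule integral_dominated_convergence[where w="\<lambda>g. \<bar>u f\<bar> * \<bar>u g\<bar>"])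
    show "AE g in Q. (\<lambda>n. limit_kernel (C n) f g * u f * u g) \<longlonglongrightarrow> limit_kernel C0 f g * u f * u g"
      by (intro AE_I2 tendsto_mult tendsto_const kernel_tendsto)
  qed (use b iu in \<open>auto\<close>)
  show ?thesis
  proof (rule integral_dominated_convergence[where w="\<lambda>f. \<bar>u f\<bar> * (\<integral>g. \<bar>u g\<bar> \<partial>Q)"])
    show "AE f in Q. (\<lambda>n. \<integral>g. limit_kernel (C n) f g * u f * u g \<partial>Q) \<longlonglongrightarrow> (\<integral>g. limit_kernel C0 f g * u f * u g \<partial>Q)"
      by (intro AE_I2 inner)
    show "AE f in Q. norm (\<integral>g. limit_kernel (C n) f g * u f * u g \<partial>Q) \<le> \<bar>u f\<bar> * (\<integral>g. \<bar>u g\<bar> \<partial>Q)" for n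
    proof (rule AE_I2)
      fix f
      have "norm (\<integral>g. limit_kernel (C n) f g * u f * u g \<partial>Q) \<le> (\<integral>g. norm (limit_kernel (C n) f g * u f * u g) \<partial>Q)"
        by (rule integral_norm_bound)
      also have "\<dots> \<le> (\<integral>g. \<bar>u f\<bar> * \<bar>u g\<bar> \<partial>Q)"
      proof (rule integral_mono)
        have "integrable Q (\<lambda>g. limit_kernel (C n) f g * u f * u g)"
          by (rule Bochner_Integration.integrable_bound[where f="\<lambda>g. \<bar>u f\<bar> * \<bar>u g\<bar>"]) (use b iu in auto)
        then show "integrable Q (\<lambda>g. norm (limit_kernel (C n) f g * u f * u g))" by (rule integrable_norm)
      qed (use b iu in auto)
      finally show "norm (\<integral>g. limit_kernel (C n) f g * u f * u g \<partial>Q) \<le> \<bar>u f\<bar> * (\<integral>g. \<bar>u g\<bar> \<partial>Q)" by simp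
    qed
    show "integrable Q (\<lambda>f. \<bar>u f\<bar> * (\<integral>g. \<bar>u g\<bar> \<partial>Q))" using iu by simp
  qed measurable
qed

lemma diag_measurable: "pos_op B \<Longrightarrow> (\<lambda>f. limit_kernel B f f) \<in> borel_measurable Q"
  using measurable_compose[OF _ kernel_measurable, of "\<lambda>f. (f, f)" Q B] by simp

lemma trace_tendsto: "(\<lambda>n. \<integral>f. limit_kernel (C n) f f \<partial>Q) \<longlonglongrightarrow> (\<integral>f. limit_kernel C0 f f \<partial>Q)"
  by (rule integral_dominated_convergence[where w="\<lambda>_. 1"])
    (use kernel_tendsto kernel_abs_le diag_measurable[OF posn] diag_measurable[OF pos0] in auto)

definition score_sum :: "nat \<Rightarrow> (nat \<Rightarrow> L2I) \<Rightarrow> L2I \<Rightarrow> real" where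
  "score_sum n x f = (\<Sum>j<n. lin_score (C n) f (x j)) / sqrt (real n)"

abbreviation sample :: "nat \<Rightarrow> (nat \<Rightarrow> L2I) measure" where
  "sample n \<equiv> PiM {..<n} (\<lambda>_. N n)"

lemma prob_sample: "prob_space (sample n)"
  by (rule prob_space_PiM[OF prob_N])

lemma sample_component [measurable]: "j < n \<Longrightarrow> (\<lambda>x. x j) \<in> borel_measurable (sample n)"
  using measurable_component_singleton[of j "{..<n}" "\<lambda>_. N n"] by (simp cong: measurable_cong_sets)

lemma score_sum_l2fun: "score_sum n x \<in> l2fun Q"
proof -
  have "(\<lambda>f. (1 / sqrt (real n)) * (\<Sum>j<n. lin_score (C n) f (x j))) \<in> l2fun Q"
    by (intro l2fun_scale l2fun_sum lin_score_l2fun posn) auto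
  then show ?thesis by (simp add: score_sum_def[abs_def])
qed

text \<open>At each f the variance of the normalised sum is that of a single score, so the expected
  squared norm is the trace of the kernel.\<close>

lemma score_sum_square:
  assumes n: "n > 0"
  shows "integrable (sample n \<Otimes>\<^sub>M Q) (\<lambda>z. (score_sum n (fst z) (snd z))\<^sup>2)"
    and "(\<integral>x. (\<integral>f. (score_sum n x f)\<^sup>2 \<partial>Q) \<partial>sample n) = (\<integral>f. limit_kernel (C n) f f \<partial>Q)"
proof -
  interpret P: prob_space "sample n" by (rule prob_sample)
  interpret G: gaussian_score "N n" "C n" Q by (rule gscore)
  interpret QP: pair_prob_space Q "sample n" ..
  interpret PQ: pair_prob_space "sample n" Q ..
  have hl2: "integrable (N n) (\<lambda>x. (lin_score (C n) f x)\<^sup>2)" for f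
    using G.integrable_lin_score_mult[of f f] by (simp add: power2_eq_square)
  have hm: "lin_score (C n) f \<in> borel_measurable (N n)" for f using G.integrable_lin_score[of f] by simp
  note nss = iid_normalised_sum_square[OF prob_N hm n hl2 G.expectation_lin_score]
  have E: "(\<integral>x. (score_sum n x f)\<^sup>2 \<partial>sample n) = limit_kernel (C n) f f" for f
    unfolding score_sum_def nss(2) using G.expectation_lin_score_mult[of f f] by (simp add: power2_eq_square)
  have "integrable (Q \<Otimes>\<^sub>M sample n) (\<lambda>z. (score_sum n (snd z) (fst z))\<^sup>2)"
  proof (rule QP.Fubini_integrable)
    show "(\<lambda>z. (score_sum n (snd z) (fst z))\<^sup>2) \<in> borel_measurable (Q \<Otimes>\<^sub>M sample n)"
      unfolding score_sum_def
      by (intro borel_measurable_power borel_measurable_divide borel_measurable_sum borel_measurable_const lin_score_measurable[OF posn]) measurable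
    show "AE f in Q. integrable (sample n) (\<lambda>x. (score_sum n (snd (f, x)) (fst (f, x)))\<^sup>2)"
      using nss(1) by (simp add: score_sum_def)
    have "integrable Q (\<lambda>f. limit_kernel (C n) f f)"
      by (rule integrable_const_bound[where B=1]) (use kernel_abs_le diag_measurable[OF posn] in auto)
    then show "integrable Q (\<lambda>f. \<integral>x. norm ((score_sum n (snd (f, x)) (fst (f, x)))\<^sup>2) \<partial>sample n)"
      by (simp add: E)
  qed
  from QP.integrable_product_swap[OF this]
  show i: "integrable (sample n \<Otimes>\<^sub>M Q) (\<lambda>z. (score_sum n (fst z) (snd z))\<^sup>2)" by (simp add: split_def)
  have "(\<integral>x. (\<integral>f. (score_sum n x f)\<^sup>2 \<partial>Q) \<partial>sample n) = (\<integral>f. (\<integral>x. (score_sum n x f)\<^sup>2 \<partial>sample n) \<partial>Q)"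
    by (rule PQ.Fubini_integral[symmetric]) (use i in \<open>simp add: split_def\<close>)
  then show "(\<integral>x. (\<integral>f. (score_sum n x f)\<^sup>2 \<partial>Q) \<partial>sample n) = (\<integral>f. limit_kernel (C n) f f \<partial>Q)"
    by (simp add: E)
qed

lemma integrable_score_sum_norm: "integrable (sample n) (\<lambda>x. \<integral>f. (score_sum n x f)\<^sup>2 \<partial>Q)"
proof (cases "n = 0")
  case True
  then show ?thesis by (simp add: score_sum_def)
next
  case False
  interpret P: prob_space "sample n" by (rule prob_sample)
  interpret PQ: pair_prob_space "sample n" Q ..
  show ?thesis using PQ.integrable_fst'[OF score_sum_square(1)] False by simp
qed

lemma score_sum_inner:
  assumes u: "u \<in> l2fun Q"
  shows "l2inner Q (score_sum n x) u = (\<Sum>j<n. gaussian_score.proj (C n) Q u (x j)) / sqrt (real n)"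
proof -
  have "l2inner Q (score_sum n x) u = (\<integral>f. (\<Sum>j<n. lin_score (C n) f (x j) * u f) / sqrt (real n) \<partial>Q)"
    unfolding l2inner_def score_sum_def by (simp add: sum_distrib_right)
  also have "\<dots> = (\<Sum>j<n. \<integral>f. lin_score (C n) f (x j) * u f \<partial>Q) / sqrt (real n)"
    unfolding integral_divide_zero
    by (subst Bochner_Integration.integral_sum) (auto intro!: l2fun_integrable_mult lin_score_l2fun posn u)
  finally show ?thesis by (simp add: gaussian_score.proj_def[OF gscore] l2inner_def)
qed

text \<open>The coordinates are taken along a Parseval frame, so that their squares sum to the
  squared norm. The same identity makes the squared norm of \<open>V\<close> measurable, as a limit
  of sums of squared functionals.\<close>

theorem score_sum_laplace_tendsto:
  fixes W :: "'w measure" and V :: "'w \<Rightarrow> L2I \<Rightarrow> real"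
  assumes cg: "centred_gaussian W Q V" and hk: "has_cov_kernel W Q V (limit_kernel C0)" and s: "s \<ge> 0"
  shows "(\<lambda>n. \<integral>x. exp (- s * (\<integral>f. (score_sum n x f)\<^sup>2 \<partial>Q)) \<partial>sample n) \<longlonglongrightarrow> (\<integral>w. exp (- s * (l2norm Q (V w))\<^sup>2) \<partial>W)"
    and "(\<lambda>w. (l2norm Q (V w))\<^sup>2) \<in> borel_measurable W"
proof -
  obtain \<phi> where "kernel_series Q (limit_kernel C0) \<phi>" using kernel_series_exists by blast
  then interpret KS: kernel_series Q "limit_kernel C0" \<phi> .
  obtain e :: "nat \<Rightarrow> L2I \<Rightarrow> real" where e: "\<And>k. e k \<in> l2fun Q"
    and parseval: "\<And>u v. u \<in> l2fun Q \<Longrightarrow> v \<in> l2fun Q \<Longrightarrow> (\<lambda>k. l2inner Q u (e k) * l2inner Q v (e k)) sums l2inner Q u v"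
    by (rule l2_parseval[OF finite_measure_axioms sets_Q]) blast
  note cgD = centred_gaussianD[OF cg hk]
  have W: "prob_space W" by (rule cgD(1)[OF l2fun_zero])
  have Vl2: "V w \<in> l2fun Q" if "w \<in> space W" for w
    using measurable_space[OF cgD(2)[OF l2fun_zero] that] by (simp add: space_l2_borel)
  have bm: "(\<lambda>w. l2inner Q (V w) (e k)) \<in> borel_measurable W" for k by (rule cgD(3)[OF e])
  have Bs: "(\<lambda>k. (l2inner Q (V w) (e k))\<^sup>2) sums (l2norm Q (V w))\<^sup>2" if "w \<in> space W" for w
    using parseval[OF Vl2[OF that] Vl2[OF that]] unfolding l2inner_self power2_eq_square[of "l2inner _ _ _"] .
  show Bm: "(\<lambda>w. (l2norm Q (V w))\<^sup>2) \<in> borel_measurable W"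
    by (rule borel_measurable_LIMSEQ_real[of W "\<lambda>n w. \<Sum>k<n. (l2inner Q (V w) (e k))\<^sup>2"])
      (use Bs bm in \<open>auto simp: sums_def\<close>)
  have am: "(\<lambda>x. l2inner Q (score_sum n x) (e k)) \<in> borel_measurable (sample n)" for n k
  proof -
    interpret G: gaussian_score "N n" "C n" Q by (rule gscore)
    have [measurable]: "G.proj (e k) \<in> borel_measurable borel"
      using G.proj_measurable[OF l2fun_measurable[OF e]] by (simp cong: measurable_cong_sets add: sets_Nn)
    show ?thesis unfolding score_sum_inner[OF e] by measurable
  qed
  show "(\<lambda>n. \<integral>x. exp (- s * (\<integral>f. (score_sum n x f)\<^sup>2 \<partial>Q)) \<partial>sample n) \<longlonglongrightarrow> (\<integral>w. exp (- s * (l2norm Q (V w))\<^sup>2) \<partial>W)"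
  proof (rule sum_squares_laplace_tendsto[where a="\<lambda>n k x. l2inner Q (score_sum n x) (e k)"
        and b="\<lambda>k w. l2inner Q (V w) (e k)", OF prob_sample W am bm])
    fix m and \<xi> :: "nat \<Rightarrow> real"
    \<comment> \<open>A linear combination of coordinates is again one functional, so the joint
      limit reduces to the one-dimensional theorem for the projection on \<open>u\<close>.\<close>
    define u where "u f = (\<Sum>k<m. \<xi> k * e k f)" for f
    have u: "u \<in> l2fun Q" unfolding u_def using e by (intro l2fun_sum l2fun_scale) auto
    have comb: "(\<Sum>k<m. \<xi> k * l2inner Q v (e k)) = l2inner Q v u" if "v \<in> l2fun Q" for v
      unfolding u_def using e by (intro l2inner_sum_right[OF that, symmetric]) auto
    have lhs: "(\<integral>x. iexp (\<Sum>k<m. \<xi> k * l2inner Q (score_sum n x) (e k)) \<partial>sample n)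
        = (\<integral>x. iexp (gaussian_score.proj (C n) Q u x / sqrt (real n)) \<partial>N n) ^ n" for n
    proof -
      interpret G: gaussian_score "N n" "C n" Q by (rule gscore)
      show ?thesis
        unfolding comb[OF score_sum_l2fun] score_sum_inner[OF u]
        by (rule iid_normalised_sum_char[OF prob_N G.proj_measurable[OF l2fun_measurable[OF u]]])
    qed
    have rhs: "(\<integral>w. iexp (\<Sum>k<m. \<xi> k * l2inner Q (V w) (e k)) \<partial>W)
        = complex_of_real (exp (- (\<integral>f. (\<integral>g. limit_kernel C0 f g * u f * u g \<partial>Q) \<partial>Q) / 2))"
      unfolding cgD(4)[OF u, symmetric]
      by (intro Bochner_Integration.integral_cong refl) (simp only: comb Vl2)
    show "(\<lambda>n. \<integral>x. iexp (\<Sum>k<m. \<xi> k * l2inner Q (score_sum n x) (e k)) \<partial>sample n)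
        \<longlonglongrightarrow> (\<integral>w. iexp (\<Sum>k<m. \<xi> k * l2inner Q (V w) (e k)) \<partial>W)"
      unfolding lhs rhs
    proof (rule triangular_clt[where b="(l2norm Q u) ^ 4 * score_const", OF prob_N])
      fix n
      interpret G: gaussian_score "N n" "C n" Q by (rule gscore)
      show "G.proj u \<in> borel_measurable (N n)" by (rule G.proj_measurable[OF l2fun_measurable[OF u]])
      show "(\<integral>x. G.proj u x \<partial>N n) = 0" by (rule G.expectation_proj[OF u])
      show "integrable (N n) (\<lambda>x. G.proj u x ^ 4)" "(\<integral>x. G.proj u x ^ 4 \<partial>N n) \<le> (l2norm Q u) ^ 4 * score_const"
        by (rule G.proj_fourth[OF u])+
    next
      show "(\<lambda>n. \<integral>x. (gaussian_score.proj (C n) Q u x)\<^sup>2 \<partial>N n) \<longlonglongrightarrow> (\<integral>f. (\<integral>g. limit_kernel C0 f g * u f * u g \<partial>Q) \<partial>Q)"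
        unfolding gaussian_score.proj_square[OF gscore u] by (rule form_tendsto[OF u])
    qed
  next
    fix n
    show "integrable (sample n) (\<lambda>x. \<integral>f. (score_sum n x f)\<^sup>2 \<partial>Q)" by (rule integrable_score_sum_norm)
    show "AE x in sample n. (\<lambda>k. (l2inner Q (score_sum n x) (e k))\<^sup>2) sums (\<integral>f. (score_sum n x f)\<^sup>2 \<partial>Q)"
      using parseval[OF score_sum_l2fun score_sum_l2fun] by (simp add: power2_eq_square l2inner_def)
  next
    show "AE w in W. (\<lambda>k. (l2inner Q (V w) (e k))\<^sup>2) sums (l2norm Q (V w))\<^sup>2" by (rule AE_I2[OF Bs])
  next
    fix r :: real assume r: "r > 0"
    let ?B = "\<lambda>C k. \<integral>f. (\<integral>g. limit_kernel C f g * e k f * e k g \<partial>Q) \<partial>Q"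
    have "(\<lambda>m. \<Sum>k<m. ?B C0 k) \<longlonglongrightarrow> (\<integral>f. limit_kernel C0 f f \<partial>Q)"
      using KS.kform_trace[OF e parseval] unfolding KS.kform_def sums_def .
    then obtain m where m: "norm ((\<Sum>k<m. ?B C0 k) - (\<integral>f. limit_kernel C0 f f \<partial>Q)) < r"
      using LIMSEQ_D[OF _ r] by blast
    \<comment> \<open>The expected tail at sample size n is the trace minus the first m values of
      the form. For fixed m both converge, and the limiting difference is below r by the choice of
      m.\<close>
    have lim: "(\<lambda>n. (\<integral>f. limit_kernel (C n) f f \<partial>Q) - (\<Sum>k<m. ?B (C n) k)) \<longlonglongrightarrow> (\<integral>f. limit_kernel C0 f f \<partial>Q) - (\<Sum>k<m. ?B C0 k)"
      by (intro tendsto_diff trace_tendsto tendsto_sum form_tendsto e)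
    have "(\<integral>f. limit_kernel C0 f f \<partial>Q) - (\<Sum>k<m. ?B C0 k) < r" using m by simp
    then have ev: "\<forall>\<^sub>F n in sequentially. (\<integral>f. limit_kernel (C n) f f \<partial>Q) - (\<Sum>k<m. ?B (C n) k) < r"
      by (rule order_tendstoD(2)[OF lim])
    have "\<forall>\<^sub>F n in sequentially. (\<integral>x. (\<integral>f. (score_sum n x f)\<^sup>2 \<partial>Q) - (\<Sum>k<m. (l2inner Q (score_sum n x) (e k))\<^sup>2) \<partial>sample n) \<le> r"
      using ev eventually_gt_at_top[of 0]
    proof eventually_elim
      case (elim n)
      interpret G: gaussian_score "N n" "C n" Q by (rule gscore)
      note nss = iid_normalised_sum_square[OF prob_N G.proj_measurable[OF l2fun_measurable[OF e]] elim(2)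
          l2fun_integrable_square[OF G.proj_l2fun[OF e]] G.expectation_proj[OF e]]
      have "(\<integral>x. (\<integral>f. (score_sum n x f)\<^sup>2 \<partial>Q) - (\<Sum>k<m. (l2inner Q (score_sum n x) (e k))\<^sup>2) \<partial>sample n)
          = (\<integral>x. (\<integral>f. (score_sum n x f)\<^sup>2 \<partial>Q) \<partial>sample n) - (\<Sum>k<m. \<integral>x. (l2inner Q (score_sum n x) (e k))\<^sup>2 \<partial>sample n)"
        using integrable_score_sum_norm[of n] nss(1) unfolding score_sum_inner[OF e]
        by (simp add: Bochner_Integration.integral_diff Bochner_Integration.integral_sum Bochner_Integration.integrable_sum)
      also have "\<dots> = (\<integral>f. limit_kernel (C n) f f \<partial>Q) - (\<Sum>k<m. ?B (C n) k)"
        unfolding score_sum_square(2)[OF elim(2)] score_sum_inner[OF e] nss(2) G.proj_square[OF e] ..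
      finally show ?case using elim(1) by simp
    qed
    then show "\<exists>m. \<forall>\<^sub>F n in sequentially. (\<integral>x. (\<integral>f. (score_sum n x f)\<^sup>2 \<partial>Q) - (\<Sum>k<m. (l2inner Q (score_sum n x) (e k))\<^sup>2) \<partial>sample n) \<le> r"
      by blast
  qed (use Bm s in auto)
qed

end

section \<open>Linearisation of the test statistic\<close>

text \<open>The exponential at the smaller of x and y is factored out, so that the prefactor is at
  most 1 in both cases.\<close>

lemma exp_minus_linearisation:
  "\<bar>exp (- y) - exp (- x) * (1 - (y - x))\<bar> \<le> (y - x)\<^sup>2" if x: "0 \<le> x" and y: "0 \<le> y" for x y :: real
proof (cases "x \<le> y")
  case True
  have "exp (- y) - exp (- x) * (1 - (y - x)) = exp (- x) * (exp (- (y - x)) - (1 - (y - x)))"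
    by (simp add: right_diff_distrib exp_add[symmetric])
  then have "\<bar>exp (- y) - exp (- x) * (1 - (y - x))\<bar> = exp (- x) * \<bar>(1 - (y - x)) - exp (- (y - x))\<bar>"
    by (simp add: abs_mult abs_minus_commute)
  also have "\<dots> \<le> 1 * ((y - x)\<^sup>2 / 2)"
    using exp_minus_quadratic[of "y - x"] True x by (intro mult_mono) auto
  also have "\<dots> \<le> (y - x)\<^sup>2" by simp
  finally show ?thesis .
next
  case False
  define t where "t = x - y"
  have t: "0 \<le> t" using False by (simp add: t_def)
  have y': "y = x - t" by (simp add: t_def)
  have "exp (- y) - exp (- x) * (1 - (y - x)) = exp (- y) * (1 - exp (- t) * (1 + t))"
    unfolding y' by (simp add: right_diff_distrib exp_add[symmetric] distrib_left)
  then have "\<bar>exp (- y) - exp (- x) * (1 - (y - x))\<bar> = exp (- y) * \<bar>1 - exp (- t) * (1 + t)\<bar>"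
    by (simp add: abs_mult)
  also have "\<dots> \<le> 1 * t\<^sup>2"
  proof (intro mult_mono)
    have "exp (- t) * (1 + t) \<le> exp (- t) * exp t"
      using exp_ge_add_one_self[of t] by (intro mult_left_mono) auto
    then have 1: "exp (- t) * (1 + t) \<le> 1" by (simp add: exp_minus)
    have "(1 - t) * (1 + t) \<le> exp (- t) * (1 + t)"
    proof (rule mult_right_mono)
      show "1 - t \<le> exp (- t)" using exp_ge_add_one_self[of "- t"] by linarith
    qed (use t in simp)
    then have "1 - t\<^sup>2 \<le> exp (- t) * (1 + t)" by (simp add: power2_eq_square algebra_simps)
    with 1 show "\<bar>1 - exp (- t) * (1 + t)\<bar> \<le> t\<^sup>2" by simp
  qed (use y in auto)
  also have "\<dots> = (y - x)\<^sup>2" by (simp add: t_def power2_commute)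
  finally show ?thesis .
qed

text \<open>Here a is the sample mean along f, s the variance of the sampling law, b the excess of
  the empirical second moment over s, and s + b - a^2 the sample variance. The first bound is
  quadratic, hence small for large samples; the second grows more slowly, so that its expected
  square stays within the fourth moment of the weight.\<close>

lemma exp_linearisation_error:
  fixes a b s :: real
  assumes s: "0 \<le> s" and sh: "0 \<le> s + b - a\<^sup>2"
  defines "E \<equiv> exp (\<i> * of_real a - of_real (s + b - a\<^sup>2) / 2) - of_real (exp (- s / 2)) * (1 + \<i> * of_real a - of_real (b / 2))"
  shows "norm E \<le> 2 * (a\<^sup>2 + b\<^sup>2)" and "norm E \<le> a\<^sup>2 + 2 * \<bar>a\<bar> + \<bar>b\<bar>"
proof -
  define m where "m = s + b"
  have m: "0 \<le> m" using sh zero_le_power2[of a] unfolding m_def by linarith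
  define h where "h = m - a\<^sup>2"
  have h: "0 \<le> h" using sh by (simp add: h_def m_def)
  define ea where "ea = exp (\<i> * complex_of_real a)"
  have nea: "norm ea = 1" by (simp add: ea_def)
  have Eh: "E = ea * of_real (exp (- (h / 2))) - of_real (exp (- (s / 2))) * (1 + \<i> * of_real a - of_real (b / 2))"
    unfolding E_def ea_def h_def m_def by (simp add: exp_of_real[symmetric] exp_add[symmetric])
  \<comment> \<open>A telescoping decomposition: \<open>X1\<close> replaces h by m in the exponent,
    \<open>X2\<close> expands exp (i a) to first order, \<open>X3\<close> replaces m by s in the
    linear term, and \<open>X4\<close> linearises the remaining exponential at s.\<close>
  define X1 where "X1 = ea * complex_of_real (exp (- (h / 2)) - exp (- (m / 2)))"
  define X2 where "X2 = (ea - (1 + \<i> * of_real a)) * complex_of_real (exp (- (m / 2)))"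
  define X3 where "X3 = \<i> * of_real a * complex_of_real (exp (- (m / 2)) - exp (- (s / 2)))"
  define X4 where "X4 = complex_of_real (exp (- (m / 2)) - exp (- (s / 2)) * (1 - (m / 2 - s / 2)))"
  have split: "E = X1 + X2 + X3 + X4"
    unfolding Eh X1_def X2_def X3_def X4_def m_def by (simp add: algebra_simps add_divide_distrib diff_divide_distrib)
  have n1: "norm X1 \<le> a\<^sup>2 / 2"
    unfolding X1_def norm_mult nea norm_of_real
  proof -
    have "h / 2 - m / 2 = - (a\<^sup>2 / 2)" by (simp add: h_def diff_divide_distrib)
    then show "1 * \<bar>exp (- (h / 2)) - exp (- (m / 2))\<bar> \<le> a\<^sup>2 / 2"
      using exp_minus_lipschitz[of "h / 2" "m / 2"] h m by simp
  qed
  have tay: "norm (ea - (1 + \<i> * of_real a)) \<le> a\<^sup>2 / 2"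
    using iexp_approx1[of a 1] by (simp add: ea_def power2_eq_square)
  have n2: "norm X2 \<le> a\<^sup>2 / 2"
  proof -
    have "norm X2 \<le> a\<^sup>2 / 2 * 1"
      unfolding X2_def norm_mult norm_of_real using tay m by (intro mult_mono) auto
    then show ?thesis by simp
  qed
  have n3: "norm X3 \<le> \<bar>a\<bar> * (\<bar>b\<bar> / 2)"
  proof -
    have "\<bar>exp (- (m / 2)) - exp (- (s / 2))\<bar> \<le> \<bar>b\<bar> / 2"
    proof -
      have e: "m / 2 - s / 2 = b / 2" by (simp add: m_def add_divide_distrib)
      show ?thesis using exp_minus_lipschitz[of "m / 2" "s / 2"] m s unfolding e by simp
    qed
    from mult_left_mono[OF this, of "\<bar>a\<bar>"] show ?thesis
      unfolding X3_def norm_mult norm_of_real by simp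
  qed
  have n4: "norm X4 \<le> b\<^sup>2 / 4"
  proof -
    have e: "m / 2 - s / 2 = b / 2" by (simp add: m_def add_divide_distrib)
    have "\<bar>exp (- (m / 2)) - exp (- (s / 2)) * (1 - (m / 2 - s / 2))\<bar> \<le> (m / 2 - s / 2)\<^sup>2"
      by (rule exp_minus_linearisation) (use m s in auto)
    then show ?thesis unfolding X4_def norm_of_real e power_divide by simp
  qed
  have "norm E \<le> a\<^sup>2 / 2 + a\<^sup>2 / 2 + \<bar>a\<bar> * (\<bar>b\<bar> / 2) + b\<^sup>2 / 4"
    unfolding split using n1 n2 n3 n4 by (intro norm_triangle_le add_mono) auto
  also have "\<bar>a\<bar> * (\<bar>b\<bar> / 2) \<le> (a\<^sup>2 + b\<^sup>2) / 4"
    using sum_squares_bound[of "\<bar>a\<bar>" "\<bar>b\<bar>"] by simp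
  finally show "norm E \<le> 2 * (a\<^sup>2 + b\<^sup>2)"
    using zero_le_power2[of a] zero_le_power2[of b] unfolding distrib_left add_divide_distrib by linarith
  \<comment> \<open>A cruder decomposition: differences are bounded by Lipschitz estimates instead
    of Taylor remainders, which keeps b to the first power.\<close>
  have "E = (ea - 1) * of_real (exp (- (h / 2))) + of_real (exp (- (h / 2)) - exp (- (s / 2)))
      - of_real (exp (- (s / 2))) * (\<i> * of_real a) + of_real (exp (- (s / 2))) * of_real (b / 2)"
    unfolding Eh by (simp add: algebra_simps)
  then have "norm E \<le> norm ((ea - 1) * of_real (exp (- (h / 2)))) + norm (complex_of_real (exp (- (h / 2)) - exp (- (s / 2))))
      + norm (of_real (exp (- (s / 2))) * (\<i> * of_real a)) + norm (complex_of_real (exp (- (s / 2))) * of_real (b / 2))"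
    by (simp only:) (intro norm_triangle_le norm_triangle_le_diff add_mono order_refl)
  also have "norm ((ea - 1) * of_real (exp (- (h / 2)))) \<le> \<bar>a\<bar> * 1"
  proof -
    have "norm (ea - 1) \<le> \<bar>a\<bar>" using iexp_approx1[of a 0] by (simp add: ea_def)
    then show ?thesis unfolding norm_mult norm_of_real using h by (intro mult_mono) auto
  qed
  also have "norm (complex_of_real (exp (- (h / 2)) - exp (- (s / 2)))) \<le> (\<bar>b\<bar> + a\<^sup>2) / 2"
  proof -
    have e: "h / 2 - s / 2 = (b - a\<^sup>2) / 2" by (simp add: h_def m_def add_divide_distrib diff_divide_distrib)
    have "\<bar>exp (- (h / 2)) - exp (- (s / 2))\<bar> \<le> \<bar>b - a\<^sup>2\<bar> / 2"
      using exp_minus_lipschitz[of "h / 2" "s / 2"] h s unfolding e by simp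
    also have "\<dots> \<le> (\<bar>b\<bar> + a\<^sup>2) / 2"
      using abs_triangle_ineq4[of b "a\<^sup>2"] by simp
    finally show ?thesis unfolding norm_of_real .
  qed
  also have "norm (of_real (exp (- (s / 2))) * (\<i> * complex_of_real a)) \<le> 1 * \<bar>a\<bar>"
    unfolding norm_mult norm_of_real using s by (intro mult_mono) auto
  also have "norm (complex_of_real (exp (- (s / 2))) * of_real (b / 2)) \<le> 1 * \<bar>b / 2\<bar>"
    unfolding norm_mult norm_of_real using s by (intro mult_mono) auto
  finally have "norm E \<le> \<bar>b\<bar> + (2 * \<bar>a\<bar> + a\<^sup>2 / 2)" by (simp add: add_divide_distrib)
  then show "norm E \<le> a\<^sup>2 + 2 * \<bar>a\<bar> + \<bar>b\<bar>"
    using zero_le_power2[of a] by linarith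
qed

context bootstrap_array
begin

section \<open>Full and linearised deviations from the Gaussian functional\<close>

definition avg :: "nat \<Rightarrow> (nat \<Rightarrow> L2I) \<Rightarrow> L2I \<Rightarrow> real" where
  "avg n x f = (\<Sum>j<n. x j \<bullet> f) / real n"

definition sq_dev :: "nat \<Rightarrow> (nat \<Rightarrow> L2I) \<Rightarrow> L2I \<Rightarrow> real" where
  "sq_dev n x f = (\<Sum>j<n. (x j \<bullet> f)\<^sup>2 - C n f \<bullet> f) / real n"

definition emp :: "nat \<Rightarrow> (nat \<Rightarrow> L2I) \<Rightarrow> L2I \<Rightarrow> complex" where
  "emp n x f = (1 / of_nat n) * (\<Sum>j<n. exp (\<i> * of_real (f \<bullet> x j)))"

definition full_dev :: "nat \<Rightarrow> (nat \<Rightarrow> L2I) \<Rightarrow> L2I \<Rightarrow> complex" where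
  "full_dev n x f = emp n x f - gauss_cf (smean n x) (scov n x) f"

text \<open>The subtracted term is the first-order expansion of the Gaussian functional around mean
  0 and covariance \<open>C n\<close>. The squared mean that enters the sample covariance is of
  second order and left out.\<close>

definition lin_dev :: "nat \<Rightarrow> (nat \<Rightarrow> L2I) \<Rightarrow> L2I \<Rightarrow> complex" where
  "lin_dev n x f = emp n x f - of_real (exp (- (C n f \<bullet> f) / 2)) * (1 + \<i> * of_real (avg n x f) - of_real (sq_dev n x f / 2))"

lemma T_stat_eq: "T_stat Q n x = (\<integral>f. (cmod (full_dev n x f))\<^sup>2 \<partial>Q)"
  unfolding T_stat_def full_dev_def emp_def ..

lemma dev_error:
  assumes n: "n > 0"
  shows "cmod (full_dev n x f - lin_dev n x f) \<le> 2 * ((avg n x f)\<^sup>2 + (sq_dev n x f)\<^sup>2)"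
    and "cmod (full_dev n x f - lin_dev n x f) \<le> (avg n x f)\<^sup>2 + 2 * \<bar>avg n x f\<bar> + \<bar>sq_dev n x f\<bar>"
proof -
  let ?a = "avg n x f" and ?b = "sq_dev n x f" and ?s = "C n f \<bullet> f"
  have m: "smean n x \<bullet> f = ?a" by (simp add: smean_def avg_def inner_sum_left)
  have b: "?b = (\<Sum>j<n. (x j \<bullet> f) * (x j \<bullet> f)) / real n - ?s"
    unfolding sq_dev_def using n by (simp add: sum_subtractf diff_divide_distrib power2_eq_square)
  have sc: "scov n x f \<bullet> f = ?s + ?b - ?a\<^sup>2"
    unfolding scov_inner_raw[OF n] m b by (simp add: power2_eq_square)
  have s0: "0 \<le> ?s" by (rule pos_op_bilinear(6)[OF posn])
  have h0: "0 \<le> ?s + ?b - ?a\<^sup>2" unfolding sc[symmetric] by (rule pos_op_bilinear(6)[OF pos_op_scov])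
  have e: "cmod (full_dev n x f - lin_dev n x f)
      = cmod (exp (\<i> * of_real ?a - of_real (?s + ?b - ?a\<^sup>2) / 2) - of_real (exp (- ?s / 2)) * (1 + \<i> * of_real ?a - of_real (?b / 2)))"
    unfolding full_dev_def lin_dev_def gauss_cf_def m sc by (subst norm_minus_commute) simp
  show "cmod (full_dev n x f - lin_dev n x f) \<le> 2 * (?a\<^sup>2 + ?b\<^sup>2)"
    "cmod (full_dev n x f - lin_dev n x f) \<le> ?a\<^sup>2 + 2 * \<bar>?a\<bar> + \<bar>?b\<bar>"
    unfolding e by (rule exp_linearisation_error[OF s0 h0])+
qed

lemma dev_measurable:
  "(\<lambda>z. avg n (fst z) (snd z)) \<in> borel_measurable (sample n \<Otimes>\<^sub>M Q)"
  "(\<lambda>z. sq_dev n (fst z) (snd z)) \<in> borel_measurable (sample n \<Otimes>\<^sub>M Q)"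
  "(\<lambda>z. emp n (fst z) (snd z)) \<in> borel_measurable (sample n \<Otimes>\<^sub>M Q)"
  "(\<lambda>z. full_dev n (fst z) (snd z)) \<in> borel_measurable (sample n \<Otimes>\<^sub>M Q)"
  "(\<lambda>z. lin_dev n (fst z) (snd z)) \<in> borel_measurable (sample n \<Otimes>\<^sub>M Q)"
proof -
  have [measurable]: "C n \<in> borel_measurable borel" by (rule pos_op_measurable[OF posn])
  show 1[measurable]: "(\<lambda>z. avg n (fst z) (snd z)) \<in> borel_measurable (sample n \<Otimes>\<^sub>M Q)"
    "(\<lambda>z. sq_dev n (fst z) (snd z)) \<in> borel_measurable (sample n \<Otimes>\<^sub>M Q)"
    "(\<lambda>z. emp n (fst z) (snd z)) \<in> borel_measurable (sample n \<Otimes>\<^sub>M Q)"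
    unfolding avg_def sq_dev_def emp_def by measurable
  have [measurable]: "(\<lambda>z. smean n (fst z)) \<in> borel_measurable (sample n \<Otimes>\<^sub>M Q)"
    unfolding smean_def by measurable
  show "(\<lambda>z. full_dev n (fst z) (snd z)) \<in> borel_measurable (sample n \<Otimes>\<^sub>M Q)"
    unfolding full_dev_def gauss_cf_def scov_def by measurable
  show "(\<lambda>z. lin_dev n (fst z) (snd z)) \<in> borel_measurable (sample n \<Otimes>\<^sub>M Q)"
    unfolding lin_dev_def by measurable
qed

text \<open>Symmetry of \<open>Q\<close>: the real part is even and the imaginary part is odd, so the mixed term
  vanishes and the complex norm may be replaced by that of the sum of both parts.\<close>

lemma lin_dev_norm:
  assumes n: "n > 0" and sym: "distr Q borel uminus = Q"
  shows "integrable Q (\<lambda>f. (cmod (lin_dev n x f))\<^sup>2)"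
    and "real n * (\<integral>f. (cmod (lin_dev n x f))\<^sup>2 \<partial>Q) = (\<integral>f. (score_sum n x f)\<^sup>2 \<partial>Q)"
proof -
  let ?R = "\<lambda>f. Re (lin_dev n x f)" and ?I = "\<lambda>f. Im (lin_dev n x f)"
  have Cm[measurable]: "C n \<in> borel_measurable borel" by (rule pos_op_measurable[OF posn])
  have lm[measurable]: "lin_dev n x \<in> borel_measurable borel"
    unfolding lin_dev_def emp_def avg_def sq_dev_def by measurable
  have um[measurable]: "uminus \<in> borel_measurable Q"
    by (rule borel_measurable_uminus[OF measurable_ident_sets[OF sets_Q]])
  have emp: "Re (emp n x f) = (\<Sum>j<n. cos (x j \<bullet> f)) / real n" "Im (emp n x f) = (\<Sum>j<n. sin (x j \<bullet> f)) / real n" for f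
    unfolding emp_def by (simp_all add: Re_divide_of_nat Im_divide_of_nat Re_exp Im_exp inner_commute)
  have R: "?R f = (\<Sum>j<n. cos (x j \<bullet> f)) / real n - exp (- (C n f \<bullet> f) / 2) * (1 - sq_dev n x f / 2)" for f
    unfolding lin_dev_def by (simp add: emp)
  have I: "?I f = (\<Sum>j<n. sin (x j \<bullet> f)) / real n - exp (- (C n f \<bullet> f) / 2) * avg n x f" for f
    unfolding lin_dev_def by (simp add: emp)
  have even: "?R (- f) = ?R f" for f
    unfolding R sq_dev_def by (simp add: pos_op_bilinear[OF posn])
  have odd: "?I (- f) = - ?I f" for f
    unfolding I avg_def by (simp add: pos_op_bilinear[OF posn] sum_negf)
  have S: "score_sum n x f = sqrt (real n) * (?R f + ?I f)" for f
  proof -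
    have "(\<Sum>j<n. lin_score (C n) f (x j)) = (\<Sum>j<n. cos (x j \<bullet> f)) + (\<Sum>j<n. sin (x j \<bullet> f))
        - exp (- (C n f \<bullet> f) / 2) * (real n + (\<Sum>j<n. x j \<bullet> f) - (\<Sum>j<n. (x j \<bullet> f)\<^sup>2 - C n f \<bullet> f) / 2)"
      unfolding lin_score_def by (simp add: sum.distrib sum_subtractf sum_distrib_left[symmetric] sum_divide_distrib[symmetric])
    also have "\<dots> = real n * (?R f + ?I f)"
      unfolding R I avg_def sq_dev_def using n by (simp add: field_simps)
    finally have *: "(\<Sum>j<n. lin_score (C n) f (x j)) = real n * (?R f + ?I f)" .
    have "real n * z / sqrt (real n) = sqrt (real n) * z" for z
    proof -
      have "real n * z / sqrt (real n) = (real n / sqrt (real n)) * z" by simp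
      then show ?thesis by (simp only: real_div_sqrt[OF of_nat_0_le_iff])
    qed
    then show ?thesis unfolding score_sum_def * .
  qed
  have "?R \<in> l2fun Q \<and> ?I \<in> l2fun Q"
  proof -
    have s1: "(\<lambda>f. score_sum n x f) \<in> l2fun Q" using score_sum_l2fun by simp
    have s2: "(\<lambda>f. score_sum n x (- f)) \<in> l2fun Q"
    proof (rule l2funI)
      have sm[measurable]: "(\<lambda>f. score_sum n x f) \<in> borel_measurable borel"
        using l2fun_measurable[OF s1] by (simp cong: measurable_cong_sets add: sets_Q)
      show "(\<lambda>f. score_sum n x (- f)) \<in> borel_measurable Q"
        by (rule measurable_compose[OF borel_measurable_uminus[OF measurable_ident_sets[OF sets_Q]] sm])
      have "integrable (distr Q borel uminus) (\<lambda>f. (score_sum n x f)\<^sup>2)"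
        unfolding sym by (rule l2fun_integrable_square[OF s1])
      then show "integrable Q (\<lambda>f. (score_sum n x (- f))\<^sup>2)"
        using um by (subst (asm) integrable_distr_eq) auto
    qed
    \<comment> \<open>Up to the factor sqrt n, real and imaginary part are the even and the odd part
      of the score sum; symmetry of \<open>Q\<close> makes the reflected score sum
      square-integrable.\<close>
    have g: "p = 1 / (2 * t) * (t * (p + q) + t * (p + - q))" "q = 1 / (2 * t) * (t * (p + q) - t * (p + - q))"
      if "t \<noteq> 0" for t p q :: real using that by (simp_all add: field_simps)
    have rn: "sqrt (real n) \<noteq> 0" using n by simp
    have "?R = (\<lambda>f. (1 / (2 * sqrt (real n))) * (score_sum n x f + score_sum n x (- f)))"
      unfolding S even odd by (rule ext) (rule g(1)[OF rn])
    moreover have "?I = (\<lambda>f. (1 / (2 * sqrt (real n))) * (score_sum n x f - score_sum n x (- f)))"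
      unfolding S even odd by (rule ext) (rule g(2)[OF rn])
    ultimately show ?thesis by (metis l2fun_add l2fun_diff l2fun_scale s1 s2)
  qed
  then have Rl: "?R \<in> l2fun Q" and Il: "?I \<in> l2fun Q" by auto
  have c2: "(cmod (lin_dev n x f))\<^sup>2 = (?R f)\<^sup>2 + (?I f)\<^sup>2" for f by (rule cmod_power2)
  show "integrable Q (\<lambda>f. (cmod (lin_dev n x f))\<^sup>2)"
    unfolding c2 using Rl Il by (intro Bochner_Integration.integrable_add l2fun_integrable_square)
  have zero: "(\<integral>f. ?R f * ?I f \<partial>Q) = 0"
  proof -
    have "(\<integral>f. ?R f * ?I f \<partial>Q) = (\<integral>f. ?R f * ?I f \<partial>distr Q borel uminus)" unfolding sym ..
    also have "\<dots> = (\<integral>f. ?R (- f) * ?I (- f) \<partial>Q)" using um by (subst integral_distr) auto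
    also have "\<dots> = - (\<integral>f. ?R f * ?I f \<partial>Q)" unfolding even odd by simp
    finally show ?thesis by simp
  qed
  have "(\<integral>f. (score_sum n x f)\<^sup>2 \<partial>Q) = (\<integral>f. real n * ((?R f)\<^sup>2 + (?I f)\<^sup>2) + (2 * real n) * (?R f * ?I f) \<partial>Q)"
    unfolding S by (intro Bochner_Integration.integral_cong refl) (simp add: power_mult_distrib power2_sum algebra_simps)
  also have "\<dots> = real n * (\<integral>f. (?R f)\<^sup>2 + (?I f)\<^sup>2 \<partial>Q) + (2 * real n) * (\<integral>f. ?R f * ?I f \<partial>Q)"
    using l2fun_integrable_square[OF Rl] l2fun_integrable_square[OF Il] l2fun_integrable_mult[OF Rl Il]
    by (simp add: distrib_left)
  finally show "real n * (\<integral>f. (cmod (lin_dev n x f))\<^sup>2 \<partial>Q) = (\<integral>f. (score_sum n x f)\<^sup>2 \<partial>Q)"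
    unfolding c2 zero by simp
qed

definition sq_const :: real where "sq_const = (\<integral>y. (y\<^sup>2 - 1) ^ 4 \<partial>stdn)"

lemma sq_const_nonneg: "0 \<le> sq_const" unfolding sq_const_def by simp

text \<open>All moments scale with the variance \<open>C n f \<bullet> f\<close> because \<open>x j \<bullet> f\<close> is normal.\<close>

lemma avg_moments:
  assumes n: "n > 0"
  shows "integrable (sample n) (\<lambda>x. (avg n x f) ^ 4)" "(\<integral>x. (avg n x f) ^ 4 \<partial>sample n) \<le> 9 * (C n f \<bullet> f)\<^sup>2 / (real n)\<^sup>2"
    "integrable (sample n) (\<lambda>x. (avg n x f)\<^sup>2)" "(\<integral>x. (avg n x f)\<^sup>2 \<partial>sample n) \<le> 2 * (C n f \<bullet> f) / real n"
    "integrable (sample n) (\<lambda>x. (sq_dev n x f) ^ 4)" "(\<integral>x. (sq_dev n x f) ^ 4 \<partial>sample n) \<le> 3 * sq_const * (C n f \<bullet> f) ^ 4 / (real n)\<^sup>2"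
    "integrable (sample n) (\<lambda>x. (sq_dev n x f)\<^sup>2)" "(\<integral>x. (sq_dev n x f)\<^sup>2 \<partial>sample n) \<le> sqrt sq_const * (C n f \<bullet> f)\<^sup>2 / real n"
proof -
  interpret G: gaussian_score "N n" "C n" Q by (rule gscore)
  interpret P: prob_space "sample n" by (rule prob_sample)
  let ?s = "C n f \<bullet> f"
  have s0: "0 \<le> ?s" by (rule pos_op_bilinear(6)[OF posn])
  \<comment> \<open>Stated for a general centred \<open>Y\<close>, to be used for x \<bullet> f and
    for (x \<bullet> f)^2 minus its mean.\<close>
  have gen: "integrable (sample n) (\<lambda>x. ((\<Sum>j<n. Y (x j)) / real n) ^ 4) \<and>
      (\<integral>x. ((\<Sum>j<n. Y (x j)) / real n) ^ 4 \<partial>sample n) \<le> 3 * b / (real n)\<^sup>2 \<and>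
      integrable (sample n) (\<lambda>x. ((\<Sum>j<n. Y (x j)) / real n)\<^sup>2) \<and>
      (\<integral>x. ((\<Sum>j<n. Y (x j)) / real n)\<^sup>2 \<partial>sample n) \<le> sqrt b / real n"
    if [measurable]: "Y \<in> borel_measurable (N n)" and i4: "integrable (N n) (\<lambda>x. Y x ^ 4)"
      and m: "(\<integral>x. Y x \<partial>N n) = 0" and b: "(\<integral>x. Y x ^ 4 \<partial>N n) \<le> b" for Y b
  proof -
    have ind: "P.indep_vars (\<lambda>_. borel) (\<lambda>i x. Y (x i)) {..<n}"
      by (rule indep_vars_PiM_coordinates) (use prob_N n in auto)
    have m4: "(\<lambda>x. (Y x) ^ 4) \<in> borel_measurable (N n)" by measurable
    have *: "integrable (sample n) (\<lambda>x. (\<Sum>j<n. Y (x j)) ^ 4) \<and> (\<integral>x. (\<Sum>j<n. Y (x j)) \<partial>sample n) = 0 \<and>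
      (\<integral>x. (\<Sum>j<n. Y (x j))\<^sup>2 \<partial>sample n) \<le> card {..<n} * sqrt b \<and>
      (\<integral>x. (\<Sum>j<n. Y (x j)) ^ 4 \<partial>sample n) \<le> 3 * (card {..<n})\<^sup>2 * b"
      by (rule P.fourth_moment_sum_le[OF ind finite_lessThan order_refl])
        (use PiM_component_integral[OF prob_N _ m4] PiM_component_integral[OF prob_N _ that(1)] i4 m b in auto)
    have Sm: "(\<lambda>x. \<Sum>j<n. Y (x j)) \<in> borel_measurable (sample n)"
      by measurable
    have i2: "integrable (sample n) (\<lambda>x. (\<Sum>j<n. Y (x j))\<^sup>2)"
      using P.fourth_moment_imp_integrable_power[OF Sm, of 2] * by simp
    have "(\<integral>x. (\<Sum>j<n. Y (x j)) ^ 4 \<partial>sample n) / real n ^ 4 \<le> 3 * (real n)\<^sup>2 * b / real n ^ 4"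
      using * by (intro divide_right_mono) auto
    also have "\<dots> = 3 * b / (real n)\<^sup>2" using n by (simp add: field_simps eval_nat_numeral)
    finally have a: "(\<integral>x. (\<Sum>j<n. Y (x j)) ^ 4 \<partial>sample n) / real n ^ 4 \<le> 3 * b / (real n)\<^sup>2" .
    have "(\<integral>x. (\<Sum>j<n. Y (x j))\<^sup>2 \<partial>sample n) / (real n)\<^sup>2 \<le> real n * sqrt b / (real n)\<^sup>2"
      using * by (intro divide_right_mono) auto
    also have "\<dots> = sqrt b / real n" using n by (simp add: power2_eq_square)
    finally have b: "(\<integral>x. (\<Sum>j<n. Y (x j))\<^sup>2 \<partial>sample n) / (real n)\<^sup>2 \<le> sqrt b / real n" .
    show ?thesis unfolding power_divide using * i2 a b by simp
  qed
  have i1: "integrable (N n) (\<lambda>x. x \<bullet> f)" using G.integrable_inner_power[of f 1] by simp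
  have "sqrt (3 * ?s\<^sup>2) \<le> 2 * ?s"
    using s0 by (intro real_le_lsqrt) (auto simp: power_mult_distrib)
  then have sq3: "sqrt (3 * ?s\<^sup>2) / real n \<le> 2 * ?s / real n" by (intro divide_right_mono) auto
  have g1: "integrable (sample n) (\<lambda>x. (avg n x f) ^ 4) \<and>
      (\<integral>x. (avg n x f) ^ 4 \<partial>sample n) \<le> 3 * (3 * ?s\<^sup>2) / (real n)\<^sup>2 \<and>
      integrable (sample n) (\<lambda>x. (avg n x f)\<^sup>2) \<and>
      (\<integral>x. (avg n x f)\<^sup>2 \<partial>sample n) \<le> sqrt (3 * ?s\<^sup>2) / real n"
    unfolding avg_def
  proof (rule gen)
    show "(\<integral>x. x \<bullet> f \<partial>N n) = 0" by (rule G.expectation_odd) auto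
  qed (use G.integrable_inner_power G.fourth_moment borel_measurable_integrable[OF i1] in auto)
  show "integrable (sample n) (\<lambda>x. (avg n x f) ^ 4)" "(\<integral>x. (avg n x f) ^ 4 \<partial>sample n) \<le> 9 * ?s\<^sup>2 / (real n)\<^sup>2"
    "integrable (sample n) (\<lambda>x. (avg n x f)\<^sup>2)" "(\<integral>x. (avg n x f)\<^sup>2 \<partial>sample n) \<le> 2 * ?s / real n"
    using g1 sq3 by auto
  have e4: "((sqrt ?s * y)\<^sup>2 - ?s) ^ 4 = ?s ^ 4 * (y\<^sup>2 - 1) ^ 4" for y
  proof -
    have "(sqrt ?s * y)\<^sup>2 - ?s = ?s * (y\<^sup>2 - 1)" using s0 by (simp add: power_mult_distrib right_diff_distrib)
    then show ?thesis by (simp add: power_mult_distrib)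
  qed
  have iq: "integrable stdn (\<lambda>y. (y\<^sup>2 - 1) ^ 4)"
  proof -
    have "(y\<^sup>2 - 1) ^ 4 = y ^ 8 - 4 * y ^ 6 + 6 * y ^ 4 - 4 * y ^ 2 + 1 * y ^ 0" for y :: real by simp algebra
    then show ?thesis
      by (simp only:) (intro Bochner_Integration.integrable_add Bochner_Integration.integrable_diff integrable_mult_right stdn_integrable_power)
  qed
  have i4: "integrable (N n) (\<lambda>x. ((x \<bullet> f)\<^sup>2 - ?s) ^ 4)"
    using G.integral_inner(2)[of "\<lambda>u. (u\<^sup>2 - ?s) ^ 4" f] iq unfolding e4 by simp
  have sqm: "(\<lambda>x. (x \<bullet> f)\<^sup>2 - ?s) \<in> borel_measurable (N n)"
    using borel_measurable_integrable[OF i1] by measurable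
  have E4: "(\<integral>x. ((x \<bullet> f)\<^sup>2 - ?s) ^ 4 \<partial>N n) = sq_const * ?s ^ 4"
    using G.integral_inner(1)[of "\<lambda>u. (u\<^sup>2 - ?s) ^ 4" f] unfolding e4 by (simp add: sq_const_def)
  have g2: "integrable (sample n) (\<lambda>x. (sq_dev n x f) ^ 4) \<and>
      (\<integral>x. (sq_dev n x f) ^ 4 \<partial>sample n) \<le> 3 * (sq_const * ?s ^ 4) / (real n)\<^sup>2 \<and>
      integrable (sample n) (\<lambda>x. (sq_dev n x f)\<^sup>2) \<and>
      (\<integral>x. (sq_dev n x f)\<^sup>2 \<partial>sample n) \<le> sqrt (sq_const * ?s ^ 4) / real n"
    unfolding sq_dev_def
  proof (rule gen)
    show "(\<integral>x. (x \<bullet> f)\<^sup>2 - ?s \<partial>N n) = 0"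
      using G.integrable_inner_power[of f 2] G.second_moment[of f] G.prob_space by simp
  qed (use i4 E4 sqm in auto)
  have "sqrt (sq_const * ?s ^ 4) = sqrt sq_const * ?s\<^sup>2"
  proof -
    have "sqrt (?s ^ 4) = ?s\<^sup>2" by (rule real_sqrt_unique) (simp_all flip: power_mult)
    then show ?thesis by (simp add: real_sqrt_mult)
  qed
  then show "integrable (sample n) (\<lambda>x. (sq_dev n x f) ^ 4)" "(\<integral>x. (sq_dev n x f) ^ 4 \<partial>sample n) \<le> 3 * sq_const * ?s ^ 4 / (real n)\<^sup>2"
    "integrable (sample n) (\<lambda>x. (sq_dev n x f)\<^sup>2)" "(\<integral>x. (sq_dev n x f)\<^sup>2 \<partial>sample n) \<le> sqrt sq_const * ?s\<^sup>2 / real n"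
    using g2 by (auto simp: mult.assoc)
qed

end

context bootstrap_array
begin

section \<open>The linearisation error in mean\<close>

lemma c_bound: "(C n f \<bullet> f)\<^sup>2 \<le> c\<^sup>2 * norm f ^ 4" "C n f \<bullet> f \<le> \<bar>c\<bar> * (1 + norm f ^ 4)"
proof -
  have s0: "0 \<le> C n f \<bullet> f" by (rule pos_op_bilinear(6)[OF posn])
  have "(C n f \<bullet> f)\<^sup>2 \<le> (c * (norm f)\<^sup>2)\<^sup>2" by (rule power_mono[OF bd s0])
  then show "(C n f \<bullet> f)\<^sup>2 \<le> c\<^sup>2 * norm f ^ 4" by (simp add: power_mult_distrib flip: power_mult)
  have "2 * (norm f)\<^sup>2 \<le> 1 + norm f ^ 4"
    using sum_squares_bound[of 1 "(norm f)\<^sup>2"] by (simp flip: power_mult)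
  then have "(norm f)\<^sup>2 \<le> 1 + norm f ^ 4"
    using zero_le_power2[of "norm f"] by linarith
  then have "\<bar>c\<bar> * (norm f)\<^sup>2 \<le> \<bar>c\<bar> * (1 + norm f ^ 4)" by (intro mult_left_mono) auto
  moreover have "c * (norm f)\<^sup>2 \<le> \<bar>c\<bar> * (norm f)\<^sup>2" by (intro mult_right_mono) auto
  ultimately show "C n f \<bullet> f \<le> \<bar>c\<bar> * (1 + norm f ^ 4)" using bd[of n f] by linarith
qed

definition err :: "nat \<Rightarrow> (nat \<Rightarrow> L2I) \<Rightarrow> L2I \<Rightarrow> real" where
  "err n x f = real n * (cmod (full_dev n x f - lin_dev n x f))\<^sup>2"

lemma err_measurable: "(\<lambda>z. err n (fst z) (snd z)) \<in> borel_measurable (sample n \<Otimes>\<^sub>M Q)"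
  "(\<lambda>z. err n (snd z) (fst z)) \<in> borel_measurable (Q \<Otimes>\<^sub>M sample n)"
proof -
  note [measurable] = dev_measurable
  show 1: "(\<lambda>z. err n (fst z) (snd z)) \<in> borel_measurable (sample n \<Otimes>\<^sub>M Q)"
    unfolding err_def by measurable
  show "(\<lambda>z. err n (snd z) (fst z)) \<in> borel_measurable (Q \<Otimes>\<^sub>M sample n)"
    using measurable_compose[OF measurable_pair_swap' 1] by (simp add: split_def)
qed

lemma err_section_measurable: "(\<lambda>x. err n x f) \<in> borel_measurable (sample n)"
  using measurable_compose[OF measurable_Pair2' err_measurable(1), of f] by (simp add: sets_eq_imp_space_eq[OF sets_Q])

text \<open>The two estimates come from the two pointwise bounds. The first vanishes as n grows, but
  the fourth power of the variance is of order eight in the norm of f; the second is uniform in n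
  and of order at most four.\<close>

lemma err_moments:
  assumes n: "n > 0"
  shows "integrable (sample n) (\<lambda>x. err n x f)"
    and "(\<integral>x. err n x f \<partial>sample n) \<le> 8 * (9 * (C n f \<bullet> f)\<^sup>2 + 3 * sq_const * (C n f \<bullet> f) ^ 4) / real n"
    and "(\<integral>x. err n x f \<partial>sample n) \<le> 3 * (9 * (C n f \<bullet> f)\<^sup>2 + 8 * (C n f \<bullet> f) + sqrt sq_const * (C n f \<bullet> f)\<^sup>2)"
proof -
  interpret P: prob_space "sample n" by (rule prob_sample)
  note am = avg_moments[OF n, of f]
  let ?s = "C n f \<bullet> f"
  have b1: "err n x f \<le> 8 * real n * ((avg n x f) ^ 4 + (sq_dev n x f) ^ 4)" for x
  proof -
    have "(cmod (full_dev n x f - lin_dev n x f))\<^sup>2 \<le> (2 * ((avg n x f)\<^sup>2 + (sq_dev n x f)\<^sup>2))\<^sup>2"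
      by (rule power_mono[OF dev_error(1)[OF n]]) simp
    also have "\<dots> \<le> 8 * (((avg n x f)\<^sup>2)\<^sup>2 + ((sq_dev n x f)\<^sup>2)\<^sup>2)"
    proof -
      have "(2 * (p + q))\<^sup>2 \<le> 8 * (p\<^sup>2 + q\<^sup>2)" for p q :: real
        unfolding power_mult_distrib using square_add_le[of p q] by simp
      then show ?thesis .
    qed
    also have "\<dots> = 8 * ((avg n x f) ^ 4 + (sq_dev n x f) ^ 4)" by (simp flip: power_mult)
    finally show ?thesis unfolding err_def using n by (simp add: mult_left_mono mult.assoc mult.left_commute)
  qed
  have b2: "err n x f \<le> 3 * real n * ((avg n x f) ^ 4 + 4 * (avg n x f)\<^sup>2 + (sq_dev n x f)\<^sup>2)" for x
  proof -
    have three: "(p + q + r)\<^sup>2 \<le> 3 * (p\<^sup>2 + q\<^sup>2 + r\<^sup>2)" for p q r :: real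
      using sum_squares_bound[of p q] sum_squares_bound[of p r] sum_squares_bound[of q r]
      by (simp add: power2_eq_square algebra_simps)
    have "(cmod (full_dev n x f - lin_dev n x f))\<^sup>2 \<le> ((avg n x f)\<^sup>2 + 2 * \<bar>avg n x f\<bar> + \<bar>sq_dev n x f\<bar>)\<^sup>2"
      by (rule power_mono[OF dev_error(2)[OF n]]) simp
    also have "\<dots> \<le> 3 * ((avg n x f) ^ 4 + 4 * (avg n x f)\<^sup>2 + (sq_dev n x f)\<^sup>2)"
      using three[of "(avg n x f)\<^sup>2" "2 * \<bar>avg n x f\<bar>" "\<bar>sq_dev n x f\<bar>"]
      by (simp add: power_mult_distrib flip: power_mult)
    finally show ?thesis unfolding err_def using n by (simp add: mult_left_mono mult.assoc mult.left_commute)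
  qed
  have e0: "0 \<le> err n x f" for x by (simp add: err_def)
  have i1: "integrable (sample n) (\<lambda>x. 8 * real n * ((avg n x f) ^ 4 + (sq_dev n x f) ^ 4))"
    using am by simp
  show i: "integrable (sample n) (\<lambda>x. err n x f)"
  proof (rule Bochner_Integration.integrable_bound[OF i1 err_section_measurable])
    show "AE x in sample n. norm (err n x f) \<le> norm (8 * real n * ((avg n x f) ^ 4 + (sq_dev n x f) ^ 4))"
      using b1 e0 by (intro AE_I2) (simp add: order_trans[OF _ abs_ge_self])
  qed
  have "(\<integral>x. err n x f \<partial>sample n) \<le> (\<integral>x. 8 * real n * ((avg n x f) ^ 4 + (sq_dev n x f) ^ 4) \<partial>sample n)"
    by (rule integral_mono[OF i i1 b1])
  also have "\<dots> = 8 * real n * ((\<integral>x. (avg n x f) ^ 4 \<partial>sample n) + (\<integral>x. (sq_dev n x f) ^ 4 \<partial>sample n))"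
    using am by simp
  also have "\<dots> \<le> 8 * real n * (9 * ?s\<^sup>2 / (real n)\<^sup>2 + 3 * sq_const * ?s ^ 4 / (real n)\<^sup>2)"
    using am by (intro mult_left_mono add_mono) auto
  also have "\<dots> = 8 * (9 * ?s\<^sup>2 + 3 * sq_const * ?s ^ 4) / real n"
    using n by (simp add: field_simps power2_eq_square)
  finally show "(\<integral>x. err n x f \<partial>sample n) \<le> 8 * (9 * ?s\<^sup>2 + 3 * sq_const * ?s ^ 4) / real n" .
  have i2: "integrable (sample n) (\<lambda>x. 3 * real n * ((avg n x f) ^ 4 + 4 * (avg n x f)\<^sup>2 + (sq_dev n x f)\<^sup>2))"
    using am by simp
  have "(\<integral>x. err n x f \<partial>sample n) \<le> (\<integral>x. 3 * real n * ((avg n x f) ^ 4 + 4 * (avg n x f)\<^sup>2 + (sq_dev n x f)\<^sup>2) \<partial>sample n)"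
    by (rule integral_mono[OF i i2 b2])
  also have "\<dots> = 3 * real n * ((\<integral>x. (avg n x f) ^ 4 \<partial>sample n) + 4 * (\<integral>x. (avg n x f)\<^sup>2 \<partial>sample n) + (\<integral>x. (sq_dev n x f)\<^sup>2 \<partial>sample n))"
    using am by simp
  also have "\<dots> \<le> 3 * real n * (9 * ?s\<^sup>2 / (real n)\<^sup>2 + 4 * (2 * ?s / real n) + sqrt sq_const * ?s\<^sup>2 / real n)"
    using am by (intro mult_left_mono add_mono) auto
  also have "\<dots> = 3 * (9 * ?s\<^sup>2 / real n + 8 * ?s + sqrt sq_const * ?s\<^sup>2)"
    using n by (simp add: field_simps power2_eq_square)
  also have "\<dots> \<le> 3 * (9 * ?s\<^sup>2 + 8 * ?s + sqrt sq_const * ?s\<^sup>2)"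
  proof -
    have "9 * ?s\<^sup>2 / real n \<le> 9 * ?s\<^sup>2 / 1" using n by (intro divide_left_mono) auto
    then show ?thesis by simp
  qed
  finally show "(\<integral>x. err n x f \<partial>sample n) \<le> 3 * (9 * ?s\<^sup>2 + 8 * ?s + sqrt sq_const * ?s\<^sup>2)" .
qed

lemma err_nonneg: "0 \<le> err n x f"
  by (simp add: err_def)

text \<open>Dominated convergence in f: the uniform estimate supplies the majorant, the one of order
  1 / n the pointwise limit. Joint integrability permits the exchange of the two integrals
  later.\<close>

lemma err_tendsto:
  "(\<lambda>n. \<integral>f. (\<integral>x. err n x f \<partial>sample n) \<partial>Q) \<longlonglongrightarrow> 0"
  "\<And>n. n > 0 \<Longrightarrow> integrable (sample n \<Otimes>\<^sub>M Q) (\<lambda>z. err n (fst z) (snd z))"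
proof -
  define D where "D = 3 * (9 * c\<^sup>2 + 8 * \<bar>c\<bar> + sqrt sq_const * c\<^sup>2)"
  define w where "w f = D * (1 + norm f ^ 4)" for f :: L2I
  have iw: "integrable Q w" unfolding w_def using norm4 by simp
  have D0: "0 \<le> D" unfolding D_def using sq_const_nonneg by simp
  have w0: "0 \<le> w f" for f unfolding w_def using D0 by simp
  have bound: "(\<integral>x. err n x f \<partial>sample n) \<le> w f" for n f
  proof (cases "n = 0")
    case True
    then show ?thesis using w0 by (simp add: err_def)
  next
    case False
    then have n: "n > 0" by simp
    have a: "(C n f \<bullet> f)\<^sup>2 \<le> c\<^sup>2 * (1 + norm f ^ 4)"
      using c_bound(1)[of n f] zero_le_power2[of c] unfolding distrib_left mult_1_right by linarith
    have "(\<integral>x. err n x f \<partial>sample n) \<le> 3 * (9 * (C n f \<bullet> f)\<^sup>2 + 8 * (C n f \<bullet> f) + sqrt sq_const * (C n f \<bullet> f)\<^sup>2)"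
      by (rule err_moments(3)[OF n])
    also have "\<dots> \<le> 3 * (9 * (c\<^sup>2 * (1 + norm f ^ 4)) + 8 * (\<bar>c\<bar> * (1 + norm f ^ 4)) + sqrt sq_const * (c\<^sup>2 * (1 + norm f ^ 4)))"
      using a c_bound(2)[of n f] sq_const_nonneg by (intro mult_left_mono add_mono) auto
    also have "\<dots> = w f" unfolding w_def D_def by (simp add: algebra_simps)
    finally show ?thesis .
  qed
  have E0: "0 \<le> (\<integral>x. err n x f \<partial>sample n)" for n f by (simp add: err_nonneg)
  have m: "(\<lambda>f. \<integral>x. err n x f \<partial>sample n) \<in> borel_measurable Q" for n
  proof -
    interpret P: prob_space "sample n" by (rule prob_sample)
    show ?thesis using P.borel_measurable_lebesgue_integral[of "\<lambda>f x. err n x f" Q] err_measurable(2) by (simp add: split_def)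
  qed
  show "(\<lambda>n. \<integral>f. (\<integral>x. err n x f \<partial>sample n) \<partial>Q) \<longlonglongrightarrow> 0"
  proof -
    have "(\<lambda>n. \<integral>f. (\<integral>x. err n x f \<partial>sample n) \<partial>Q) \<longlonglongrightarrow> (\<integral>f. 0 \<partial>Q)"
    proof (rule integral_dominated_convergence[where w=w])
      show "AE f in Q. norm (\<integral>x. err n x f \<partial>sample n) \<le> w f" for n
        using bound E0 by (intro AE_I2) simp
      show "AE f in Q. (\<lambda>n. \<integral>x. err n x f \<partial>sample n) \<longlonglongrightarrow> 0"
      proof (rule AE_I2)
        fix f :: L2I
        let ?s2 = "c\<^sup>2 * norm f ^ 4"
        show "(\<lambda>n. \<integral>x. err n x f \<partial>sample n) \<longlonglongrightarrow> 0"
        proof (rule Lim_null_comparison)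
          show "\<forall>\<^sub>F n in sequentially. norm (\<integral>x. err n x f \<partial>sample n) \<le> 8 * (9 * ?s2 + 3 * sq_const * ?s2\<^sup>2) * (1 / real n)"
            using eventually_gt_at_top[of 0]
          proof eventually_elim
            case (elim n)
            have "(C n f \<bullet> f) ^ 4 = ((C n f \<bullet> f)\<^sup>2)\<^sup>2" by (simp flip: power_mult)
            also have "\<dots> \<le> ?s2\<^sup>2" by (rule power_mono[OF c_bound(1)]) simp
            finally have 4: "(C n f \<bullet> f) ^ 4 \<le> ?s2\<^sup>2" .
            have "(\<integral>x. err n x f \<partial>sample n) \<le> 8 * (9 * (C n f \<bullet> f)\<^sup>2 + 3 * sq_const * (C n f \<bullet> f) ^ 4) / real n"
              by (rule err_moments(2)[OF elim])
            also have "\<dots> \<le> 8 * (9 * ?s2 + 3 * sq_const * ?s2\<^sup>2) / real n"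
              using 4 c_bound(1)[of n f] sq_const_nonneg by (intro divide_right_mono mult_left_mono add_mono) auto
            finally show ?case using E0[of n f] by simp
          qed
          have "(\<lambda>n. 1 / real n) \<longlonglongrightarrow> 0" by real_asymp
          from tendsto_mult[OF tendsto_const this]
          show "(\<lambda>n. 8 * (9 * ?s2 + 3 * sq_const * ?s2\<^sup>2) * (1 / real n)) \<longlonglongrightarrow> 0" by simp
        qed
      qed
    qed (use iw m in auto)
    then show ?thesis by simp
  qed
  fix n :: nat assume n: "n > 0"
  interpret P: prob_space "sample n" by (rule prob_sample)
  interpret QP: pair_prob_space Q "sample n" ..
  have "integrable (Q \<Otimes>\<^sub>M sample n) (\<lambda>z. err n (snd z) (fst z))"
  proof (rule QP.Fubini_integrable[OF err_measurable(2)])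
    show "AE f in Q. integrable (sample n) (\<lambda>x. err n (snd (f, x)) (fst (f, x)))"
      using err_moments(1)[OF n] by simp
    have "integrable Q (\<lambda>f. \<integral>x. err n x f \<partial>sample n)"
      by (rule Bochner_Integration.integrable_bound[OF iw m]) (use bound E0 w0 in auto)
    then show "integrable Q (\<lambda>f. \<integral>x. norm (err n (snd (f, x)) (fst (f, x))) \<partial>sample n)"
      by (simp add: err_nonneg)
  qed
  from QP.integrable_product_swap[OF this]
  show "integrable (sample n \<Otimes>\<^sub>M Q) (\<lambda>z. err n (fst z) (snd z))" by (simp add: split_def)
qed

section \<open>From the score sum to the test statistic\<close>

lemma full_dev_bound: "cmod (full_dev n x f) \<le> 2"
proof -
  have "cmod (emp n x f) \<le> 1"
  proof (cases "n = 0")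
    case False
    have "cmod (\<Sum>j<n. exp (\<i> * of_real (f \<bullet> x j))) \<le> (\<Sum>j<n. cmod (exp (\<i> * of_real (f \<bullet> x j))))" by (rule norm_sum)
    also have "\<dots> = real n" by simp
    finally show ?thesis using False by (simp add: emp_def norm_mult norm_divide field_simps)
  qed (simp add: emp_def)
  moreover have "cmod (gauss_cf (smean n x) (scov n x) f) \<le> 1"
    using pos_op_bilinear(6)[OF pos_op_scov, of n x f] by (simp add: gauss_cf_def)
  ultimately show ?thesis
    unfolding full_dev_def using norm_triangle_ineq4[of "emp n x f" "gauss_cf (smean n x) (scov n x) f"] by linarith
qed

lemma integrable_full_dev: "n > 0 \<Longrightarrow> integrable Q (\<lambda>f. (cmod (full_dev n x f))\<^sup>2)"
proof (rule integrable_const_bound[where B=4])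
  show "AE f in Q. norm ((cmod (full_dev n x f))\<^sup>2) \<le> 4"
  proof (rule AE_I2)
    fix f show "norm ((cmod (full_dev n x f))\<^sup>2) \<le> 4"
      using power_mono[OF full_dev_bound[of n x f] norm_ge_zero, of 2] by simp
  qed
  note sample_component [measurable del]
  have [measurable]: "scov n x \<in> borel_measurable borel" by (rule pos_op_measurable[OF pos_op_scov])
  show "(\<lambda>f. (cmod (full_dev n x f))\<^sup>2) \<in> borel_measurable Q"
    unfolding full_dev_def emp_def gauss_cf_def by measurable
qed

lemma T_stat_measurable: "T_stat Q n \<in> borel_measurable (PiM {..<n} (\<lambda>_. borel))"
proof -
  have [measurable]: "(\<lambda>x. x j) \<in> borel_measurable (PiM {..<n} (\<lambda>_. borel :: L2I measure))" if "j < n" for j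
    using that by simp
  have [measurable]: "(\<lambda>z. smean n (fst z)) \<in> borel_measurable (PiM {..<n} (\<lambda>_. borel) \<Otimes>\<^sub>M Q)"
    unfolding smean_def by measurable
  have "(\<lambda>(x, f). (cmod (full_dev n x f))\<^sup>2) \<in> borel_measurable (PiM {..<n} (\<lambda>_. borel) \<Otimes>\<^sub>M Q)"
    unfolding full_dev_def emp_def gauss_cf_def scov_def split_def by measurable
  from borel_measurable_lebesgue_integral[OF this] show ?thesis
    by (simp add: T_stat_eq[abs_def])
qed

text \<open>The cross term is split by 2 p q \<le> p^2 / d + d q^2 with d free. The linearised norm
  is only bounded in expectation, so its share is made small through d; the error then vanishes for
  fixed d.\<close>

lemma cmod_square_diff_le:
  fixes z w :: complex
  assumes d: "d > 0"
  shows "\<bar>(cmod z)\<^sup>2 - (cmod w)\<^sup>2\<bar> \<le> (1 + 1 / d) * (cmod (z - w))\<^sup>2 + d * (cmod w)\<^sup>2"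
proof -
  define p q where "p = cmod (z - w)" and "q = cmod w"
  have "\<bar>cmod z - q\<bar> \<le> p" unfolding p_def q_def by (rule norm_triangle_ineq3)
  then have "\<bar>(cmod z)\<^sup>2 - q\<^sup>2\<bar> \<le> p\<^sup>2 + 2 * (p * q)"
  proof -
    have "(cmod z)\<^sup>2 - q\<^sup>2 = (cmod z - q)\<^sup>2 + 2 * q * (cmod z - q)" by (simp add: power2_eq_square algebra_simps)
    also have "\<bar>\<dots>\<bar> \<le> (cmod z - q)\<^sup>2 + 2 * q * \<bar>cmod z - q\<bar>"
      by (rule order_trans[OF abs_triangle_ineq]) (simp add: abs_mult q_def)
    also have "\<dots> \<le> p\<^sup>2 + 2 * q * p"
      using power_mono[OF \<open>\<bar>cmod z - q\<bar> \<le> p\<close>, of 2] \<open>\<bar>cmod z - q\<bar> \<le> p\<close>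
      by (intro add_mono mult_left_mono) (auto simp: q_def)
    finally show ?thesis by (simp add: mult_ac)
  qed
  also have "2 * (p * q) \<le> p\<^sup>2 / d + d * q\<^sup>2"
  proof -
    have "0 \<le> (p - d * q)\<^sup>2 / d" using d by simp
    also have "\<dots> = p\<^sup>2 / d + d * q\<^sup>2 - 2 * (p * q)" using d by (simp add: field_simps power2_eq_square)
    finally show ?thesis by simp
  qed
  finally show ?thesis by (simp add: p_def q_def algebra_simps)
qed

text \<open>The squared norm of the score sum already has the right limit. The statistic differs
  from it by little in expectation, and the Lipschitz property of exp (- x) transfers this to
  Laplace transforms.\<close>

theorem T_stat_laplace_tendsto:
  fixes W :: "'w measure" and V :: "'w \<Rightarrow> L2I \<Rightarrow> real"
  assumes sym: "distr Q borel uminus = Q"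
    and cg: "centred_gaussian W Q V" and hk: "has_cov_kernel W Q V (limit_kernel C0)" and s: "s \<ge> 0"
  shows "(\<lambda>n. \<integral>x. exp (- s * (real n * T_stat Q n x)) \<partial>sample n) \<longlonglongrightarrow> (\<integral>w. exp (- s * (l2norm Q (V w))\<^sup>2) \<partial>W)"
proof -
  define A where "A n x = (\<integral>f. (score_sum n x f)\<^sup>2 \<partial>Q)" for n x
  define \<epsilon> where "\<epsilon> n = (\<integral>f. (\<integral>x. err n x f \<partial>sample n) \<partial>Q)" for n
  have main: "\<bar>(\<integral>x. exp (- s * (real n * T_stat Q n x)) \<partial>sample n) - (\<integral>x. exp (- s * A n x) \<partial>sample n)\<bar>
      \<le> s * ((1 + 1 / d) * \<epsilon> n + d)" if n: "n > 0" and d: "d > 0" for n d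
  proof -
    interpret P: prob_space "sample n" by (rule prob_sample)
    interpret PQ: pair_prob_space "sample n" Q ..
    have Tm[measurable]: "T_stat Q n \<in> borel_measurable (sample n)"
      using T_stat_measurable by (simp cong: measurable_cong_sets sets_PiM_cong add: sets_Nn)
    have iA: "integrable (sample n) (A n)" unfolding A_def by (rule integrable_score_sum_norm)
    have Am[measurable]: "A n \<in> borel_measurable (sample n)" using iA by simp
    have T0: "0 \<le> T_stat Q n x" for x unfolding T_stat_eq by simp
    have A0: "0 \<le> A n x" for x unfolding A_def by simp
    have ierr: "AE x in sample n. integrable Q (\<lambda>f. err n x f)"
      using PQ.AE_integrable_fst'[OF err_tendsto(2)[OF n]] by simp
    have iE: "integrable (sample n) (\<lambda>x. \<integral>f. err n x f \<partial>Q)"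
      using PQ.integrable_fst'[OF err_tendsto(2)[OF n]] by simp
    have near: "AE x in sample n. \<bar>real n * T_stat Q n x - A n x\<bar> \<le> (1 + 1 / d) * (\<integral>f. err n x f \<partial>Q) + d * A n x"
      using ierr
    proof eventually_elim
      case (elim x)
      note il = lin_dev_norm[OF n sym, of x] and if' = integrable_full_dev[OF n, of x]
      have "real n * T_stat Q n x - A n x = (\<integral>f. real n * ((cmod (full_dev n x f))\<^sup>2 - (cmod (lin_dev n x f))\<^sup>2) \<partial>Q)"
        unfolding A_def il(2)[symmetric] T_stat_eq using il(1) if' by (simp add: right_diff_distrib)
      also have "\<bar>\<dots>\<bar> \<le> (\<integral>f. \<bar>real n * ((cmod (full_dev n x f))\<^sup>2 - (cmod (lin_dev n x f))\<^sup>2)\<bar> \<partial>Q)"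
        by (rule integral_abs_bound)
      also have "\<dots> \<le> (\<integral>f. (1 + 1 / d) * err n x f + d * (real n * (cmod (lin_dev n x f))\<^sup>2) \<partial>Q)"
      proof (rule integral_mono)
        show "integrable Q (\<lambda>f. \<bar>real n * ((cmod (full_dev n x f))\<^sup>2 - (cmod (lin_dev n x f))\<^sup>2)\<bar>)"
          using il(1) if' by simp
        show "integrable Q (\<lambda>f. (1 + 1 / d) * err n x f + d * (real n * (cmod (lin_dev n x f))\<^sup>2))"
          using il(1) elim by simp
        show "\<bar>real n * ((cmod (full_dev n x f))\<^sup>2 - (cmod (lin_dev n x f))\<^sup>2)\<bar>
            \<le> (1 + 1 / d) * err n x f + d * (real n * (cmod (lin_dev n x f))\<^sup>2)" for f
          using mult_left_mono[OF cmod_square_diff_le[OF d, of "full_dev n x f" "lin_dev n x f"], of "real n"]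
          by (simp add: err_def abs_mult distrib_left mult.left_commute)
      qed
      also have "\<dots> = (1 + 1 / d) * (\<integral>f. err n x f \<partial>Q) + d * A n x"
        unfolding A_def il(2)[symmetric] using il(1) elim by simp
      finally show ?case .
    qed
    have ie: "integrable (sample n) (\<lambda>x. exp (- s * (real n * T_stat Q n x)))" "integrable (sample n) (\<lambda>x. exp (- s * A n x))"
      using s T0 A0 by (auto intro!: P.integrable_const_bound[where B=1])
    have "\<bar>(\<integral>x. exp (- s * (real n * T_stat Q n x)) \<partial>sample n) - (\<integral>x. exp (- s * A n x) \<partial>sample n)\<bar>
        = \<bar>\<integral>x. exp (- s * (real n * T_stat Q n x)) - exp (- s * A n x) \<partial>sample n\<bar>"
      using ie by (simp add: Bochner_Integration.integral_diff)
    also have "\<dots> \<le> (\<integral>x. \<bar>exp (- s * (real n * T_stat Q n x)) - exp (- s * A n x)\<bar> \<partial>sample n)"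
      by (rule integral_abs_bound)
    also have "\<dots> \<le> (\<integral>x. s * ((1 + 1 / d) * (\<integral>f. err n x f \<partial>Q) + d * A n x) \<partial>sample n)"
    proof (rule integral_mono_AE)
      show "integrable (sample n) (\<lambda>x. \<bar>exp (- s * (real n * T_stat Q n x)) - exp (- s * A n x)\<bar>)"
        by (intro integrable_abs Bochner_Integration.integrable_diff ie)
      show "integrable (sample n) (\<lambda>x. s * ((1 + 1 / d) * (\<integral>f. err n x f \<partial>Q) + d * A n x))"
        using iE iA by simp
      show "AE x in sample n. \<bar>exp (- s * (real n * T_stat Q n x)) - exp (- s * A n x)\<bar> \<le> s * ((1 + 1 / d) * (\<integral>f. err n x f \<partial>Q) + d * A n x)"
        using near
      proof eventually_elim
        case (elim x)
        have "\<bar>exp (- (s * (real n * T_stat Q n x))) - exp (- (s * A n x))\<bar> \<le> \<bar>s * (real n * T_stat Q n x) - s * A n x\<bar>"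
          using s T0[of x] A0[of x] by (intro exp_minus_lipschitz) auto
        also have "\<dots> = s * \<bar>real n * T_stat Q n x - A n x\<bar>"
          using s by (simp add: right_diff_distrib[symmetric] abs_mult)
        also have "\<dots> \<le> s * ((1 + 1 / d) * (\<integral>f. err n x f \<partial>Q) + d * A n x)"
          by (rule mult_left_mono[OF elim s])
        finally show ?case by simp
      qed
    qed
    also have "\<dots> = s * ((1 + 1 / d) * (\<integral>x. (\<integral>f. err n x f \<partial>Q) \<partial>sample n) + d * (\<integral>x. A n x \<partial>sample n))"
      using iE iA by simp
    also have "(\<integral>x. (\<integral>f. err n x f \<partial>Q) \<partial>sample n) = \<epsilon> n"
      unfolding \<epsilon>_def by (rule PQ.Fubini_integral[symmetric]) (use err_tendsto(2)[OF n] in \<open>simp add: split_def\<close>)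
    \<comment> \<open>The expected squared norm of the score sum is the trace of the kernel, which
      is at most 1.\<close>
    also have "s * ((1 + 1 / d) * \<epsilon> n + d * (\<integral>x. A n x \<partial>sample n)) \<le> s * ((1 + 1 / d) * \<epsilon> n + d)"
    proof -
      have "(\<integral>x. A n x \<partial>sample n) = (\<integral>f. limit_kernel (C n) f f \<partial>Q)"
        unfolding A_def by (rule score_sum_square(2)[OF n])
      also have "\<dots> \<le> (\<integral>f. 1 \<partial>Q)"
      proof (rule integral_mono)
        show "integrable Q (\<lambda>f. limit_kernel (C n) f f)"
          by (rule integrable_const_bound[where B=1]) (use kernel_abs_le diag_measurable[OF posn] in auto)
      qed (use limit_kernel_diag_le_one[OF posn] in auto)
      finally have "(\<integral>x. A n x \<partial>sample n) \<le> 1" by (simp add: prob_space)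
      then have "d * (\<integral>x. A n x \<partial>sample n) \<le> d" using d mult_left_mono[of _ 1 d] by simp
      then show ?thesis using s by (intro mult_left_mono add_left_mono) auto
    qed
    finally show ?thesis .
  qed
  have "(\<lambda>n. (\<integral>x. exp (- s * (real n * T_stat Q n x)) \<partial>sample n) - (\<integral>x. exp (- s * A n x) \<partial>sample n)) \<longlonglongrightarrow> 0"
  proof (rule LIMSEQ_I)
    fix r :: real assume r: "r > 0"
    define d where "d = r / (2 * (s + 1))"
    have d: "d > 0" "s * d \<le> r / 2" using r s by (auto simp: d_def field_simps)
    have L: "(\<lambda>n. s * ((1 + 1 / d) * \<epsilon> n)) \<longlonglongrightarrow> s * ((1 + 1 / d) * 0)"
      unfolding \<epsilon>_def by (intro tendsto_mult tendsto_const err_tendsto(1))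
    have "\<exists>n0. \<forall>n\<ge>n0. norm (s * ((1 + 1 / d) * \<epsilon> n) - s * ((1 + 1 / d) * 0)) < r / 2"
      by (rule LIMSEQ_D[OF L]) (use r in simp)
    then obtain n0 where n0: "\<And>n. n \<ge> n0 \<Longrightarrow> norm (s * ((1 + 1 / d) * \<epsilon> n) - s * ((1 + 1 / d) * 0)) < r / 2" by blast
    have "norm ((\<integral>x. exp (- s * (real n * T_stat Q n x)) \<partial>sample n) - (\<integral>x. exp (- s * A n x) \<partial>sample n) - 0) < r"
      if nn: "n \<ge> Suc n0" for n
    proof -
      have "\<bar>(\<integral>x. exp (- s * (real n * T_stat Q n x)) \<partial>sample n) - (\<integral>x. exp (- s * A n x) \<partial>sample n)\<bar>
          \<le> s * ((1 + 1 / d) * \<epsilon> n) + s * d"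
        using main[of n d] nn d(1) by (simp add: distrib_left)
      also have "\<dots> < r"
      proof -
        define X where "X = s * ((1 + 1 / d) * \<epsilon> n)"
        have "\<bar>X\<bar> < r / 2" using n0[of n] nn by (simp add: X_def)
        then show ?thesis using d(2) abs_ge_self[of X] unfolding X_def[symmetric] by linarith
      qed
      finally show ?thesis by simp
    qed
    then show "\<exists>no. \<forall>n\<ge>no. norm ((\<integral>x. exp (- s * (real n * T_stat Q n x)) \<partial>sample n) - (\<integral>x. exp (- s * A n x) \<partial>sample n) - 0) < r" by blast
  qed
  from tendsto_add[OF this score_sum_laplace_tendsto(1)[OF cg hk s]]
  show ?thesis by (simp add: A_def)
qed

end

section \<open>Almost sure convergence of the bootstrap law\<close>

lemma cdf_le_if_rat:
  assumes "real_distribution A" "real_distribution B"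
    and q: "\<And>q::rat. cdf A (of_rat q) = cdf B (of_rat q)"
  shows "cdf A x \<le> cdf B x"
proof (rule tendsto_lowerbound)
  interpret A: real_distribution A by fact
  interpret B: real_distribution B by fact
  show "(cdf B \<longlongrightarrow> cdf B x) (at_right x)"
    using B.cdf_is_right_cont[of x] by (simp add: continuous_within)
  have "cdf A x \<le> cdf B y" if y: "x < y" for y
  proof -
    obtain r :: rat where r: "x < of_rat r" "of_rat r < y" using of_rat_dense[OF y] by blast
    have "cdf A x \<le> cdf A (of_rat r)" using r by (intro A.cdf_nondecreasing) auto
    also have "\<dots> = cdf B (of_rat r)" by (rule q)
    also have "\<dots> \<le> cdf B y" using r by (intro B.cdf_nondecreasing) auto
    finally show ?thesis .
  qed
  then show "\<forall>\<^sub>F y in at_right x. cdf A x \<le> cdf B y"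
    by (intro eventually_at_rightI[of x "x + 1"]) auto
qed simp

text \<open>Right continuity of distribution functions reduces equality to rational thresholds.
  Being countable, these allow almost sure identities between conditional probabilities to hold
  simultaneously.\<close>

lemma real_distribution_eqI_rat:
  assumes A: "real_distribution A" and B: "real_distribution B"
    and q: "\<And>q::rat. measure A {..of_rat q} = measure B {..of_rat q}"
  shows "A = B"
proof (rule cdf_unique[OF A B])
  have "cdf A x = cdf B x" for x
    using cdf_le_if_rat[OF A B] cdf_le_if_rat[OF B A] q by (intro antisym) (auto simp: cdf_def)
  then show "cdf A = cdf B" ..
qed

text \<open>Index 0 is left out because the conditional laws are prescribed for positive sample
  sizes.\<close>

lemma weak_conv_m_cong:
  assumes "\<And>n::nat. n > 0 \<Longrightarrow> A n = B n" "weak_conv_m A L"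
  shows "weak_conv_m B L"
  unfolding weak_conv_m_def weak_conv_def
proof (intro allI impI)
  fix x assume "isCont (cdf L) x"
  then have "(\<lambda>n. cdf (A n) x) \<longlonglongrightarrow> cdf L x" using assms(2) by (simp add: weak_conv_m_def weak_conv_def)
  moreover have "\<forall>\<^sub>F n in sequentially. cdf (A n) x = cdf (B n) x"
    by (rule eventually_mono[OF eventually_gt_at_top[of 0]]) (simp add: assms(1))
  ultimately show "(\<lambda>n. cdf (B n) x) \<longlonglongrightarrow> cdf L x" by (rule Lim_transform_eventually)
qed

section \<open>Convergence of positive operators\<close>

lemma pos_op_Cauchy_Schwarz:
  assumes C: "pos_op C"
  shows "(C f \<bullet> g)\<^sup>2 \<le> (C f \<bullet> f) * (C g \<bullet> g)"
proof -
  have "psd_kernel_on UNIV (\<lambda>f g. C f \<bullet> g)"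
    unfolding psd_kernel_on_def
  proof (intro conjI ballI allI impI)
    show "C x \<bullet> y = C y \<bullet> x" for x y by (rule pos_op_bilinear(5)[OF C])
    fix N :: nat and x :: "nat \<Rightarrow> L2I" and c :: "nat \<Rightarrow> real"
    interpret bounded_linear C using C by (simp add: pos_op_def)
    have "0 \<le> C (\<Sum>i<N. c i *\<^sub>R x i) \<bullet> (\<Sum>j<N. c j *\<^sub>R x j)" by (rule pos_op_bilinear(6)[OF C])
    also have "\<dots> = (\<Sum>i<N. \<Sum>j<N. c i * c j * (C (x i) \<bullet> x j))"
      by (simp add: sum scaleR inner_sum_left inner_sum_right sum_distrib_left mult.assoc)
        (subst sum.swap, simp add: mult.left_commute)
    finally show "0 \<le> (\<Sum>i<N. \<Sum>j<N. c i * c j * (C (x i) \<bullet> x j))" .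
  qed
  from psd_kernel_on_Cauchy_Schwarz[OF this, of f g] show ?thesis by simp
qed

text \<open>The difference of the two values is C (f - d) \<bullet> (f + d), estimated by
  Cauchy-Schwarz for the form of \<open>C\<close>. The constant depends on \<open>C\<close> only
  through the bound of the form, so a bounded sequence of forms is equicontinuous.\<close>

lemma pos_op_diag_diff:
  assumes C: "pos_op C" and bd: "\<And>f. C f \<bullet> f \<le> c * (norm f)\<^sup>2"
  shows "\<bar>C f \<bullet> f - C d \<bullet> d\<bar> \<le> \<bar>c\<bar> * (norm (f - d) * norm (f + d))"
proof -
  note b = pos_op_bilinear[OF C]
  have bd': "C f \<bullet> f \<le> \<bar>c\<bar> * (norm f)\<^sup>2" for f
    by (rule order_trans[OF bd]) (simp add: mult_right_mono)
  have "C f \<bullet> f - C d \<bullet> d = C (f - d) \<bullet> (f + d)"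
    using b(5)[of d f] by (simp add: b(2) inner_diff_left inner_add_right)
  moreover have "(C (f - d) \<bullet> (f + d))\<^sup>2 \<le> (\<bar>c\<bar> * (norm (f - d) * norm (f + d)))\<^sup>2"
  proof -
    have "(C (f - d) \<bullet> (f + d))\<^sup>2 \<le> (C (f - d) \<bullet> (f - d)) * (C (f + d) \<bullet> (f + d))"
      by (rule pos_op_Cauchy_Schwarz[OF C])
    also have "\<dots> \<le> (\<bar>c\<bar> * (norm (f - d))\<^sup>2) * (\<bar>c\<bar> * (norm (f + d))\<^sup>2)"
      by (intro mult_mono bd' b(6)) auto
    finally show ?thesis by (simp add: power_mult_distrib power2_eq_square mult_ac)
  qed
  ultimately show ?thesis
    using power2_le_imp_le[of "\<bar>C (f - d) \<bullet> (f + d)\<bar>" "\<bar>c\<bar> * (norm (f - d) * norm (f + d))"] by simp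
qed

text \<open>The null set in the strong law depends on the direction, so convergence is at first
  available for countably many directions. Equicontinuity extends it to all f, polarisation to all
  pairs.\<close>

lemma pos_op_tendsto_dense:
  assumes Cn: "\<And>n::nat. pos_op (C n)" and C0: "pos_op C0"
    and bd: "\<And>n f. C n f \<bullet> f \<le> c * (norm f)\<^sup>2" and bd0: "\<And>f. C0 f \<bullet> f \<le> c0 * (norm f)\<^sup>2"
    and D: "\<And>X. open X \<Longrightarrow> X \<noteq> {} \<Longrightarrow> \<exists>d\<in>D. d \<in> X"
    and conv: "\<And>d. d \<in> D \<Longrightarrow> (\<lambda>n. C n d \<bullet> d) \<longlonglongrightarrow> C0 d \<bullet> d"
  shows "(\<lambda>n. C n f \<bullet> g) \<longlonglongrightarrow> C0 f \<bullet> g"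
proof -
  have diag: "(\<lambda>n. C n f \<bullet> f) \<longlonglongrightarrow> C0 f \<bullet> f" for f
  proof (rule LIMSEQ_I)
    fix r :: real assume r: "r > 0"
    define B where "B = \<bar>c\<bar> + \<bar>c0\<bar> + 1"
    have "open {d. B * (norm (f - d) * norm (f + d)) < r / 3}"
      by (intro open_Collect_less continuous_intros)
    moreover have "f \<in> {d. B * (norm (f - d) * norm (f + d)) < r / 3}" using r by simp
    ultimately obtain d where d: "d \<in> D" "B * (norm (f - d) * norm (f + d)) < r / 3" using D by blast
    have "\<bar>c\<bar> * (norm (f - d) * norm (f + d)) \<le> B * (norm (f - d) * norm (f + d))"
      "\<bar>c0\<bar> * (norm (f - d) * norm (f + d)) \<le> B * (norm (f - d) * norm (f + d))"
      unfolding B_def by (intro mult_right_mono; simp)+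
    then have near: "\<bar>C n f \<bullet> f - C n d \<bullet> d\<bar> < r / 3" "\<bar>C0 f \<bullet> f - C0 d \<bullet> d\<bar> < r / 3" for n
      using pos_op_diag_diff[OF Cn bd, of n f d] pos_op_diag_diff[OF C0 bd0, of f d] d(2) by linarith+
    have "\<exists>n0. \<forall>n\<ge>n0. norm (C n d \<bullet> d - C0 d \<bullet> d) < r / 3"
      by (rule LIMSEQ_D[OF conv[OF d(1)]]) (use r in simp)
    then obtain n0 where n0: "\<And>n. n \<ge> n0 \<Longrightarrow> norm (C n d \<bullet> d - C0 d \<bullet> d) < r / 3" by blast
    have "norm (C n f \<bullet> f - C0 f \<bullet> f) < r" if "n \<ge> n0" for n
      using near(1)[of n] near(2) n0[OF that] unfolding real_norm_def by linarith
    then show "\<exists>no. \<forall>n\<ge>no. norm (C n f \<bullet> f - C0 f \<bullet> f) < r" by blast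
  qed
  have pol: "C f \<bullet> g = (C (f + g) \<bullet> (f + g) - C f \<bullet> f - C g \<bullet> g) / 2" if "pos_op C" for C
    using pos_op_bilinear(5)[OF that, of g f] by (simp add: pos_op_bilinear(1)[OF that] inner_add_left inner_add_right)
  show ?thesis
    unfolding pol[OF Cn] pol[OF C0] by (intro tendsto_divide tendsto_diff diag tendsto_const) simp
qed

section \<open>The covariance operator and its sample versions\<close>

context
  fixes P :: "'p measure" and X :: "'p \<Rightarrow> L2I"
  assumes P: "prob_space P" and X[measurable]: "X \<in> borel_measurable P"
    and X2: "integrable P (\<lambda>\<omega>. (norm (X \<omega>))\<^sup>2)"
begin

interpretation P: prob_space P by (rule P)

lemma integrable_X: "integrable P X"
proof (rule Bochner_Integration.integrable_bound[where f="\<lambda>\<omega>. 1 + (norm (X \<omega>))\<^sup>2"])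
  show "AE \<omega> in P. norm (X \<omega>) \<le> norm (1 + (norm (X \<omega>))\<^sup>2)"
  proof (rule AE_I2)
    fix \<omega>
    have "norm (X \<omega>) \<le> 1 + (norm (X \<omega>))\<^sup>2"
      using sum_squares_bound[of 1 "norm (X \<omega>)"] norm_ge_zero[of "X \<omega>"]
      by (simp only: power_one mult_1_right)
    then show "norm (X \<omega>) \<le> norm (1 + (norm (X \<omega>))\<^sup>2)" by simp
  qed
qed (use X2 in auto)

lemma integrable_X_inner: "integrable P (\<lambda>\<omega>. X \<omega> \<bullet> f)" "(\<integral>\<omega>. X \<omega> \<bullet> f \<partial>P) = (\<integral>\<omega>. X \<omega> \<partial>P) \<bullet> f"
  using integrable_X by auto

lemma integrable_X_inner2: "integrable P (\<lambda>\<omega>. (X \<omega> \<bullet> f) * (X \<omega> \<bullet> g))"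
proof (rule Bochner_Integration.integrable_bound[where f="\<lambda>\<omega>. (norm f * norm g) * (norm (X \<omega>))\<^sup>2"])
  show "AE \<omega> in P. norm ((X \<omega> \<bullet> f) * (X \<omega> \<bullet> g)) \<le> norm ((norm f * norm g) * (norm (X \<omega>))\<^sup>2)"
  proof (rule AE_I2)
    fix \<omega>
    have "\<bar>X \<omega> \<bullet> f\<bar> * \<bar>X \<omega> \<bullet> g\<bar> \<le> (norm (X \<omega>) * norm f) * (norm (X \<omega>) * norm g)"
      by (intro mult_mono Cauchy_Schwarz_ineq2) auto
    then show "norm ((X \<omega> \<bullet> f) * (X \<omega> \<bullet> g)) \<le> norm ((norm f * norm g) * (norm (X \<omega>))\<^sup>2)"
      by (simp add: abs_mult power2_eq_square mult_ac)
  qed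
qed (use X2 in auto)

lemma integrable_cov_integrand: "integrable P (\<lambda>\<omega>. ((X \<omega> - (\<integral>\<omega>'. X \<omega>' \<partial>P)) \<bullet> f) *\<^sub>R X \<omega>)"
  and cov_integrand_bound: "integrable P (\<lambda>\<omega>. norm (X \<omega> - (\<integral>\<omega>'. X \<omega>' \<partial>P)) * norm (X \<omega>))"
proof -
  let ?m = "\<integral>\<omega>'. X \<omega>' \<partial>P"
  show i: "integrable P (\<lambda>\<omega>. norm (X \<omega> - ?m) * norm (X \<omega>))"
  proof (rule Bochner_Integration.integrable_bound[where f="\<lambda>\<omega>. (norm (X \<omega>))\<^sup>2 + norm ?m * norm (X \<omega>)"])
    show "integrable P (\<lambda>\<omega>. (norm (X \<omega>))\<^sup>2 + norm ?m * norm (X \<omega>))"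
      using X2 integrable_X by simp
    show "AE \<omega> in P. norm (norm (X \<omega> - ?m) * norm (X \<omega>)) \<le> norm ((norm (X \<omega>))\<^sup>2 + norm ?m * norm (X \<omega>))"
    proof (rule AE_I2)
      fix \<omega>
      have "norm (X \<omega> - ?m) * norm (X \<omega>) \<le> (norm (X \<omega>) + norm ?m) * norm (X \<omega>)"
        by (intro mult_right_mono norm_triangle_ineq4) simp
      then show "norm (norm (X \<omega> - ?m) * norm (X \<omega>)) \<le> norm ((norm (X \<omega>))\<^sup>2 + norm ?m * norm (X \<omega>))"
        by (simp add: distrib_right power2_eq_square)
    qed
  qed measurable
  show "integrable P (\<lambda>\<omega>. ((X \<omega> - ?m) \<bullet> f) *\<^sub>R X \<omega>)"
  proof (rule Bochner_Integration.integrable_bound[OF integrable_mult_right[OF i, of "norm f"]])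
    show "AE \<omega> in P. norm (((X \<omega> - ?m) \<bullet> f) *\<^sub>R X \<omega>) \<le> norm (norm f * (norm (X \<omega> - ?m) * norm (X \<omega>)))"
    proof (rule AE_I2)
      fix \<omega>
      have "\<bar>(X \<omega> - ?m) \<bullet> f\<bar> * norm (X \<omega>) \<le> (norm (X \<omega> - ?m) * norm f) * norm (X \<omega>)"
        by (intro mult_right_mono Cauchy_Schwarz_ineq2) simp
      then show "norm (((X \<omega> - ?m) \<bullet> f) *\<^sub>R X \<omega>) \<le> norm (norm f * (norm (X \<omega> - ?m) * norm (X \<omega>)))"
        by (simp add: mult_ac)
    qed
  qed measurable
qed

text \<open>The form in terms of raw moments matches \<open>scov_inner_raw\<close> term by term, so
  that the strong law applies to each moment.\<close>

lemma cov_op_inner: "cov_op P X f \<bullet> g = (\<integral>\<omega>. (X \<omega> \<bullet> f) * (X \<omega> \<bullet> g) \<partial>P) - ((\<integral>\<omega>. X \<omega> \<partial>P) \<bullet> f) * ((\<integral>\<omega>. X \<omega> \<partial>P) \<bullet> g)"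
proof -
  let ?m = "\<integral>\<omega>'. X \<omega>' \<partial>P"
  have "cov_op P X f \<bullet> g = (\<integral>\<omega>. (((X \<omega> - ?m) \<bullet> f) *\<^sub>R X \<omega>) \<bullet> g \<partial>P)"
    unfolding cov_op_def by (rule integral_inner_left[symmetric]) (rule integrable_cov_integrand)
  also have "\<dots> = (\<integral>\<omega>. (X \<omega> \<bullet> f) * (X \<omega> \<bullet> g) - (?m \<bullet> f) * (X \<omega> \<bullet> g) \<partial>P)"
    by (intro Bochner_Integration.integral_cong refl) (simp add: inner_diff_left left_diff_distrib)
  also have "\<dots> = (\<integral>\<omega>. (X \<omega> \<bullet> f) * (X \<omega> \<bullet> g) \<partial>P) - (?m \<bullet> f) * (?m \<bullet> g)"
    using integrable_X_inner2 integrable_X_inner by simp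
  finally show ?thesis .
qed

lemma pos_op_cov_op: "pos_op (cov_op P X)"
proof -
  let ?m = "\<integral>\<omega>'. X \<omega>' \<partial>P"
  note i = integrable_cov_integrand
  have "bounded_linear (cov_op P X)"
  proof (rule bounded_linear_intro)
    show "cov_op P X (f + g) = cov_op P X f + cov_op P X g" for f g
      unfolding cov_op_def inner_add_right scaleR_left_distrib by (rule Bochner_Integration.integral_add[OF i i])
    show "cov_op P X (r *\<^sub>R f) = r *\<^sub>R cov_op P X f" for r f
      unfolding cov_op_def using i[of f] by (simp flip: scaleR_scaleR)
    show "norm (cov_op P X f) \<le> norm f * (\<integral>\<omega>. norm (X \<omega> - ?m) * norm (X \<omega>) \<partial>P)" for f
    proof -
      have "norm (cov_op P X f) \<le> (\<integral>\<omega>. norm (((X \<omega> - ?m) \<bullet> f) *\<^sub>R X \<omega>) \<partial>P)"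
        unfolding cov_op_def by (rule integral_norm_bound)
      also have "\<dots> \<le> (\<integral>\<omega>. norm f * (norm (X \<omega> - ?m) * norm (X \<omega>)) \<partial>P)"
      proof (rule integral_mono)
        fix \<omega>
        have "\<bar>(X \<omega> - ?m) \<bullet> f\<bar> * norm (X \<omega>) \<le> (norm (X \<omega> - ?m) * norm f) * norm (X \<omega>)"
          by (intro mult_right_mono Cauchy_Schwarz_ineq2) simp
        then show "norm (((X \<omega> - ?m) \<bullet> f) *\<^sub>R X \<omega>) \<le> norm f * (norm (X \<omega> - ?m) * norm (X \<omega>))"
          by (simp add: mult_ac)
      qed (use integrable_norm[OF i[of f]] cov_integrand_bound in auto)
      finally show ?thesis by simp
    qed
  qed
  moreover have "cov_op P X f \<bullet> g = f \<bullet> cov_op P X g" for f g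
    unfolding inner_commute[of f] cov_op_inner by (simp add: mult.commute)
  moreover have "0 \<le> cov_op P X f \<bullet> f" for f
  proof -
    have "0 \<le> P.variance (\<lambda>\<omega>. X \<omega> \<bullet> f)" by (rule P.variance_positive)
    also have "\<dots> = cov_op P X f \<bullet> f"
      using integrable_X_inner[of f] integrable_X_inner2[of f f]
      unfolding cov_op_inner by (subst P.variance_eq) (simp_all add: power2_eq_square)
    finally show ?thesis .
  qed
  ultimately show ?thesis by (simp add: pos_op_def)
qed

text \<open>Three kinds of averages enter: squared norms for the uniform bound, and first and second
  moments along the directions of a countable dense set for the limit.\<close>

lemma sample_scov_tendsto:
  fixes M :: "'m measure" and Xs :: "nat \<Rightarrow> 'm \<Rightarrow> L2I"
  assumes M: "prob_space M" and ind: "prob_space.indep_vars M (\<lambda>_. borel) Xs UNIV"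
    and distr: "\<And>i. distr M borel (Xs i) = distr P borel X"
  shows "AE \<omega> in M. \<exists>c. (\<forall>n f. scov n (\<lambda>j. Xs j \<omega>) f \<bullet> f \<le> c * (norm f)\<^sup>2) \<and>
     (\<forall>f g. (\<lambda>n. scov n (\<lambda>j. Xs j \<omega>) f \<bullet> g) \<longlonglongrightarrow> cov_op P X f \<bullet> g)"
proof -
  interpret M: prob_space M by fact
  have Xm[measurable]: "Xs i \<in> borel_measurable M" for i using ind by (auto simp: M.indep_vars_def)
  have LLN: "AE \<omega> in M. (\<lambda>n. (\<Sum>j<n. F (Xs j \<omega>)) / real n) \<longlonglongrightarrow> (\<integral>\<omega>. F (X \<omega>) \<partial>P)"
    if F[measurable]: "F \<in> borel_measurable borel" and iF: "integrable P (\<lambda>\<omega>. F (X \<omega>))" for F :: "L2I \<Rightarrow> real"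
  proof -
    have d: "distr M borel (\<lambda>\<omega>. F (Xs i \<omega>)) = distr P borel (\<lambda>\<omega>. F (X \<omega>))" for i
      using distr_distr[OF F Xm[of i]] distr_distr[OF F X] distr[of i] by (simp add: comp_def)
    have "integrable (distr M borel (Xs 0)) F" unfolding distr using iF by (subst integrable_distr_eq) auto
    then have i0: "integrable M (\<lambda>\<omega>. F (Xs 0 \<omega>))" by (subst (asm) integrable_distr_eq) auto
    have "(\<integral>\<omega>. F (Xs 0 \<omega>) \<partial>M) = integral\<^sup>L (distr M borel (Xs 0)) F" by (subst integral_distr) auto
    also have "\<dots> = (\<integral>\<omega>. F (X \<omega>) \<partial>P)" unfolding distr by (subst integral_distr) auto
    finally have e: "(\<integral>\<omega>. F (Xs 0 \<omega>) \<partial>M) = (\<integral>\<omega>. F (X \<omega>) \<partial>P)" .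
    have "AE \<omega> in M. (\<lambda>n. (\<Sum>j<n. F (Xs j \<omega>)) / real n) \<longlonglongrightarrow> (\<integral>\<omega>. F (Xs 0 \<omega>) \<partial>M)"
    proof (rule M.SLLN[where Y="\<lambda>j \<omega>. F (Xs j \<omega>)"])
      show "M.indep_vars (\<lambda>_. borel) (\<lambda>j \<omega>. F (Xs j \<omega>)) UNIV"
        by (rule M.indep_vars_compose2[OF ind]) simp
      show "distr M borel (\<lambda>\<omega>. F (Xs i \<omega>)) = distr M borel (\<lambda>\<omega>. F (Xs 0 \<omega>))" for i unfolding d ..
    qed (rule i0)
    then show ?thesis unfolding e .
  qed
  obtain D :: "L2I set" where D: "countable D" "\<And>X. open X \<Longrightarrow> X \<noteq> {} \<Longrightarrow> \<exists>d\<in>D. d \<in> X"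
    using countable_dense_exists by blast
  obtain c0 where c0: "\<And>f. cov_op P X f \<bullet> f \<le> c0 * (norm f)\<^sup>2" using pos_op_bound[OF pos_op_cov_op] by blast
  have A1: "AE \<omega> in M. (\<lambda>n. (\<Sum>j<n. (norm (Xs j \<omega>))\<^sup>2) / real n) \<longlonglongrightarrow> (\<integral>\<omega>. (norm (X \<omega>))\<^sup>2 \<partial>P)"
    by (rule LLN) (use X2 in auto)
  have A2: "AE \<omega> in M. \<forall>d\<in>D. (\<lambda>n. (\<Sum>j<n. Xs j \<omega> \<bullet> d) / real n) \<longlonglongrightarrow> (\<integral>\<omega>. X \<omega> \<partial>P) \<bullet> d"
    unfolding AE_ball_countable[OF D(1)] integrable_X_inner(2)[symmetric]
    by (intro ballI LLN) (use integrable_X_inner in auto)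
  have A3: "AE \<omega> in M. \<forall>d\<in>D. (\<lambda>n. (\<Sum>j<n. (Xs j \<omega> \<bullet> d) * (Xs j \<omega> \<bullet> d)) / real n) \<longlonglongrightarrow> (\<integral>\<omega>. (X \<omega> \<bullet> d) * (X \<omega> \<bullet> d) \<partial>P)"
    unfolding AE_ball_countable[OF D(1)]
    by (intro ballI LLN) (use integrable_X_inner2 in auto)
  from A1 A2 A3 show ?thesis
  proof eventually_elim
    case (elim \<omega>)
    let ?x = "\<lambda>j. Xs j \<omega>"
    \<comment> \<open>A convergent sequence is bounded; the bound depends on the
      realization.\<close>
    have "Bseq (\<lambda>n. (\<Sum>j<n. (norm (?x j))\<^sup>2) / real n)"
      using elim(1) by (intro convergent_imp_Bseq) (auto simp: convergent_def)
    then obtain c where c: "c > 0" "\<And>n. norm ((\<Sum>j<n. (norm (?x j))\<^sup>2) / real n) \<le> c"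
      by (auto simp: Bseq_def)
    have bd: "scov n ?x f \<bullet> f \<le> c * (norm f)\<^sup>2" for n f
    proof (cases "n = 0")
      case True
      then show ?thesis using c(1) by (simp add: scov_inner)
    next
      case False
      then have "scov n ?x f \<bullet> f \<le> ((\<Sum>j<n. (norm (?x j))\<^sup>2) / real n) * (norm f)\<^sup>2" by (intro scov_bound) simp
      also have "\<dots> \<le> c * (norm f)\<^sup>2"
        using c(2)[of n] abs_ge_self[of "(\<Sum>j<n. (norm (?x j))\<^sup>2) / real n"]
        unfolding real_norm_def by (intro mult_right_mono) simp_all
      finally show ?thesis .
    qed
    have conv: "(\<lambda>n. scov n ?x d \<bullet> d) \<longlonglongrightarrow> cov_op P X d \<bullet> d" if d: "d \<in> D" for d
    proof (rule Lim_transform_eventually)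
      show "(\<lambda>n. (\<Sum>j<n. (?x j \<bullet> d) * (?x j \<bullet> d)) / real n - ((\<Sum>j<n. ?x j \<bullet> d) / real n) * ((\<Sum>j<n. ?x j \<bullet> d) / real n)) \<longlonglongrightarrow> cov_op P X d \<bullet> d"
        unfolding cov_op_inner using elim(2,3) d by (intro tendsto_diff tendsto_mult) auto
      have "smean n ?x \<bullet> d = (\<Sum>j<n. ?x j \<bullet> d) / real n" for n by (simp add: smean_def inner_sum_left)
      then show "\<forall>\<^sub>F n in sequentially. (\<Sum>j<n. (?x j \<bullet> d) * (?x j \<bullet> d)) / real n - ((\<Sum>j<n. ?x j \<bullet> d) / real n) * ((\<Sum>j<n. ?x j \<bullet> d) / real n) = scov n ?x d \<bullet> d"
        by (intro eventually_mono[OF eventually_gt_at_top[of 0]]) (simp add: scov_inner_raw)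
    qed
    show ?case
      using bd pos_op_tendsto_dense[OF pos_op_scov pos_op_cov_op bd c0 D(2) conv] by blast
  qed
qed

end

section \<open>The conditional law of the statistic and the bootstrap limit\<close>

lemma T_stat_restrict: "T_stat Q n (\<lambda>j\<in>{..<n}. x j) = T_stat Q n x"
proof -
  have m: "smean n (\<lambda>j\<in>{..<n}. x j) = smean n x" by (simp add: smean_def)
  have "scov n (\<lambda>j\<in>{..<n}. x j) = scov n x" by (simp add: scov_def[abs_def] m)
  then show ?thesis by (simp add: T_stat_def m)
qed

text \<open>Both regular conditional distributions are versions of the same conditional probabilities.\<close>

lemma bootstrap_law_unique:
  assumes Tm: "T_stat Q n \<in> borel_measurable (PiM {..<n} (\<lambda>_. borel))"
    and gk: "regular_cond_distr M (sample_algebra M Xs n) (PiM {..<n} (\<lambda>_. borel)) (\<lambda>\<omega>. \<lambda>j\<in>{..<n}. Xb j \<omega>) G"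
    and kk: "regular_cond_distr M (sample_algebra M Xs n) borel (\<lambda>\<omega>. real n * T_stat Q n (\<lambda>j. Xb j \<omega>)) \<kappa>"
  shows "AE \<omega> in M. \<kappa> \<omega> = distr (G \<omega>) borel (\<lambda>x. real n * T_stat Q n x)"
proof -
  let ?P = "PiM {..<n} (\<lambda>_. borel) :: (nat \<Rightarrow> L2I) measure"
  define H where "H x = real n * T_stat Q n x" for x
  have Hm[measurable]: "H \<in> borel_measurable ?P" unfolding H_def using Tm by measurable
  define B where "B q = H -` {..q} \<inter> space ?P" for q
  have B[measurable]: "B q \<in> sets ?P" for q unfolding B_def by measurable
  \<comment> \<open>Both regular conditional distributions describe the same event, so its
    conditional probability is literally the same function in both.\<close>
  have eq: "(\<lambda>\<omega>. \<lambda>j\<in>{..<n}. Xb j \<omega>) -` B q = (\<lambda>\<omega>. real n * T_stat Q n (\<lambda>j. Xb j \<omega>)) -` {..q}" for q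
    by (auto simp: B_def H_def T_stat_restrict space_PiM)
  have sp: "space (sample_algebra M Xs n) = space M" by (simp add: sample_algebra_def)
  have "AE \<omega> in M. \<forall>q::rat. measure (\<kappa> \<omega>) {..of_rat q} = measure (G \<omega>) (B (of_rat q))"
    unfolding AE_all_countable
  proof
    fix q :: rat
    have "AE \<omega> in M. measure (G \<omega>) (B (of_rat q)) = real_cond_exp M (sample_algebra M Xs n) (indicator ((\<lambda>\<omega>. \<lambda>j\<in>{..<n}. Xb j \<omega>) -` B (of_rat q))) \<omega>"
      using gk B unfolding regular_cond_distr_def by blast
    moreover have "AE \<omega> in M. measure (\<kappa> \<omega>) {..of_rat q} = real_cond_exp M (sample_algebra M Xs n) (indicator ((\<lambda>\<omega>. real n * T_stat Q n (\<lambda>j. Xb j \<omega>)) -` {..of_rat q})) \<omega>"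
      using kk unfolding regular_cond_distr_def by (meson atMost_borel)
    ultimately show "AE \<omega> in M. measure (\<kappa> \<omega>) {..of_rat q} = measure (G \<omega>) (B (of_rat q))"
      unfolding eq by eventually_elim simp
  qed
  with AE_space show ?thesis
  proof eventually_elim
    case (elim \<omega>)
    have G: "sets (G \<omega>) = sets ?P" "prob_space (G \<omega>)"
      using gk measurable_space[of G "sample_algebra M Xs n" "prob_algebra ?P" \<omega>] elim(1)
      by (auto simp: regular_cond_distr_def space_prob_algebra sp)
    have k: "sets (\<kappa> \<omega>) = sets borel" "prob_space (\<kappa> \<omega>)"
      using kk measurable_space[of \<kappa> "sample_algebra M Xs n" "prob_algebra borel" \<omega>] elim(1)
      by (auto simp: regular_cond_distr_def space_prob_algebra sp)
    have HG: "H \<in> borel_measurable (G \<omega>)" using Hm by (simp cong: measurable_cong_sets add: G(1))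
    have "\<kappa> \<omega> = distr (G \<omega>) borel H"
    proof (rule real_distribution_eqI_rat)
      show "real_distribution (\<kappa> \<omega>)"
        using k sets_eq_imp_space_eq[OF k(1)] by (simp add: real_distribution_def real_distribution_axioms_def)
      show "real_distribution (distr (G \<omega>) borel H)" by (rule prob_space.real_distribution_distr[OF G(2) HG])
      show "measure (\<kappa> \<omega>) {..of_rat q} = measure (distr (G \<omega>) borel H) {..of_rat q}" for q :: rat
        using elim(2) HG sets_eq_imp_space_eq[OF G(1)] by (simp add: measure_distr B_def)
    qed
    then show ?case by (simp add: H_def[abs_def])
  qed
qed

theorem theorem5p3:
  fixes Q :: "L2I measure"
    and P :: "'p measure" and X :: "'p \<Rightarrow> L2I"
    and M :: "'m measure" and Xs :: "nat \<Rightarrow> 'm \<Rightarrow> L2I"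
    and Xb :: "nat \<Rightarrow> nat \<Rightarrow> 'm \<Rightarrow> L2I"
    and \<kappa> :: "nat \<Rightarrow> 'm \<Rightarrow> real measure"
  assumes "sets Q = sets borel" and "prob_space Q" and "distr Q borel uminus = Q"
    and "integrable Q (\<lambda>f. norm f ^ 4)"
    and "prob_space P" and "X \<in> borel_measurable P" and "integrable P (\<lambda>\<omega>. (norm (X \<omega>))\<^sup>2)"
    and "prob_space M"
    and "prob_space.indep_vars M (\<lambda>_. borel) Xs UNIV"
    and "\<And>i. distr M borel (Xs i) = distr P borel X"
    and "\<And>n j. j < n \<Longrightarrow> Xb n j \<in> borel_measurable M"
    and "\<And>n. n > 0 \<Longrightarrow>
           regular_cond_distr M (sample_algebra M Xs n) (PiM {..<n} (\<lambda>_. borel))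
             (\<lambda>\<omega>. \<lambda>j\<in>{..<n}. Xb n j \<omega>)
             (\<lambda>\<omega>. PiM {..<n} (\<lambda>_. gauss_law 0 (scov n (\<lambda>j. Xs j \<omega>))))"
    and "\<And>n. n > 0 \<Longrightarrow>
           regular_cond_distr M (sample_algebra M Xs n) borel
             (\<lambda>\<omega>. real n * T_stat Q n (\<lambda>j. Xb n j \<omega>)) (\<kappa> n)"
  shows "(\<exists>(W :: (L2I \<Rightarrow> real) measure) V.
            centred_gaussian W Q V \<and> has_cov_kernel W Q V (limit_kernel (cov_op P X))) \<and>
         (\<forall>(W :: 'w measure) V.
            centred_gaussian W Q V \<and> has_cov_kernel W Q V (limit_kernel (cov_op P X)) \<longrightarrow>
            (AE \<omega> in M. weak_conv_m (\<lambda>n. \<kappa> n \<omega>) (distr W borel (\<lambda>w. (l2norm Q (V w))\<^sup>2))))"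
proof -
  interpret M: prob_space M by fact
  have wm: "weight_measure Q"
    using assms(1,2,4) by (simp add: weight_measure_def weight_measure_axioms_def)
  let ?G = "\<lambda>\<omega> n. gauss_law 0 (scov n (\<lambda>j. Xs j \<omega>))"
  have array: "AE \<omega> in M. \<exists>c. bootstrap_array Q (?G \<omega>) (\<lambda>n. scov n (\<lambda>j. Xs j \<omega>)) (cov_op P X) c"
    using sample_scov_tendsto[OF assms(5-10)]
  proof eventually_elim
    case (elim \<omega>)
    then obtain c where c: "\<And>n f. scov n (\<lambda>j. Xs j \<omega>) f \<bullet> f \<le> c * (norm f)\<^sup>2"
      "\<And>f g. (\<lambda>n. scov n (\<lambda>j. Xs j \<omega>) f \<bullet> g) \<longlonglongrightarrow> cov_op P X f \<bullet> g" by blast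
    show ?case
      by (rule exI[of _ c]) (simp add: bootstrap_array_def bootstrap_array_axioms_def wm
          hilbert_gaussian_gauss_law pos_op_cov_op[OF assms(5-7)] c)
  qed
  \<comment> \<open>A good realization exists because \<open>M\<close> is a probability space. It
    serves to derive the facts about the limit kernel and the statistic that do not involve the
    data.\<close>
  have "\<exists>\<omega> c. bootstrap_array Q (?G \<omega>) (\<lambda>n. scov n (\<lambda>j. Xs j \<omega>)) (cov_op P X) c"
  proof (rule ccontr)
    assume "\<not> ?thesis"
    then have "AE \<omega> in M. False" using array by simp
    then show False by simp
  qed
  then obtain \<omega>0 c0 where ba0: "bootstrap_array Q (?G \<omega>0) (\<lambda>n. scov n (\<lambda>j. Xs j \<omega>0)) (cov_op P X) c0" by blast
  obtain \<phi> where ks: "kernel_series Q (limit_kernel (cov_op P X)) \<phi>"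
    using bootstrap_array.kernel_series_exists[OF ba0] by blast
  have unique: "AE \<omega> in M. \<forall>n. n > 0 \<longrightarrow> \<kappa> n \<omega> = distr (PiM {..<n} (\<lambda>_. ?G \<omega> n)) borel (\<lambda>x. real n * T_stat Q n x)"
    unfolding AE_all_countable
  proof
    fix n
    show "AE \<omega> in M. n > 0 \<longrightarrow> \<kappa> n \<omega> = distr (PiM {..<n} (\<lambda>_. ?G \<omega> n)) borel (\<lambda>x. real n * T_stat Q n x)"
    proof (cases "n > 0")
      case True
      show ?thesis
        using bootstrap_law_unique[OF bootstrap_array.T_stat_measurable[OF ba0] assms(12)[OF True] assms(13)[OF True]]
        by eventually_elim simp
    qed simp
  qed
  \<comment> \<open>The element is arbitrary, on an arbitrary space: only the laws of its scalar
    functionals enter, and these are fixed by the kernel.\<close>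
  have "AE \<omega> in M. weak_conv_m (\<lambda>n. \<kappa> n \<omega>) (distr W borel (\<lambda>w. (l2norm Q (V w))\<^sup>2))"
    if cg: "centred_gaussian W Q V" and hk: "has_cov_kernel W Q V (limit_kernel (cov_op P X))"
    for W :: "'w measure" and V
    using array unique
  proof eventually_elim
    case (elim \<omega>)
    then obtain c where "bootstrap_array Q (?G \<omega>) (\<lambda>n. scov n (\<lambda>j. Xs j \<omega>)) (cov_op P X) c" by blast
    then interpret B: bootstrap_array Q "?G \<omega>" "\<lambda>n. scov n (\<lambda>j. Xs j \<omega>)" "cov_op P X" c .
    interpret W: prob_space W using cg by (simp add: centred_gaussian_def)
    note Vm = B.score_sum_laplace_tendsto(2)[OF cg hk order_refl]
    have Tm: "(\<lambda>x. real n * T_stat Q n x) \<in> borel_measurable (B.sample n)" for n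
      using B.T_stat_measurable[of n] by (simp cong: measurable_cong_sets sets_PiM_cong add: B.sets_Nn)
    show ?case
    proof (rule weak_conv_m_cong)
      show "distr (B.sample n) borel (\<lambda>x. real n * T_stat Q n x) = \<kappa> n \<omega>" if "n > 0" for n
        using elim(2) that by simp
      show "weak_conv_m (\<lambda>n. distr (B.sample n) borel (\<lambda>x. real n * T_stat Q n x)) (distr W borel (\<lambda>w. (l2norm Q (V w))\<^sup>2))"
      proof (rule laplace_imp_weak_conv_m)
        show "real_distribution (distr (B.sample n) borel (\<lambda>x. real n * T_stat Q n x))" for n
          by (rule prob_space.real_distribution_distr[OF B.prob_sample Tm])
        show "real_distribution (distr W borel (\<lambda>w. (l2norm Q (V w))\<^sup>2))"
          by (rule W.real_distribution_distr[OF Vm])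
        show "AE y in distr (B.sample n) borel (\<lambda>x. real n * T_stat Q n x). 0 \<le> y" for n
          by (subst AE_distr_iff[OF Tm]) (auto simp: T_stat_def)
        show "AE y in distr W borel (\<lambda>w. (l2norm Q (V w))\<^sup>2). 0 \<le> y"
          by (subst AE_distr_iff[OF Vm]) auto
        fix s :: real assume s: "s \<ge> 0"
        show "(\<lambda>n. \<integral>y. exp (- s * y) \<partial>distr (B.sample n) borel (\<lambda>x. real n * T_stat Q n x))
            \<longlonglongrightarrow> (\<integral>y. exp (- s * y) \<partial>distr W borel (\<lambda>w. (l2norm Q (V w))\<^sup>2))"
          using B.T_stat_laplace_tendsto[OF assms(3) cg hk s]
          by (simp add: integral_distr[OF Tm] integral_distr[OF Vm])
      qed
    qed
  qed
  then show ?thesis using kernel_series.centred_gaussian_exists[OF ks] by blast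
qed

end
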